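(* Let $(X,\omega)$ be a complex Hermitian manifold with $\dim_{\mathbb C}X=n\ge2$. For any $C^\infty$ function $\eta$ on $X$ such that $\eta>0$ or $\eta<0$, the following $\eta$-twisted commutation relations hold on differential forms of any degree on $X$: (a) $D_\eta^\star+\tau_\eta^\star=-i\,[\Lambda,\overline D_{-\eta}]+\frac n\eta\,[\,i\,\overline d_{-\eta}\eta\wedge\cdot\,,\Lambda]$; (b) $\overline D_{-\eta}^\star+\overline\tau_{-\eta}^\star=i\,[\Lambda,D_\eta]-\frac n\eta\,[\,i\,d_\eta\eta\wedge\cdot\,,\Lambda]$; (c) $D_\eta+\tau_\eta=i\,[\overline D_{-\eta}^\star,\omega\wedge\cdot\,]-\frac n\eta\,[\omega\wedge\cdot\,,\ i\,(\overline d_{-\eta}\eta\wedge\cdot)^\star]$; (d) $\overline D_{-\eta}+\overline\tau_{-\eta}=-i\,[D_\eta^\star,\omega\wedge\cdot\,]+\frac n\eta\,[\omega\wedge\cdot\,,\ i\,(d_\eta\eta\wedge\cdot)^\star]$.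
   Context: $\eta$ is real-valued and $\eta>0$ (resp. $\eta<0$) means at every point. The Hermitian metric is identified with its positive definite $(1,1)$-form $\omega$, normalized so that $\omega=i\sum_j\zeta_j\wedge\bar\zeta_j$ for a local orthonormal coframe of $(1,0)$-forms. $\star$ denotes the formal adjoint for the $L^2$-inner product induced by $\omega$ (pointwise adjoint for zero-order operators); $\Lambda$ is the adjoint of $\omega\wedge\cdot$; $[A,B]=AB-(-1)^{ab}BA$ is the graded commutator of operators of degrees $a,b$. The conjugate of an operator $P$ is $\overline P u=\overline{P\bar u}$. $\theta_\eta$ acts on $(p,q)$-forms as multiplication by $\eta^p$ (extended linearly), and $D_\eta:=\theta_\eta d\theta_\eta^{-1}$; $\overline D_{-\eta}$ is the conjugate of $D_{-\eta}$. Explicitly, on $(p,q)$-forms, $$D_\eta=\eta\partial+\bar\partial-p\,\partial\eta\wedge\cdot-\tfrac p\eta\,\bar\partial\eta\wedge\cdot,\qquad \overline D_{-\eta}=\partial-\eta\bar\partial-\tfrac q\eta\,\partial\eta\wedge\cdot+q\,\bar\partial\eta\wedge\cdot.$$ Also $d_\eta=\eta\partial+\bar\partial$, $\overline d_{-\eta}=\partial-\eta\bar\partial$, so $d_\eta\eta=\eta\,\partial\eta+\bar\partial\eta$ and $\overline d_{-\eta}\eta=\partial\eta-\eta\,\bar\partial\eta$. The $\eta$-torsion operator is $\tau_\eta=[\Lambda,D_\eta\omega\wedge\cdot]$, and $\overline\tau_{-\eta}=[\Lambda,\overline D_{-\eta}\omega\wedge\cdot]$ is the conjugate of $\tau_{-\eta}$.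 *)

theory Defs
  imports "HOL-Analysis.Analysis" "HOL-Library.Function_Algebras"
begin

section \<open>Smooth maps and complex manifolds\<close>

fun Ck_on :: "nat \<Rightarrow> 'b::real_normed_vector set \<Rightarrow> ('b \<Rightarrow> 'c::real_normed_vector) \<Rightarrow> bool" where
  "Ck_on 0 S f \<longleftrightarrow> continuous_on S f"
| "Ck_on (Suc k) S f \<longleftrightarrow>
     (\<forall>z\<in>S. f differentiable (at z)) \<and> (\<forall>v. Ck_on k S (\<lambda>z. frechet_derivative f (at z) v))"

text \<open>Only used for open sets \<open>S\<close> of a finite-dimensional space.\<close>

definition smooth_on :: "'b::real_normed_vector set \<Rightarrow> ('b \<Rightarrow> 'c::real_normed_vector) \<Rightarrow> bool" where
  "smooth_on S f \<longleftrightarrow> (\<forall>k. Ck_on k S f)"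

definition holomorphic_map_on :: "(complex^'n::finite) set \<Rightarrow> (complex^'n \<Rightarrow> complex^'n) \<Rightarrow> bool" where
  "holomorphic_map_on S f \<longleftrightarrow> smooth_on S f \<and>
     (\<forall>z\<in>S. \<forall>c v. frechet_derivative f (at z) (c *s v) = c *s frechet_derivative f (at z) v)"

type_synonym ('a, 'n) chart = "'a set \<times> ('a \<Rightarrow> complex^'n)"

text \<open>The manifold is the whole type \<open>'a\<close>; the type classes make it Hausdorff and second countable.
  Its complex dimension is \<open>CARD('n)\<close>.\<close>

definition complex_atlas ::
    "('a::{t2_space,second_countable_topology}, 'n::finite) chart set \<Rightarrow> bool" where
  "complex_atlas A \<longleftrightarrow>
     (\<Union>(U, \<phi>)\<in>A. U) = UNIV \<and>
     (\<forall>(U, \<phi>)\<in>A. open U \<and> open (\<phi> ` U) \<and> homeomorphism U (\<phi> ` U) \<phi> (inv_into U \<phi>)) \<and>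
     (\<forall>(U, \<phi>)\<in>A. \<forall>(V, \<psi>)\<in>A. holomorphic_map_on (\<phi> ` (U \<inter> V)) (\<psi> \<circ> inv_into U \<phi>))"

definition chart_at :: "('a, 'n) chart set \<Rightarrow> 'a \<Rightarrow> ('a, 'n) chart" where
  "chart_at A x = (SOME c. c \<in> A \<and> x \<in> fst c)"

definition smooth_function :: "('a, 'n::finite) chart set \<Rightarrow> ('a \<Rightarrow> real) \<Rightarrow> bool" where
  "smooth_function A f \<longleftrightarrow> (\<forall>(U, \<phi>)\<in>A. smooth_on (\<phi> ` U) (f \<circ> inv_into U \<phi>))"

section \<open>Exterior algebra of one tangent space\<close>

text \<open>A complex-valued (mixed-degree) form on the real vector space \<open>complex^'n\<close> is a function on lists
  of vectors; its degree \<open>k\<close> component is the restriction to lists of length \<open>k\<close>.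
  The complex structure \<open>J\<close> is \<open>v \<mapsto> \<i> *s v\<close>.\<close>

type_synonym 'n fibre = "(complex^'n) list \<Rightarrow> complex"

definition alternating :: "'n::finite fibre \<Rightarrow> bool" where
  "alternating \<alpha> \<longleftrightarrow>
     (\<forall>xs ys. linear (\<lambda>v. \<alpha> (xs @ [v] @ ys))) \<and>
     (\<forall>xs ys zs v. \<alpha> (xs @ [v] @ ys @ [v] @ zs) = 0)"

text \<open>Shuffle convention: \<open>\<alpha> \<and> \<beta> (v, w) = \<alpha> v \<cdot> \<beta> w - \<alpha> w \<cdot> \<beta> v\<close> on one-forms. The exponent of
  \<open>-1\<close> is the number of inversions of the shuffle that puts the positions in \<open>S\<close> first.\<close>

definition fwedge :: "'n fibre \<Rightarrow> 'n fibre \<Rightarrow> 'n fibre" where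
  "fwedge \<alpha> \<beta> vs = (\<Sum>S\<in>Pow {..<length vs}.
     (- 1) ^ card {(i, j). i \<in> S \<and> j \<notin> S \<and> j < i} * \<alpha> (nths vs S) * \<beta> (nths vs (- S)))"

text \<open>Complex-multilinear extension to the complexified tangent space; the pair \<open>(v, w)\<close> stands for
  \<open>v + \<i> w\<close>, where \<open>\<i>\<close> is the imaginary unit of the complexification (and not \<open>J\<close>).\<close>

definition complexified :: "'n::finite fibre \<Rightarrow> ((complex^'n) \<times> (complex^'n)) list \<Rightarrow> complex" where
  "complexified \<alpha> ws = (\<Sum>T\<in>Pow {..<length ws}.
     \<i> ^ card T * \<alpha> (map (\<lambda>i. if i \<in> T then snd (ws ! i) else fst (ws ! i)) [0..<length ws]))"

text \<open>\<open>v\<^sup>1\<^sup>,\<^sup>0 = (v - \<i> J v) / 2\<close> and \<open>v\<^sup>0\<^sup>,\<^sup>1 = (v + \<i> J v) / 2\<close>.\<close>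

definition part10 :: "complex^'n::finite \<Rightarrow> (complex^'n) \<times> (complex^'n)" where
  "part10 v = ((1/2) *\<^sub>R v, - (1/2) *\<^sub>R (\<i> *s v))"

definition part01 :: "complex^'n::finite \<Rightarrow> (complex^'n) \<times> (complex^'n)" where
  "part01 v = ((1/2) *\<^sub>R v, (1/2) *\<^sub>R (\<i> *s v))"

text \<open>The component of bidegree \<open>(p, q)\<close>: insert \<open>v\<^sup>1\<^sup>,\<^sup>0\<close> in \<open>p\<close> slots and \<open>v\<^sup>0\<^sup>,\<^sup>1\<close> in the other \<open>q\<close>.\<close>

definition bidegree :: "nat \<Rightarrow> nat \<Rightarrow> 'n::finite fibre \<Rightarrow> 'n fibre" where
  "bidegree p q \<alpha> vs = (if length vs = p + q
     then \<Sum>S | S \<subseteq> {..<p + q} \<and> card S = p.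
            complexified \<alpha> (map (\<lambda>i. if i \<in> S then part10 (vs ! i) else part01 (vs ! i)) [0..<p + q])
     else 0)"

section \<open>Differential forms\<close>

text \<open>The tangent space at \<open>x\<close> is identified with \<open>complex^'n\<close> through the chart \<open>chart_at A x\<close>.\<close>

type_synonym ('a, 'n) form = "'a \<Rightarrow> 'n fibre"

text \<open>The form \<open>u\<close> read in an arbitrary chart, i.e. its pullback to the image of the chart.\<close>

definition in_chart :: "('a, 'n::finite) chart set \<Rightarrow> ('a, 'n) chart \<Rightarrow> ('a, 'n) form
    \<Rightarrow> complex^'n \<Rightarrow> 'n fibre" where
  "in_chart A c u z vs =
     (let x = inv_into (fst c) (snd c) z
      in u x (map (frechet_derivative (snd (chart_at A x) \<circ> inv_into (fst c) (snd c)) (at z)) vs))"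

definition forms :: "('a, 'n::finite) chart set \<Rightarrow> ('a, 'n) form set" where
  "forms A = {u. (\<forall>x. alternating (u x)) \<and>
     (\<forall>c\<in>A. \<forall>vs. smooth_on (snd c ` fst c) (\<lambda>z. in_chart A c u z vs))}"

definition fun_form :: "('a \<Rightarrow> real) \<Rightarrow> ('a, 'n) form" where
  "fun_form f x vs = (if vs = [] then of_real (f x) else 0)"

definition fmult :: "('a \<Rightarrow> complex) \<Rightarrow> ('a, 'n) form \<Rightarrow> ('a, 'n) form" (infixr "\<odot>" 75) where
  "(f \<odot> u) x vs = f x * u x vs"

definition wedge :: "('a, 'n) form \<Rightarrow> ('a, 'n) form \<Rightarrow> ('a, 'n) form" where
  "wedge u v x = fwedge (u x) (v x)"

definition component :: "nat \<Rightarrow> nat \<Rightarrow> ('a, 'n::finite) form \<Rightarrow> ('a, 'n) form" where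
  "component p q u x = bidegree p q (u x)"

definition ext_d :: "('a, 'n::finite) chart set \<Rightarrow> ('a, 'n) form \<Rightarrow> ('a, 'n) form" where
  "ext_d A u x vs = (\<Sum>i<length vs. (- 1) ^ i *
     frechet_derivative
       (\<lambda>z. in_chart A (chart_at A x) u z (take i vs @ drop (Suc i) vs))
       (at (snd (chart_at A x) x)) (vs ! i))"

text \<open>\<open>\<partial>\<close> (resp. \<open>\<partial>\<close>-bar) on \<open>(p, q)\<close>-forms is the \<open>(p+1, q)\<close> (resp. \<open>(p, q+1)\<close>) component of \<open>d\<close>.
  Below, \<open>length vs\<close> is the degree of the result.\<close>

definition del :: "('a, 'n::finite) chart set \<Rightarrow> ('a, 'n) form \<Rightarrow> ('a, 'n) form" where
  "del A u x vs = (\<Sum>p<length vs. let q = length vs - Suc p in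
     component (Suc p) q (ext_d A (component p q u)) x vs)"

definition delbar :: "('a, 'n::finite) chart set \<Rightarrow> ('a, 'n) form \<Rightarrow> ('a, 'n) form" where
  "delbar A u x vs = (\<Sum>p<length vs. let q = length vs - Suc p in
     component p (Suc q) (ext_d A (component p q u)) x vs)"

definition conj_form :: "('a, 'n) form \<Rightarrow> ('a, 'n) form" where
  "conj_form u x vs = cnj (u x vs)"

definition conj_op :: "(('a, 'n) form \<Rightarrow> ('a, 'n) form) \<Rightarrow> ('a, 'n) form \<Rightarrow> ('a, 'n) form" where
  "conj_op P u = conj_form (P (conj_form u))"

text \<open>Graded commutator of operators \<open>P\<close>, \<open>Q\<close> of degrees \<open>a\<close>, \<open>b\<close>.\<close>

definition gcomm :: "int \<Rightarrow> int \<Rightarrow> (('a, 'n) form \<Rightarrow> ('a, 'n) form) \<Rightarrow> (('a, 'n) form \<Rightarrow> ('a, 'n) form)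
    \<Rightarrow> ('a, 'n) form \<Rightarrow> ('a, 'n) form" where
  "gcomm a b P Q u = P (Q u) - (\<lambda>_. (- 1) powi (a * b)) \<odot> Q (P u)"

section \<open>Hermitian metrics, the inner product and formal adjoints\<close>

definition hermitian_metric :: "('a, 'n::finite) chart set \<Rightarrow> ('a, 'n) form \<Rightarrow> bool" where
  "hermitian_metric A \<omega> \<longleftrightarrow> \<omega> \<in> forms A \<and> component 1 1 \<omega> = \<omega> \<and> conj_form \<omega> = \<omega> \<and>
     (\<forall>x v. v \<noteq> 0 \<longrightarrow> Re (\<omega> x [v, \<i> *s v]) > 0)"

text \<open>The Riemannian metric \<open>g(v, w) = \<omega>(v, J w)\<close>. If \<open>\<omega> = \<i> \<Sum>\<^sub>j \<zeta>\<^sub>j \<and> cnj \<zeta>\<^sub>j\<close>, then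
  \<open>g = 2 Re (\<Sum>\<^sub>j \<zeta>\<^sub>j \<otimes> cnj \<zeta>\<^sub>j)\<close>, so \<open>Re \<zeta>\<^sub>j\<close> and \<open>Im \<zeta>\<^sub>j\<close> are \<open>g\<close>-orthogonal of norm \<open>1/\<surd>2\<close>, and the
  \<open>\<zeta>\<^sub>I \<and> cnj \<zeta>\<^sub>J\<close> are orthonormal for the induced Hermitian inner product \<open>form_inner\<close>.\<close>

definition riem :: "('a, 'n) form \<Rightarrow> 'a \<Rightarrow> complex^'n \<Rightarrow> complex^'n \<Rightarrow> real" where
  "riem \<omega> x v w = Re (\<omega> x [v, \<i> *s w])"

definition orthonormal_basis :: "('a, 'n::finite) form \<Rightarrow> 'a \<Rightarrow> (complex^'n) set \<Rightarrow> bool" where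
  "orthonormal_basis \<omega> x B \<longleftrightarrow> card B = 2 * CARD('n) \<and>
     (\<forall>b\<in>B. \<forall>c\<in>B. riem \<omega> x b c = (if b = c then 1 else 0))"

text \<open>Induced by \<open>g\<close> on the exterior algebra; the value does not depend on the orthonormal basis.
  Different degrees are orthogonal, and alternating forms vanish in degrees above \<open>2 * CARD('n)\<close>.\<close>

definition form_inner :: "('a, 'n::finite) form \<Rightarrow> 'a \<Rightarrow> 'n fibre \<Rightarrow> 'n fibre \<Rightarrow> complex" where
  "form_inner \<omega> x \<alpha> \<beta> =
     (let B = (SOME B. orthonormal_basis \<omega> x B)
      in \<Sum>k\<le>2 * CARD('n). (\<Sum>bs | set bs \<subseteq> B \<and> length bs = k. \<alpha> bs * cnj (\<beta> bs)) / fact k)"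

text \<open>In a chart, \<open>\<omega> = \<i> \<Sum>\<^sub>j\<^sub>k h\<^sub>j\<^sub>k dz\<^sub>j \<and> cnj dz\<^sub>k\<close> with
  \<open>h\<^sub>j\<^sub>k = (\<omega>(e\<^sub>j, J e\<^sub>k) - \<i> \<omega>(e\<^sub>j, e\<^sub>k)) / 2\<close>, and \<open>\<i> dz \<and> cnj dz = 2 dx \<and> dy\<close>, so the volume form
  \<open>\<omega>\<^sup>n / n!\<close> is \<open>2\<^sup>n det h\<close> times Lebesgue measure.\<close>

definition hermitian_matrix :: "('a, 'n::finite) chart set \<Rightarrow> ('a, 'n) chart \<Rightarrow> ('a, 'n) form
    \<Rightarrow> complex^'n \<Rightarrow> complex^'n^'n" where
  "hermitian_matrix A c \<omega> z = (\<chi> j k.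
     (in_chart A c \<omega> z [axis j 1, \<i> *s axis k 1] - \<i> * in_chart A c \<omega> z [axis j 1, axis k 1]) / 2)"

text \<open>The Borel measure on the manifold given by \<open>\<omega>\<^sup>n / n!\<close>.\<close>

definition vol :: "('a::{t2_space,second_countable_topology}, 'n::finite) chart set
    \<Rightarrow> ('a, 'n) form \<Rightarrow> 'a measure" where
  "vol A \<omega> = (THE \<mu>. sets \<mu> = sets borel \<and>
     (\<forall>c\<in>A. \<forall>S\<in>sets borel. S \<subseteq> fst c \<longrightarrow>
        emeasure \<mu> S = (\<integral>\<^sup>+z. indicator (snd c ` S) z *
          ennreal (2 ^ CARD('n) * Re (det (hermitian_matrix A c \<omega> z))) \<partial>lborel)))"

definition L2_inner :: "('a::{t2_space,second_countable_topology}, 'n::finite) chart set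
    \<Rightarrow> ('a, 'n) form \<Rightarrow> ('a, 'n) form \<Rightarrow> ('a, 'n) form \<Rightarrow> complex" where
  "L2_inner A \<omega> u v = (\<integral>x. form_inner \<omega> x (u x) (v x) \<partial>(vol A \<omega>))"

definition compactly_supported :: "('a::topological_space, 'n) form \<Rightarrow> bool" where
  "compactly_supported u \<longleftrightarrow> compact (closure {x. u x \<noteq> 0})"

text \<open>The formal adjoint; for operators of order zero it is the pointwise adjoint.\<close>

definition adj :: "('a::{t2_space,second_countable_topology}, 'n::finite) chart set \<Rightarrow> ('a, 'n) form
    \<Rightarrow> (('a, 'n) form \<Rightarrow> ('a, 'n) form) \<Rightarrow> ('a, 'n) form \<Rightarrow> ('a, 'n) form" where
  "adj A \<omega> P v = (THE w. w \<in> forms A \<and>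
     (\<forall>u\<in>forms A. compactly_supported u \<longrightarrow> L2_inner A \<omega> (P u) v = L2_inner A \<omega> u w))"

definition Lam :: "('a::{t2_space,second_countable_topology}, 'n::finite) chart set \<Rightarrow> ('a, 'n) form
    \<Rightarrow> ('a, 'n) form \<Rightarrow> ('a, 'n) form" where
  "Lam A \<omega> = adj A \<omega> (wedge \<omega>)"

section \<open>The twisted operators\<close>

definition theta :: "('a \<Rightarrow> real) \<Rightarrow> ('a, 'n::finite) form \<Rightarrow> ('a, 'n) form" where
  "theta \<eta> u x vs = (\<Sum>p\<le>length vs. of_real (\<eta> x ^ p) * component p (length vs - p) u x vs)"

text \<open>For nowhere vanishing \<open>\<eta>\<close>, the inverse of \<open>theta \<eta>\<close> is \<open>theta (1/\<eta>)\<close>.\<close>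

definition tw_D :: "('a, 'n::finite) chart set \<Rightarrow> ('a \<Rightarrow> real) \<Rightarrow> ('a, 'n) form \<Rightarrow> ('a, 'n) form" where
  "tw_D A \<eta> u = theta \<eta> (ext_d A (theta (\<lambda>x. 1 / \<eta> x) u))"

definition tw_d :: "('a, 'n::finite) chart set \<Rightarrow> ('a \<Rightarrow> real) \<Rightarrow> ('a, 'n) form \<Rightarrow> ('a, 'n) form" where
  "tw_d A \<eta> u = (\<lambda>x. of_real (\<eta> x)) \<odot> del A u + delbar A u"

text \<open>The operators \<open>D\<close>-bar and \<open>d\<close>-bar with index \<open>-\<eta>\<close>.\<close>

definition tw_Dbar_minus ::
    "('a, 'n::finite) chart set \<Rightarrow> ('a \<Rightarrow> real) \<Rightarrow> ('a, 'n) form \<Rightarrow> ('a, 'n) form" where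
  "tw_Dbar_minus A \<eta> = conj_op (tw_D A (\<lambda>x. - \<eta> x))"

definition tw_dbar_minus ::
    "('a, 'n::finite) chart set \<Rightarrow> ('a \<Rightarrow> real) \<Rightarrow> ('a, 'n) form \<Rightarrow> ('a, 'n) form" where
  "tw_dbar_minus A \<eta> = conj_op (tw_d A (\<lambda>x. - \<eta> x))"

definition torsion :: "('a::{t2_space,second_countable_topology}, 'n::finite) chart set
    \<Rightarrow> ('a, 'n) form \<Rightarrow> ('a \<Rightarrow> real) \<Rightarrow> ('a, 'n) form \<Rightarrow> ('a, 'n) form" where
  "torsion A \<omega> \<eta> = gcomm (- 2) 3 (Lam A \<omega>) (wedge (tw_D A \<eta> \<omega>))"

definition torsion_bar_minus :: "('a::{t2_space,second_countable_topology}, 'n::finite) chart set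
    \<Rightarrow> ('a, 'n) form \<Rightarrow> ('a \<Rightarrow> real) \<Rightarrow> ('a, 'n) form \<Rightarrow> ('a, 'n) form" where
  "torsion_bar_minus A \<omega> \<eta> = gcomm (- 2) 3 (Lam A \<omega>) (wedge (tw_Dbar_minus A \<eta> \<omega>))"

end

theory Submission
  imports Defs "HOL-Analysis.Analysis" "HOL-Computational_Algebra.Polynomial"
begin

text \<open>For \<open>\<eta> = 1\<close> relation (a) reads \<open>d\<^sup>\<star> + \<tau>\<^sup>\<star> = [\<Lambda>, d\<^sup>c]\<close>. In a chart, the divergence of the vector field dual to
  \<open>\<xi> \<mapsto> \<langle>\<xi> \<and> u, v\<rangle>\<close> equals \<open>\<langle>du, v\<rangle> - \<langle>u, \<delta>v\<rangle>\<close>, where \<open>\<delta>v\<close> collects the derivatives of \<open>v\<close> and of the metric; a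
  pointwise identity for invariant two-forms turns \<open>\<delta>\<close> into \<open>[\<Lambda>, d\<^sup>c] - \<tau>\<^sup>\<star>\<close>. By a partition of unity and Stokes'
  theorem in charts \<open>\<delta>\<close> is a formal adjoint of \<open>d\<close>, and bump functions show that formal adjoints are unique.

  For general \<open>\<eta>\<close>, let \<open>T\<^sub>s\<^sub>,\<^sub>t\<close> act as \<open>s\<^sup>p t\<^sup>q\<close> on \<open>(p, q)\<close>-forms. Conjugating \<open>d\<close> by \<open>T\<^sub>\<eta>\<^sub>,\<^sub>1\<close> gives \<open>D\<^sub>\<eta>\<close>, and conjugating
  it by \<open>T\<^sub>1\<^sub>,\<^sub>-\<^sub>\<eta>\<close> gives the conjugate of \<open>D\<^sub>-\<^sub>\<eta>\<close>. As \<open>T\<^sub>s\<^sub>,\<^sub>t\<close> is self-adjoint, multiplicative and compatible with \<open>\<Lambda>\<close>,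
  (a) and (b) follow from the case \<open>\<eta> = 1\<close>, up to the zero-order commutators of \<open>\<Lambda>\<close> with \<open>d\<eta> \<and> \<cdot>\<close>, which produce the terms
  with \<open>n / \<eta>\<close>. Relations (c) and (d) are the formal adjoints of (a) and (b).\<close>

section \<open>Alternating forms on a complex vector space\<close>

text \<open>No local (1,0)-coframe is differentiated. Pointwise adjoints are traces over a real
  orthonormal basis; such traces do not depend on the basis, so a basis may be chosen at every point
  although the choice need not be continuous, and smoothness and derivatives go through the inverse
  metric. Both \<open>vol\<close> and \<open>adj\<close> are definite descriptions, so existence has
  to be proved: the measure is glued from chart densities, and formal adjoints are carried as pairs
  of local operators, because a composition can only be tested if P u is again compactly supported.
  Origin of n / \<eta>: D and its partner are built from operators related by T_{s',t'} =
  T_{\<eta>,\<eta>} T_{1,-1} T_{s,t}^{-1}. Conjugating d by T_{\<eta>,\<eta>}, which is \<eta>^k on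
  k-forms, leaves a term d\<eta> \<and> times the degree. On the torsion side the derivative of
  T^{-1} \<omega> contains d\<eta> \<and> \<omega>, whose adjoint meets [\<Lambda>, \<omega> \<and>]
  = n - k. The degrees cancel and n is left.\<close>

abbreviation J :: "complex^'n \<Rightarrow> complex^'n" where "J v \<equiv> \<i> *s v"

lemma J_J [simp]: "J (J v) = - v"
  by (simp add: vec_eq_iff flip: mult.assoc)

lemma J_add: "J (v + w) = J v + J w"
  by (simp add: vec_eq_iff algebra_simps)

lemma J_scaleR: "J (r *\<^sub>R v) = r *\<^sub>R J v"
  by (simp add: vec_eq_iff)

lemma linear_J: "linear (J :: complex^'n \<Rightarrow> complex^'n)"
  by (rule linearI) (simp_all add: J_add J_scaleR)

section \<open>Interior products and alternating functions on lists\<close>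

definition ins :: "'v \<Rightarrow> ('v list \<Rightarrow> complex) \<Rightarrow> 'v list \<Rightarrow> complex" where
  "ins v \<alpha> = (\<lambda>vs. \<alpha> (v # vs))"

lemma ins_app [simp]: "ins v \<alpha> vs = \<alpha> (v # vs)"
  by (simp add: ins_def)

text \<open>The condition on lists of one length only. A fibre is of mixed degree, so this
  localization is what makes induction on the degree possible.\<close>

definition alternating_deg :: "nat \<Rightarrow> 'n::finite fibre \<Rightarrow> bool" where
  "alternating_deg k \<alpha> \<longleftrightarrow>
     (\<forall>xs ys. Suc (length xs + length ys) = k \<longrightarrow> linear (\<lambda>v. \<alpha> (xs @ [v] @ ys))) \<and>
     (\<forall>xs ys zs v. Suc (Suc (length xs + length ys + length zs)) = k \<longrightarrow> \<alpha> (xs @ [v] @ ys @ [v] @ zs) = 0)"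

lemma alternating_iff_deg: "alternating \<alpha> \<longleftrightarrow> (\<forall>k. alternating_deg k \<alpha>)"
  unfolding alternating_def alternating_deg_def by blast

lemma alternating_deg_0 [simp]: "alternating_deg 0 \<alpha>"
  by (simp add: alternating_deg_def)

lemma alternating_deg_same:
  "alternating_deg k \<alpha> \<Longrightarrow> Suc (Suc (length xs + length ys + length zs)) = k \<Longrightarrow> \<alpha> (xs @ [v] @ ys @ [v] @ zs) = 0"
  by (simp add: alternating_deg_def)

text \<open>Conditions at the head suffice: a slot further back is reached by contracting with the
  entries in front of it, and a repetition that starts at the head is moved behind it by a
  transposition.\<close>

lemma alternating_deg_Suc:
  assumes ins: "\<And>v. alternating_deg k (ins v \<alpha>)"
    and lin: "\<And>vs. length vs = k \<Longrightarrow> linear (\<lambda>v. \<alpha> (v # vs))"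
    and alt: "\<And>v vs. Suc (length vs) = k \<Longrightarrow> \<alpha> (v # v # vs) = 0"
  shows "alternating_deg (Suc k) \<alpha>"
  unfolding alternating_deg_def
proof (intro conjI allI impI)
  fix xs ys :: "(complex^'a) list" assume len: "Suc (length xs + length ys) = Suc k"
  show "linear (\<lambda>v. \<alpha> (xs @ [v] @ ys))"
  proof (cases xs)
    case Nil
    then show ?thesis using lin len by simp
  next
    case (Cons x xs')
    then have "linear (\<lambda>v. ins x \<alpha> (xs' @ [v] @ ys))"
      using ins[of x] len by (simp add: alternating_deg_def del: ins_app)
    then show ?thesis using Cons by simp
  qed
next
  fix xs ys zs :: "(complex^'a) list" and v
  assume len: "Suc (Suc (length xs + length ys + length zs)) = Suc k"
  \<comment> \<open>Polarization of the vanishing on repeated vectors at v + w. Linearity in the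
    second slot comes from the contraction, which is already known to be alternating.\<close>
  have swap: "\<alpha> (v # w # vs) = - \<alpha> (w # v # vs)" if "Suc (length vs) = k" for v w vs
  proof -
    have add: "\<alpha> ((v + w) # x # vs) = \<alpha> (v # x # vs) + \<alpha> (w # x # vs)" for x
      using lin[of "x # vs"] that by (simp add: linear_iff)
    have "linear (\<lambda>x. ins y \<alpha> ([] @ [x] @ vs))" for y
      using ins[of y] that by (simp add: alternating_deg_def del: ins_app append_Nil)
    then have "\<alpha> (y # (v + w) # vs) = \<alpha> (y # v # vs) + \<alpha> (y # w # vs)" for y
      by (simp add: linear_iff)
    then show ?thesis
      using alt[OF that, of "v + w"] alt[OF that, of v] alt[OF that, of w] add
      by (simp add: add_eq_0_iff2)
  qed
  show "\<alpha> (xs @ [v] @ ys @ [v] @ zs) = 0"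
  proof (cases xs)
    case (Cons x xs')
    then have "ins x \<alpha> (xs' @ [v] @ ys @ [v] @ zs) = 0"
      using len by (intro alternating_deg_same[OF ins]) simp
    then show ?thesis using Cons by simp
  next
    case Nil
    show ?thesis
    proof (cases ys)
      case Nil
      then show ?thesis using \<open>xs = []\<close> alt len by simp
    next
      case (Cons y ys')
      \<comment> \<open>The repeated v sits at the head and again further back. Transposing it with
        y puts both copies behind y, where the contraction with y applies.\<close>
      then have "ins y \<alpha> ([] @ [v] @ ys' @ [v] @ zs) = 0"
        using len \<open>xs = []\<close> by (intro alternating_deg_same[OF ins]) simp
      then show ?thesis using Cons \<open>xs = []\<close> swap[of "ys' @ v # zs" v y] len by simp
    qed
  qed
qed

text \<open>Iterating contractions never leaves X, so the head conditions reach every slot. It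
  serves operators given by recursion on the head of the list or by differentiation, where general
  slots are awkward to reach.\<close>

lemma alternating_coinduct:
  assumes ins: "\<And>\<alpha> v. \<alpha> \<in> X \<Longrightarrow> ins v \<alpha> \<in> X"
    and lin: "\<And>\<alpha> vs. \<alpha> \<in> X \<Longrightarrow> linear (\<lambda>v. \<alpha> (v # vs))"
    and alt: "\<And>\<alpha> v vs. \<alpha> \<in> X \<Longrightarrow> \<alpha> (v # v # vs) = 0"
    and "\<alpha> \<in> X"
  shows "alternating \<alpha>"
proof -
  have "\<forall>\<alpha>\<in>X. alternating_deg k \<alpha>" for k
    by (induction k) (auto intro!: alternating_deg_Suc ins lin alt)
  then show ?thesis using assms(4) by (auto simp: alternating_iff_deg)
qed

lemma alternating_linear_at: "alternating \<alpha> \<Longrightarrow> linear (\<lambda>v. \<alpha> (xs @ [v] @ ys))"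
  by (simp add: alternating_def)

lemma alternating_repeat: "alternating \<alpha> \<Longrightarrow> \<alpha> (xs @ [v] @ ys @ [v] @ zs) = 0"
  by (simp add: alternating_def)

lemma alternating_linear: "alternating \<alpha> \<Longrightarrow> linear (\<lambda>v. \<alpha> (v # vs))"
  using alternating_linear_at[of \<alpha> "[]" vs] by simp

lemma alternating_ins [intro, simp]: "alternating \<alpha> \<Longrightarrow> alternating (ins v \<alpha>)"
  unfolding alternating_def ins_def append_Cons[symmetric] by blast

lemma alternating_same: "alternating \<alpha> \<Longrightarrow> \<alpha> (v # v # vs) = 0"
  using alternating_repeat[of \<alpha> "[]" v "[]" vs] by simp

lemma alternating_head_add: "alternating \<alpha> \<Longrightarrow> \<alpha> ((v + w) # vs) = \<alpha> (v # vs) + \<alpha> (w # vs)"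
  using alternating_linear[of \<alpha> vs] by (simp add: linear_iff)

lemma alternating_head_scaleR: "alternating \<alpha> \<Longrightarrow> \<alpha> ((r *\<^sub>R v) # vs) = r * \<alpha> (v # vs)"
  using alternating_linear[of \<alpha> vs] by (simp add: linear_iff scaleR_conv_of_real)

lemma alternating_head_minus: "alternating \<alpha> \<Longrightarrow> \<alpha> ((- v) # vs) = - \<alpha> (v # vs)"
  using alternating_head_scaleR[of \<alpha> "-1" v vs] by simp

lemma alternating_head_sum:
  "alternating \<alpha> \<Longrightarrow> \<alpha> ((\<Sum>i\<in>I. f i) # vs) = (\<Sum>i\<in>I. \<alpha> (f i # vs))"
  using linear_sum[OF alternating_linear[of \<alpha> vs], of f I] .

lemma ins_add: "alternating \<alpha> \<Longrightarrow> ins (v + w) \<alpha> = (\<lambda>vs. ins v \<alpha> vs + ins w \<alpha> vs)"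
  by (auto simp: alternating_head_add)

lemma ins_scaleR: "alternating \<alpha> \<Longrightarrow> ins (r *\<^sub>R v) \<alpha> = (\<lambda>vs. of_real r * ins v \<alpha> vs)"
  by (auto simp: alternating_head_scaleR)

lemma alternating_swap:
  assumes "alternating \<alpha>"
  shows "\<alpha> (v # w # vs) = - \<alpha> (w # v # vs)"
proof -
  have add: "\<alpha> (x # (v + w) # vs) = \<alpha> (x # v # vs) + \<alpha> (x # w # vs)" for x
    using alternating_head_add[OF alternating_ins[OF assms, of x]] by simp
  have "0 = \<alpha> ((v + w) # (v + w) # vs)"
    by (simp only: alternating_same[OF assms])
  also have "\<dots> = \<alpha> (v # w # vs) + \<alpha> (w # v # vs)"
    unfolding alternating_head_add[OF assms] add
    by (simp only: alternating_same[OF assms] add_0_left add_0_right add.commute)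
  finally show ?thesis by (metis add_eq_0_iff2)
qed

lemma alternating_add: "alternating \<alpha> \<Longrightarrow> alternating \<beta> \<Longrightarrow> alternating (\<lambda>vs. \<alpha> vs + \<beta> vs)"
  unfolding alternating_def by (auto intro: linear_compose_add)

lemma alternating_mult: "alternating \<alpha> \<Longrightarrow> alternating (\<lambda>vs. c * \<alpha> vs)"
  unfolding alternating_def by (auto simp: linear_iff algebra_simps)

lemma alternating_zero: "alternating (\<lambda>vs. 0)"
  unfolding alternating_def by (auto simp: linear_iff)

lemma alternating_sum: "(\<And>i. i \<in> I \<Longrightarrow> alternating (\<alpha> i)) \<Longrightarrow> alternating (\<lambda>vs. \<Sum>i\<in>I. \<alpha> i vs)"
  unfolding alternating_def by (auto intro!: linear_compose_sum)

lemma alternating_cnj: "alternating \<alpha> \<Longrightarrow> alternating (\<lambda>vs. cnj (\<alpha> vs))"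
  unfolding alternating_def by (auto simp: linear_iff)

lemma alternating_deg_add:
  "alternating_deg k \<alpha> \<Longrightarrow> alternating_deg k \<beta> \<Longrightarrow> alternating_deg k (\<lambda>vs. \<alpha> vs + \<beta> vs)"
  unfolding alternating_deg_def by (auto intro: linear_compose_add)

section \<open>The grading involution and the wedge product\<close>

definition sgf :: "'n fibre \<Rightarrow> 'n fibre" where
  "sgf \<alpha> = (\<lambda>vs. (- 1) ^ length vs * \<alpha> vs)"

lemma alternating_sgf:
  assumes "alternating \<alpha>" shows "alternating (sgf \<alpha>)"
  using assms unfolding alternating_def sgf_def by (auto simp: linear_iff algebra_simps)

lemma ins_sgf: "ins v (sgf \<alpha>) = (\<lambda>vs. - sgf (ins v \<alpha>) vs)"
  by (auto simp: sgf_def)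

text \<open>Subsets are split by whether they contain 0, that is, by whether the first argument of a
  wedge product goes to the left or to the right factor.\<close>

lemma sum_Pow_lessThan_Suc:
  fixes f :: "nat set \<Rightarrow> 'b::comm_monoid_add"
  shows "(\<Sum>S\<in>Pow {..<Suc n}. f S) = (\<Sum>S\<in>Pow {..<n}. f (insert 0 (Suc ` S))) + (\<Sum>S\<in>Pow {..<n}. f (Suc ` S))"
proof -
  have eq: "Pow {..<Suc n} = (\<lambda>S. insert 0 (Suc ` S)) ` Pow {..<n} \<union> (`) Suc ` Pow {..<n}"
  proof -
    have "{..<Suc n} = insert 0 (Suc ` {..<n})" by (rule lessThan_Suc_eq_insert_0)
    then have "Pow {..<Suc n} = Pow (Suc ` {..<n}) \<union> insert 0 ` Pow (Suc ` {..<n})"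
      by (simp only: Pow_insert)
    also have "Pow (Suc ` {..<n::nat}) = (`) Suc ` Pow {..<n}"
      by (rule image_Pow_surj[OF refl, symmetric])
    finally show ?thesis by (simp only: image_image Un_commute)
  qed
  have inj1: "inj_on (\<lambda>S. insert 0 (Suc ` S)) (Pow {..<n})"
  proof (rule inj_onI)
    fix A B assume eq: "insert 0 (Suc ` A) = insert 0 (Suc ` B)"
    have "x \<in> A \<longleftrightarrow> x \<in> B" for x
      using arg_cong[OF eq, of "\<lambda>s. Suc x \<in> s"] by (simp add: inj_image_mem_iff)
    then show "A = B" by blast
  qed
  have inj2: "inj_on ((`) Suc) (Pow {..<n})" by (auto simp: inj_on_def inj_image_eq_iff)
  show ?thesis unfolding eq
    by (subst sum.union_disjoint) (auto simp: sum.reindex[OF inj1] sum.reindex[OF inj2])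
qed

lemma fwedge_Nil [simp]: "fwedge \<alpha> \<beta> [] = \<alpha> [] * \<beta> []"
  by (simp add: fwedge_def)

text \<open>Position 0 lies outside the shifted set, so each element of S jumps over it. These
  \<open>card S\<close> additional inversions become the sign \<open>sgf\<close> of the left factor
  in \<open>fwedge_Cons\<close>.\<close>

lemma card_inversions_Suc:
  "card {(i, j). i \<in> Suc ` S \<and> j \<notin> Suc ` S \<and> j < i} = card S + card {(i, j). i \<in> S \<and> j \<notin> S \<and> j < i}"
  if "finite S" for S :: "nat set"
proof -
  let ?I = "{(i, j). i \<in> S \<and> j \<notin> S \<and> j < i}"
  have fin: "finite ?I"
    by (rule finite_subset[of _ "S \<times> {..Max S}"]) (use that in \<open>auto intro: less_imp_le order.trans[OF less_imp_le Max_ge]\<close>)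
  have "{(i, j). i \<in> Suc ` S \<and> j \<notin> Suc ` S \<and> j < i}
      = (\<lambda>i. (Suc i, 0)) ` S \<union> (\<lambda>(i, j). (Suc i, Suc j)) ` ?I" (is "?L = ?R")
  proof (rule set_eqI, clarify)
    fix i j show "(i, j) \<in> ?L \<longleftrightarrow> (i, j) \<in> ?R"
      by (cases j; cases i) (auto simp: image_iff)
  qed
  moreover have "inj_on (\<lambda>i. (Suc i, 0::nat)) S" "inj_on (\<lambda>(i, j). (Suc i, Suc j)) ?I"
    by (auto simp: inj_on_def)
  ultimately show ?thesis using that fin
    by (subst \<open>?L = ?R\<close>, subst card_Un_disjoint) (auto simp: card_image)
qed

text \<open>Position 0 belongs to the set and precedes everything, so it takes part in no
  inversion.\<close>

lemma card_inversions_insert: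
  "card {(i, j). i \<in> insert 0 (Suc ` S) \<and> j \<notin> insert 0 (Suc ` S) \<and> j < i} = card {(i, j). i \<in> S \<and> j \<notin> S \<and> j < i}"
  for S :: "nat set"
proof -
  let ?I = "{(i, j). i \<in> S \<and> j \<notin> S \<and> j < i}"
  have "{(i, j). i \<in> insert 0 (Suc ` S) \<and> j \<notin> insert 0 (Suc ` S) \<and> j < i} = (\<lambda>(i, j). (Suc i, Suc j)) ` ?I"
    (is "?L = ?R")
  proof (rule set_eqI, clarify)
    fix i j show "(i, j) \<in> ?L \<longleftrightarrow> (i, j) \<in> ?R"
      by (cases j; cases i) (auto simp: image_iff)
  qed
  moreover have "inj_on (\<lambda>(i, j). (Suc i, Suc j)) ?I" by (auto simp: inj_on_def)
  ultimately show ?thesis by (simp add: card_image)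
qed

text \<open>Contraction with a vector is an antiderivation; most identities below are proved by induction on the
  list of arguments from such a rule for its head.\<close>

lemma fwedge_Cons: "fwedge \<alpha> \<beta> (v # vs) = fwedge (ins v \<alpha>) \<beta> vs + fwedge (sgf \<alpha>) (ins v \<beta>) vs"
proof -
  let ?t = "\<lambda>\<alpha> \<beta> vs S. (- 1) ^ card {(i, j). i \<in> S \<and> j \<notin> S \<and> j < i} * \<alpha> (nths vs S) * \<beta> (nths vs (- S))
    :: complex"
  have compl: "{j. \<forall>x\<in>S. j \<noteq> x} = - S" for S :: "nat set" by auto
  have 1: "?t \<alpha> \<beta> (v # vs) (insert 0 (Suc ` S)) = ?t (ins v \<alpha>) \<beta> vs S" for S
    unfolding card_inversions_insert by (simp add: nths_Cons Compl_eq image_iff compl)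
  have 2: "?t \<alpha> \<beta> (v # vs) (Suc ` S) = ?t (sgf \<alpha>) (ins v \<beta>) vs S" if "S \<in> Pow {..<length vs}" for S
  proof -
    have fin: "finite S" using that finite_subset by auto
    have "card {i. i < length vs \<and> i \<in> S} = card S"
      using that by (intro arg_cong[where f=card]) auto
    then have "length (nths vs S) = card S" by (simp add: length_nths)
    then show ?thesis
      unfolding card_inversions_Suc[OF fin] by (simp add: nths_Cons Compl_eq image_iff sgf_def power_add compl)
  qed
  show ?thesis
    unfolding fwedge_def list.size add_0_right add_Suc_right sum_Pow_lessThan_Suc 1
    by (subst sum.cong[OF refl 2]) (simp_all add: fwedge_def)
qed

lemma fwedge_add_left: "fwedge (\<lambda>vs. \<alpha> vs + \<alpha>' vs) \<beta> vs = fwedge \<alpha> \<beta> vs + fwedge \<alpha>' \<beta> vs"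
  by (simp add: fwedge_def algebra_simps sum.distrib)

lemma fwedge_add_right: "fwedge \<alpha> (\<lambda>vs. \<beta> vs + \<beta>' vs) vs = fwedge \<alpha> \<beta> vs + fwedge \<alpha> \<beta>' vs"
  by (simp add: fwedge_def algebra_simps sum.distrib)

lemma fwedge_mult_left: "fwedge (\<lambda>vs. c * \<alpha> vs) \<beta> vs = c * fwedge \<alpha> \<beta> vs"
  by (simp add: fwedge_def algebra_simps sum_distrib_left)

lemma fwedge_mult_right: "fwedge \<alpha> (\<lambda>vs. c * \<beta> vs) vs = c * fwedge \<alpha> \<beta> vs"
  by (simp add: fwedge_def algebra_simps sum_distrib_left)

lemma fwedge_minus_left: "fwedge (\<lambda>vs. - \<alpha> vs) \<beta> vs = - fwedge \<alpha> \<beta> vs"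
  using fwedge_mult_left[of "-1" \<alpha> \<beta>] by simp

lemma fwedge_minus_right: "fwedge \<alpha> (\<lambda>vs. - \<beta> vs) vs = - fwedge \<alpha> \<beta> vs"
  using fwedge_mult_right[of \<alpha> "-1" \<beta>] by simp

lemma fwedge_sum_left: "fwedge (\<lambda>vs. \<Sum>i\<in>I. \<alpha> i vs) \<beta> vs = (\<Sum>i\<in>I. fwedge (\<alpha> i) \<beta> vs)"
  by (simp add: fwedge_def sum_distrib_left sum_distrib_right sum.swap[of _ I])

lemma fwedge_sum_right: "fwedge \<alpha> (\<lambda>vs. \<Sum>i\<in>I. \<beta> i vs) vs = (\<Sum>i\<in>I. fwedge \<alpha> (\<beta> i) vs)"
  by (simp add: fwedge_def sum_distrib_left sum_distrib_right sum.swap[of _ I])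

lemma fwedge_zero_left: "fwedge (\<lambda>vs. 0) \<beta> vs = 0"
  by (simp add: fwedge_def)

lemma fwedge_zero_right: "fwedge \<alpha> (\<lambda>vs. 0) vs = 0"
  by (simp add: fwedge_def)

lemma alternating_fwedge:
  assumes "alternating \<alpha>" "alternating \<beta>"
  shows "alternating (fwedge \<alpha> \<beta>)"
proof -
  have "alternating_deg k (fwedge \<alpha> \<beta>)" if "alternating \<alpha>" "alternating \<beta>" for k \<alpha> \<beta>
    using that
  proof (induction k arbitrary: \<alpha> \<beta>)
    case 0 then show ?case by simp
  next
    case (Suc k)
    note A = Suc.prems
    show ?case
    proof (rule alternating_deg_Suc)
      fix v
      have "ins v (fwedge \<alpha> \<beta>) = (\<lambda>vs. fwedge (ins v \<alpha>) \<beta> vs + fwedge (sgf \<alpha>) (ins v \<beta>) vs)"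
        by (auto simp: fwedge_Cons)
      then show "alternating_deg k (ins v (fwedge \<alpha> \<beta>))"
        using Suc by (auto intro!: alternating_deg_add Suc.IH alternating_sgf)
    next
      fix vs
      show "linear (\<lambda>v. fwedge \<alpha> \<beta> (v # vs))"
        unfolding fwedge_Cons
        by (rule linearI) (simp_all only: ins_add[OF A(1)] ins_add[OF A(2)] ins_scaleR[OF A(1)] ins_scaleR[OF A(2)]
            fwedge_add_left fwedge_add_right fwedge_mult_left fwedge_mult_right, simp_all add: algebra_simps scaleR_conv_of_real del: ins_app)
    next
      fix v vs
      \<comment> \<open>Contracting one factor twice with v gives zero, and the two mixed terms
        cancel because \<open>sgf\<close> anticommutes with contraction.\<close>
      have z: "ins v (ins v \<alpha>) = (\<lambda>vs. 0)" "ins v (ins v \<beta>) = (\<lambda>vs. 0)"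
        using A by (auto simp: alternating_same)
      have s: "sgf (sgf \<alpha>) = \<alpha>" by (auto simp: sgf_def simp flip: power_mult_distrib mult.assoc)
      show "fwedge \<alpha> \<beta> (v # v # vs) = 0"
        by (simp add: fwedge_Cons z s ins_sgf fwedge_minus_left del: ins_app) (simp add: fwedge_def)
    qed
  qed
  then show ?thesis using assms by (auto simp: alternating_iff_deg)
qed

section \<open>One-forms and homogeneous elements\<close>

declare ins_app [simp del]

definition one_form :: "(complex^'n \<Rightarrow> complex) \<Rightarrow> 'n fibre" where
  "one_form \<xi> vs = (case vs of [v] \<Rightarrow> \<xi> v | _ \<Rightarrow> 0)"

lemma one_form_Nil [simp]: "one_form \<xi> [] = 0"
  and one_form_single [simp]: "one_form \<xi> [v] = \<xi> v"
  by (simp_all add: one_form_def)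

definition homog :: "nat \<Rightarrow> 'n fibre \<Rightarrow> bool" where
  "homog k \<alpha> \<longleftrightarrow> (\<forall>vs. length vs \<noteq> k \<longrightarrow> \<alpha> vs = 0)"

lemma homogD: "homog k \<alpha> \<Longrightarrow> length vs \<noteq> k \<Longrightarrow> \<alpha> vs = 0"
  by (simp add: homog_def)

lemma homog_ins: "homog (Suc k) \<alpha> \<Longrightarrow> homog k (ins v \<alpha>)"
  by (simp add: homog_def ins_app)

lemma homog_one_form: "homog (Suc 0) (one_form \<xi>)"
  by (auto simp: homog_def one_form_def split: list.splits)

lemma homog_1_eq: "homog (Suc 0) \<alpha> \<Longrightarrow> \<alpha> = one_form (\<lambda>v. \<alpha> [v])"
  by (rule ext) (auto simp: homog_def one_form_def split: list.splits)

lemma sgf_homog: "homog k \<alpha> \<Longrightarrow> sgf \<alpha> = (\<lambda>vs. (- 1) ^ k * \<alpha> vs)"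
  by (rule ext) (auto simp: homog_def sgf_def)

lemma alternating_one_form: "linear \<xi> \<Longrightarrow> alternating (one_form \<xi>)"
proof -
  assume lin: "linear \<xi>"
  have *: "linear (\<lambda>v. one_form \<xi> (xs @ [v] @ ys))" for xs ys
  proof (cases "xs = [] \<and> ys = []")
    case True then show ?thesis using lin by (simp add: one_form_def)
  next
    case False
    then have "(\<lambda>v. one_form \<xi> (xs @ [v] @ ys)) = (\<lambda>v. 0)"
      by (cases xs; cases ys) (auto simp: one_form_def split: list.splits)
    then show ?thesis by (simp add: linear_iff)
  qed
  show ?thesis
    unfolding alternating_def using * by (auto simp: one_form_def split: list.splits)
qed

lemma fwedge_function: "fwedge (\<lambda>vs. if vs = [] then c else 0) u vs = c * u vs"
proof (induction vs arbitrary: u)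
  case (Cons v vs)
  have 1: "ins v (\<lambda>vs. if vs = [] then c else 0) = (\<lambda>vs. 0)" by (auto simp: ins_def)
  have 2: "sgf (\<lambda>vs. if vs = [] then c else 0) = (\<lambda>vs. if vs = [] then c else 0)"
    by (auto simp: sgf_def)
  show ?case unfolding fwedge_Cons 1 2 Cons.IH by (simp add: fwedge_zero_left ins_app)
qed simp

lemma fwedge_one_form_Cons [simp]:
  "fwedge (one_form \<xi>) u (v # vs) = \<xi> v * u vs - fwedge (one_form \<xi>) (ins v u) vs"
proof -
  have 1: "ins v (one_form \<xi>) = (\<lambda>vs. if vs = [] then \<xi> v else 0)"
    by (auto simp: ins_def one_form_def split: list.splits)
  have 2: "sgf (one_form \<xi>) = (\<lambda>vs. - one_form \<xi> vs)"
    by (simp add: sgf_homog[OF homog_one_form])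
  show ?thesis unfolding fwedge_Cons 1 2 fwedge_function by (simp add: fwedge_minus_left)
qed

lemma ins_fwedge_one_form:
  "ins v (fwedge (one_form \<xi>) u) = (\<lambda>vs. \<xi> v * u vs - fwedge (one_form \<xi>) (ins v u) vs)"
  by (rule ext) (simp add: ins_app)

lemma one_form_add: "one_form (\<lambda>v. \<xi> v + \<zeta> v) = (\<lambda>vs. one_form \<xi> vs + one_form \<zeta> vs)"
  by (auto simp: one_form_def split: list.splits)

lemma one_form_mult: "one_form (\<lambda>v. c * \<xi> v) = (\<lambda>vs. c * one_form \<xi> vs)"
  by (auto simp: one_form_def split: list.splits)

lemma one_form_minus: "one_form (\<lambda>v. - \<xi> v) = (\<lambda>vs. - one_form \<xi> vs)"
  by (auto simp: one_form_def split: list.splits)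

lemma one_form_sum: "one_form (\<lambda>v. \<Sum>i\<in>I. \<xi> i v) = (\<lambda>vs. \<Sum>i\<in>I. one_form (\<xi> i) vs)"
  by (auto simp: one_form_def split: list.splits)

lemma fwedge_two_Cons:
  assumes "homog 2 \<sigma>"
  shows "fwedge \<sigma> u (v # vs) = fwedge (one_form (\<lambda>w. \<sigma> [v, w])) u vs + fwedge \<sigma> (ins v u) vs"
proof -
  have 1: "ins v \<sigma> = one_form (\<lambda>w. \<sigma> [v, w])"
    using homog_1_eq[OF homog_ins, of \<sigma> v] assms by (simp add: numeral_2_eq_2 ins_app)
  show ?thesis unfolding fwedge_Cons 1 using sgf_homog[OF assms] by simp
qed

lemma sgf_fwedge: "sgf (fwedge \<alpha> \<beta>) = fwedge (sgf \<alpha>) (sgf \<beta>)"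
proof
  fix vs show "sgf (fwedge \<alpha> \<beta>) vs = fwedge (sgf \<alpha>) (sgf \<beta>) vs"
  proof (induction vs arbitrary: \<alpha> \<beta>)
    case (Cons v vs)
    have "sgf (fwedge \<alpha> \<beta>) (v # vs) = - sgf (ins v (fwedge \<alpha> \<beta>)) vs"
      by (simp add: sgf_def ins_app)
    also have "\<dots> = - sgf (fwedge (ins v \<alpha>) \<beta>) vs - sgf (fwedge (sgf \<alpha>) (ins v \<beta>)) vs"
      by (simp add: sgf_def fwedge_Cons ins_app algebra_simps)
    finally show ?case
      unfolding Cons.IH by (simp add: fwedge_Cons ins_sgf fwedge_minus_left fwedge_minus_right)
  qed (simp add: sgf_def)
qed

lemma fwedge_assoc: "fwedge (fwedge \<alpha> \<beta>) \<gamma> = fwedge \<alpha> (fwedge \<beta> \<gamma>)"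
proof
  fix vs show "fwedge (fwedge \<alpha> \<beta>) \<gamma> vs = fwedge \<alpha> (fwedge \<beta> \<gamma>) vs"
  proof (induction vs arbitrary: \<alpha> \<beta> \<gamma>)
    case (Cons v vs)
    have 1: "ins v (fwedge \<alpha> \<beta>) = (\<lambda>vs. fwedge (ins v \<alpha>) \<beta> vs + fwedge (sgf \<alpha>) (ins v \<beta>) vs)" for \<alpha> \<beta> :: "'a fibre"
      by (rule ext) (simp add: fwedge_Cons ins_app)
    show ?case
      by (simp add: fwedge_Cons[of _ _ v vs] 1 fwedge_add_left fwedge_add_right Cons.IH sgf_fwedge)
  qed simp
qed

text \<open>A left factor of degree k consumes exactly k of the arguments, so the right factor is
  only evaluated on lists of the remaining length.\<close>

lemma fwedge_right_cong:
  assumes "homog k \<alpha>" "\<And>ws. length ws + k = length vs \<Longrightarrow> \<beta> ws = \<beta>' ws"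
  shows "fwedge \<alpha> \<beta> vs = fwedge \<alpha> \<beta>' vs"
  using assms
proof (induction vs arbitrary: \<alpha> \<beta> \<beta>' k)
  case Nil
  then show ?case by (cases k) (auto simp: homog_def)
next
  case (Cons v vs)
  have "fwedge (ins v \<alpha>) \<beta> vs = fwedge (ins v \<alpha>) \<beta>' vs"
  proof (cases k)
    case 0
    then have "ins v \<alpha> = (\<lambda>vs. 0)" using Cons.prems(1) by (auto simp: homog_def ins_def)
    then show ?thesis by (simp add: fwedge_zero_left)
  next
    case (Suc j)
    then show ?thesis using Cons.prems by (intro Cons.IH[of j]) (auto simp: homog_def ins_app)
  qed
  moreover have "fwedge (sgf \<alpha>) (ins v \<beta>) vs = fwedge (sgf \<alpha>) (ins v \<beta>') vs"
    using Cons.prems by (intro Cons.IH[of k]) (auto simp: homog_def sgf_def ins_app)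
  ultimately show ?case by (simp add: fwedge_Cons)
qed

text \<open>The operator \<open>s\<^sup>p t\<^sup>q\<close> on forms of bidegree \<open>(p, q)\<close>: it replaces each argument \<open>v\<close> by
  \<open>s v\<^sup>1\<^sup>,\<^sup>0 + t v\<^sup>0\<^sup>,\<^sup>1 = (s + t) / 2 v + \<i> (t - s) / 2 J v\<close>.\<close>

definition tw_ins :: "real \<Rightarrow> real \<Rightarrow> complex^'n::finite \<Rightarrow> 'n fibre \<Rightarrow> 'n fibre" where
  "tw_ins s t v \<alpha> ws = of_real ((s + t) / 2) * \<alpha> (v # ws) + \<i> * of_real ((t - s) / 2) * \<alpha> (J v # ws)"

fun tw :: "real \<Rightarrow> real \<Rightarrow> 'n::finite fibre \<Rightarrow> 'n fibre" where
  "tw s t \<alpha> [] = \<alpha> []"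
| "tw s t \<alpha> (v # vs) = tw s t (tw_ins s t v \<alpha>) vs"

lemma ins_tw: "ins v (tw s t \<alpha>) = tw s t (tw_ins s t v \<alpha>)"
  by (rule ext) (simp add: ins_app)

lemma tw_cong: "(\<And>ws. length ws = length vs \<Longrightarrow> \<alpha> ws = \<beta> ws) \<Longrightarrow> tw s t \<alpha> vs = tw s t \<beta> vs"
proof (induction vs arbitrary: \<alpha> \<beta>)
  case (Cons v vs)
  show ?case unfolding tw.simps by (rule Cons.IH) (simp add: tw_ins_def Cons.prems)
qed simp

lemma tw_add: "tw s t (\<lambda>vs. \<alpha> vs + \<beta> vs) vs = tw s t \<alpha> vs + tw s t \<beta> vs"
proof (induction vs arbitrary: \<alpha> \<beta>)
  case (Cons v vs)
  have "tw_ins s t v (\<lambda>vs. \<alpha> vs + \<beta> vs) = (\<lambda>vs. tw_ins s t v \<alpha> vs + tw_ins s t v \<beta> vs)"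
    by (rule ext) (simp add: tw_ins_def ins_app field_simps)
  then show ?case by (simp add: Cons.IH)
qed simp

lemma tw_mult: "tw s t (\<lambda>vs. c * \<alpha> vs) vs = c * tw s t \<alpha> vs"
proof (induction vs arbitrary: \<alpha>)
  case (Cons v vs)
  have "tw_ins s t v (\<lambda>vs. c * \<alpha> vs) = (\<lambda>vs. c * tw_ins s t v \<alpha> vs)"
    by (rule ext) (simp add: tw_ins_def ins_app field_simps)
  then show ?case by (simp add: Cons.IH)
qed simp

lemma tw_zero: "tw s t (\<lambda>vs. 0) vs = 0"
  using tw_mult[of s t 0 "\<lambda>vs. 0" vs] by simp

lemma tw_minus: "tw s t (\<lambda>vs. - \<alpha> vs) vs = - tw s t \<alpha> vs"
  using tw_mult[of s t "-1" \<alpha> vs] by simp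

lemma tw_diff: "tw s t (\<lambda>vs. \<alpha> vs - \<beta> vs) vs = tw s t \<alpha> vs - tw s t \<beta> vs"
  using tw_add[of s t \<alpha> "\<lambda>vs. - \<beta> vs" vs] by (simp add: tw_minus)

lemma tw_sum: "tw s t (\<lambda>vs. \<Sum>i\<in>I. \<alpha> i vs) vs = (\<Sum>i\<in>I. tw s t (\<alpha> i) vs)"
  by (induction I rule: infinite_finite_induct) (simp_all add: tw_zero tw_add)

lemma tw_tw_ins:
  "tw s t (tw_ins s' t' v \<alpha>) vs = of_real ((s' + t') / 2) * tw s t (ins v \<alpha>) vs
     + \<i> * of_real ((t' - s') / 2) * tw s t (ins (J v) \<alpha>) vs"
proof -
  have "tw_ins s' t' v \<alpha> = (\<lambda>ws. of_real ((s' + t') / 2) * ins v \<alpha> ws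
     + \<i> * of_real ((t' - s') / 2) * ins (J v) \<alpha> ws)"
    by (rule ext) (simp add: tw_ins_def ins_app)
  then show ?thesis by (simp only: tw_add tw_mult)
qed

lemma alternating_tw_ins: "alternating \<alpha> \<Longrightarrow> alternating (tw_ins s t v \<alpha>)"
proof -
  assume a: "alternating \<alpha>"
  have "tw_ins s t v \<alpha> = (\<lambda>ws. of_real ((s + t) / 2) * ins v \<alpha> ws
     + \<i> * of_real ((t - s) / 2) * ins (J v) \<alpha> ws)"
    by (rule ext) (simp add: tw_ins_def ins_app)
  then show ?thesis
    using a by (simp only:) (intro alternating_add alternating_mult alternating_ins)
qed

lemma alternating_tw:
  assumes "alternating \<alpha>" shows "alternating (tw s t \<alpha>)"
proof (rule alternating_coinduct[where X = "{tw s t \<beta> |\<beta>. alternating \<beta>}"])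
  fix \<gamma> :: "'a fibre" and v vs assume "\<gamma> \<in> {tw s t \<beta> |\<beta>. alternating \<beta>}"
  then obtain \<beta> where \<beta>: "\<gamma> = tw s t \<beta>" "alternating \<beta>" by blast
  then show "ins v \<gamma> \<in> {tw s t \<beta> |\<beta>. alternating \<beta>}" by (auto simp: ins_tw intro: alternating_tw_ins)
  have "tw_ins s t (v + w) \<beta> = (\<lambda>ws. tw_ins s t v \<beta> ws + tw_ins s t w \<beta> ws)" for v w
    by (rule ext) (use \<beta>(2) in \<open>simp add: tw_ins_def J_add alternating_head_add field_simps\<close>)
  moreover have "tw_ins s t (r *\<^sub>R v) \<beta> = (\<lambda>ws. r * tw_ins s t v \<beta> ws)" for r v
    by (rule ext) (use \<beta>(2) in \<open>simp add: tw_ins_def J_scaleR alternating_head_scaleR algebra_simps\<close>)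
  ultimately show "linear (\<lambda>v. \<gamma> (v # vs))"
    unfolding \<beta> by (intro linearI) (simp_all add: tw_add tw_mult scaleR_conv_of_real)
  \<comment> \<open>The terms with a repeated argument vanish, and the two mixed terms in v and
    \<open>J v\<close> cancel by antisymmetry.\<close>
  have "tw_ins s t v (tw_ins s t v \<beta>) = (\<lambda>ws. 0)"
    by (rule ext) (use \<beta>(2) alternating_swap[OF \<beta>(2), of "J v" v] in \<open>simp add: tw_ins_def alternating_same field_simps\<close>)
  then show "\<gamma> (v # v # vs) = 0" by (simp add: \<beta> tw_zero)
qed (use assms in blast)

lemma tw_homog: "homog k \<alpha> \<Longrightarrow> homog k (tw s t \<alpha>)"
  unfolding homog_def using tw_cong[of _ \<alpha> "\<lambda>_. 0" s t] by (simp add: tw_zero)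

lemma sgf_tw: "sgf (tw s t \<alpha>) = tw s t (sgf \<alpha>)"
proof
  fix vs
  have "tw s t (sgf \<alpha>) vs = tw s t (\<lambda>ws. (- 1) ^ length vs * \<alpha> ws) vs"
    by (rule tw_cong) (simp add: sgf_def)
  then show "sgf (tw s t \<alpha>) vs = tw s t (sgf \<alpha>) vs"
    by (simp only: tw_mult sgf_def)
qed

text \<open>Twisting applies one fixed endomorphism of the complexified tangent space to every
  argument, and such a substitution respects the antiderivation rule.\<close>

lemma tw_fwedge: "tw s t (fwedge \<alpha> \<beta>) = fwedge (tw s t \<alpha>) (tw s t \<beta>)"
proof
  fix vs show "tw s t (fwedge \<alpha> \<beta>) vs = fwedge (tw s t \<alpha>) (tw s t \<beta>) vs"
  proof (induction vs arbitrary: \<alpha> \<beta>)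
    case (Cons v vs)
    have "tw_ins s t v (fwedge \<alpha> \<beta>)
        = (\<lambda>ws. fwedge (tw_ins s t v \<alpha>) \<beta> ws + fwedge (sgf \<alpha>) (tw_ins s t v \<beta>) ws)"
    proof
      have e: "tw_ins s t v \<gamma> = (\<lambda>ws. of_real ((s + t) / 2) * ins v \<gamma> ws
          + \<i> * of_real ((t - s) / 2) * ins (J v) \<gamma> ws)" for \<gamma>
        by (rule ext) (simp add: tw_ins_def ins_app)
      fix ws show "tw_ins s t v (fwedge \<alpha> \<beta>) ws = fwedge (tw_ins s t v \<alpha>) \<beta> ws + fwedge (sgf \<alpha>) (tw_ins s t v \<beta>) ws"
        unfolding e[of \<alpha>] e[of \<beta>] fwedge_add_left fwedge_add_right fwedge_mult_left fwedge_mult_right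
        by (simp add: tw_ins_def fwedge_Cons field_simps)
    qed
    then show ?case
      by (simp add: tw_add Cons.IH fwedge_Cons ins_tw sgf_tw)
  qed simp
qed

text \<open>The substitutions multiply \<open>v\<^sup>1\<^sup>,\<^sup>0\<close> by s and
  \<open>v\<^sup>0\<^sup>,\<^sup>1\<close> by t, so the factors multiply. In the coefficients of v
  and \<open>J v\<close> this is the rule \<open>J (J v) = - v\<close>.\<close>

lemma tw_tw:
  assumes "alternating \<alpha>"
  shows "tw s t (tw s' t' \<alpha>) = tw (s * s') (t * t') \<alpha>"
proof
  fix vs show "tw s t (tw s' t' \<alpha>) vs = tw (s * s') (t * t') \<alpha> vs"
    using assms
  proof (induction vs arbitrary: \<alpha>)
    case (Cons v vs)
    have "tw_ins s t v (tw s' t' \<alpha>) = (\<lambda>ws. of_real ((s + t) / 2) * tw s' t' (tw_ins s' t' v \<alpha>) ws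
        + \<i> * of_real ((t - s) / 2) * tw s' t' (tw_ins s' t' (J v) \<alpha>) ws)"
      by (rule ext) (simp add: tw_ins_def ins_app)
    also have "\<dots> = tw s' t' (tw_ins (s * s') (t * t') v \<alpha>)"
    proof
      fix ws
      have n: "ins (J (J v)) \<alpha> = (\<lambda>ws. - ins v \<alpha> ws)"
        using Cons.prems by (auto simp: ins_def alternating_head_minus)
      show "of_real ((s + t) / 2) * tw s' t' (tw_ins s' t' v \<alpha>) ws
          + \<i> * of_real ((t - s) / 2) * tw s' t' (tw_ins s' t' (J v) \<alpha>) ws
        = tw s' t' (tw_ins (s * s') (t * t') v \<alpha>) ws"
        unfolding tw_tw_ins n tw_minus by (simp add: field_simps)
    qed
    finally show ?case using Cons by (simp add: alternating_tw_ins)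
  qed simp
qed

lemma tw_scalar:
  assumes "alternating \<alpha>"
  shows "tw c c \<alpha> vs = of_real c ^ length vs * \<alpha> vs"
  using assms
proof (induction vs arbitrary: \<alpha>)
  case (Cons v vs)
  have "tw_ins c c v \<alpha> = (\<lambda>ws. of_real c * ins v \<alpha> ws)" by (rule ext) (simp add: tw_ins_def ins_app)
  then show ?case using Cons by (simp add: tw_mult) (simp add: ins_app)
qed simp

lemma tw_one: "alternating \<alpha> \<Longrightarrow> tw 1 1 \<alpha> = \<alpha>"
  by (rule ext) (simp add: tw_scalar)

lemma tw_cnj: "cnj (tw s t \<alpha> vs) = tw t s (\<lambda>vs. cnj (\<alpha> vs)) vs"
proof (induction vs arbitrary: \<alpha>)
  case (Cons v vs)
  have "(\<lambda>ws. cnj (tw_ins s t v \<alpha> ws)) = tw_ins t s v (\<lambda>ws. cnj (\<alpha> ws))"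
    by (rule ext) (simp add: tw_ins_def field_simps)
  then show ?case by (simp add: Cons.IH)
qed simp

lemma tw_one_form:
  "tw s t (one_form \<xi>) = one_form (\<lambda>v. of_real ((s + t) / 2) * \<xi> v + \<i> * of_real ((t - s) / 2) * \<xi> (J v))"
proof -
  have "tw s t (one_form \<xi>) = one_form (\<lambda>v. tw s t (one_form \<xi>) [v])"
    by (rule homog_1_eq[OF tw_homog[OF homog_one_form]])
  then show ?thesis by (simp add: tw_ins_def one_form_def)
qed

text \<open>J-invariance of a two-form means type (1,1), where \<open>s\<^sup>p t\<^sup>q\<close> is
  s t. Applied to the metric form it gives T \<omega> = s t \<omega>.\<close>

lemma tw_invariant_two_form:
  assumes "alternating \<sigma>" "homog 2 \<sigma>" "\<And>v w. \<sigma> [J v, J w] = \<sigma> [v, w]"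
  shows "tw s t \<sigma> = (\<lambda>vs. of_real (s * t) * \<sigma> vs)"
proof
  fix vs
  show "tw s t \<sigma> vs = of_real (s * t) * \<sigma> vs"
  proof (cases "length vs = 2")
    case False
    then show ?thesis using homogD[OF assms(2)] homogD[OF tw_homog[OF assms(2)]] by simp
  next
    case True
    then obtain v w where vs: "vs = [v, w]" by (auto simp: numeral_2_eq_2 length_Suc_conv)
    have "\<sigma> [J v, w] = - \<sigma> [v, J w]"
      using assms(3)[of "J v" w] alternating_head_minus[OF assms(1), of v "[J w]"] by simp
    then show ?thesis by (simp add: vs tw_ins_def assms(3) field_simps)
  qed
qed

section \<open>Components of type (p, q)\<close>

lemma complexified_Nil [simp]: "complexified \<alpha> [] = \<alpha> []"
  by (simp add: complexified_def)

lemma complexified_Cons: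
  "complexified \<alpha> ((v, w) # ws) = complexified (ins v \<alpha>) ws + \<i> * complexified (ins w \<alpha>) ws"
proof -
  have 1: "map (\<lambda>i. if i \<in> insert 0 (Suc ` T) then snd (((v, w) # ws) ! i) else fst (((v, w) # ws) ! i)) [0..<Suc n]
      = w # map (\<lambda>i. if i \<in> T then snd (ws ! i) else fst (ws ! i)) [0..<n]" for T n
    by (simp add: upt_conv_Cons map_Suc_upt[symmetric] image_iff del: upt_Suc)
  have 2: "map (\<lambda>i. if i \<in> Suc ` T then snd (((v, w) # ws) ! i) else fst (((v, w) # ws) ! i)) [0..<Suc n]
      = v # map (\<lambda>i. if i \<in> T then snd (ws ! i) else fst (ws ! i)) [0..<n]" for T n
    by (simp add: upt_conv_Cons map_Suc_upt[symmetric] image_iff del: upt_Suc)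
  have c: "card (insert 0 (Suc ` T)) = Suc (card T)" "card (Suc ` T) = card T" if "T \<in> Pow {..<n}" for T n
    using that by (auto simp: card_image card_insert_if finite_subset image_iff)
  show ?thesis
    unfolding complexified_def list.size add_0_right add_Suc_right sum_Pow_lessThan_Suc 1 2
    by (simp add: c sum_distrib_left ins_app algebra_simps)
qed

lemma complexified_linear:
  "complexified (\<lambda>vs. a * \<alpha> vs + b * \<beta> vs) ws = a * complexified \<alpha> ws + b * complexified \<beta> ws"
  by (simp add: complexified_def sum_distrib_left algebra_simps sum.distrib)

lemma complexified_part10:
  assumes "alternating \<alpha>"
  shows "complexified \<alpha> (part10 v # ws) = complexified (\<lambda>vs. 1/2 * ins v \<alpha> vs + (- \<i>/2) * ins (J v) \<alpha> vs) ws"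
proof -
  have "ins ((1/2) *\<^sub>R v) \<alpha> = (\<lambda>vs. 1/2 * ins v \<alpha> vs + 0 * ins v \<alpha> vs)"
    "ins (- (1/2) *\<^sub>R J v) \<alpha> = (\<lambda>vs. (- 1/2) * ins (J v) \<alpha> vs + 0 * ins v \<alpha> vs)"
    using assms by (auto simp: ins_def alternating_head_scaleR alternating_head_minus)
  then show ?thesis unfolding part10_def complexified_Cons by (simp only: complexified_linear) simp
qed

lemma complexified_part01:
  assumes "alternating \<alpha>"
  shows "complexified \<alpha> (part01 v # ws) = complexified (\<lambda>vs. 1/2 * ins v \<alpha> vs + (\<i>/2) * ins (J v) \<alpha> vs) ws"
proof -
  have "ins ((1/2) *\<^sub>R v) \<alpha> = (\<lambda>vs. 1/2 * ins v \<alpha> vs + 0 * ins v \<alpha> vs)"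
    "ins ((1/2) *\<^sub>R J v) \<alpha> = (\<lambda>vs. (1/2) * ins (J v) \<alpha> vs + 0 * ins v \<alpha> vs)"
    using assms by (auto simp: ins_def alternating_head_scaleR)
  then show ?thesis unfolding part01_def complexified_Cons by (simp only: complexified_linear) simp
qed

text \<open>Multiplying out \<open>s v\<^sup>1\<^sup>,\<^sup>0 + t v\<^sup>0\<^sup>,\<^sup>1\<close>
  in every slot; S is the set of slots that receive the (1,0)-part. This ties the recursive
  \<open>tw\<close> to the definition of \<open>bidegree\<close>.\<close>

lemma tw_expand:
  assumes "alternating \<alpha>"
  shows "tw s t \<alpha> vs = (\<Sum>S\<in>Pow {..<length vs}. of_real (s ^ card S * t ^ (length vs - card S)) *
    complexified \<alpha> (map (\<lambda>i. if i \<in> S then part10 (vs ! i) else part01 (vs ! i)) [0..<length vs]))"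
  using assms
proof (induction vs arbitrary: \<alpha>)
  case (Cons v vs)
  let ?n = "length vs"
  let ?m = "\<lambda>S vs. map (\<lambda>i. if i \<in> S then part10 (vs ! i) else part01 (vs ! i)) [0..<length vs]"
  have 1: "?m (insert 0 (Suc ` S)) (v # vs) = part10 v # ?m S vs"
    "?m (Suc ` S) (v # vs) = part01 v # ?m S vs" for S
    by (simp_all add: upt_conv_Cons map_Suc_upt[symmetric] image_iff del: upt_Suc)
  have c: "card (insert 0 (Suc ` S)) = Suc (card S)" "card (Suc ` S) = card S" "card S \<le> ?n"
    if "S \<in> Pow {..<?n}" for S
    using that card_mono[of "{..<?n}" S] by (auto simp: card_image card_insert_if finite_subset image_iff)
  have e: "of_real s * complexified \<alpha> (part10 v # ws) + of_real t * complexified \<alpha> (part01 v # ws)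
      = complexified (tw_ins s t v \<alpha>) ws" for ws
  proof -
    have "tw_ins s t v \<alpha> = (\<lambda>ws. of_real ((s + t) / 2) * ins v \<alpha> ws
     + \<i> * of_real ((t - s) / 2) * ins (J v) \<alpha> ws)"
      by (rule ext) (simp add: tw_ins_def ins_app)
    then show ?thesis
      unfolding complexified_part10[OF Cons.prems] complexified_part01[OF Cons.prems]
      by (simp only: complexified_linear) (simp add: field_simps)
  qed
  have "(\<Sum>S\<in>Pow {..<length (v # vs)}. of_real (s ^ card S * t ^ (length (v # vs) - card S)) * complexified \<alpha> (?m S (v # vs)))
    = (\<Sum>S\<in>Pow {..<?n}. of_real (s ^ card S * t ^ (?n - card S)) *
        (of_real s * complexified \<alpha> (part10 v # ?m S vs) + of_real t * complexified \<alpha> (part01 v # ?m S vs)))"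
    unfolding list.size(4) add_0_right add_Suc_right sum_Pow_lessThan_Suc
    unfolding sum.distrib[symmetric]
  proof (rule sum.cong[OF refl])
    fix S assume S: "S \<in> Pow {..<?n}"
    show "of_real (s ^ card (insert 0 (Suc ` S)) * t ^ (Suc ?n - card (insert 0 (Suc ` S)))) *
         complexified \<alpha> (map (\<lambda>i. if i \<in> insert 0 (Suc ` S) then part10 ((v # vs) ! i) else part01 ((v # vs) ! i)) [0..<Suc ?n]) +
         of_real (s ^ card (Suc ` S) * t ^ (Suc ?n - card (Suc ` S))) *
         complexified \<alpha> (map (\<lambda>i. if i \<in> Suc ` S then part10 ((v # vs) ! i) else part01 ((v # vs) ! i)) [0..<Suc ?n])
       = of_real (s ^ card S * t ^ (?n - card S)) *
        (of_real s * complexified \<alpha> (part10 v # ?m S vs) + of_real t * complexified \<alpha> (part01 v # ?m S vs))"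
      using 1[of S] by (simp add: c[OF S] Suc_diff_le del: upt_Suc) (simp add: algebra_simps)
  qed
  then show ?case
    by (simp only: tw.simps Cons.IH[OF alternating_tw_ins[OF Cons.prems]] e)
qed simp

text \<open>Subsets in \<open>tw_expand\<close> are grouped by cardinality. The left side is the sum
  that defines \<open>theta\<close>, which is thereby identified with \<open>tw\<close> for t =
  1.\<close>

lemma bidegree_expand:
  assumes "alternating \<alpha>"
  shows "(\<Sum>p\<le>length vs. of_real (s ^ p) * bidegree p (length vs - p) \<alpha> vs) = tw s 1 \<alpha> vs"
proof -
  let ?n = "length vs"
  let ?c = "\<lambda>S. complexified \<alpha> (map (\<lambda>i. if i \<in> S then part10 (vs ! i) else part01 (vs ! i)) [0..<?n])"
  have "(\<Sum>p\<le>?n. of_real (s ^ p) * bidegree p (?n - p) \<alpha> vs)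
    = (\<Sum>p\<le>?n. \<Sum>S | S \<in> Pow {..<?n} \<and> card S = p. of_real (s ^ card S) * ?c S)"
    by (intro sum.cong refl) (simp add: bidegree_def sum_distrib_left)
  also have "\<dots> = (\<Sum>S\<in>Pow {..<?n}. of_real (s ^ card S) * ?c S)"
    using card_mono[of "{..<?n}"] by (intro sum.group) auto
  finally show ?thesis by (simp add: tw_expand[OF assms])
qed

lemma bidegree_1_0:
  assumes "alternating \<alpha>"
  shows "bidegree 1 0 \<alpha> [v] = (\<alpha> [v] - \<i> * \<alpha> [J v]) / 2"
proof -
  have "{S. S \<subseteq> {..<1::nat} \<and> card S = 1} = {{0}}"
    by (auto simp: card_1_singleton_iff)
  then show ?thesis
    using complexified_part10[OF assms, of v "[]"] by (simp add: bidegree_def ins_app field_simps)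
qed

lemma bidegree_0_1:
  assumes "alternating \<alpha>"
  shows "bidegree 0 1 \<alpha> [v] = (\<alpha> [v] + \<i> * \<alpha> [J v]) / 2"
proof -
  have "{S. S \<subseteq> {..<1::nat} \<and> card S = 0} = {{}}"
    by (auto simp: finite_subset)
  then show ?thesis
    using complexified_part01[OF assms, of v "[]"] by (simp add: bidegree_def ins_app field_simps)
qed

lemma bidegree_0_0: "bidegree 0 0 \<alpha> [] = \<alpha> []"
proof -
  have "{S. S = {} \<and> card S = (0::nat)} = {{}::nat set}"
    by auto
  then show ?thesis by (simp add: bidegree_def)
qed

text \<open>Turns the condition that the metric form equals its own (1,1)-component into invariance
  under J in both arguments.\<close>

lemma bidegree_1_1:
  assumes "alternating \<alpha>"
  shows "bidegree 1 1 \<alpha> [v, w] = (\<alpha> [v, w] + \<alpha> [J v, J w]) / 2"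
proof -
  have S: "{S. S \<subseteq> {..<1 + 1::nat} \<and> card S = 1} = {{0}, {Suc 0}}"
    by (auto simp: card_1_singleton_iff numeral_2_eq_2)
  have l: "complexified \<beta> [part10 w] = (\<beta> [w] - \<i> * \<beta> [J w]) / 2"
    "complexified \<beta> [part01 w] = (\<beta> [w] + \<i> * \<beta> [J w]) / 2" if "alternating \<beta>" for \<beta>
    using complexified_part10[OF that, of w "[]"] complexified_part01[OF that, of w "[]"] by (simp_all add: ins_app field_simps)
  have a: "alternating (\<lambda>vs. 1/2 * ins v \<alpha> vs + c * ins (J v) \<alpha> vs)" for c
    using assms by (intro alternating_add alternating_mult alternating_ins)
  have "bidegree 1 1 \<alpha> [v, w] = complexified \<alpha> [part10 v, part01 w] + complexified \<alpha> [part01 v, part10 w]"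
    unfolding bidegree_def S by simp
  also have "\<dots> = (\<alpha> [v, w] + \<alpha> [J v, J w]) / 2"
    unfolding complexified_part10[OF assms, of v] complexified_part01[OF assms, of v] l[OF a]
    by (simp add: ins_app field_simps)
  finally show ?thesis .
qed

lemma homog_bidegree: "homog (p + q) (bidegree p q \<alpha>)"
  by (simp add: homog_def bidegree_def)

section \<open>Hermitian forms\<close>

text \<open>The pointwise content of \<open>hermitian_metric\<close>, stated for a bare fibre so
  that it applies both to the metric at a point of the manifold and to the metric read in a
  chart.\<close>

definition herm :: "'n::finite fibre \<Rightarrow> bool" where
  "herm w \<longleftrightarrow> alternating w \<and> homog 2 w \<and> (\<forall>vs. cnj (w vs) = w vs) \<and>
     (\<forall>v u. w [J v, J u] = w [v, u]) \<and> (\<forall>v. v \<noteq> 0 \<longrightarrow> Re (w [v, J v]) > 0)"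

definition gm :: "'n::finite fibre \<Rightarrow> complex^'n \<Rightarrow> complex^'n \<Rightarrow> real" where
  "gm w v u = Re (w [v, J u])"

definition onb :: "'n::finite fibre \<Rightarrow> (complex^'n) set \<Rightarrow> bool" where
  "onb w B \<longleftrightarrow> card B = 2 * CARD('n) \<and> (\<forall>b\<in>B. \<forall>c\<in>B. gm w b c = (if b = c then 1 else 0))"

lemma onb_finite: "onb w (B :: (complex^'n::finite) set) \<Longrightarrow> finite B"
  unfolding onb_def by (metis card.infinite mult_eq_0_iff zero_neq_numeral zero_less_card_finite less_irrefl)

text \<open>The pointwise adjoint of \<open>fwedge \<xi>\<close> for \<open>\<xi>\<close> of degree \<open>k\<close>. The divisions amount to \<open>k!\<close>, because the
  sums run over ordered tuples from \<open>B\<close>.\<close>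

fun adjw :: "(complex^'n) set \<Rightarrow> nat \<Rightarrow> 'n::finite fibre \<Rightarrow> 'n fibre \<Rightarrow> 'n fibre" where
  "adjw B 0 \<xi> v vs = cnj (\<xi> []) * v vs"
| "adjw B (Suc k) \<xi> v vs = (\<Sum>b\<in>B. adjw B k (ins b \<xi>) (ins b v) vs) / of_nat (Suc k)"

text \<open>\<open>form_inner\<close> for a given basis. The degree k part of the inner product is
  the pointwise adjoint of the wedge with \<beta>, applied to \<alpha> and evaluated at no
  arguments.\<close>

definition finn :: "(complex^'n) set \<Rightarrow> 'n::finite fibre \<Rightarrow> 'n fibre \<Rightarrow> complex" where
  "finn B \<alpha> \<beta> = (\<Sum>k\<le>2 * CARD('n). adjw B k \<beta> \<alpha> [])"

lemma adjw_explicit: "finite B \<Longrightarrow> adjw B k \<xi> v vs = (\<Sum>bs | set bs \<subseteq> B \<and> length bs = k. v (bs @ vs) * cnj (\<xi> bs)) / fact k"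
proof (induction k arbitrary: \<xi> v)
  case 0
  have "{bs. set bs \<subseteq> B \<and> length bs = 0} = {[]}" by auto
  then show ?case by simp
next
  case (Suc k)
  have "{bs. set bs \<subseteq> B \<and> length bs = Suc k} = (\<lambda>(b, bs). b # bs) ` (B \<times> {bs. set bs \<subseteq> B \<and> length bs = k})"
    by (auto simp: length_Suc_conv)
  moreover have "inj_on (\<lambda>(b, bs). b # bs) (B \<times> {bs. set bs \<subseteq> B \<and> length bs = k})"
    by (auto simp: inj_on_def)
  ultimately have "(\<Sum>bs | set bs \<subseteq> B \<and> length bs = Suc k. v (bs @ vs) * cnj (\<xi> bs))
    = (\<Sum>b\<in>B. \<Sum>bs | set bs \<subseteq> B \<and> length bs = k. ins b v (bs @ vs) * cnj (ins b \<xi> bs))"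
    using Suc.prems by (simp add: sum.reindex sum.cartesian_product finite_lists_length_eq ins_app split_def)
  then show ?case by (simp add: Suc.IH[OF Suc.prems] sum_divide_distrib[symmetric] del: of_nat_Suc)
qed

lemma form_inner_eq_finn:
  "onb (\<omega> x) (SOME B. orthonormal_basis \<omega> x B) \<Longrightarrow>
   form_inner \<omega> x \<alpha> \<beta> = finn (SOME B. orthonormal_basis \<omega> x B) \<alpha> \<beta>"
  unfolding form_inner_def Let_def finn_def by (simp add: adjw_explicit onb_finite)

lemma adjw_cnj: "cnj (adjw B k \<xi> v []) = adjw B k v \<xi> []"
  by (induction k arbitrary: \<xi> v) simp_all

lemma finn_cnj: "cnj (finn B \<alpha> \<beta>) = finn B \<beta> \<alpha>"
  by (simp add: finn_def adjw_cnj)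

lemma orthonormal_basis_iff_onb: "orthonormal_basis \<omega> x B \<longleftrightarrow> onb (\<omega> x) B"
  by (simp add: orthonormal_basis_def onb_def riem_def gm_def)

lemma adjw_add: "adjw B k \<xi> (\<lambda>vs. u vs + v vs) vs = adjw B k \<xi> u vs + adjw B k \<xi> v vs"
proof (induction k arbitrary: \<xi> u v)
  case (Suc k)
  have "ins b (\<lambda>vs. u vs + v vs) = (\<lambda>vs. ins b u vs + ins b v vs)" for b by (simp add: ins_def)
  then show ?case by (simp add: Suc.IH sum.distrib add_divide_distrib del: of_nat_Suc)
qed (simp add: algebra_simps)

lemma adjw_mult: "adjw B k \<xi> (\<lambda>vs. c * u vs) vs = c * adjw B k \<xi> u vs"
proof (induction k arbitrary: \<xi> u)
  case (Suc k)
  have "ins b (\<lambda>vs. c * u vs) = (\<lambda>vs. c * ins b u vs)" for b by (simp add: ins_def)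
  then show ?case by (simp add: Suc.IH sum_distrib_left del: of_nat_Suc)
qed simp

lemma adjw_sum: "adjw B k \<xi> (\<lambda>vs. \<Sum>i\<in>I. u i vs) vs = (\<Sum>i\<in>I. adjw B k \<xi> (u i) vs)"
proof (induction I rule: infinite_finite_induct)
  case (infinite A) then show ?case using adjw_mult[of B k \<xi> 0 "\<lambda>vs. 0" vs] by simp
next
  case empty then show ?case using adjw_mult[of B k \<xi> 0 "\<lambda>vs. 0" vs] by simp
qed (simp add: adjw_add)

lemma adjw_left_add: "adjw B k (\<lambda>vs. \<xi> vs + \<zeta> vs) u vs = adjw B k \<xi> u vs + adjw B k \<zeta> u vs"
proof (induction k arbitrary: \<xi> \<zeta> u)
  case (Suc k)
  have "ins b (\<lambda>vs. \<xi> vs + \<zeta> vs) = (\<lambda>vs. ins b \<xi> vs + ins b \<zeta> vs)" for b by (simp add: ins_def)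
  then show ?case by (simp add: Suc.IH sum.distrib add_divide_distrib del: of_nat_Suc)
qed (simp add: algebra_simps)

lemma adjw_left_mult: "adjw B k (\<lambda>vs. c * \<xi> vs) u vs = cnj c * adjw B k \<xi> u vs"
proof (induction k arbitrary: \<xi> u)
  case (Suc k)
  have "ins b (\<lambda>vs. c * \<xi> vs) = (\<lambda>vs. c * ins b \<xi> vs)" for b by (simp add: ins_def)
  then show ?case by (simp add: Suc.IH sum_distrib_left del: of_nat_Suc)
qed simp

lemma adjw_left_sum: "adjw B k (\<lambda>vs. \<Sum>i\<in>I. \<xi> i vs) u vs = (\<Sum>i\<in>I. adjw B k (\<xi> i) u vs)"
proof (induction I rule: infinite_finite_induct)
  case (infinite A) then show ?case using adjw_left_mult[of B k 0 "\<lambda>vs. 0" u vs] by simp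
next
  case empty then show ?case using adjw_left_mult[of B k 0 "\<lambda>vs. 0" u vs] by simp
qed (simp add: adjw_left_add)

lemma adjw_cong:
  "(\<And>bs. length bs = k \<Longrightarrow> \<xi> bs = \<xi>' bs) \<Longrightarrow> (\<And>ws. length ws = k + length vs \<Longrightarrow> u ws = u' ws)
    \<Longrightarrow> adjw B k \<xi> u vs = adjw B k \<xi>' u' vs"
proof (induction k arbitrary: \<xi> u \<xi>' u')
  case (Suc k)
  have "adjw B k (ins b \<xi>) (ins b u) vs = adjw B k (ins b \<xi>') (ins b u') vs" for b
    by (rule Suc.IH) (simp_all add: ins_app Suc.prems)
  then show ?case by simp
qed simp

lemma ins_ins_swap: "alternating \<alpha> \<Longrightarrow> ins v (ins w \<alpha>) = (\<lambda>vs. (- 1) * ins w (ins v \<alpha>) vs)"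
  by (rule ext) (simp add: ins_app alternating_swap[of \<alpha> w v])

lemma alternating_adjw: "alternating v \<Longrightarrow> alternating (adjw B k \<xi> v)"
proof (induction k arbitrary: \<xi> v)
  case 0
  have "adjw B 0 \<xi> v = (\<lambda>vs. cnj (\<xi> []) * v vs)" by auto
  then show ?case using 0 by (simp add: alternating_mult)
next
  case (Suc k)
  have "adjw B (Suc k) \<xi> v = (\<lambda>vs. (1 / of_nat (Suc k)) * (\<Sum>b\<in>B. adjw B k (ins b \<xi>) (ins b v) vs))"
    by auto
  then show ?case
    using Suc by (simp only:) (intro alternating_mult alternating_sum Suc.IH alternating_ins)
qed

lemma alternating_repeat_in_list:
  assumes "alternating \<alpha>" "\<not> distinct vs" shows "\<alpha> vs = 0"
proof -
  obtain xs ys zs v where "vs = xs @ [v] @ ys @ [v] @ zs"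
    using not_distinct_decomp[OF assms(2)] by blast
  then show ?thesis using alternating_repeat[OF assms(1)] by blast
qed

section \<open>Orthonormal bases and pointwise adjoints\<close>

locale hermitian =
  fixes w :: "'n::finite fibre" and B :: "(complex^'n) set"
  assumes herm: "herm w" and onb: "onb w B"
begin

lemma alt_w: "alternating w" and homog_w: "homog 2 w" and real_w: "cnj (w vs) = w vs"
  and w_J: "w [J v, J u] = w [v, u]" and pos_w: "v \<noteq> 0 \<Longrightarrow> gm w v v > 0"
  using herm by (auto simp: herm_def gm_def)

lemma fin [simp]: "finite B" using onb by (rule onb_finite)

lemma cardB: "card B = 2 * CARD('n)" using onb by (simp add: onb_def)

lemma gB: "b \<in> B \<Longrightarrow> c \<in> B \<Longrightarrow> gm w b c = (if b = c then 1 else 0)"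
  using onb by (simp add: onb_def)

lemma w_J_left: "w [J v, u] = - w [v, J u]"
  using w_J[of "J v" u] alternating_head_minus[OF alt_w, of v "[J u]"] by simp

lemma gm_sym: "gm w v u = gm w u v"
  unfolding gm_def using w_J_left[of u v] alternating_swap[OF alt_w, of v "J u" "[]"] by simp

lemma w_eq_gm: "w [v, u] = of_real (gm w (J v) u)"
  using real_w[of "[v, u]"] by (simp add: gm_def w_J complex_eq_iff)

lemma gm_linear_left: "linear (\<lambda>v. gm w v u)"
  by (rule linearI) (simp_all add: gm_def alternating_head_add[OF alt_w] alternating_head_scaleR[OF alt_w])

lemma gm_linear: "linear (gm w v)"
proof -
  have "gm w v = (\<lambda>u. gm w u v)" by (rule ext) (rule gm_sym)
  then show ?thesis using gm_linear_left[of v] by simp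
qed

lemma gm_J_J: "gm w (J v) (J u) = gm w v u"
  unfolding gm_def by (simp only: w_J)

lemma gm_J_left: "gm w (J v) u = - gm w v (J u)"
  using gm_J_J[of v "J u"] linear_neg[OF gm_linear_left] linear_neg[OF gm_linear] by (simp add: gm_J_J[of v u])

lemma independent_B: "independent B"
proof (rule independent_if_scalars_zero)
  fix f c assume s: "(\<Sum>x\<in>B. f x *\<^sub>R x) = 0" and c: "c \<in> B"
  have "0 = gm w c (\<Sum>x\<in>B. f x *\<^sub>R x)" by (simp add: s linear_0[OF gm_linear])
  also have "\<dots> = (\<Sum>x\<in>B. f x * (if c = x then 1 else 0))"
    by (simp add: linear_sum[OF gm_linear] linear_scale[OF gm_linear] gB c cong: sum.cong)
  also have "\<dots> = f c" using c by (simp add: if_distrib[of "\<lambda>x. _ * x"] cong: if_cong)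
  finally show "f c = 0" by simp
qed simp

lemma expand: "v = (\<Sum>b\<in>B. gm w b v *\<^sub>R b)"
proof -
  have "dim (UNIV :: (complex^'n) set) \<le> card B"
    by (simp add: cardB mult.commute)
  then have "UNIV \<subseteq> span B"
    using card_ge_dim_independent[OF subset_UNIV independent_B] by blast
  then obtain f where f: "v = (\<Sum>x\<in>B. f x *\<^sub>R x)"
    by (auto simp: span_finite)
  have "gm w b v = f b" if "b \<in> B" for b
  proof -
    have "gm w b v = (\<Sum>x\<in>B. f x * (if b = x then 1 else 0))"
      by (simp add: f linear_sum[OF gm_linear] linear_scale[OF gm_linear] gB that cong: sum.cong)
    then show ?thesis using that by (simp add: if_distrib[of "\<lambda>x. _ * x"] cong: if_cong)
  qed
  then show ?thesis using f by simp
qed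

lemma expand_linear:
  fixes F :: "complex^'n \<Rightarrow> 'c::real_vector"
  assumes "linear F" shows "(\<Sum>b\<in>B. gm w b v *\<^sub>R F b) = F v"
proof -
  have "F v = F (\<Sum>b\<in>B. gm w b v *\<^sub>R b)" using expand[of v] by simp
  then show ?thesis by (simp add: linear_sum[OF assms] linear_scale[OF assms])
qed

text \<open>Expand one argument of \<open>F c c\<close> in the basis B; symmetry of the metric then
  allows the sum over C to be contracted with the other argument.\<close>

lemma trace_indep:
  fixes F :: "complex^'n \<Rightarrow> complex^'n \<Rightarrow> 'c::real_vector"
  assumes F1: "\<And>u. linear (\<lambda>v. F v u)" and F2: "\<And>v. linear (F v)" and C: "onb w C"
  shows "(\<Sum>c\<in>C. F c c) = (\<Sum>b\<in>B. F b b)"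
proof -
  interpret C: hermitian w C using herm C by unfold_locales
  have "(\<Sum>c\<in>C. F c c) = (\<Sum>c\<in>C. \<Sum>b\<in>B. gm w b c *\<^sub>R F b c)"
    using expand_linear[OF F1] by simp
  also have "\<dots> = (\<Sum>b\<in>B. \<Sum>c\<in>C. gm w c b *\<^sub>R F b c)"
    by (subst sum.swap) (simp add: gm_sym)
  also have "\<dots> = (\<Sum>b\<in>B. F b b)"
    using C.expand_linear[OF F2] by simp
  finally show ?thesis .
qed

lemma inj_J: "inj_on J B"
  using linear_injective_0[OF linear_J] by (auto intro: inj_on_subset)

lemma onb_J: "onb w (J ` B)"
  unfolding onb_def using gB by (auto simp: card_image[OF inj_J] cardB gm_J_J inj_on_eq_iff[OF inj_J])

text \<open>J is an isometry, so the image of B under J is orthonormal too. This is the device for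
  moving J from one factor of a contraction to the other.\<close>

lemma trace_J:
  fixes F :: "complex^'n \<Rightarrow> complex^'n \<Rightarrow> 'c::real_vector"
  assumes "\<And>u. linear (\<lambda>v. F v u)" "\<And>v. linear (F v)"
  shows "(\<Sum>b\<in>B. F (J b) (J b)) = (\<Sum>b\<in>B. F b b)"
  using trace_indep[OF assms onb_J] by (simp add: sum.reindex[OF inj_J])

text \<open>Euler's identity: wedging with the dual covector of b after contracting with b, summed
  over a basis, multiplies a form by its degree.\<close>

lemma one_form_gm_expand:
  assumes "alternating \<xi>" "homog (Suc k) \<xi>"
  shows "\<xi> vs = (\<Sum>b\<in>B. fwedge (one_form (\<lambda>v. of_real (gm w b v))) (ins b \<xi>) vs) / of_nat (Suc k)"
  using assms
proof (induction k arbitrary: \<xi> vs)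
  case 0
  show ?case
  proof (cases vs)
    case Nil
    then show ?thesis using 0 by (simp add: homog_def)
  next
    case (Cons x xs)
    have z: "ins x (ins b \<xi>) = (\<lambda>vs. 0)" for b
      using 0 by (auto simp: homog_def ins_def)
    have "\<xi> vs = (\<Sum>b\<in>B. of_real (gm w b x) * ins b \<xi> xs)"
      using Cons expand_linear[OF alternating_linear[OF 0(1)], of x xs]
      by (simp add: ins_app scaleR_conv_of_real)
    then show ?thesis
      by (simp add: Cons z fwedge_zero_right)
  qed
next
  case (Suc k)
  show ?case
  proof (cases vs)
    case Nil
    then show ?thesis using Suc.prems by (simp add: homog_def)
  next
    case (Cons x xs)
    let ?e = "\<lambda>b. one_form (\<lambda>v. of_real (gm w b v) :: complex)"
    have 1: "\<xi> vs = (\<Sum>b\<in>B. of_real (gm w b x) * ins b \<xi> xs)"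
      using Cons expand_linear[OF alternating_linear[OF Suc.prems(1)], of x xs]
      by (simp add: ins_app scaleR_conv_of_real)
    have "of_nat (Suc k) * ins x \<xi> xs = (\<Sum>b\<in>B. fwedge (?e b) (ins b (ins x \<xi>)) xs)"
      using Suc.prems by (subst Suc.IH) (auto intro: homog_ins simp del: of_nat_Suc)
    also have "\<dots> = (\<Sum>b\<in>B. - fwedge (?e b) (ins x (ins b \<xi>)) xs)"
      by (intro sum.cong refl) (simp add: ins_ins_swap[OF Suc.prems(1), of _ x] fwedge_minus_right)
    finally have 2: "of_nat (Suc k) * ins x \<xi> xs = \<dots>" .
    have "of_nat (Suc (Suc k)) * \<xi> vs = \<xi> vs + of_nat (Suc k) * ins x \<xi> xs"
      by (simp add: Cons ins_app algebra_simps)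
    then have "of_nat (Suc (Suc k)) * \<xi> vs = (\<Sum>b\<in>B. fwedge (?e b) (ins b \<xi>) vs)"
      unfolding 2 1 by (simp only: Cons fwedge_one_form_Cons sum.distrib diff_conv_add_uminus)
    then show ?thesis by (simp add: field_simps del: of_nat_Suc)
  qed
qed

text \<open>The adjoint is a sum of values of v on lists with more than 2n entries from a set of 2n
  vectors, and such lists repeat an entry.\<close>

lemma adjw_top_degree:
  assumes "alternating v" "set bs \<subseteq> B" "length bs + k > 2 * CARD('n)"
  shows "adjw B k \<xi> v bs = 0"
proof -
  have "adjw B k \<xi> v bs = 0" if "\<And>cs. set cs \<subseteq> B \<Longrightarrow> length cs = k + length bs \<Longrightarrow> v cs = 0" for v
    using that
  proof (induction k arbitrary: \<xi> v)
    case 0 then show ?case using assms by simp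
  next
    case (Suc k)
    have "adjw B k (ins b \<xi>) (ins b v) bs = 0" if "b \<in> B" for b
      by (rule Suc.IH) (use that in \<open>simp add: ins_app Suc.prems\<close>)
    then show ?case by simp
  qed
  moreover have "v cs = 0" if "set cs \<subseteq> B" "length cs = k + length bs" for cs
  proof -
    have "card (set cs) \<le> 2 * CARD('n)" using card_mono[OF fin that(1)] cardB by simp
    then have "\<not> distinct cs" using that(2) assms(3) distinct_card[of cs] by auto
    then show ?thesis by (rule alternating_repeat_in_list[OF assms(1)])
  qed
  ultimately show ?thesis by blast
qed

text \<open>Taking adjoints reverses the factors: the adjoint of \<xi> is contraction with the dual
  vector, followed by the adjoint of \<sigma>.\<close>

lemma adjw_fwedge_one_form:
  assumes "alternating v"
  shows "adjw B (Suc k) (fwedge (one_form \<xi>) \<sigma>) v vs = (\<Sum>b\<in>B. cnj (\<xi> b) * adjw B k \<sigma> (ins b v) vs)"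
  using assms
proof (induction k arbitrary: \<sigma> v)
  case 0
  then show ?case by (simp add: ins_app mult.assoc)
next
  case (Suc k)
  have "of_nat (Suc (Suc k)) * adjw B (Suc (Suc k)) (fwedge (one_form \<xi>) \<sigma>) v vs
     = (\<Sum>b\<in>B. adjw B (Suc k) (ins b (fwedge (one_form \<xi>) \<sigma>)) (ins b v) vs)"
    unfolding adjw.simps(2)[of B "Suc k"] by (simp del: of_nat_Suc adjw.simps)
  also have "\<dots> = (\<Sum>b\<in>B. cnj (\<xi> b) * adjw B (Suc k) \<sigma> (ins b v) vs
      - adjw B (Suc k) (fwedge (one_form \<xi>) (ins b \<sigma>)) (ins b v) vs)"
  proof (rule sum.cong[OF refl])
    fix b
    have "ins b (fwedge (one_form \<xi>) \<sigma>) = (\<lambda>vs. \<xi> b * \<sigma> vs + (- 1) * fwedge (one_form \<xi>) (ins b \<sigma>) vs)"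
      by (simp add: ins_fwedge_one_form)
    then show "adjw B (Suc k) (ins b (fwedge (one_form \<xi>) \<sigma>)) (ins b v) vs = cnj (\<xi> b) * adjw B (Suc k) \<sigma> (ins b v) vs
      - adjw B (Suc k) (fwedge (one_form \<xi>) (ins b \<sigma>)) (ins b v) vs"
      by (simp only: adjw_left_add adjw_left_mult) simp
  qed
  also have "\<dots> = (\<Sum>b\<in>B. cnj (\<xi> b) * adjw B (Suc k) \<sigma> (ins b v) vs)
      - (\<Sum>b\<in>B. \<Sum>c\<in>B. cnj (\<xi> c) * adjw B k (ins b \<sigma>) (ins c (ins b v)) vs)"
    using Suc by (simp only: sum_subtractf alternating_ins)
  \<comment> \<open>Exchanging the two contractions costs a sign and produces \<open>Suc k\<close>
    copies of the right side of the claim. Together with the single copy in front there are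
    \<open>Suc (Suc k)\<close>, which cancels the normalization.\<close>
  also have "(\<Sum>b\<in>B. \<Sum>c\<in>B. cnj (\<xi> c) * adjw B k (ins b \<sigma>) (ins c (ins b v)) vs)
     = (\<Sum>c\<in>B. \<Sum>b\<in>B. cnj (\<xi> c) * ((- 1) * adjw B k (ins b \<sigma>) (ins b (ins c v)) vs))"
    by (subst sum.swap) (intro sum.cong refl, subst ins_ins_swap[OF Suc.prems], simp only: adjw_mult)
  also have "\<dots> = - of_nat (Suc k) * (\<Sum>c\<in>B. cnj (\<xi> c) * adjw B (Suc k) \<sigma> (ins c v) vs)"
    by (simp add: sum_distrib_left sum_negf del: of_nat_Suc) (simp add: sum_distrib_left[symmetric] field_simps del: of_nat_Suc)
  finally have "of_nat (Suc (Suc k)) * adjw B (Suc (Suc k)) (fwedge (one_form \<xi>) \<sigma>) v vs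
     = of_nat (Suc (Suc k)) * (\<Sum>b\<in>B. cnj (\<xi> b) * adjw B (Suc k) \<sigma> (ins b v) vs)"
    by (simp add: algebra_simps)
  then show ?case by (simp only: mult_cancel_left of_nat_eq_0_iff) simp
qed

text \<open>Reduction to a one-form as left factor: Euler's identity writes \<xi> as a sum of wedge
  products of covectors with contractions of \<xi>, to which induction applies.\<close>

lemma adjw_fwedge:
  assumes "alternating v" "alternating \<xi>" "homog k \<xi>"
  shows "adjw B (k + j) (fwedge \<xi> u) v vs = adjw B j u (adjw B k \<xi> v) vs"
  using assms
proof (induction k arbitrary: v \<xi>)
  case 0
  have eq: "\<xi> = (\<lambda>vs. if vs = [] then \<xi> [] else 0)" using 0(3) by (auto simp: homog_def)
  have "fwedge \<xi> u = fwedge (\<lambda>vs. if vs = [] then \<xi> [] else 0) u" by (rule arg_cong[OF eq])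
  also have "\<dots> = (\<lambda>vs. \<xi> [] * u vs)" by (rule ext) (rule fwedge_function)
  finally have 1: "fwedge \<xi> u = (\<lambda>vs. \<xi> [] * u vs)" .
  have "adjw B 0 \<xi> v = (\<lambda>vs. cnj (\<xi> []) * v vs)" by (rule ext) simp
  then show ?case unfolding 1 by (simp only: adjw_left_mult adjw_mult add_0)
next
  case (Suc k)
  let ?e = "\<lambda>b. one_form (\<lambda>v. of_real (gm w b v) :: complex)"
  have eq: "\<xi> = (\<lambda>vs. (1 / of_nat (Suc k)) * (\<Sum>b\<in>B. fwedge (?e b) (ins b \<xi>) vs))"
    by (rule ext, subst one_form_gm_expand[OF Suc.prems(2,3)]) (simp only: times_divide_eq_left mult_1)
  have "fwedge \<xi> u = fwedge (\<lambda>vs. (1 / of_nat (Suc k)) * (\<Sum>b\<in>B. fwedge (?e b) (ins b \<xi>) vs)) u"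
    by (rule arg_cong[OF eq, of "\<lambda>x. fwedge x u"])
  also have "\<dots> = (\<lambda>vs. (1 / of_nat (Suc k)) * (\<Sum>b\<in>B. fwedge (?e b) (fwedge (ins b \<xi>) u) vs))"
    by (rule ext) (simp only: fwedge_mult_left fwedge_sum_left fwedge_assoc)
  finally have "adjw B (Suc k + j) (fwedge \<xi> u) v vs
    = 1 / of_nat (Suc k) * (\<Sum>b\<in>B. \<Sum>c\<in>B. of_real (gm w b c) * adjw B (k + j) (fwedge (ins b \<xi>) u) (ins c v) vs)"
    by (simp only: adjw_left_mult adjw_left_sum add_Suc adjw_fwedge_one_form[OF Suc.prems(1)] complex_cnj_complex_of_real) simp
  also have "\<dots> = 1 / of_nat (Suc k) * (\<Sum>b\<in>B. adjw B (k + j) (fwedge (ins b \<xi>) u) (ins b v) vs)"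
    by (simp add: gB if_distrib[of of_real] if_distrib[of "\<lambda>x. x * _"] cong: if_cong sum.cong)
  also have "\<dots> = 1 / of_nat (Suc k) * (\<Sum>b\<in>B. adjw B j u (adjw B k (ins b \<xi>) (ins b v)) vs)"
    using Suc.prems by (intro arg_cong2[where f="(*)"] refl sum.cong Suc.IH) (auto intro: homog_ins)
  also have "\<dots> = adjw B j u (\<lambda>vs. 1 / of_nat (Suc k) * (\<Sum>b\<in>B. adjw B k (ins b \<xi>) (ins b v) vs)) vs"
    by (simp only: adjw_mult adjw_sum)
  also have "(\<lambda>vs. 1 / of_nat (Suc k) * (\<Sum>b\<in>B. adjw B k (ins b \<xi>) (ins b v) vs)) = adjw B (Suc k) \<xi> v"
    by auto
  finally show ?case .
qed

text \<open>The case of \<open>adjw_fwedge\<close> without arguments, summed over degrees; this is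
  adjointness for the inner product.\<close>

lemma finn_fwedge:
  assumes "alternating v" "alternating \<xi>" "homog k \<xi>"
  shows "finn B (fwedge \<xi> u) v = finn B u (adjw B k \<xi> v)"
proof -
  let ?N = "2 * CARD('n)" and ?t = "\<lambda>j. adjw B j (fwedge \<xi> u) v []"
  have "?t j = 0" if "j < k" for j
  proof -
    have "fwedge \<xi> u bs = 0" if "length bs = j" for bs
      using fwedge_right_cong[OF assms(3), of bs u "\<lambda>vs. 0"] that \<open>j < k\<close> by (simp add: fwedge_def)
    then have "?t j = adjw B j (\<lambda>vs. 0 * fwedge \<xi> u vs) v []" by (intro adjw_cong) auto
    also have "\<dots> = 0" unfolding adjw_left_mult by simp
    finally show ?thesis .
  qed
  moreover have "?t j = 0" if "?N < j" for j
    using that by (intro adjw_top_degree[OF assms(1)]) auto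
  \<comment> \<open>The wedge product has no component of degree below k, and degrees above 2n
    contribute nothing, so the range of summation may be shifted by k.\<close>
  ultimately have "(\<Sum>j\<le>?N. ?t j) = (\<Sum>j\<in>{0 + k..?N + k}. ?t j)"
    by (intro sum.mono_neutral_cong) auto
  also have "\<dots> = (\<Sum>j\<le>?N. adjw B j u (adjw B k \<xi> v) [])"
    unfolding sum.shift_bounds_cl_nat_ivl by (simp only: add.commute[of _ k] adjw_fwedge[OF assms] atMost_atLeast0)
  finally have "finn B v (fwedge \<xi> u) = finn B (adjw B k \<xi> v) u" by (simp only: finn_def)
  then show ?thesis by (metis finn_cnj)
qed

end

section \<open>Commutators of contractions with wedge products\<close>

declare adjw.simps [simp del]

text \<open>Real forms of type (1,1), without positivity: the class contains the metric form and
  also its directional derivatives in a holomorphic chart.\<close>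

definition invariant_two_form :: "'n::finite fibre \<Rightarrow> bool" where
  "invariant_two_form \<sigma> \<longleftrightarrow> alternating \<sigma> \<and> homog 2 \<sigma> \<and> (\<forall>vs. cnj (\<sigma> vs) = \<sigma> vs) \<and> (\<forall>v u. \<sigma> [J v, J u] = \<sigma> [v, u])"

lemma invariant_two_form_J_left: "invariant_two_form \<sigma> \<Longrightarrow> \<sigma> [J v, u] = - \<sigma> [v, J u]"
  using alternating_head_minus[of \<sigma> v "[J u]"] unfolding invariant_two_form_def by (metis J_J)

lemma herm_invariant: "herm w \<Longrightarrow> invariant_two_form w"
  by (simp add: herm_def invariant_two_form_def)

lemma linear_two_left: "alternating \<sigma> \<Longrightarrow> linear (\<lambda>v. \<sigma> [v, u])"
  using alternating_linear[of \<sigma> "[u]"] by simp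

lemma linear_two_right: "alternating \<sigma> \<Longrightarrow> linear (\<lambda>u. \<sigma> [v, u])"
  using alternating_linear[OF alternating_ins, of \<sigma> v "[]"] by (simp add: ins_app)

lemma fwedge_one_form_linear:
  "(\<And>v. linear (\<lambda>b. \<xi> b v)) \<Longrightarrow> linear (\<lambda>b. fwedge (one_form (\<xi> b)) x vs)"
proof (rule linearI)
  fix b c assume l: "\<And>v. linear (\<lambda>b. \<xi> b v)"
  have "\<xi> (b + c) = (\<lambda>v. \<xi> b v + \<xi> c v)" by (rule ext) (rule linear_add[OF l])
  then have "one_form (\<xi> (b + c)) = (\<lambda>vs. one_form (\<xi> b) vs + one_form (\<xi> c) vs)"
    by (simp only: one_form_add)
  then show "fwedge (one_form (\<xi> (b + c))) x vs = fwedge (one_form (\<xi> b)) x vs + fwedge (one_form (\<xi> c)) x vs"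
    by (simp add: fwedge_add_left)
next
  fix r b assume l: "\<And>v. linear (\<lambda>b. \<xi> b v)"
  have "\<xi> (r *\<^sub>R b) = (\<lambda>v. of_real r * \<xi> b v)"
    by (rule ext) (simp only: linear_scale[OF l] scaleR_conv_of_real)
  then have "one_form (\<xi> (r *\<^sub>R b)) = (\<lambda>vs. of_real r * one_form (\<xi> b) vs)"
    by (simp only: one_form_mult)
  then show "fwedge (one_form (\<xi> (r *\<^sub>R b))) x vs = r *\<^sub>R fwedge (one_form (\<xi> b)) x vs"
    by (simp add: fwedge_mult_left scaleR_conv_of_real)
qed

lemma fwedge_ins_linear: "alternating x \<Longrightarrow> linear (\<lambda>c. fwedge \<xi> (ins c x) vs)"
  by (rule linearI)
    (simp_all only: ins_add ins_scaleR fwedge_add_right fwedge_mult_right scaleR_conv_of_real[where 'a=complex])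

lemma adjw_ins_linear: "alternating x \<Longrightarrow> linear (\<lambda>c. adjw B k \<xi> (ins c x) vs)"
  by (rule linearI)
    (simp_all only: ins_add ins_scaleR adjw_add adjw_mult scaleR_conv_of_real[where 'a=complex])

lemma adjw_left_ins_linear: "alternating x \<Longrightarrow> linear (\<lambda>c. adjw B k (ins c x) u vs)"
  by (rule linearI)
    (simp_all only: ins_add ins_scaleR adjw_left_add adjw_left_mult scaleR_conv_of_real[where 'a=complex] complex_cnj_complex_of_real)

lemma linear_mult_left_real: "linear f \<Longrightarrow> linear (\<lambda>v. f v * (c::complex))"
  by (simp add: linear_iff algebra_simps)

lemma linear_mult_right_real: "linear f \<Longrightarrow> linear (\<lambda>v. (c::complex) * f v)"
  by (simp add: linear_iff algebra_simps)

lemma linear_comp_J: "linear f \<Longrightarrow> linear (\<lambda>v. f (J v))"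
  using linear_compose[OF linear_J, of f] by (simp add: o_def)

lemma adjw_2: "adjw B 2 \<sigma> x vs = (\<Sum>b\<in>B. \<Sum>c\<in>B. cnj (\<sigma> [b, c]) * x (b # c # vs)) / 2"
  by (simp add: numeral_2_eq_2 ins_app adjw.simps)

lemma adjw_1: "adjw B 1 \<sigma> x vs = (\<Sum>b\<in>B. cnj (\<sigma> [b]) * x (b # vs))"
  by (simp add: ins_app adjw.simps)

lemma antisym_sum:
  assumes "alternating (\<sigma> :: 'n::finite fibre)"
  shows "(\<Sum>b\<in>B. \<Sum>c\<in>B. cnj (\<sigma> [b, c]) * (F c b :: complex)) = - (\<Sum>b\<in>B. \<Sum>c\<in>B. cnj (\<sigma> [b, c]) * F b c)"
proof -
  have "(\<Sum>b\<in>B. \<Sum>c\<in>B. cnj (\<sigma> [b, c]) * F c b) = (\<Sum>b\<in>B. \<Sum>c\<in>B. cnj (\<sigma> [c, b]) * F b c)"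
    by (rule sum.swap)
  also have "\<dots> = (\<Sum>b\<in>B. \<Sum>c\<in>B. - (cnj (\<sigma> [b, c]) * F b c))"
    by (intro sum.cong refl) (subst alternating_swap[OF assms], simp)
  finally show ?thesis by (simp add: sum_negf)
qed

text \<open>Of the two inserted vectors \<xi> takes none or one. The two ways of taking one agree by
  antisymmetry of \<sigma>, which cancels the factor 1/2 of \<open>adjw_2\<close>.\<close>

lemma adjw_2_fwedge_one_form:
  assumes "alternating \<sigma>"
  shows "adjw B 2 \<sigma> (fwedge (one_form \<xi>) x) vs
    = fwedge (one_form \<xi>) (adjw B 2 \<sigma> x) vs + (\<Sum>b\<in>B. \<Sum>c\<in>B. cnj (\<sigma> [b, c]) * (\<xi> b * x (c # vs)))"
proof -
  have e: "fwedge (one_form \<xi>) x (b # c # vs) = \<xi> b * x (c # vs) - \<xi> c * x (b # vs) + fwedge (one_form \<xi>) (ins c (ins b x)) vs" for b c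
    by (simp add: ins_app)
  have "adjw B 2 \<sigma> x = (\<lambda>vs. (1/2) * (\<Sum>b\<in>B. \<Sum>c\<in>B. cnj (\<sigma> [b, c]) * ins c (ins b x) vs))"
    by (rule ext) (simp add: adjw_2 ins_app)
  then have 1: "fwedge (one_form \<xi>) (adjw B 2 \<sigma> x) vs
      = (1/2) * (\<Sum>b\<in>B. \<Sum>c\<in>B. cnj (\<sigma> [b, c]) * fwedge (one_form \<xi>) (ins c (ins b x)) vs)"
    by (simp only: fwedge_mult_right fwedge_sum_right)
  have "adjw B 2 \<sigma> (fwedge (one_form \<xi>) x) vs = ((\<Sum>b\<in>B. \<Sum>c\<in>B. cnj (\<sigma> [b, c]) * (\<xi> b * x (c # vs)))
     - (\<Sum>b\<in>B. \<Sum>c\<in>B. cnj (\<sigma> [b, c]) * (\<xi> c * x (b # vs)))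
     + (\<Sum>b\<in>B. \<Sum>c\<in>B. cnj (\<sigma> [b, c]) * fwedge (one_form \<xi>) (ins c (ins b x)) vs)) / 2"
    unfolding adjw_2 e by (simp add: ring_distribs sum.distrib sum_subtractf)
  also have "(\<Sum>b\<in>B. \<Sum>c\<in>B. cnj (\<sigma> [b, c]) * (\<xi> c * x (b # vs))) = - (\<Sum>b\<in>B. \<Sum>c\<in>B. cnj (\<sigma> [b, c]) * (\<xi> b * x (c # vs)))"
    by (rule antisym_sum[OF assms, where F = "\<lambda>b c. \<xi> b * x (c # vs)"])
  finally show ?thesis unfolding 1 by (simp add: field_simps)
qed

text \<open>The terms are sorted by how many of the two inserted vectors enter \<tau>. Both give the
  trace, none gives the commuted product, and the two ways of splitting them agree by
  antisymmetry.\<close>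

lemma adjw_2_fwedge_two_form:
  assumes "alternating \<sigma>" "homog 2 \<tau>"
  shows "adjw B 2 \<sigma> (fwedge \<tau> x) vs = fwedge \<tau> (adjw B 2 \<sigma> x) vs
    + (\<Sum>b\<in>B. \<Sum>c\<in>B. cnj (\<sigma> [b, c]) * \<tau> [b, c]) / 2 * x vs
    - (\<Sum>b\<in>B. \<Sum>c\<in>B. cnj (\<sigma> [b, c]) * fwedge (one_form (\<lambda>v. \<tau> [b, v])) (ins c x) vs)"
proof -
  let ?f = "\<lambda>b. fwedge (one_form (\<lambda>v. \<tau> [b, v]))"
  define p where "p = (\<Sum>b\<in>B. \<Sum>c\<in>B. cnj (\<sigma> [b, c]) * \<tau> [b, c])"
  have P: "(\<Sum>b\<in>B. \<Sum>c\<in>B. cnj (\<sigma> [b, c]) * \<tau> [b, c] * x vs) = p * x vs"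
    by (simp only: p_def sum_distrib_right)
  have e: "fwedge \<tau> x (b # c # vs) = \<tau> [b, c] * x vs - ?f b (ins c x) vs + ?f c (ins b x) vs + fwedge \<tau> (ins c (ins b x)) vs" for b c
    by (simp add: fwedge_two_Cons[OF assms(2)])
  have "adjw B 2 \<sigma> x = (\<lambda>vs. (1/2) * (\<Sum>b\<in>B. \<Sum>c\<in>B. cnj (\<sigma> [b, c]) * ins c (ins b x) vs))"
    by (rule ext) (simp add: adjw_2 ins_app)
  then have 1: "fwedge \<tau> (adjw B 2 \<sigma> x) vs
      = (1/2) * (\<Sum>b\<in>B. \<Sum>c\<in>B. cnj (\<sigma> [b, c]) * fwedge \<tau> (ins c (ins b x)) vs)"
    by (simp only: fwedge_mult_right fwedge_sum_right)
  have "adjw B 2 \<sigma> (fwedge \<tau> x) vs = ((\<Sum>b\<in>B. \<Sum>c\<in>B. cnj (\<sigma> [b, c]) * \<tau> [b, c] * x vs)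
     - (\<Sum>b\<in>B. \<Sum>c\<in>B. cnj (\<sigma> [b, c]) * ?f b (ins c x) vs)
     + (\<Sum>b\<in>B. \<Sum>c\<in>B. cnj (\<sigma> [b, c]) * ?f c (ins b x) vs)
     + (\<Sum>b\<in>B. \<Sum>c\<in>B. cnj (\<sigma> [b, c]) * fwedge \<tau> (ins c (ins b x)) vs)) / 2"
    unfolding adjw_2 e by (simp add: ring_distribs sum.distrib sum_subtractf mult.assoc)
  also have "(\<Sum>b\<in>B. \<Sum>c\<in>B. cnj (\<sigma> [b, c]) * ?f c (ins b x) vs) = - (\<Sum>b\<in>B. \<Sum>c\<in>B. cnj (\<sigma> [b, c]) * ?f b (ins c x) vs)"
    by (rule antisym_sum[OF assms(1), where F = "\<lambda>b c. ?f b (ins c x) vs"])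
  finally show ?thesis unfolding 1 P p_def[symmetric] by (simp add: field_simps)
qed

context hermitian
begin

abbreviation flat :: "complex^'n \<Rightarrow> 'n fibre" where
  "flat b \<equiv> one_form (\<lambda>v. of_real (gm w b v))"

text \<open>The commutator of \<open>adjw B 2 \<sigma>\<close> with the wedge by w. When \<sigma> is
  a directional derivative of the metric form, the first summand is the logarithmic derivative of
  the volume density and the second the change of the metric on forms; this coincidence carries the
  computation of the codifferential.\<close>

definition two_form_op :: "'n fibre \<Rightarrow> 'n fibre \<Rightarrow> 'n fibre" where
  "two_form_op \<sigma> x vs = (\<Sum>b\<in>B. \<sigma> [b, J b]) / 2 * x vs
     - (\<Sum>b\<in>B. \<Sum>c\<in>B. \<sigma> [b, J c] * fwedge (flat b) (ins c x) vs)"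

lemma expand_complex:
  assumes "linear (F :: complex^'n \<Rightarrow> complex)"
  shows "(\<Sum>b\<in>B. of_real (gm w b v) * F b) = F v" "(\<Sum>b\<in>B. of_real (gm w v b) * F b) = F v"
  using expand_linear[OF assms, of v] by (simp_all add: scaleR_conv_of_real gm_sym)

text \<open>Since \<open>w [b, c] = gm w (J b) c\<close>, the sum over c is the expansion of
  \<open>J b\<close> in the basis.\<close>

lemma sum_w:
  assumes "\<And>b. linear (F b :: complex^'n \<Rightarrow> complex)"
  shows "(\<Sum>b\<in>B. \<Sum>c\<in>B. cnj (w [b, c]) * F b c) = (\<Sum>b\<in>B. F b (J b))"
  using expand_complex(2)[OF assms] by (simp add: w_eq_gm)

lemma linear_gm_left: "linear (\<lambda>b. complex_of_real (gm w b v))"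
  and linear_gm_right: "linear (\<lambda>b. complex_of_real (gm w v b))"
  using gm_linear_left[of v] gm_linear[of v] by (simp_all add: linear_iff scaleR_conv_of_real)

lemma flat_minus: "flat (- b) = (\<lambda>vs. - flat b vs)"
  unfolding one_form_minus[symmetric] using linear_neg[OF linear_gm_left] by simp

lemma adjw_2_fwedge_w:
  assumes \<sigma>: "invariant_two_form \<sigma>" and x: "alternating x"
  shows "adjw B 2 \<sigma> (fwedge w x) vs = fwedge w (adjw B 2 \<sigma> x) vs + two_form_op \<sigma> x vs"
proof -
  have alt: "alternating \<sigma>" and real: "\<And>vs. cnj (\<sigma> vs) = \<sigma> vs" using \<sigma> by (auto simp: invariant_two_form_def)
  note l = linear_two_left[OF alt] linear_two_right[OF alt]
  have tr: "(\<Sum>b\<in>B. \<Sum>c\<in>B. \<sigma> [b, c] * w [b, c]) = (\<Sum>b\<in>B. \<sigma> [b, J b])"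
    using sum_w[OF l(2), of "\<lambda>b. b"] by (simp add: real_w mult.commute)
  let ?F = "\<lambda>b b'. \<Sum>c\<in>B. \<sigma> [b, c] * fwedge (flat (J b')) (ins c x) vs"
  \<comment> \<open>Summing over the rotated basis replaces \<open>flat (J b)\<close> by minus
    \<open>flat b\<close> and moves J into \<sigma>, again with a minus sign.\<close>
  have "(\<Sum>b\<in>B. ?F b b) = (\<Sum>b\<in>B. ?F (J b) (J b))"
  proof (rule trace_J[where F = ?F, symmetric])
    show "linear (\<lambda>b. ?F b b')" for b'
      by (rule linear_compose_sum, rule ballI, rule linear_mult_left_real, rule l(1))
    show "linear (\<lambda>b'. ?F b b')" for b
      by (rule linear_compose_sum, rule ballI, rule linear_mult_right_real,
          rule linear_comp_J[of "\<lambda>b. fwedge (flat b) _ vs"], rule fwedge_one_form_linear, rule linear_gm_left)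
  qed
  also have "\<dots> = (\<Sum>b\<in>B. \<Sum>c\<in>B. \<sigma> [b, J c] * fwedge (flat b) (ins c x) vs)"
    by (intro sum.cong refl) (simp add: invariant_two_form_J_left[OF \<sigma>] flat_minus fwedge_minus_left)
  finally have "(\<Sum>b\<in>B. \<Sum>c\<in>B. \<sigma> [b, c] * fwedge (flat (J b)) (ins c x) vs) = \<dots>" .
  then show ?thesis
    unfolding adjw_2_fwedge_two_form[OF alt homog_w] two_form_op_def real tr w_eq_gm
    by (simp add: w_eq_gm[symmetric] tr)
qed

text \<open>The sum in \<open>two_form_op\<close> is a derivation of degree 0, so contracting it
  with a leaves one extra term in which the underlying endomorphism acts on a.\<close>

lemma two_form_op_ins:
  assumes \<sigma>: "invariant_two_form \<sigma>" and x: "alternating x"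
  shows "two_form_op \<sigma> x (a # vs) = two_form_op \<sigma> (ins a x) vs - (\<Sum>c\<in>B. \<sigma> [a, J c] * x (c # vs))"
proof -
  have alt: "alternating \<sigma>" using \<sigma> by (auto simp: invariant_two_form_def)
  have e: "fwedge (flat b) (ins c x) (a # vs) = of_real (gm w b a) * x (c # vs) + fwedge (flat b) (ins c (ins a x)) vs" for b c
    by (simp only: fwedge_one_form_Cons ins_ins_swap[OF x, of a c] fwedge_mult_right) (simp add: ins_app[of c x])
  have "(\<Sum>b\<in>B. \<Sum>c\<in>B. \<sigma> [b, J c] * (of_real (gm w b a) * x (c # vs)))
     = (\<Sum>c\<in>B. (\<Sum>b\<in>B. of_real (gm w b a) * \<sigma> [b, J c]) * x (c # vs))"
    by (subst sum.swap) (simp add: sum_distrib_right sum_distrib_left ac_simps)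
  also have "\<dots> = (\<Sum>c\<in>B. \<sigma> [a, J c] * x (c # vs))"
    by (simp add: expand_complex(1)[OF linear_two_left[OF alt]])
  finally show ?thesis
    unfolding two_form_op_def e by (simp add: ring_distribs sum.distrib ins_app)
qed

text \<open>Contraction with a inside the commutator of \<open>adjw B 2 \<sigma>\<close> and w
  \<and>. In the codifferential a runs through B and \<sigma> is the derivative of the metric form
  in direction a. The wedge by \<open>flat (J a)\<close> then comes from differentiating \<Lambda>
  in d^c \<Lambda>, and the right side is the adjoint of the torsion, so that the three together
  collapse to \<open>two_form_op\<close>.\<close>

lemma kaehler_pointwise:
  assumes \<sigma>: "invariant_two_form \<sigma>" and x: "alternating x"
  shows "two_form_op \<sigma> x (a # vs) + fwedge (flat (J a)) (adjw B 2 \<sigma> x) vs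
    = adjw B 2 \<sigma> (ins a (fwedge w x)) vs - fwedge w (adjw B 2 \<sigma> (ins a x)) vs"
proof -
  have alt: "alternating \<sigma>" and hom: "homog 2 \<sigma>" and real: "\<And>vs. cnj (\<sigma> vs) = \<sigma> vs"
    using \<sigma> by (auto simp: invariant_two_form_def)
  have "ins a (fwedge w x) = (\<lambda>vs. fwedge (flat (J a)) x vs + fwedge w (ins a x) vs)"
    by (rule ext) (simp add: ins_app fwedge_two_Cons[OF homog_w] w_eq_gm)
  then have "adjw B 2 \<sigma> (ins a (fwedge w x)) vs
    = adjw B 2 \<sigma> (fwedge (flat (J a)) x) vs + adjw B 2 \<sigma> (fwedge w (ins a x)) vs"
    by (simp only: adjw_add)
  also have "\<dots> = fwedge (flat (J a)) (adjw B 2 \<sigma> x) vs + (\<Sum>b\<in>B. \<Sum>c\<in>B. \<sigma> [b, c] * (of_real (gm w (J a) b) * x (c # vs)))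
      + (fwedge w (adjw B 2 \<sigma> (ins a x)) vs + two_form_op \<sigma> (ins a x) vs)"
    using x by (simp only: adjw_2_fwedge_one_form[OF alt] real adjw_2_fwedge_w[OF \<sigma>] alternating_ins)
  also have "(\<Sum>b\<in>B. \<Sum>c\<in>B. \<sigma> [b, c] * (of_real (gm w (J a) b) * x (c # vs)))
      = (\<Sum>c\<in>B. (\<Sum>b\<in>B. of_real (gm w (J a) b) * \<sigma> [b, c]) * x (c # vs))"
    by (subst sum.swap) (simp add: sum_distrib_right sum_distrib_left ac_simps)
  also have "\<dots> = (\<Sum>c\<in>B. \<sigma> [J a, c] * x (c # vs))"
    by (simp add: expand_complex(2)[OF linear_two_left[OF alt]])
  finally show ?thesis
    by (simp add: two_form_op_ins[OF \<sigma> x] invariant_two_form_J_left[OF \<sigma>] sum_negf)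
qed

text \<open>The general commutator with the contraction against w evaluated by \<open>sum_w\<close>;
  the extra term is contraction with J applied to the vector dual to \<xi>.\<close>

lemma Lam_fwedge_one_form:
  assumes x: "alternating x" and \<xi>: "linear \<xi>"
  shows "adjw B 2 w (fwedge (one_form \<xi>) x) vs = fwedge (one_form \<xi>) (adjw B 2 w x) vs + (\<Sum>b\<in>B. \<xi> b * x (J b # vs))"
proof -
  have "(\<Sum>b\<in>B. \<Sum>c\<in>B. cnj (w [b, c]) * (\<xi> b * x (c # vs))) = (\<Sum>b\<in>B. \<xi> b * x (J b # vs))"
    by (rule sum_w) (rule linear_mult_right_real[OF alternating_linear[OF x]])
  then show ?thesis by (simp add: adjw_2_fwedge_one_form[OF alt_w])
qed

lemma number_op:
  "alternating x \<Longrightarrow> (\<Sum>b\<in>B. fwedge (flat b) (ins b x) vs) = of_nat (length vs) * x vs"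
proof (induction vs arbitrary: x)
  case (Cons v vs)
  have "(\<Sum>b\<in>B. fwedge (flat b) (ins b x) (v # vs)) = (\<Sum>b\<in>B. of_real (gm w b v) * ins b x vs + fwedge (flat b) (ins b (ins v x)) vs)"
    by (intro sum.cong refl) (simp add: ins_ins_swap[OF Cons.prems, of v] fwedge_minus_right)
  also have "\<dots> = x (v # vs) + of_nat (length vs) * ins v x vs"
    unfolding sum.distrib Cons.IH[OF alternating_ins[OF Cons.prems]] ins_app[of _ x]
    by (simp only: expand_complex(1)[OF alternating_linear[OF Cons.prems]])
  finally show ?case by (simp add: ins_app[of v x] algebra_simps)
qed simp

text \<open>The classical relation [\<Lambda>, \<omega> \<and>] = n - k: half the trace of the
  metric is n, and the remaining sum counts the degree. This is where the n of the theorem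
  enters.\<close>

lemma two_form_op_w:
  assumes "alternating x"
  shows "two_form_op w x vs = (of_nat CARD('n) - of_nat (length vs)) * x vs"
proof -
  have g: "w [b, J c] = of_real (gm w b c)" for b c
    using w_eq_gm[of b "J c"] gm_J_J by simp
  have "(\<Sum>c\<in>B. w [b, J c] * fwedge (flat b) (ins c x) vs) = fwedge (flat b) (ins b x) vs" for b
    unfolding g by (rule expand_complex(2)[OF fwedge_ins_linear[OF assms]])
  moreover have "(\<Sum>b\<in>B. w [b, J b]) = of_nat (2 * CARD('n))"
    by (simp add: g gB cardB)
  ultimately show ?thesis
    by (simp add: two_form_op_def number_op[OF assms] algebra_simps)
qed

text \<open>For a one-form \<zeta> the adjoint of \<zeta> \<and> w is \<Lambda> after contraction
  with \<zeta>; the first claim is its commutator with w \<and>. The factor n - k is taken in degree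
  \<open>length vs\<close>, since the contraction has already lowered the degree, and the extra -1
  comes from the second claim.\<close>

lemma zero_order:
  fixes \<xi> :: "complex^'n \<Rightarrow> real"
  assumes x: "alternating x" and \<xi>: "linear \<xi>"
  defines "\<zeta> \<equiv> one_form (\<lambda>v. complex_of_real (\<xi> v))" and "\<zeta>' \<equiv> one_form (\<lambda>v. - complex_of_real (\<xi> (J v)))"
  shows "adjw B 2 w (adjw B 1 \<zeta> (fwedge w x)) vs - fwedge w (adjw B 2 w (adjw B 1 \<zeta> x)) vs
    = (of_nat CARD('n) - of_nat (length vs) - 1) * adjw B 1 \<zeta> x vs + fwedge \<zeta>' (adjw B 2 w x) vs"
    and "adjw B 2 w (fwedge \<zeta>' x) vs = fwedge \<zeta>' (adjw B 2 w x) vs - adjw B 1 \<zeta> x vs"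
proof -
  have l: "linear (\<lambda>v. complex_of_real (\<xi> v))" "linear (\<lambda>v. - complex_of_real (\<xi> (J v)))"
    using \<xi> linear_compose[OF linear_J \<xi>] by (auto simp: linear_iff scaleR_conv_of_real o_def)
  have a1: "adjw B 1 \<zeta> x vs = (\<Sum>b\<in>B. of_real (\<xi> b) * x (b # vs))" for x vs
    by (simp only: adjw_1 \<zeta>_def one_form_single complex_cnj_complex_of_real)
  have "(\<Sum>b\<in>B. - complex_of_real (\<xi> (J b)) * x (J b # vs)) = (\<Sum>b\<in>B. - complex_of_real (\<xi> b) * x (b # vs))"
  proof (rule trace_J[where F = "\<lambda>b c. - complex_of_real (\<xi> b) * x (c # vs)"])
    show "linear (\<lambda>b. - complex_of_real (\<xi> b) * x (c # vs))" for c
      by (rule linear_mult_left_real) (use l(1) in \<open>simp add: linear_iff\<close>)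
    show "linear (\<lambda>c. - complex_of_real (\<xi> b) * x (c # vs))" for b
      by (rule linear_mult_right_real) (rule alternating_linear[OF x])
  qed
  then show 2: "adjw B 2 w (fwedge \<zeta>' x) vs = fwedge \<zeta>' (adjw B 2 w x) vs - adjw B 1 \<zeta> x vs"
    unfolding \<zeta>'_def Lam_fwedge_one_form[OF x l(2)] by (simp add: a1 sum_negf del: One_nat_def)
  \<comment> \<open>The adjoint of \<zeta> is an interior product, and contracting w with the vector
    dual to \<zeta> gives \<zeta>'.\<close>
  have "adjw B 1 \<zeta> (fwedge w x) = (\<lambda>vs. fwedge w (adjw B 1 \<zeta> x) vs + fwedge \<zeta>' x vs)"
  proof
    fix vs
    have "adjw B 1 \<zeta> x = (\<lambda>vs. \<Sum>b\<in>B. of_real (\<xi> b) * ins b x vs)"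
      by (rule ext) (simp only: a1 ins_app)
    then have 1: "fwedge w (adjw B 1 \<zeta> x) vs = (\<Sum>b\<in>B. of_real (\<xi> b) * fwedge w (ins b x) vs)"
      by (simp only: fwedge_sum_right fwedge_mult_right)
    have "(\<Sum>b\<in>B. of_real (\<xi> b) * of_real (gm w (J b) v)) = - complex_of_real (\<xi> (J v))" for v
      using expand_complex(1)[OF l(1), of "J v"] by (simp add: gm_J_left sum_negf mult.commute)
    then have "\<zeta>' = one_form (\<lambda>v. \<Sum>b\<in>B. of_real (\<xi> b) * of_real (gm w (J b) v))"
      by (simp only: \<zeta>'_def)
    also have "\<dots> = (\<lambda>vs. \<Sum>b\<in>B. of_real (\<xi> b) * flat (J b) vs)"
      by (simp only: one_form_sum one_form_mult)
    finally have "\<zeta>' = (\<lambda>vs. \<Sum>b\<in>B. of_real (\<xi> b) * flat (J b) vs)" .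
    then have "fwedge \<zeta>' x vs = (\<Sum>b\<in>B. of_real (\<xi> b) * fwedge (flat (J b)) x vs)"
      by (simp only: fwedge_sum_left fwedge_mult_left)
    then show "adjw B 1 \<zeta> (fwedge w x) vs = fwedge w (adjw B 1 \<zeta> x) vs + fwedge \<zeta>' x vs"
      unfolding a1 1 by (simp add: fwedge_two_Cons[OF homog_w] w_eq_gm ring_distribs sum.distrib)
  qed
  then have "adjw B 2 w (adjw B 1 \<zeta> (fwedge w x)) vs
    = adjw B 2 w (fwedge w (adjw B 1 \<zeta> x)) vs + adjw B 2 w (fwedge \<zeta>' x) vs"
    by (simp only: adjw_add)
  then show "adjw B 2 w (adjw B 1 \<zeta> (fwedge w x)) vs - fwedge w (adjw B 2 w (adjw B 1 \<zeta> x)) vs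
    = (of_nat CARD('n) - of_nat (length vs) - 1) * adjw B 1 \<zeta> x vs + fwedge \<zeta>' (adjw B 2 w x) vs"
    unfolding 2 adjw_2_fwedge_w[OF herm_invariant[OF herm] alternating_adjw[OF x]] two_form_op_w[OF alternating_adjw[OF x]]
    by (simp add: algebra_simps del: One_nat_def)
qed

text \<open>Formally the adjoint of \<open>tw_fwedge\<close> for a self-adjoint T. Self-adjointness
  itself, \<open>finn_tw\<close>, is the case without arguments, so both are obtained in one
  induction.\<close>

lemma adjw_tw:
  assumes "alternating x" "alternating \<zeta>"
  shows "adjw B k \<zeta> (tw s t x) vs = tw s t (adjw B k (tw s t \<zeta>) x) vs"
  using assms
proof (induction k arbitrary: x \<zeta> vs)
  case 0
  have "adjw B 0 (tw s t \<zeta>) x = (\<lambda>vs. cnj (\<zeta> []) * x vs)" by (rule ext) (simp add: adjw.simps)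
  then show ?case by (simp only: tw_mult adjw.simps(1) tw.simps(1))
next
  case (Suc k)
  note alt = Suc.prems
  let ?x = "of_real ((s + t) / 2) :: complex" and ?y = "\<i> * of_real ((t - s) / 2)"
  have M: "tw_ins s t b x = (\<lambda>vs. ?x * ins b x vs + ?y * ins (J b) x vs)" for b and x :: "'n fibre"
    by (rule ext) (simp add: tw_ins_def ins_app)
  have TM: "tw s t (tw_ins s t b \<zeta>) = (\<lambda>vs. ?x * tw s t (ins b \<zeta>) vs + ?y * tw s t (ins (J b) \<zeta>) vs)" for b
    by (rule ext) (simp only: tw_tw_ins)
  have L: "linear (\<lambda>b. adjw B k (tw s t (ins b \<zeta>)) u ws)" for u ws
    by (rule linearI) (simp_all only: ins_add[OF alt(2)] ins_scaleR[OF alt(2)]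
        tw_add[abs_def] tw_mult[abs_def] adjw_left_add adjw_left_mult complex_cnj_complex_of_real scaleR_conv_of_real[where 'a=complex])
  \<comment> \<open>J is skew for the metric, so it crosses the trace with a sign. The conjugation
    of the factor \<i> in the conjugate-linear argument of \<open>adjw\<close> compensates for
    it.\<close>
  have tr: "(\<Sum>b\<in>B. adjw B k (tw s t (ins b \<zeta>)) (ins (J b) x) ws)
      = - (\<Sum>b\<in>B. adjw B k (tw s t (ins (J b) \<zeta>)) (ins b x) ws)" for ws
  proof -
    let ?F = "\<lambda>b c. adjw B k (tw s t (ins b \<zeta>)) (ins (J c) x) ws"
    have "(\<Sum>b\<in>B. ?F b b) = (\<Sum>b\<in>B. ?F (J b) (J b))"
    proof (rule trace_J[where F = ?F, symmetric])
      show "linear (\<lambda>c. ?F b c)" for b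
        by (rule linear_comp_J[of "\<lambda>c. adjw B k _ (ins c x) ws"], rule adjw_ins_linear[OF alt(1)])
    qed (rule L)
    also have "\<dots> = (\<Sum>b\<in>B. (- 1) * adjw B k (tw s t (ins (J b) \<zeta>)) (ins b x) ws)"
    proof (intro sum.cong refl)
      fix b
      have "ins (J (J b)) x = (\<lambda>vs. (- 1) * ins b x vs)" using alt(1) by (simp add: ins_def alternating_head_minus)
      then show "?F (J b) (J b) = (- 1) * adjw B k (tw s t (ins (J b) \<zeta>)) (ins b x) ws"
        by (simp only: adjw_mult)
    qed
    finally show ?thesis by (simp add: sum_negf)
  qed
  have eq: "(\<Sum>b\<in>B. adjw B k (tw s t (ins b \<zeta>)) (tw_ins s t b x) ws)
      = (\<Sum>b\<in>B. adjw B k (tw s t (tw_ins s t b \<zeta>)) (ins b x) ws)" for ws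
    unfolding TM unfolding M adjw_add adjw_mult adjw_left_add adjw_left_mult sum.distrib sum_distrib_left[symmetric] tr
    by simp
  have "adjw B (Suc k) \<zeta> (tw s t x) vs = (\<Sum>b\<in>B. tw s t (adjw B k (tw s t (ins b \<zeta>)) (tw_ins s t b x)) vs) / of_nat (Suc k)"
    using alt by (simp only: adjw.simps ins_tw Suc.IH alternating_tw_ins alternating_ins)
  also have "\<dots> = tw s t (\<lambda>vs. (1 / of_nat (Suc k)) * (\<Sum>b\<in>B. adjw B k (tw s t (ins b \<zeta>)) (tw_ins s t b x) vs)) vs"
    by (simp only: tw_mult tw_sum) simp
  also have "(\<lambda>vs. (1 / of_nat (Suc k)) * (\<Sum>b\<in>B. adjw B k (tw s t (ins b \<zeta>)) (tw_ins s t b x) vs))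
      = adjw B (Suc k) (tw s t \<zeta>) x"
    by (rule ext) (simp only: eq adjw.simps ins_tw times_divide_eq_left mult_1)
  finally show ?case .
qed

lemma tw_w: "tw s t w = (\<lambda>vs. of_real (s * t) * w vs)"
  by (rule tw_invariant_two_form[OF alt_w homog_w w_J])

text \<open>Follows from T w = s t w: the operator \<Lambda> lowers both p and q by one.\<close>

lemma Lam_tw:
  assumes "alternating x"
  shows "adjw B 2 w (tw s t x) vs = of_real (s * t) * tw s t (adjw B 2 w x) vs"
proof -
  have "adjw B 2 (tw s t w) x = (\<lambda>vs. of_real (s * t) * adjw B 2 w x vs)"
    by (rule ext) (simp only: tw_w adjw_left_mult complex_cnj_complex_of_real)
  then show ?thesis by (simp only: adjw_tw[OF assms alt_w] tw_mult)
qed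

lemma finn_tw: "alternating \<alpha> \<Longrightarrow> alternating \<beta> \<Longrightarrow> finn B (tw s t \<alpha>) \<beta> = finn B \<alpha> (tw s t \<beta>)"
  by (simp add: finn_def adjw_tw)

end

section \<open>Smooth functions\<close>

lemma Ck_on_cong:
  assumes "open S" "\<And>z. z \<in> S \<Longrightarrow> f z = g z"
  shows "Ck_on k S f \<longleftrightarrow> Ck_on k S g"
  using assms(2)
proof (induction k arbitrary: f g)
  case 0
  then show ?case by (auto intro: continuous_on_cong[THEN iffD1, rotated])
next
  case (Suc k)
  have D: "(f has_derivative D) (at z) \<longleftrightarrow> (g has_derivative D) (at z)" if "z \<in> S" for D z
    using has_derivative_transform_within_open[OF _ assms(1) that, of f D UNIV g]
      has_derivative_transform_within_open[OF _ assms(1) that, of g D UNIV f] Suc.prems by auto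
  have d: "f differentiable (at z) \<longleftrightarrow> g differentiable (at z)" if "z \<in> S" for z
    using D[OF that] by (auto simp: differentiable_def)
  have fd: "frechet_derivative f (at z) = frechet_derivative g (at z)" if "z \<in> S" for z
    using D[OF that] by (simp add: frechet_derivative_def)
  have "Ck_on k S (\<lambda>z. frechet_derivative f (at z) v) \<longleftrightarrow> Ck_on k S (\<lambda>z. frechet_derivative g (at z) v)" for v
    by (rule Suc.IH) (simp add: fd)
  then show ?case using d by simp
qed

lemma Ck_on_SucI:
  assumes "open S" "\<And>z. z \<in> S \<Longrightarrow> (f has_derivative f' z) (at z)" "\<And>v. Ck_on k S (\<lambda>z. f' z v)"
  shows "Ck_on (Suc k) S f"
proof -
  have "frechet_derivative f (at z) = f' z" if "z \<in> S" for z
    using frechet_derivative_at[OF assms(2)[OF that]] by simp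
  then have "Ck_on k S (\<lambda>z. frechet_derivative f (at z) v)" for v
    using Ck_on_cong[OF assms(1), of "\<lambda>z. frechet_derivative f (at z) v" "\<lambda>z. f' z v" k] assms(3) by simp
  then show ?thesis using assms(2) by (auto simp: differentiable_def)
qed

lemma Ck_on_SucD:
  assumes "Ck_on (Suc k) S f"
  shows "z \<in> S \<Longrightarrow> (f has_derivative frechet_derivative f (at z)) (at z)"
    and "Ck_on k S (\<lambda>z. frechet_derivative f (at z) v)"
  using assms by (auto simp: frechet_derivative_works[symmetric])

lemma Ck_on_Suc_imp: "Ck_on (Suc k) S f \<Longrightarrow> Ck_on k S f"
proof (induction k arbitrary: f)
  case 0
  then have "f differentiable (at z within S)" if "z \<in> S" for z
    using that differentiable_at_withinI by auto
  then show ?case by (simp add: differentiable_imp_continuous_on differentiable_on_def)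
next
  case (Suc k)
  then show ?case by (auto simp: Suc.IH simp del: Ck_on.simps(2)) (subst Ck_on.simps(2), use Suc in auto)
qed

lemma Ck_on_le: "Ck_on k S f \<Longrightarrow> j \<le> k \<Longrightarrow> Ck_on j S f"
  by (induction k) (auto simp: le_Suc_eq simp del: Ck_on.simps dest: Ck_on_Suc_imp)

lemma Ck_on_subset: "Ck_on k S f \<Longrightarrow> T \<subseteq> S \<Longrightarrow> Ck_on k T f"
  by (induction k arbitrary: f) (auto intro: continuous_on_subset)

lemma Ck_on_continuous: "Ck_on k S f \<Longrightarrow> continuous_on S f"
  using Ck_on_le[of k S f 0] by simp

lemma Ck_on_const: "open S \<Longrightarrow> Ck_on k S (\<lambda>z. c)"
proof (induction k arbitrary: c)
  case (Suc k)
  then show ?case by (intro Ck_on_SucI[where f' = "\<lambda>_ _. 0"]) auto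
qed simp

lemma Ck_on_linear: "open S \<Longrightarrow> bounded_linear h \<Longrightarrow> Ck_on k S h"
proof (induction k)
  case 0 then show ?case by (simp add: linear_continuous_on)
next
  case (Suc k)
  then show ?case
    by (intro Ck_on_SucI[where f' = "\<lambda>_. h"] Ck_on_const bounded_linear_imp_has_derivative)
qed

lemma Ck_on_bounded_linear:
  assumes "open S" "bounded_linear h" shows "Ck_on k S f \<Longrightarrow> Ck_on k S (\<lambda>z. h (f z))"
proof (induction k arbitrary: f)
  case 0 then show ?case using assms(2) by (simp add: bounded_linear.continuous_on)
next
  case (Suc k)
  show ?case
    by (rule Ck_on_SucI[where f' = "\<lambda>z v. h (frechet_derivative f (at z) v)"])
      (auto intro: assms Suc.IH Ck_on_SucD[OF Suc.prems] bounded_linear.has_derivative[OF assms(2)])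
qed

lemma Ck_on_add:
  assumes "open S" shows "Ck_on k S f \<Longrightarrow> Ck_on k S g \<Longrightarrow> Ck_on k S (\<lambda>z. f z + g z)"
proof (induction k arbitrary: f g)
  case 0 then show ?case by (simp add: continuous_on_add)
next
  case (Suc k)
  show ?case
    by (rule Ck_on_SucI[where f' = "\<lambda>z v. frechet_derivative f (at z) v + frechet_derivative g (at z) v"])
      (auto intro: assms Suc.IH Ck_on_SucD[OF Suc.prems(1)] Ck_on_SucD[OF Suc.prems(2)] has_derivative_add)
qed

lemma Ck_on_bilinear:
  assumes "open S" "bounded_bilinear h" shows "Ck_on k S f \<Longrightarrow> Ck_on k S g \<Longrightarrow> Ck_on k S (\<lambda>z. h (f z) (g z))"
proof (induction k arbitrary: f g)
  case 0 then show ?case using assms(2) by (simp add: bounded_bilinear.continuous_on)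
next
  case (Suc k)
  show ?case
  proof (rule Ck_on_SucI[OF assms(1)])
    show "((\<lambda>z. h (f z) (g z)) has_derivative
        (\<lambda>v. h (f z) (frechet_derivative g (at z) v) + h (frechet_derivative f (at z) v) (g z))) (at z)" if "z \<in> S" for z
      by (rule bounded_bilinear.FDERIV[OF assms(2) Ck_on_SucD(1)[OF Suc.prems(1) that] Ck_on_SucD(1)[OF Suc.prems(2) that]])
    show "Ck_on k S (\<lambda>z. h (f z) (frechet_derivative g (at z) v) + h (frechet_derivative f (at z) v) (g z))" for v
      by (intro Ck_on_add assms(1) Suc.IH Ck_on_SucD(2)[OF Suc.prems(1)] Ck_on_SucD(2)[OF Suc.prems(2)]
          Ck_on_Suc_imp[OF Suc.prems(1)] Ck_on_Suc_imp[OF Suc.prems(2)])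
  qed
qed

lemma Ck_on_sum: "open S \<Longrightarrow> (\<And>i. i \<in> I \<Longrightarrow> Ck_on k S (f i)) \<Longrightarrow> Ck_on k S (\<lambda>z. \<Sum>i\<in>I. f i z)"
  by (induction I rule: infinite_finite_induct) (auto intro: Ck_on_add Ck_on_const)

lemma Ck_on_inverse:
  fixes f :: "'b::real_normed_vector \<Rightarrow> 'c::real_normed_field"
  assumes "open S" "\<And>z. z \<in> S \<Longrightarrow> f z \<noteq> 0" shows "Ck_on k S f \<Longrightarrow> Ck_on k S (\<lambda>z. inverse (f z))"
proof (induction k)
  case 0 then show ?case using assms by (auto intro: continuous_on_inverse)
next
  case (Suc k)
  show ?case
  proof (rule Ck_on_SucI[OF assms(1)])
    show "((\<lambda>z. inverse (f z)) has_derivative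
        (\<lambda>v. - (inverse (f z) * frechet_derivative f (at z) v * inverse (f z)))) (at z)" if "z \<in> S" for z
      by (rule has_derivative_compose[OF Ck_on_SucD(1)[OF Suc.prems that] has_derivative_inverse'[OF assms(2)[OF that]]])
    have "bounded_linear (uminus :: 'c \<Rightarrow> 'c)" by (rule bounded_linear_minus[OF bounded_linear_ident])
    then show "Ck_on k S (\<lambda>z. - (inverse (f z) * frechet_derivative f (at z) v * inverse (f z)))" for v
      by (rule Ck_on_bounded_linear[OF assms(1)])
        (intro Ck_on_bilinear[OF assms(1) bounded_bilinear_mult] Suc.IH Ck_on_Suc_imp[OF Suc.prems] Ck_on_SucD(2)[OF Suc.prems])
  qed
qed

lemma Ck_on_compose:
  fixes f :: "'b::euclidean_space \<Rightarrow> 'c::real_normed_vector"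
  assumes "open S" "open T" "\<And>z. z \<in> S \<Longrightarrow> \<Phi> z \<in> T"
  shows "Ck_on k T f \<Longrightarrow> Ck_on k S \<Phi> \<Longrightarrow> Ck_on k S (\<lambda>z. f (\<Phi> z))"
proof (induction k arbitrary: f)
  case 0 then show ?case using assms(3) by (auto intro: continuous_on_compose2)
next
  case (Suc k)
  let ?f = "\<lambda>z v. frechet_derivative f (at z) v" and ?p = "\<lambda>z v. frechet_derivative \<Phi> (at z) v"
  show ?case
  proof (rule Ck_on_SucI[OF assms(1)])
    fix z assume z: "z \<in> S"
    have f: "(f has_derivative ?f (\<Phi> z)) (at (\<Phi> z))"
      by (rule Ck_on_SucD(1)[OF Suc.prems(1) assms(3)[OF z]])
    have lin: "linear (?f (\<Phi> z))" using has_derivative_linear[OF f] .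
    have "((\<lambda>z. f (\<Phi> z)) has_derivative (\<lambda>v. ?f (\<Phi> z) (?p z v))) (at z)"
      by (rule has_derivative_compose[OF Ck_on_SucD(1)[OF Suc.prems(2) z] f])
    \<comment> \<open>The derivative of f is expanded in the standard basis, so that only
      derivatives in constant directions occur, to which the induction hypothesis applies.\<close>
    moreover have "?f (\<Phi> z) (?p z v) = (\<Sum>e\<in>Basis. (?p z v \<bullet> e) *\<^sub>R ?f (\<Phi> z) e)" for v
    proof -
      have "?f (\<Phi> z) (?p z v) = ?f (\<Phi> z) (\<Sum>e\<in>Basis. (?p z v \<bullet> e) *\<^sub>R e)" by (simp add: euclidean_representation)
      then show ?thesis by (simp add: linear_sum[OF lin] linear_scale[OF lin])
    qed
    ultimately show "((\<lambda>z. f (\<Phi> z)) has_derivative (\<lambda>v. \<Sum>e\<in>Basis. (?p z v \<bullet> e) *\<^sub>R ?f (\<Phi> z) e)) (at z)"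
      by simp
  next
    fix v
    show "Ck_on k S (\<lambda>z. \<Sum>e\<in>Basis. (?p z v \<bullet> e) *\<^sub>R ?f (\<Phi> z) e)"
      by (intro Ck_on_sum assms(1) Ck_on_bilinear[OF assms(1) bounded_bilinear_scaleR] Suc.IH Ck_on_Suc_imp[OF Suc.prems(2)]
          Ck_on_bounded_linear[OF assms(1) bounded_linear_inner_left] Ck_on_SucD(2)[OF Suc.prems(1)] Ck_on_SucD(2)[OF Suc.prems(2)])
  qed
qed

lemma Ck_on_local:
  assumes "\<And>z. z \<in> S \<Longrightarrow> \<exists>T. open T \<and> z \<in> T \<and> Ck_on k T f"
  shows "Ck_on k S f"
  using assms
proof (induction k arbitrary: f)
  case 0
  have "isCont f z" if "z \<in> S" for z
    using 0[OF that] by (auto simp: continuous_on_eq_continuous_at)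
  then show ?case by (simp add: continuous_at_imp_continuous_on)
next
  case (Suc k)
  have "Ck_on k S (\<lambda>z. frechet_derivative f (at z) v)" for v
  proof (rule Suc.IH)
    fix z assume "z \<in> S"
    then obtain T where "open T" "z \<in> T" "Ck_on (Suc k) T f" using Suc.prems by blast
    then show "\<exists>T. open T \<and> z \<in> T \<and> Ck_on k T (\<lambda>z. frechet_derivative f (at z) v)"
      by (intro exI[of _ T]) auto
  qed
  moreover have "f differentiable (at z)" if "z \<in> S" for z using Suc.prems[OF that] by auto
  ultimately show ?case by simp
qed

lemma smooth_on_cong: "open S \<Longrightarrow> (\<And>z. z \<in> S \<Longrightarrow> f z = g z) \<Longrightarrow> smooth_on S f \<longleftrightarrow> smooth_on S g"
  using Ck_on_cong[of S f g] by (simp add: smooth_on_def)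

lemma smooth_on_subset: "smooth_on S f \<Longrightarrow> T \<subseteq> S \<Longrightarrow> smooth_on T f"
  unfolding smooth_on_def using Ck_on_subset by metis

lemma smooth_on_local: "(\<And>z. z \<in> S \<Longrightarrow> \<exists>T. open T \<and> z \<in> T \<and> smooth_on T f) \<Longrightarrow> smooth_on S f"
  unfolding smooth_on_def by (intro allI Ck_on_local) blast

lemma smooth_on_continuous: "smooth_on S f \<Longrightarrow> continuous_on S f"
  unfolding smooth_on_def by (rule Ck_on_continuous[of 0]) (erule spec)

lemma smooth_on_has_derivative:
  "smooth_on S f \<Longrightarrow> z \<in> S \<Longrightarrow> (f has_derivative frechet_derivative f (at z)) (at z)"
  unfolding smooth_on_def by (rule Ck_on_SucD(1)[of 0 S f z]) (erule spec)

lemma smooth_on_frechet: "smooth_on S f \<Longrightarrow> smooth_on S (\<lambda>z. frechet_derivative f (at z) v)"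
  unfolding smooth_on_def by (intro allI Ck_on_SucD(2)) (erule spec)

lemma smooth_on_const: "open S \<Longrightarrow> smooth_on S (\<lambda>z. c)"
  by (simp add: smooth_on_def Ck_on_const)

lemma smooth_on_linear: "open S \<Longrightarrow> bounded_linear h \<Longrightarrow> smooth_on S h"
  by (simp add: smooth_on_def Ck_on_linear)

lemma smooth_on_bounded_linear: "open S \<Longrightarrow> bounded_linear h \<Longrightarrow> smooth_on S f \<Longrightarrow> smooth_on S (\<lambda>z. h (f z))"
  by (simp add: smooth_on_def Ck_on_bounded_linear)

lemma smooth_on_add: "open S \<Longrightarrow> smooth_on S f \<Longrightarrow> smooth_on S g \<Longrightarrow> smooth_on S (\<lambda>z. f z + g z)"
  by (simp add: smooth_on_def Ck_on_add)

lemma smooth_on_minus: "open S \<Longrightarrow> smooth_on S f \<Longrightarrow> smooth_on S (\<lambda>z. - f z)"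
  by (rule smooth_on_bounded_linear[OF _ bounded_linear_minus[OF bounded_linear_ident]])

lemma smooth_on_diff: "open S \<Longrightarrow> smooth_on S f \<Longrightarrow> smooth_on S g \<Longrightarrow> smooth_on S (\<lambda>z. f z - g z)"
  using smooth_on_add[OF _ _ smooth_on_minus] by fastforce

lemma smooth_on_bilinear:
  "open S \<Longrightarrow> bounded_bilinear h \<Longrightarrow> smooth_on S f \<Longrightarrow> smooth_on S g \<Longrightarrow> smooth_on S (\<lambda>z. h (f z) (g z))"
  by (simp add: smooth_on_def Ck_on_bilinear)

lemma smooth_on_mult:
  fixes f g :: "'b::real_normed_vector \<Rightarrow> 'c::real_normed_algebra"
  shows "open S \<Longrightarrow> smooth_on S f \<Longrightarrow> smooth_on S g \<Longrightarrow> smooth_on S (\<lambda>z. f z * g z)"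
  by (rule smooth_on_bilinear[OF _ bounded_bilinear_mult])

lemma smooth_on_sum: "open S \<Longrightarrow> (\<And>i. i \<in> I \<Longrightarrow> smooth_on S (f i)) \<Longrightarrow> smooth_on S (\<lambda>z. \<Sum>i\<in>I. f i z)"
  by (simp add: smooth_on_def Ck_on_sum)

lemma smooth_on_prod:
  fixes f :: "'i \<Rightarrow> 'b::real_normed_vector \<Rightarrow> 'c::{real_normed_algebra,comm_ring_1}"
  shows "open S \<Longrightarrow> (\<And>i. i \<in> I \<Longrightarrow> smooth_on S (f i)) \<Longrightarrow> smooth_on S (\<lambda>z. \<Prod>i\<in>I. f i z)"
  by (induction I rule: infinite_finite_induct) (auto intro: smooth_on_const smooth_on_mult)

lemma smooth_on_inverse:
  fixes f :: "'b::real_normed_vector \<Rightarrow> 'c::real_normed_field"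
  shows "open S \<Longrightarrow> (\<And>z. z \<in> S \<Longrightarrow> f z \<noteq> 0) \<Longrightarrow> smooth_on S f \<Longrightarrow> smooth_on S (\<lambda>z. inverse (f z))"
  by (simp add: smooth_on_def Ck_on_inverse)

lemma smooth_on_divide:
  fixes f :: "'b::real_normed_vector \<Rightarrow> 'c::real_normed_field"
  shows "open S \<Longrightarrow> (\<And>z. z \<in> S \<Longrightarrow> g z \<noteq> 0) \<Longrightarrow> smooth_on S f \<Longrightarrow> smooth_on S g \<Longrightarrow> smooth_on S (\<lambda>z. f z / g z)"
  unfolding divide_inverse by (intro smooth_on_mult smooth_on_inverse)

lemma smooth_on_of_real: "open S \<Longrightarrow> smooth_on S f \<Longrightarrow> smooth_on S (\<lambda>z. of_real (f z) :: 'c::real_normed_algebra_1)"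
  by (rule smooth_on_bounded_linear[OF _ bounded_linear_of_real])

lemma smooth_on_cnj: "open S \<Longrightarrow> smooth_on S f \<Longrightarrow> smooth_on S (\<lambda>z. cnj (f z))"
  by (rule smooth_on_bounded_linear[OF _ bounded_linear_cnj])

lemma smooth_on_Re: "open S \<Longrightarrow> smooth_on S f \<Longrightarrow> smooth_on S (\<lambda>z. Re (f z))"
  by (rule smooth_on_bounded_linear[OF _ bounded_linear_Re])

lemma smooth_on_compose:
  fixes f :: "'b::euclidean_space \<Rightarrow> 'c::real_normed_vector"
  shows "open S \<Longrightarrow> open T \<Longrightarrow> (\<And>z. z \<in> S \<Longrightarrow> \<Phi> z \<in> T) \<Longrightarrow> smooth_on T f \<Longrightarrow> smooth_on S \<Phi> \<Longrightarrow> smooth_on S (\<lambda>z. f (\<Phi> z))"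
  by (simp add: smooth_on_def Ck_on_compose)

section \<open>Symmetry of second derivatives\<close>

lemma mvt_two:
  fixes f :: "'b::real_normed_vector \<Rightarrow> real"
  assumes "smooth_on S f" and r: "r > 0"
    and S: "\<And>s t. 0 \<le> s \<Longrightarrow> s \<le> r \<Longrightarrow> 0 \<le> t \<Longrightarrow> t \<le> r \<Longrightarrow> z + s *\<^sub>R u + t *\<^sub>R v \<in> S"
  shows "\<exists>s t. 0 < s \<and> s < r \<and> 0 < t \<and> t < r \<and>
    f (z + r *\<^sub>R u + r *\<^sub>R v) - f (z + r *\<^sub>R u) - f (z + r *\<^sub>R v) + f z
    = r * r * frechet_derivative (\<lambda>z. frechet_derivative f (at z) u) (at (z + s *\<^sub>R u + t *\<^sub>R v)) v"
proof -
  let ?f' = "\<lambda>z. frechet_derivative f (at z)"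
  \<comment> \<open>The increment along v as a function of the step along u. The mean value theorem
    is used for it, and then once more for the derivative in direction u.\<close>
  define \<phi> where "\<phi> s = f (z + s *\<^sub>R u + r *\<^sub>R v) - f (z + s *\<^sub>R u)" for s
  have d: "((\<lambda>s. f (w + s *\<^sub>R u)) has_derivative (\<lambda>h. h * ?f' (w + s *\<^sub>R u) u)) (at s)" if "w + s *\<^sub>R u \<in> S" for w s
  proof -
    have f: "(f has_derivative ?f' (w + s *\<^sub>R u)) (at (w + s *\<^sub>R u))"
      by (rule smooth_on_has_derivative[OF assms(1) that])
    have "((\<lambda>s. w + s *\<^sub>R u) has_derivative (\<lambda>h. h *\<^sub>R u)) (at s)"
      by (auto intro!: derivative_eq_intros)
    from has_derivative_compose[OF this f] show ?thesis
      by (simp add: linear_scale[OF has_derivative_linear[OF f]])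
  qed
  have "\<exists>s. 0 < s \<and> s < r \<and> \<phi> r - \<phi> 0 = (r - 0) * (?f' (z + s *\<^sub>R u + r *\<^sub>R v) u - ?f' (z + s *\<^sub>R u) u)"
  proof (rule MVT2[OF r])
    fix s assume s: "0 \<le> s" "s \<le> r"
    have e: "z + s *\<^sub>R u + r *\<^sub>R v = (z + r *\<^sub>R v) + s *\<^sub>R u" for s by simp
    have "(\<phi> has_derivative (\<lambda>h. h * ?f' ((z + r *\<^sub>R v) + s *\<^sub>R u) u - h * ?f' (z + s *\<^sub>R u) u)) (at s)"
      unfolding \<phi>_def e using S[of s r] S[of s 0] s r by (intro has_derivative_diff d) (auto simp: algebra_simps)
    moreover have "(\<lambda>h. h * a - h * b) = (*) (a - b)" for a b :: real by (auto simp: algebra_simps)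
    ultimately show "(\<phi> has_real_derivative ?f' (z + s *\<^sub>R u + r *\<^sub>R v) u - ?f' (z + s *\<^sub>R u) u) (at s)"
      unfolding e has_field_derivative_def by simp
  qed
  then obtain s where s: "0 < s" "s < r"
    and 1: "\<phi> r - \<phi> 0 = r * (?f' (z + s *\<^sub>R u + r *\<^sub>R v) u - ?f' (z + s *\<^sub>R u) u)" by auto
  let ?g = "\<lambda>z. ?f' z u" and ?g' = "\<lambda>z. frechet_derivative (\<lambda>z. ?f' z u) (at z)"
  have "\<exists>t. 0 < t \<and> t < r \<and> ?g (z + s *\<^sub>R u + r *\<^sub>R v) - ?g (z + s *\<^sub>R u + 0 *\<^sub>R v)
      = (r - 0) * ?g' (z + s *\<^sub>R u + t *\<^sub>R v) v"
  proof (rule MVT2[OF r])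
    fix t assume t: "0 \<le> t" "t \<le> r"
    have "z + s *\<^sub>R u + t *\<^sub>R v \<in> S" using S s t by auto
    then have g: "(?g has_derivative ?g' (z + s *\<^sub>R u + t *\<^sub>R v)) (at (z + s *\<^sub>R u + t *\<^sub>R v))"
      by (rule smooth_on_has_derivative[OF smooth_on_frechet[OF assms(1)]])
    have "((\<lambda>t. z + s *\<^sub>R u + t *\<^sub>R v) has_derivative (\<lambda>h. h *\<^sub>R v)) (at t)"
      by (auto intro!: derivative_eq_intros)
    from has_derivative_compose[OF this g] show "((\<lambda>t. ?g (z + s *\<^sub>R u + t *\<^sub>R v)) has_real_derivative
        ?g' (z + s *\<^sub>R u + t *\<^sub>R v) v) (at t)"
      by (simp add: linear_scale[OF has_derivative_linear[OF g]] has_field_derivative_def mult_commute_abs)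
  qed
  then obtain t where t: "0 < t" "t < r" "?g (z + s *\<^sub>R u + r *\<^sub>R v) - ?g (z + s *\<^sub>R u) = r * ?g' (z + s *\<^sub>R u + t *\<^sub>R v) v"
    by auto
  have "\<phi> r - \<phi> 0 = r * r * ?g' (z + s *\<^sub>R u + t *\<^sub>R v) v" unfolding 1 t(3) by simp
  then show ?thesis using s t(1,2) unfolding \<phi>_def by (intro exI[of _ s] exI[of _ t]) simp
qed

text \<open>By \<open>mvt_two\<close> the same second difference over a small parallelogram equals
  either mixed derivative at a nearby point. Continuity forbids this if the two mixed derivatives
  differ at z.\<close>

lemma symmetric_second_derivative_real:
  fixes f :: "'b::real_normed_vector \<Rightarrow> real"
  assumes f: "smooth_on S f" and "open S" "z \<in> S"
  shows "frechet_derivative (\<lambda>z. frechet_derivative f (at z) u) (at z) v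
    = frechet_derivative (\<lambda>z. frechet_derivative f (at z) v) (at z) u"
proof (rule ccontr)
  let ?D = "\<lambda>u v z. frechet_derivative (\<lambda>z. frechet_derivative f (at z) u) (at z) v"
  assume ne: "?D u v z \<noteq> ?D v u z"
  define e where "e = \<bar>?D u v z - ?D v u z\<bar> / 2"
  have e: "e > 0" using ne by (simp add: e_def)
  have "isCont (?D u v) z" for u v
    using smooth_on_continuous[OF smooth_on_frechet[OF smooth_on_frechet[OF f]]] assms(2,3)
    by (simp add: continuous_on_eq_continuous_at)
  then have ex: "\<exists>d>0. \<forall>w. dist w z < d \<longrightarrow> \<bar>?D u v w - ?D u v z\<bar> < e" for u v
    using e unfolding continuous_at_eps_delta dist_real_def by blast
  obtain d1 d2 d3 where d: "d1 > 0" "d2 > 0" "d3 > 0"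
    and "\<And>w. dist w z < d1 \<Longrightarrow> \<bar>?D u v w - ?D u v z\<bar> < e" "\<And>w. dist w z < d2 \<Longrightarrow> \<bar>?D v u w - ?D v u z\<bar> < e"
      "\<And>w. dist w z < d3 \<Longrightarrow> w \<in> S"
    using ex[of u v] ex[of v u] assms(2,3) unfolding open_dist by blast
  moreover define d where "d = min d1 (min d2 d3)"
  ultimately have d: "d > 0" and D: "\<And>w. dist w z < d \<Longrightarrow> w \<in> S \<and> \<bar>?D u v w - ?D u v z\<bar> < e \<and> \<bar>?D v u w - ?D v u z\<bar> < e"
    by auto
  \<comment> \<open>Chosen so that the whole parallelogram with sides r u and r v stays in the ball
    of radius d around z.\<close>
  define r where "r = d / (norm u + norm v + 1)"
  have N: "norm u + norm v + 1 > 0" by (simp add: add_nonneg_pos)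
  have r: "r > 0" using d N by (simp add: r_def)
  have in_ball: "dist (z + s *\<^sub>R u + t *\<^sub>R v) z < d" if "0 \<le> s" "s \<le> r" "0 \<le> t" "t \<le> r" for s t
  proof -
    have "dist (z + s *\<^sub>R u + t *\<^sub>R v) z = norm (s *\<^sub>R u + t *\<^sub>R v)" by (simp add: dist_norm add.assoc)
    also have "\<dots> \<le> s * norm u + t * norm v" using that norm_triangle_ineq[of "s *\<^sub>R u" "t *\<^sub>R v"] by simp
    also have "\<dots> \<le> r * norm u + r * norm v" using that by (intro add_mono mult_right_mono) auto
    also have "\<dots> < r * (norm u + norm v + 1)" using r by (simp add: algebra_simps)
    also have "\<dots> = d" using N by (simp add: r_def)
    finally show ?thesis .
  qed
  have in_ball': "dist (z + s *\<^sub>R v + t *\<^sub>R u) z < d" if "0 \<le> s" "s \<le> r" "0 \<le> t" "t \<le> r" for s t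
    using in_ball[of t s] that by (simp add: add.commute add.left_commute)
  obtain s t where 1: "0 < s" "s < r" "0 < t" "t < r"
    "f (z + r *\<^sub>R u + r *\<^sub>R v) - f (z + r *\<^sub>R u) - f (z + r *\<^sub>R v) + f z = r * r * ?D u v (z + s *\<^sub>R u + t *\<^sub>R v)"
    using mvt_two[OF f r, of z u v] in_ball D by blast
  obtain s' t' where 2: "0 < s'" "s' < r" "0 < t'" "t' < r"
    "f (z + r *\<^sub>R v + r *\<^sub>R u) - f (z + r *\<^sub>R v) - f (z + r *\<^sub>R u) + f z = r * r * ?D v u (z + s' *\<^sub>R v + t' *\<^sub>R u)"
    using mvt_two[OF f r, of z v u] in_ball' D by blast
  have "r * r * ?D u v (z + s *\<^sub>R u + t *\<^sub>R v) = r * r * ?D v u (z + s' *\<^sub>R v + t' *\<^sub>R u)"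
    unfolding 1(5)[symmetric] 2(5)[symmetric] by (simp add: algebra_simps)
  then have "?D u v (z + s *\<^sub>R u + t *\<^sub>R v) = ?D v u (z + s' *\<^sub>R v + t' *\<^sub>R u)" using r by simp
  moreover have "\<bar>?D u v (z + s *\<^sub>R u + t *\<^sub>R v) - ?D u v z\<bar> < e" "\<bar>?D v u (z + s' *\<^sub>R v + t' *\<^sub>R u) - ?D v u z\<bar> < e"
    using D[OF in_ball[of s t]] D[OF in_ball'[of s' t']] 1 2 by auto
  ultimately show False unfolding e_def by (auto simp: abs_if split: if_splits)
qed

lemma frechet_bounded_linear:
  assumes "bounded_linear h" "f differentiable (at z)"
  shows "frechet_derivative (\<lambda>z. h (f z)) (at z) v = h (frechet_derivative f (at z) v)"
  using frechet_derivative_at[OF bounded_linear.has_derivative[OF assms(1) assms(2)[unfolded frechet_derivative_works]]]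
  by (metis)

lemma symmetric_second_derivative:
  fixes f :: "'b::real_normed_vector \<Rightarrow> 'c::euclidean_space"
  assumes f: "smooth_on S f" and S: "open S" "z \<in> S"
  shows "frechet_derivative (\<lambda>z. frechet_derivative f (at z) u) (at z) v
    = frechet_derivative (\<lambda>z. frechet_derivative f (at z) v) (at z) u"
proof (rule euclidean_eqI)
  fix e :: 'c assume "e \<in> Basis"
  let ?h = "\<lambda>x. x \<bullet> e"
  have h: "bounded_linear ?h" by (rule bounded_linear_inner_left)
  have fe: "smooth_on S (\<lambda>z. f z \<bullet> e)" by (rule smooth_on_bounded_linear[OF S(1) h f])
  have 1: "frechet_derivative (\<lambda>z. f z \<bullet> e) (at w) u = frechet_derivative f (at w) u \<bullet> e" if "w \<in> S" for w u
    using frechet_bounded_linear[OF h, of f w u] smooth_on_has_derivative[OF f that] by (auto simp: differentiable_def)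
  have 2: "frechet_derivative (\<lambda>z. frechet_derivative (\<lambda>z. f z \<bullet> e) (at z) u) (at z) v
      = frechet_derivative (\<lambda>z. frechet_derivative f (at z) u) (at z) v \<bullet> e" for u v
  proof -
    have D: "((\<lambda>z. frechet_derivative f (at z) u) has_derivative frechet_derivative (\<lambda>z. frechet_derivative f (at z) u) (at z)) (at z)"
      by (rule smooth_on_has_derivative[OF smooth_on_frechet[OF f] S(2)])
    have "((\<lambda>z. frechet_derivative f (at z) u \<bullet> e) has_derivative
        (\<lambda>v. frechet_derivative (\<lambda>z. frechet_derivative f (at z) u) (at z) v \<bullet> e)) (at z)"
      by (rule bounded_linear.has_derivative[OF h D])
    then have "((\<lambda>z. frechet_derivative (\<lambda>z. f z \<bullet> e) (at z) u) has_derivative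
        (\<lambda>v. frechet_derivative (\<lambda>z. frechet_derivative f (at z) u) (at z) v \<bullet> e)) (at z)"
      by (rule has_derivative_transform_within_open[OF _ S]) (simp add: 1)
    from frechet_derivative_at[OF this] show ?thesis by metis
  qed
  show "frechet_derivative (\<lambda>z. frechet_derivative f (at z) u) (at z) v \<bullet> e
     = frechet_derivative (\<lambda>z. frechet_derivative f (at z) v) (at z) u \<bullet> e"
    using symmetric_second_derivative_real[OF fe S, of u v] unfolding 2 .
qed

text \<open>The standard smooth function that is not analytic at \<open>0\<close>, times polynomials in \<open>1 / t\<close> so that the
  family is closed under differentiation.\<close>

definition flat_exp :: "real poly \<Rightarrow> real \<Rightarrow> real" where
  "flat_exp p t = (if t > 0 then poly p (1 / t) * exp (- (1 / t)) else 0)"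

lemma poly_exp_tendsto_0: "((\<lambda>x. poly p x * exp (- x)) \<longlongrightarrow> 0) at_top" for p :: "real poly"
proof -
  have "((\<lambda>x. \<Sum>i\<le>degree p. coeff p i * (x ^ i / exp x)) \<longlongrightarrow> (\<Sum>i\<le>degree p. coeff p i * 0)) at_top"
    by (intro tendsto_intros tendsto_power_div_exp_0)
  then show ?thesis by (simp add: poly_altdef sum_distrib_right exp_minus divide_inverse mult.assoc)
qed

lemma flat_exp_tendsto_0: "(flat_exp p \<longlongrightarrow> 0) (at 0)"
proof -
  have r: "(flat_exp p \<longlongrightarrow> 0) (at_right 0)"
  proof (rule Lim_transform_eventually)
    show "((\<lambda>t. poly p (inverse t) * exp (- inverse t)) \<longlongrightarrow> 0) (at_right 0)"
      by (rule filterlim_compose[OF poly_exp_tendsto_0 filterlim_inverse_at_top_right])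
    show "\<forall>\<^sub>F t in at_right 0. poly p (inverse t) * exp (- inverse t) = flat_exp p t"
      by (auto simp: flat_exp_def eventually_at_filter divide_inverse intro!: always_eventually)
  qed
  have l: "(flat_exp p \<longlongrightarrow> 0) (at_left 0)"
    by (rule Lim_transform_eventually[OF tendsto_const]) (auto simp: flat_exp_def eventually_at_filter)
  show ?thesis using l r by (simp add: filterlim_split_at)
qed

text \<open>With x = 1 / t one has x' = - x^2, so differentiating p(x) exp(- x) gives x^2 (p -
  p')(x) exp(- x).\<close>

lemma flat_exp_deriv:
  "(flat_exp p has_real_derivative flat_exp ([:0, 0, 1:] * (p - pderiv p)) t) (at t)"
proof -
  consider "t < 0" | "t = 0" | "t > 0" by linarith
  then show ?thesis
  proof cases
    case 1
    have "((\<lambda>_. 0) has_real_derivative 0) (at t)" by simp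
    then have "(flat_exp p has_real_derivative 0) (at t)"
      by (rule has_field_derivative_transform_within_open[where S = "{..<0}"]) (use 1 in \<open>auto simp: flat_exp_def\<close>)
    then show ?thesis using 1 by (simp add: flat_exp_def)
  next
    case 2
    \<comment> \<open>The difference quotient at 0 is the function for p multiplied by its variable:
      the division by h is absorbed as one more factor 1 / h.\<close>
    have "((\<lambda>h. flat_exp (pCons 0 p) h) \<longlongrightarrow> 0) (at 0)" by (rule flat_exp_tendsto_0)
    then have "((\<lambda>h. (flat_exp p (0 + h) - flat_exp p 0) / h) \<longlongrightarrow> 0) (at 0)"
      by (rule Lim_transform_eventually) (auto simp: flat_exp_def eventually_at_filter)
    then show ?thesis by (simp add: 2 DERIV_def flat_exp_def)
  next
    case 3
    have "((\<lambda>t. poly p (1 / t) * exp (- (1 / t))) has_real_derivative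
        poly ([:0, 0, 1:] * (p - pderiv p)) (1 / t) * exp (- (1 / t))) (at t)"
      using 3 by (auto intro!: derivative_eq_intros simp: power2_eq_square field_simps)
    then have "(flat_exp p has_real_derivative poly ([:0, 0, 1:] * (p - pderiv p)) (1 / t) * exp (- (1 / t))) (at t)"
      by (rule has_field_derivative_transform_within_open[where S = "{0<..}"]) (use 3 in \<open>auto simp: flat_exp_def\<close>)
    then show ?thesis using 3 by (simp add: flat_exp_def)
  qed
qed

lemma smooth_flat_exp: "smooth_on UNIV (flat_exp p)"
proof -
  have "Ck_on k UNIV (flat_exp p)" for k
  proof (induction k arbitrary: p)
    case 0
    show ?case using DERIV_isCont[OF flat_exp_deriv] by (simp add: continuous_at_imp_continuous_on)
  next
    case (Suc k)
    show ?case
    proof (rule Ck_on_SucI)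
      show "(flat_exp p has_derivative (\<lambda>v. v * flat_exp ([:0, 0, 1:] * (p - pderiv p)) t)) (at t)" for t
        using flat_exp_deriv[of p t] by (simp add: has_field_derivative_def mult_commute_abs)
      show "Ck_on k UNIV (\<lambda>t. v * flat_exp ([:0, 0, 1:] * (p - pderiv p)) t)" for v
        by (rule Ck_on_bounded_linear[OF _ bounded_linear_mult_right Suc.IH]) simp
    qed simp
  qed
  then show ?thesis by (simp add: smooth_on_def)
qed

text \<open>The squared distance is polynomial, so the function is smooth also at the centre; by
  \<open>bump_pos_iff\<close> it is positive exactly on the open ball.\<close>

definition bump :: "'b::euclidean_space \<Rightarrow> real \<Rightarrow> 'b \<Rightarrow> real" where
  "bump a r z = flat_exp 1 (r\<^sup>2 - (z - a) \<bullet> (z - a))"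

lemma smooth_bump: "smooth_on UNIV (bump a r)"
proof -
  have l: "smooth_on UNIV (\<lambda>z. z - a)" by (intro smooth_on_diff smooth_on_const smooth_on_linear bounded_linear_ident open_UNIV)
  have "smooth_on UNIV (\<lambda>z. r\<^sup>2 - (z - a) \<bullet> (z - a))"
    by (intro smooth_on_diff smooth_on_const smooth_on_bilinear[OF _ bounded_bilinear_inner] l open_UNIV)
  then show ?thesis unfolding bump_def by (intro smooth_on_compose[OF _ _ _ smooth_flat_exp]) auto
qed

lemma bump_nonneg: "bump a r z \<ge> 0"
  by (simp add: bump_def flat_exp_def)

lemma bump_pos_iff: "r > 0 \<Longrightarrow> bump a r z > 0 \<longleftrightarrow> z \<in> ball a r"
proof -
  assume r: "r > 0"
  have "bump a r z > 0 \<longleftrightarrow> (dist a z)\<^sup>2 < r\<^sup>2"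
    by (simp add: bump_def flat_exp_def dist_norm power2_norm_eq_inner norm_minus_commute[of a])
  also have "\<dots> \<longleftrightarrow> dist a z < r" using r by (auto intro: power_less_imp_less_base power_strict_mono)
  finally show ?thesis by simp
qed

section \<open>Integrals of compactly supported functions and derivatives of determinants\<close>

lemma integrable_continuous_compact:
  fixes f :: "'a::euclidean_space \<Rightarrow> 'b::{banach, second_countable_topology}"
  assumes "continuous_on UNIV f" "compact K" "\<And>x. x \<notin> K \<Longrightarrow> f x = 0"
  shows "integrable lborel f"
proof -
  have "integrable lborel (\<lambda>x. indicator K x *\<^sub>R f x)"
    using assms by (intro borel_integrable_compact) (auto intro: continuous_on_subset)
  moreover have "indicator K x *\<^sub>R f x = f x" for x using assms(3) by (cases "x \<in> K") auto
  ultimately show ?thesis by simp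
qed

text \<open>Difference quotients have integral zero by translation invariance of Lebesgue measure,
  and they converge to the derivative under a common bound on a compact set.\<close>

lemma integral_derivative_compact_support:
  fixes F :: "'a::euclidean_space \<Rightarrow> 'b::euclidean_space"
  assumes F: "smooth_on UNIV F" and K: "compact K" "\<And>x. x \<notin> K \<Longrightarrow> F x = 0"
  shows "(\<integral>x. frechet_derivative F (at x) e \<partial>lborel) = 0"
proof -
  let ?F' = "\<lambda>x. frechet_derivative F (at x)"
  have cF: "continuous_on UNIV F" by (rule smooth_on_continuous[OF F])
  have F': "(F has_derivative ?F' x) (at x)" for x by (rule smooth_on_has_derivative[OF F]) simp
  have F'0: "?F' x e = 0" if "x \<notin> K" for x
  proof -
    have "(F has_derivative (\<lambda>_. 0)) (at x)"
      by (rule has_derivative_transform_within_open[of "\<lambda>_. 0" _ _ _ "- K"])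
        (use that K compact_imp_closed in \<open>auto simp: open_Compl\<close>)
    then show ?thesis using frechet_derivative_at by metis
  qed
  have cF': "continuous_on UNIV (\<lambda>x. ?F' x e)" by (rule smooth_on_continuous[OF smooth_on_frechet[OF F]])
  obtain M where M: "\<And>x. norm (?F' x e) \<le> M" "M \<ge> 0"
  proof -
    have "bounded ((\<lambda>x. ?F' x e) ` K)"
      by (rule compact_imp_bounded[OF compact_continuous_image[OF continuous_on_subset[OF cF'] K(1)]]) simp
    then obtain M where "\<forall>x\<in>K. norm (?F' x e) \<le> M" by (auto simp: bounded_iff)
    then have "norm (?F' x e) \<le> max M 0" for x by (cases "x \<in> K") (auto simp: F'0 le_max_iff_disj)
    then show ?thesis using that[of "max M 0"] by auto
  qed
  \<comment> \<open>The points from which a segment in direction e with parameter in [0, 1] reaches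
    K. Difference quotients with step at most 1 vanish outside this set.\<close>
  define K' where "K' = (\<lambda>(x, t). x - t *\<^sub>R e) ` (K \<times> {0..1::real})"
  have K': "compact K'" unfolding K'_def
    by (intro compact_continuous_image compact_Times K) (auto intro!: continuous_intros simp: split_def)
  define r where "r n = 1 / real (Suc n)" for n
  have r: "0 < r n" "r n \<le> 1" for n by (auto simp: r_def)
  define g where "g n x = (F (x + r n *\<^sub>R e) - F x) /\<^sub>R r n" for n x
  have "(\<lambda>n. \<integral>x. g n x \<partial>lborel) \<longlonglongrightarrow> (\<integral>x. ?F' x e \<partial>lborel)"
  proof (rule integral_dominated_convergence[where w = "\<lambda>x. indicator K' x *\<^sub>R M"])
    show "(\<lambda>x. ?F' x e) \<in> borel_measurable lborel"
      using borel_measurable_continuous_onI[OF cF'] by simp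
    show "g n \<in> borel_measurable lborel" for n unfolding g_def
      by (simp, rule borel_measurable_continuous_onI) (intro continuous_intros continuous_on_compose2[OF cF], auto)
    show "integrable lborel (\<lambda>x. indicator K' x *\<^sub>R M)"
      using K' by (intro borel_integrable_compact continuous_on_const)
    show "AE x in lborel. (\<lambda>n. g n x) \<longlonglongrightarrow> ?F' x e"
    proof (rule AE_I2)
      fix x
      have l: "((\<lambda>t. x + t *\<^sub>R e) has_derivative (\<lambda>h. h *\<^sub>R e)) (at 0)" by (auto intro!: derivative_eq_intros)
      have "((\<lambda>t. F (x + t *\<^sub>R e)) has_derivative (\<lambda>h. ?F' x (h *\<^sub>R e))) (at 0)"
        using has_derivative_compose[OF l, of F "?F' x"] F' by simp
      then have "((\<lambda>t. F (x + t *\<^sub>R e)) has_vector_derivative ?F' x e) (at 0)"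
        by (simp add: has_vector_derivative_def linear_scale[OF has_derivative_linear[OF F']])
      then have "((\<lambda>h. norm (F (x + h *\<^sub>R e) - F x - h *\<^sub>R ?F' x e) / norm h) \<longlongrightarrow> 0) (at 0)"
        by (simp add: has_vector_derivative_def has_derivative_iff_norm)
      then have "((\<lambda>h. norm ((F (x + h *\<^sub>R e) - F x) /\<^sub>R h - ?F' x e)) \<longlongrightarrow> 0) (at 0)"
      proof (rule Lim_transform_eventually)
        have "norm (a - h *\<^sub>R b) / norm h = norm (a /\<^sub>R h - b)" if "h \<noteq> 0" for a b :: 'b and h
        proof -
          have "a /\<^sub>R h - b = (a - h *\<^sub>R b) /\<^sub>R h" using that by (simp add: scaleR_diff_right)
          then show ?thesis by (simp add: divide_inverse_commute)
        qed
        then show "\<forall>\<^sub>F h in at 0. norm (F (x + h *\<^sub>R e) - F x - h *\<^sub>R ?F' x e) / norm h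
            = norm ((F (x + h *\<^sub>R e) - F x) /\<^sub>R h - ?F' x e)"
          by (auto simp: eventually_at_filter)
      qed
      then have lim: "((\<lambda>t. (F (x + t *\<^sub>R e) - F x) /\<^sub>R t) \<longlongrightarrow> ?F' x e) (at 0)"
        by (rule LIM_zero_cancel[OF tendsto_norm_zero_cancel])
      have "r \<longlonglongrightarrow> 0"
        using LIMSEQ_inverse_real_of_nat by (simp add: r_def[abs_def] inverse_eq_divide)
      then have "filterlim r (at 0) sequentially"
        unfolding filterlim_at using r(1) by (auto simp: less_imp_neq[THEN not_sym] intro!: always_eventually)
      from filterlim_compose[OF lim this] show "(\<lambda>n. g n x) \<longlonglongrightarrow> ?F' x e" by (simp add: g_def o_def)
    qed
    show "AE x in lborel. norm (g n x) \<le> indicator K' x *\<^sub>R M" for n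
    proof (rule AE_I2)
      fix x
      show "norm (g n x) \<le> indicator K' x *\<^sub>R M"
      proof (cases "x \<in> K'")
        case False
        have "x + t *\<^sub>R e \<notin> K" if "0 \<le> t" "t \<le> 1" for t
        proof
          assume "x + t *\<^sub>R e \<in> K"
          then have "(x + t *\<^sub>R e, t) \<in> K \<times> {0..1}" using that by simp
          then have "(\<lambda>(x, t). x - t *\<^sub>R e) (x + t *\<^sub>R e, t) \<in> K'" unfolding K'_def by (rule imageI)
          then show False using False by simp
        qed
        from this[of 0] this[of "r n"] have "F x = 0" "F (x + r n *\<^sub>R e) = 0" using r[of n] K(2) by auto
        then show ?thesis using False by (simp add: g_def)
      next
        case True
        have "norm ((\<lambda>t. F (x + t *\<^sub>R e)) (r n) - (\<lambda>t. F (x + t *\<^sub>R e)) 0) \<le> M * norm (r n - 0)"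
        proof (rule differentiable_bound[of "{0..r n}"])
          show "((\<lambda>t. F (x + t *\<^sub>R e)) has_derivative (\<lambda>h. h *\<^sub>R ?F' (x + t *\<^sub>R e) e)) (at t within {0..r n})" for t
          proof -
            have l: "((\<lambda>t. x + t *\<^sub>R e) has_derivative (\<lambda>h. h *\<^sub>R e)) (at t within {0..r n})" by (auto intro!: derivative_eq_intros)
            show ?thesis using has_derivative_compose[OF l F'] by (simp add: linear_scale[OF has_derivative_linear[OF F']])
          qed
          show "onorm (\<lambda>h. h *\<^sub>R ?F' (x + t *\<^sub>R e) e) \<le> M" for t
            by (rule onorm_bound) (use M in \<open>auto simp: mult.commute[of M] intro: mult_left_mono\<close>)
        qed (use r[of n] in auto)
        moreover have "norm (g n x) = norm (F (x + r n *\<^sub>R e) - F x) / r n"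
          using r[of n] by (simp add: g_def divide_inverse_commute)
        ultimately show ?thesis using True r[of n] by (simp add: pos_divide_le_eq)
      qed
    qed
  qed
  moreover have "(\<integral>x. g n x \<partial>lborel) = 0" for n
  proof -
    have i: "integrable lborel F" by (rule integrable_continuous_compact[OF cF K])
    have d: "distr lborel borel ((+) (r n *\<^sub>R e)) = (lborel :: 'a measure)" by (rule lborel_distr_plus)
    have i2: "integrable lborel (\<lambda>x. F (r n *\<^sub>R e + x))"
      using i by (subst (asm) d[symmetric]) (subst (asm) integrable_distr_eq, auto intro: borel_measurable_continuous_onI[OF cF])
    have "(\<integral>x. F x \<partial>lborel) = (\<integral>x. F (r n *\<^sub>R e + x) \<partial>lborel)"
      by (subst d[symmetric], subst integral_distr) (auto intro: borel_measurable_continuous_onI[OF cF])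
    then show ?thesis unfolding g_def using i i2 by (simp add: add.commute[of _ "r n *\<^sub>R e"])
  qed
  ultimately show ?thesis by (simp add: LIMSEQ_const_iff)
qed

text \<open>Jacobi's formula at a scalar matrix. A permutation other than the identity moves at
  least two indices, so an off-diagonal zero remains in its product after one factor has been
  differentiated.\<close>

lemma det_has_vector_derivative:
  fixes m :: "'n::finite \<Rightarrow> 'n \<Rightarrow> real \<Rightarrow> 'a::real_normed_field"
  assumes m: "\<And>i j. (m i j has_vector_derivative m' i j) (at t0)"
    and m0: "\<And>i j. m i j t0 = (if i = j then c else 0)"
  shows "((\<lambda>t. det (\<chi> i j. m i j t)) has_vector_derivative c ^ (CARD('n) - 1) * (\<Sum>i\<in>UNIV. m' i i)) (at t0)"
proof -
  have d: "((\<lambda>t. \<Prod>i\<in>UNIV. m i (p i) t) has_vector_derivative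
      (\<Sum>i\<in>UNIV. m' i (p i) * (\<Prod>j\<in>UNIV - {i}. m j (p j) t0))) (at t0)" for p
  proof -
    have "((\<lambda>t. \<Prod>i\<in>UNIV. m i (p i) t) has_derivative
        (\<lambda>y. \<Sum>i\<in>UNIV. (y *\<^sub>R m' i (p i)) * (\<Prod>j\<in>UNIV - {i}. m j (p j) t0))) (at t0)"
      using m by (intro has_derivative_prod) (simp add: has_vector_derivative_def)
    then show ?thesis by (simp add: has_vector_derivative_def scaleR_sum_right)
  qed
  have z: "(\<Sum>i\<in>UNIV. m' i (p i) * (\<Prod>j\<in>UNIV - {i}. m j (p j) t0)) = 0" if p: "p permutes UNIV" "p \<noteq> id" for p
  proof (rule sum.neutral, rule ballI)
    fix i
    obtain a where a: "p a \<noteq> a" using p(2) by (auto simp: fun_eq_iff)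
    moreover have "p (p a) \<noteq> p a" using a permutes_inj[OF p(1)] by (auto dest: injD)
    ultimately obtain j where "j \<noteq> i" "p j \<noteq> j" by metis
    then have "(\<Prod>j\<in>UNIV - {i}. m j (p j) t0) = 0"
      by (intro prod_zero) (auto simp: m0 intro!: bexI[of _ j])
    then show "m' i (p i) * (\<Prod>j\<in>UNIV - {i}. m j (p j) t0) = 0" by simp
  qed
  have "((\<lambda>t. \<Sum>p | p permutes UNIV. of_int (sign p) * (\<Prod>i\<in>UNIV. m i (p i) t)) has_vector_derivative
      (\<Sum>p | p permutes UNIV. of_int (sign p) * (\<Sum>i\<in>UNIV. m' i (p i) * (\<Prod>j\<in>UNIV - {i}. m j (p j) t0)))) (at t0)"
    by (intro has_vector_derivative_sum has_vector_derivative_mult_right d)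
  also have "(\<Sum>p | p permutes UNIV. of_int (sign p) * (\<Sum>i\<in>UNIV. m' i (p i) * (\<Prod>j\<in>UNIV - {i}. m j (p j) t0)))
     = (\<Sum>p\<in>{id}. of_int (sign p) * (\<Sum>i\<in>UNIV. m' i (p i) * (\<Prod>j\<in>UNIV - {i}. m j (p j) t0)))"
    by (rule sum.mono_neutral_right) (auto simp: z permutes_id finite_permutations)
  also have "\<dots> = c ^ (CARD('n) - 1) * (\<Sum>i\<in>UNIV. m' i i)"
    by (simp add: m0 card_Diff_singleton sum_distrib_right mult.commute cong: prod.cong)
  finally show ?thesis by (simp add: det_def)
qed

section \<open>Lebesgue measure and determinants\<close>

text \<open>The change of variables theorem of the library is stated for \<open>real ^ 'm\<close> with a well-ordered index type;
  \<open>'n ridx\<close> indexes the real coordinates of \<open>complex ^ 'n\<close>.\<close>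

typedef ('n::finite) ridx = "UNIV :: ('n \<times> bool) set" by auto

instance ridx :: (finite) finite
proof
  have "range (Abs_ridx :: 'a \<times> bool \<Rightarrow> 'a ridx) = UNIV"
    by (metis Rep_ridx_inverse surjI)
  then show "finite (UNIV :: 'a ridx set)" by (metis finite finite_imageI)
qed

instantiation ridx :: (finite) wellorder
begin

definition less_eq_ridx :: "'a ridx \<Rightarrow> 'a ridx \<Rightarrow> bool" where
  "i \<le> j \<longleftrightarrow> to_nat (Rep_ridx i) \<le> to_nat (Rep_ridx j)"

definition less_ridx :: "'a ridx \<Rightarrow> 'a ridx \<Rightarrow> bool" where
  "i < j \<longleftrightarrow> to_nat (Rep_ridx i) < to_nat (Rep_ridx j)"

instance
proof
  fix P :: "'a ridx \<Rightarrow> bool" and a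
  assume *: "\<And>x. (\<And>y. y < x \<Longrightarrow> P y) \<Longrightarrow> P x"
  show "P a"
    by (rule measure_induct_rule[of "\<lambda>i. to_nat (Rep_ridx i)"]) (rule *, simp only: less_ridx_def)
next
  fix x y :: "'a ridx"
  assume "x \<le> y" "y \<le> x"
  then have "to_nat (Rep_ridx x) = to_nat (Rep_ridx y)" by (simp add: less_eq_ridx_def)
  then show "x = y" by (simp add: Rep_ridx_inject)
qed (simp_all only: less_eq_ridx_def less_ridx_def less_le_not_le nat_le_linear order.refl order.trans)

end

lemma sum_ridx: "(\<Sum>i\<in>UNIV. f (Rep_ridx i)) = (\<Sum>j\<in>UNIV. f (j, False) + f (j, True))" for f :: "'n::finite \<times> bool \<Rightarrow> 'b::comm_monoid_add"
proof -
  have "bij (Rep_ridx :: 'n ridx \<Rightarrow> 'n \<times> bool)"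
    by (metis Abs_ridx_inverse Rep_ridx_inverse UNIV_I bijI' )
  then have "(\<Sum>i\<in>UNIV. f (Rep_ridx i)) = (\<Sum>p\<in>UNIV. f p)"
    by (simp add: sum.reindex_bij_betw)
  also have "\<dots> = (\<Sum>j\<in>UNIV. \<Sum>b\<in>UNIV. f (j, b))"
    by (simp add: sum.cartesian_product flip: UNIV_Times_UNIV)
  finally show ?thesis by (simp add: UNIV_bool add.commute)
qed

definition rcoord :: "'n::finite ridx \<Rightarrow> complex^'n \<Rightarrow> real" where
  "rcoord i v = (case Rep_ridx i of (j, b) \<Rightarrow> if b then Im (v $ j) else Re (v $ j))"

definition rbasis :: "'n::finite ridx \<Rightarrow> complex^'n" where
  "rbasis i = (case Rep_ridx i of (j, b) \<Rightarrow> axis j (if b then \<i> else 1))"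

definition rvec :: "complex^'n::finite \<Rightarrow> real^('n ridx)" where
  "rvec v = (\<chi> i. rcoord i v)"

definition cvec :: "real^('n::finite ridx) \<Rightarrow> complex^'n" where
  "cvec x = (\<chi> j. Complex (x $ Abs_ridx (j, False)) (x $ Abs_ridx (j, True)))"

lemma Rep_Abs_ridx [simp]: "Rep_ridx (Abs_ridx p) = p"
  by (simp add: Abs_ridx_inverse)

lemma cvec_rvec [simp]: "cvec (rvec v) = v"
  by (simp add: cvec_def rvec_def rcoord_def vec_eq_iff)

lemma rvec_cvec [simp]: "rvec (cvec x) = x"
proof -
  have "rvec (cvec x) $ i = x $ i" for i
  proof (cases "Rep_ridx i")
    case (Pair j b)
    then have "i = Abs_ridx (j, b)" by (metis Rep_ridx_inverse)
    then show ?thesis by (simp add: cvec_def rvec_def rcoord_def)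
  qed
  then show ?thesis by (simp add: vec_eq_iff)
qed

lemma linear_rcoord: "linear (rcoord i)"
  by (rule linearI) (auto simp: rcoord_def split: prod.split)

lemma linear_rvec: "linear rvec"
  by (rule linearI) (simp_all add: rvec_def vec_eq_iff linear_add[OF linear_rcoord] linear_scale[OF linear_rcoord])

lemma linear_cvec: "linear cvec"
  by (rule linearI) (simp_all add: cvec_def vec_eq_iff complex_eq_iff)

lemma bounded_linear_rvec: "bounded_linear rvec" and bounded_linear_cvec: "bounded_linear cvec"
  using linear_rvec linear_cvec by (auto intro: linear_conv_bounded_linear[THEN iffD1])

lemma rcoord_expand: "v = (\<Sum>i\<in>UNIV. rcoord i v *\<^sub>R rbasis i)"
proof -
  have "(\<Sum>i\<in>UNIV. rcoord i v *\<^sub>R rbasis i)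
    = (\<Sum>j\<in>UNIV. Re (v $ j) *\<^sub>R axis j 1 + Im (v $ j) *\<^sub>R axis j \<i>)"
    unfolding rcoord_def rbasis_def
    using sum_ridx[of "\<lambda>p. (case p of (j, b) \<Rightarrow> if b then Im (v $ j) else Re (v $ j)) *\<^sub>R (case p of (j, b) \<Rightarrow> axis j (if b then \<i> else 1))"]
    by simp
  also have "\<dots> = v"
    by (auto simp: vec_eq_iff axis_def complex_eq_iff if_distrib if_distribR sum.delta cong: if_cong)
  finally show ?thesis by simp
qed

lemma rcoord_rbasis: "rcoord i (rbasis j) = (if i = j then 1 else 0)"
proof -
  have "i = j \<longleftrightarrow> Rep_ridx i = Rep_ridx j" by (simp add: Rep_ridx_inject)
  then show ?thesis by (auto simp: rcoord_def rbasis_def axis_def split: prod.splits)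
qed

lemma cvec_axis: "cvec (axis i 1) = rbasis i"
proof -
  have "rvec (rbasis i) = axis i 1" by (simp add: rvec_def vec_eq_iff rcoord_rbasis axis_def)
  then show ?thesis by (metis cvec_rvec)
qed

lemma inner_rvec: "rvec v \<bullet> rvec u = v \<bullet> u"
proof -
  have "rvec v \<bullet> rvec u = (\<Sum>i\<in>UNIV. rcoord i v * rcoord i u)" by (simp add: inner_vec_def rvec_def)
  also have "\<dots> = v \<bullet> u"
    unfolding rcoord_def
    using sum_ridx[of "\<lambda>p. (case p of (j, b) \<Rightarrow> if b then Im (v $ j) else Re (v $ j)) * (case p of (j, b) \<Rightarrow> if b then Im (u $ j) else Re (u $ j))"]
    by (simp add: inner_vec_def inner_complex_def)
  finally show ?thesis .
qed

lemma rvec_Basis: "rvec ` Basis = Basis"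
proof -
  have "Basis = range (rbasis :: 'a ridx \<Rightarrow> _)"
  proof -
    have "axis j b \<in> range rbasis" if "b \<in> {1, \<i>}" for j :: 'a and b
      using that by (auto simp: rbasis_def image_iff intro: exI[of _ "Abs_ridx (j, b = \<i>)"])
    then show ?thesis
      by (auto simp: Basis_vec_def Basis_complex_def rbasis_def split: prod.splits)
  qed
  moreover have "rvec (rbasis i) = axis i 1" for i by (metis cvec_axis rvec_cvec)
  ultimately show ?thesis by (auto simp: Basis_vec_def image_image)
qed

text \<open>\<open>rvec\<close> is an isometry that maps the standard basis onto the standard basis,
  so preimages of boxes are boxes with the same side lengths.\<close>

lemma distr_rvec: "distr lborel borel rvec = (lborel :: (real^('n::finite ridx)) measure)"
proof (rule lborel_eqI[symmetric])
  fix l u :: "real^('n ridx)" assume le: "\<And>b. b \<in> Basis \<Longrightarrow> l \<bullet> b \<le> u \<bullet> b"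
  have "continuous_on UNIV (rvec :: complex^'n \<Rightarrow> _)"
    by (rule linear_continuous_on) (rule bounded_linear_rvec)
  then have m: "(rvec :: complex^'n \<Rightarrow> _) \<in> borel_measurable lborel"
    by (simp add: borel_measurable_continuous_onI)
  have i: "x \<bullet> rvec b = cvec x \<bullet> b" for x b using inner_rvec[of "cvec x" b] by simp
  have "rvec -` box l u = box (cvec l) (cvec u)"
    unfolding box_def rvec_Basis[symmetric] by (auto simp: inner_rvec i)
  then have "emeasure (distr lborel borel rvec) (box l u) = emeasure lborel (box (cvec l) (cvec u))"
    by (subst emeasure_distr[OF m]) simp_all
  also have "\<dots> = ennreal (\<Prod>b\<in>Basis. (cvec u - cvec l) \<bullet> b)"
  proof (rule emeasure_lborel_box)
    fix b :: "complex^'n" assume "b \<in> Basis"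
    then have "rvec b \<in> Basis" using rvec_Basis by blast
    from le[OF this] show "cvec l \<bullet> b \<le> cvec u \<bullet> b" by (simp add: i)
  qed
  also have "(\<Prod>b\<in>Basis. (cvec u - cvec l) \<bullet> b) = (\<Prod>b\<in>rvec ` Basis. (u - l) \<bullet> b)"
    by (subst prod.reindex) (auto simp: i linear_diff[OF linear_cvec] intro: inj_on_inverseI[of _ cvec])
  finally show "emeasure (distr lborel borel rvec) (box l u) = ennreal (\<Prod>b\<in>Basis. (u - l) \<bullet> b)"
    by (simp add: rvec_Basis)
qed simp

section \<open>The real determinant of a complex matrix\<close>

definition realify :: "complex^'n::finite^'n \<Rightarrow> real^('n ridx)^('n ridx)" where
  "realify A = matrix (\<lambda>x. rvec (A *v cvec x))"

lemma linear_cmatrix: "linear (\<lambda>v. (A::complex^'n::finite^'n) *v v)"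
  by (rule linearI) (simp_all add: matrix_vector_mult_def vec_eq_iff scaleR_sum_right algebra_simps sum.distrib)

lemma realify_nth: "realify A $ i $ j = rcoord i (A *v rbasis j)"
  by (simp add: realify_def matrix_def cvec_axis rvec_def)

lemma realify_mult: "realify (A ** B) = realify A ** realify B"
proof -
  have l: "linear (\<lambda>x. rvec (A *v cvec x))" for A :: "complex^'n^'n"
    using linear_compose[OF linear_compose[OF linear_cvec linear_cmatrix] linear_rvec] by (simp add: o_def)
  have "(\<lambda>x. rvec ((A ** B) *v cvec x)) = (\<lambda>x. rvec (A *v cvec x)) \<circ> (\<lambda>x. rvec (B *v cvec x))"
    by (auto simp: matrix_vector_mul_assoc)
  then show ?thesis unfolding realify_def by (simp only: matrix_compose[OF l l])
qed

lemma rcoord_mult_rbasis: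
  "rcoord i (A *v rbasis j) = (let z = A $ fst (Rep_ridx i) $ fst (Rep_ridx j) * (if snd (Rep_ridx j) then \<i> else 1)
    in if snd (Rep_ridx i) then Im z else Re z)"
proof -
  have "(A *v axis l c) $ k = A $ k $ l * c" for k l and c :: complex
    by (simp add: matrix_vector_mult_def axis_def if_distrib cong: if_cong)
  then show ?thesis by (auto simp: rcoord_def rbasis_def Let_def split: prod.splits)
qed

lemma trace_realify: "(\<Sum>i\<in>UNIV. realify A $ i $ i) = 2 * Re (\<Sum>i\<in>UNIV. A $ i $ i)"
  unfolding realify_nth rcoord_mult_rbasis
  using sum_ridx[of "\<lambda>p. let z = A $ fst p $ fst p * (if snd p then \<i> else 1) in if snd p then Im z else Re z"]
  by (simp add: Let_def sum_distrib_left flip: sum.distrib)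

lemma realify_mat_1: "realify (mat 1) = mat 1"
  by (simp add: vec_eq_iff realify_nth rcoord_rbasis) (simp add: mat_def)

lemma has_vector_derivative_realify_nth:
  assumes "\<And>i j. ((\<lambda>t. M t $ i $ j) has_vector_derivative M' $ i $ j) (at t0)"
  shows "((\<lambda>t. realify (M t) $ i $ j) has_vector_derivative realify M' $ i $ j) (at t0)"
proof -
  let ?c = "if snd (Rep_ridx j) then \<i> else 1"
  have "bounded_linear (\<lambda>z. Im (z * ?c))" "bounded_linear (\<lambda>z. Re (z * ?c))"
    by (rule bounded_linear_compose[OF bounded_linear_Im bounded_linear_mult_left],
        rule bounded_linear_compose[OF bounded_linear_Re bounded_linear_mult_left])
  from this[THEN bounded_linear.has_vector_derivative, OF assms]
  show ?thesis unfolding realify_nth rcoord_mult_rbasis Let_def by simp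
qed

text \<open>Multiplying by the inverse N of C t0 moves the path to the identity, where Jacobi's
  formula applies. T is the trace of N C', and passing to real coordinates turns a trace into twice
  its real part.\<close>

lemma det_path_derivative:
  fixes C :: "real \<Rightarrow> complex^'n::finite^'n"
  assumes C: "\<And>i j. ((\<lambda>t. C t $ i $ j) has_vector_derivative C' $ i $ j) (at t0)" and inv: "invertible (C t0)"
  obtains T where "((\<lambda>t. det (C t)) has_vector_derivative det (C t0) * T) (at t0)"
    "((\<lambda>t. det (realify (C t))) has_vector_derivative det (realify (C t0)) * (2 * Re T)) (at t0)"
proof -
  obtain N where N: "C t0 ** N = mat 1" "N ** C t0 = mat 1" using inv by (auto simp: invertible_def)
  have NC: "C t = C t0 ** (N ** C t)" for t by (simp add: matrix_mul_assoc N)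
  have M: "((\<lambda>t. (N ** C t) $ i $ j) has_vector_derivative (N ** C') $ i $ j) (at t0)" for i j
    unfolding matrix_matrix_mult_def by (simp, intro has_vector_derivative_sum has_vector_derivative_mult_right C)
  define T where "T = (\<Sum>i\<in>UNIV. (N ** C') $ i $ i)"
  have "((\<lambda>t. det (\<chi> i j. (N ** C t) $ i $ j)) has_vector_derivative 1 ^ (CARD('n) - 1) * T) (at t0)"
    unfolding T_def by (rule det_has_vector_derivative[OF M]) (simp add: N mat_def)
  then have "((\<lambda>t. det (C t0) * det (N ** C t)) has_vector_derivative det (C t0) * T) (at t0)"
    by (intro has_vector_derivative_mult_right) (simp add: vec_lambda_eta)
  then have 1: "((\<lambda>t. det (C t)) has_vector_derivative det (C t0) * T) (at t0)"
    by (simp add: NC[symmetric] det_mul[symmetric])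
  have "((\<lambda>t. det (\<chi> i j. realify (N ** C t) $ i $ j)) has_vector_derivative
      1 ^ (CARD('n ridx) - 1) * (\<Sum>i\<in>UNIV. realify (N ** C') $ i $ i)) (at t0)"
    by (rule det_has_vector_derivative[OF has_vector_derivative_realify_nth[OF M]])
      (simp add: N realify_mat_1, simp add: mat_def)
  then have "((\<lambda>t. det (realify (C t0)) * det (realify (N ** C t))) has_vector_derivative det (realify (C t0)) * (2 * Re T)) (at t0)"
    by (intro has_vector_derivative_mult_right) (simp add: trace_realify vec_lambda_eta T_def)
  then have 2: "((\<lambda>t. det (realify (C t))) has_vector_derivative det (realify (C t0)) * (2 * Re T)) (at t0)"
    by (simp add: NC[symmetric] det_mul[symmetric] realify_mult[symmetric])
  show thesis by (rule that[OF 1 2])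
qed

text \<open>Both sides are 1 at the identity and have the same logarithmic derivative along a path
  of invertible matrices, so their ratio is constant along a path from the identity to A.\<close>

lemma det_realify:
  fixes A :: "complex^'n::finite^'n"
  assumes "invertible A"
  shows "det (realify A) = (cmod (det A))\<^sup>2"
proof -
  define X where "X = A - mat 1"
  define P where "P c = (mat 1 + (\<chi> i j. c * X $ i $ j) :: complex^'n^'n)" for c
  \<comment> \<open>The determinant on the complex line through the identity and A, as a polynomial
    in the complex parameter. It does not vanish at 0, so it has finitely many roots.\<close>
  define q :: "complex poly" where "q = (\<Sum>p | p permutes (UNIV :: 'n set). of_int (sign p) *
      (\<Prod>i\<in>UNIV. [: (mat 1 :: complex^'n^'n) $ i $ p i, X $ i $ p i :]))"
  have q: "poly q c = det (P c)" for c
    unfolding q_def P_def det_def by (simp add: poly_sum poly_prod of_int_poly)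
  have P01: "P 0 = mat 1" "P 1 = A" by (simp_all add: P_def X_def vec_eq_iff)
  then have "q \<noteq> 0" using q[of 0] by auto
  then have "finite {c. poly q c = 0}" by (rule poly_roots_finite)
  \<comment> \<open>The arc s + \<i> y s (1 - s) from 0 to 1 passes through a root c with 0 < Re c <
    1 only if y is this quotient; hence some y avoids all roots.\<close>
  then have "finite ((\<lambda>c. Im c / (Re c * (1 - Re c))) ` {c. poly q c = 0})" by simp
  then obtain y where y: "y \<notin> (\<lambda>c. Im c / (Re c * (1 - Re c))) ` {c. poly q c = 0}"
    using ex_new_if_finite[OF infinite_UNIV_char_0] by blast
  define \<tau> where "\<tau> s = Complex s (y * (s * (1 - s)))" for s
  have inv: "invertible (P (\<tau> s))" if "0 \<le> s" "s \<le> 1" for s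
  proof -
    have "det (P (\<tau> s)) \<noteq> 0"
    proof
      assume "det (P (\<tau> s)) = 0"
      then have r: "poly q (\<tau> s) = 0" by (simp add: q)
      have "s = 0 \<or> s = 1 \<or> (0 < s \<and> s < 1)" using that by auto
      then consider "s = 0" | "s = 1" | "0 < s" "s < 1" by blast
      then show False
      proof cases
        case 1
        then have "\<tau> s = 0" by (simp add: \<tau>_def complex_eq_iff)
        then show False using r by (simp add: q P01)
      next
        case 2
        then have "\<tau> s = 1" by (simp add: \<tau>_def complex_eq_iff)
        then show False using r assms by (simp add: q P01 invertible_det_nz)
      next
        case 3
        then have "y = Im (\<tau> s) / (Re (\<tau> s) * (1 - Re (\<tau> s)))" by (simp add: \<tau>_def)
        then show False using r y by blast
      qed
    qed
    then show ?thesis by (simp add: invertible_det_nz)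
  qed
  define C where "C s = P (\<tau> s)" for s
  define f where "f s = det (realify (C s))" for s
  define g where "g s = (cmod (det (C s)))\<^sup>2" for s
  have C: "\<exists>C'. \<forall>i j. ((\<lambda>t. C t $ i $ j) has_vector_derivative C' $ i $ j) (at s)" for s
  proof -
    have "(\<tau> has_vector_derivative Complex 1 (y * (1 - 2 * s))) (at s)"
      unfolding \<tau>_def has_vector_derivative_complex_iff
      by (auto intro!: derivative_eq_intros simp flip: has_real_derivative_iff_has_vector_derivative)
    then show ?thesis
      unfolding C_def P_def
      by (intro exI[of _ "\<chi> i j. Complex 1 (y * (1 - 2 * s)) * X $ i $ j"] allI)
        (auto intro!: derivative_eq_intros)
  qed
  have "((\<lambda>s. f s / g s) has_real_derivative 0) (at s)" if s: "0 \<le> s" "s \<le> 1" for s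
  proof -
    obtain C' where "\<And>i j. ((\<lambda>t. C t $ i $ j) has_vector_derivative C' $ i $ j) (at s)" using C by blast
    then obtain T where T: "((\<lambda>t. det (C t)) has_vector_derivative det (C s) * T) (at s)"
      "((\<lambda>t. det (realify (C t))) has_vector_derivative det (realify (C s)) * (2 * Re T)) (at s)"
      using det_path_derivative[of C C' s] inv[OF s] unfolding C_def by metis
    have nz: "det (C s) \<noteq> 0" using inv[OF s] by (simp add: C_def invertible_det_nz)
    have f: "(f has_real_derivative f s * (2 * Re T)) (at s)"
      using T(2) by (simp add: f_def[abs_def] has_real_derivative_iff_has_vector_derivative)
    have 1: "((\<lambda>t. Re (det (C t))) has_real_derivative Re (det (C s) * T)) (at s)"
      and 2: "((\<lambda>t. Im (det (C t))) has_real_derivative Im (det (C s) * T)) (at s)"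
      using T(1) by (simp_all add: has_vector_derivative_complex_iff)
    have g: "(g has_real_derivative g s * (2 * Re T)) (at s)"
      unfolding g_def[abs_def] cmod_power2
      by (rule DERIV_cong[OF DERIV_add[OF DERIV_power[OF 1] DERIV_power[OF 2]]])
        (simp add: power2_eq_square algebra_simps)
    have "g s \<noteq> 0" using nz by (simp add: g_def)
    then show ?thesis using f g by (auto intro!: derivative_eq_intros)
  qed
  then have "f 1 / g 1 = f 0 / g 0"
    by (intro DERIV_isconst2[of 0 1 "\<lambda>s. f s / g s" 1])
      (auto intro!: DERIV_isCont continuous_at_imp_continuous_on)
  moreover have "\<tau> 0 = 0" "\<tau> 1 = 1" by (simp_all add: \<tau>_def complex_eq_iff)
  ultimately show ?thesis
    using assms by (simp add: f_def g_def C_def P01 realify_mat_1 invertible_det_nz)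
qed

section \<open>Pullback along linear maps, and unitary bases\<close>

definition pb :: "(complex^'n \<Rightarrow> complex^'n) \<Rightarrow> 'n::finite fibre \<Rightarrow> 'n fibre" where
  "pb L \<alpha> vs = \<alpha> (map L vs)"

lemma ins_pb: "ins v (pb L \<alpha>) = pb L (ins (L v) \<alpha>)"
  by (rule ext) (simp add: ins_app pb_def)

lemma alternating_pb:
  assumes "linear L" "alternating \<alpha>" shows "alternating (pb L \<alpha>)"
  unfolding alternating_def
proof (intro conjI allI)
  fix xs ys
  show "linear (\<lambda>v. pb L \<alpha> (xs @ [v] @ ys))"
    using linear_compose[OF assms(1) alternating_linear_at[OF assms(2), of "map L xs" "map L ys"]]
    by (simp add: pb_def o_def)
next
  fix xs ys zs v
  show "pb L \<alpha> (xs @ [v] @ ys @ [v] @ zs) = 0"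
    using alternating_repeat[OF assms(2), of "map L xs" "L v" "map L ys" "map L zs"] by (simp add: pb_def)
qed

lemma homog_pb: "homog k \<alpha> \<Longrightarrow> homog k (pb L \<alpha>)"
  by (simp add: homog_def pb_def)

lemma pb_fwedge: "pb L (fwedge \<alpha> \<beta>) = fwedge (pb L \<alpha>) (pb L \<beta>)"
  by (rule ext) (simp add: pb_def fwedge_def nths_map)

lemma pb_tw:
  assumes "\<And>v. L (J v) = J (L v)" shows "pb L (tw s t \<alpha>) = tw s t (pb L \<alpha>)"
proof
  fix vs show "pb L (tw s t \<alpha>) vs = tw s t (pb L \<alpha>) vs"
  proof (induction vs arbitrary: \<alpha>)
    case (Cons v vs)
    have "pb L (tw_ins s t (L v) \<alpha>) = tw_ins s t v (pb L \<alpha>)"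
      by (rule ext) (simp add: pb_def tw_ins_def assms)
    moreover have "pb L (tw s t \<alpha>) (v # vs) = pb L (tw s t (tw_ins s t (L v) \<alpha>)) vs" by (simp add: pb_def)
    ultimately show ?case by (simp only: Cons tw.simps)
  qed (simp add: pb_def)
qed

lemma pb_adjw:
  assumes "inj_on L B"
  shows "pb L (adjw (L ` B) k \<xi> v) = adjw B k (pb L \<xi>) (pb L v)"
proof
  fix vs show "pb L (adjw (L ` B) k \<xi> v) vs = adjw B k (pb L \<xi>) (pb L v) vs"
  proof (induction k arbitrary: \<xi> v)
    case 0 then show ?case by (simp add: pb_def adjw.simps)
  next
    case (Suc k)
    have "pb L (adjw (L ` B) (Suc k) \<xi> v) vs
      = (\<Sum>b\<in>B. pb L (adjw (L ` B) k (ins (L b) \<xi>) (ins (L b) v)) vs) / of_nat (Suc k)"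
      by (simp add: pb_def adjw.simps sum.reindex[OF assms])
    also have "\<dots> = adjw B (Suc k) (pb L \<xi>) (pb L v) vs"
      by (simp only: Suc.IH adjw.simps ins_pb)
    finally show ?case .
  qed
qed

lemma finn_pb: "inj_on L B \<Longrightarrow> finn (L ` B) \<alpha> \<beta> = finn B (pb L \<alpha>) (pb L \<beta>)"
  by (simp add: finn_def pb_adjw[symmetric]) (simp add: pb_def)

lemma gm_pb: "(\<And>v. L (J v) = J (L v)) \<Longrightarrow> gm (pb L w) v u = gm w (L v) (L u)"
  by (simp add: gm_def pb_def)

lemma herm_pb:
  assumes "linear L" "inj L" "\<And>v. L (J v) = J (L v)" "herm w" shows "herm (pb L w)"
proof -
  have "L v \<noteq> 0" if "v \<noteq> 0" for v
    using that assms(1,2) linear_injective_0 by blast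
  then show ?thesis
    using assms unfolding herm_def by (auto intro: alternating_pb homog_pb) (simp_all add: pb_def)
qed

lemma onb_pb:
  assumes "inj L" "\<And>v. L (J v) = J (L v)" "onb (pb L w) B" shows "onb w (L ` B)"
  using assms unfolding onb_def by (auto simp: gm_pb card_image[OF inj_on_subset[OF assms(1)]] inj_eq)

context hermitian
begin

text \<open>The adjoint is an iterated trace, and each trace is independent of the orthonormal
  basis. It compares bases chosen at a point with bases chosen in a chart.\<close>

lemma adjw_indep:
  assumes "onb w C" "alternating \<xi>" "alternating v"
  shows "adjw C k \<xi> v vs = adjw B k \<xi> v vs"
  using assms(2,3)
proof (induction k arbitrary: \<xi> v)
  case 0 then show ?case by (simp add: adjw.simps)
next
  case (Suc k)
  have "(\<Sum>b\<in>C. adjw B k (ins b \<xi>) (ins b v) vs) = (\<Sum>b\<in>B. adjw B k (ins b \<xi>) (ins b v) vs)"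
    by (rule trace_indep[where F = "\<lambda>b c. adjw B k (ins b \<xi>) (ins c v) vs", OF adjw_left_ins_linear adjw_ins_linear assms(1)])
      (use Suc.prems in auto)
  moreover have "(\<Sum>b\<in>C. adjw C k (ins b \<xi>) (ins b v) vs) = (\<Sum>b\<in>C. adjw B k (ins b \<xi>) (ins b v) vs)"
    using Suc by (intro sum.cong refl Suc.IH alternating_ins)
  ultimately show ?case by (simp add: adjw.simps)
qed

lemma finn_indep: "onb w C \<Longrightarrow> alternating \<alpha> \<Longrightarrow> alternating \<beta> \<Longrightarrow> finn C \<alpha> \<beta> = finn B \<alpha> \<beta>"
  by (simp add: finn_def adjw_indep)

end

text \<open>Gram-Schmidt over the complex numbers carried out with the real metric: a new vector is
  made orthogonal to every previous a and also to \<open>J a\<close>.\<close>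

lemma unitary_basis:
  fixes w :: "'n::finite fibre"
  assumes "herm w"
  obtains f :: "'n \<Rightarrow> complex^'n"
  where "\<And>i j. gm w (f i) (f j) = (if i = j then 1 else 0)" "\<And>i j. gm w (f i) (J (f j)) = 0"
proof -
  have alt: "alternating w" and wJ: "\<And>v u. w [J v, J u] = w [v, u]" and pos: "\<And>v. v \<noteq> 0 \<Longrightarrow> gm w v v > 0"
    using assms by (auto simp: herm_def gm_def)
  have J_left: "w [J v, u] = - w [v, J u]" for v u
    by (rule invariant_two_form_J_left[OF herm_invariant[OF assms]])
  have sym: "gm w v u = gm w u v" for v u
    unfolding gm_def using J_left[of u v] alternating_swap[OF alt, of v "J u" "[]"] by simp
  have l: "linear (\<lambda>v. gm w v u)" for u
    by (rule linearI) (simp_all add: gm_def alternating_head_add[OF alt] alternating_head_scaleR[OF alt])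
  have lr: "linear (gm w v)" for v
  proof -
    have "gm w v = (\<lambda>u. gm w u v)" by (rule ext) (rule sym)
    then show ?thesis using l by simp
  qed
  have gJJ: "gm w (J v) (J u) = gm w v u" for v u
    unfolding gm_def by (simp only: wJ)
  have gJ: "gm w (J v) u = - gm w v (J u)" for v u
    using gJJ[of v "J u"] linear_neg[OF lr, of "J v" u] by simp
  have gself: "gm w v (J v) = 0" for v
    using gJ[of v v] sym[of "J v" v] by simp
  have "\<exists>F. card F = k \<and> finite F \<and> (\<forall>a\<in>F. \<forall>b\<in>F. gm w a b = (if a = b then 1 else 0) \<and> gm w a (J b) = 0)" if "k \<le> CARD('n)" for k
    using that
  proof (induction k)
    case 0 then show ?case by (intro exI[of _ "{}"]) auto
  next
    case (Suc k)
    then obtain F where F: "card F = k" "finite F"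
      and on: "\<And>a b. a \<in> F \<Longrightarrow> b \<in> F \<Longrightarrow> gm w a b = (if a = b then 1 else 0)" "\<And>a b. a \<in> F \<Longrightarrow> b \<in> F \<Longrightarrow> gm w a (J b) = 0"
      by auto
    have "vec.span F \<noteq> UNIV"
    proof
      assume "vec.span F = UNIV"
      then have "vec.dim (UNIV :: (complex^'n) set) \<le> card F"
        using vec.dim_le_card[of UNIV F] F by auto
      then show False using F(1) Suc.prems unfolding vec_dim_card by linarith
    qed
    then obtain v where v: "v \<notin> vec.span F" by auto
    \<comment> \<open>The complex orthogonal projection of v to the span of F. It lies in the
      complex span, so v - p is nonzero and can be normalized.\<close>
    define p where "p = (\<Sum>a\<in>F. gm w a v *\<^sub>R a + gm w (J a) v *\<^sub>R J a)"
    have "p = (\<Sum>a\<in>F. (of_real (gm w a v) + \<i> * of_real (gm w (J a) v)) *s a)"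
      unfolding p_def by (intro sum.cong refl) (simp add: vec_eq_iff complex_eq_iff algebra_simps)
    then have "p \<in> vec.span F" by (simp only:) (intro vec.span_sum vec.span_scale vec.span_base)
    then have ne: "v - p \<noteq> 0" using v by auto
    have gp: "gm w b p = gm w b v" "gm w (J b) p = gm w (J b) v" if "b \<in> F" for b
    proof -
      have "gm w b p = (\<Sum>a\<in>F. gm w a v * gm w b a + gm w (J a) v * gm w b (J a))"
        unfolding p_def by (simp add: linear_sum[OF lr] linear_add[OF lr] linear_scale[OF lr])
      also have "\<dots> = (\<Sum>a\<in>F. if b = a then gm w a v else 0)"
        by (intro sum.cong refl) (simp add: on that)
      finally show "gm w b p = gm w b v" using that F(2) by simp
      have "gm w (J b) p = (\<Sum>a\<in>F. gm w a v * gm w (J b) a + gm w (J a) v * gm w (J b) (J a))"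
        unfolding p_def by (simp add: linear_sum[OF lr] linear_add[OF lr] linear_scale[OF lr])
      also have "\<dots> = (\<Sum>a\<in>F. if b = a then gm w (J a) v else 0)"
        by (intro sum.cong refl) (simp add: on that gJJ gJ[of b])
      finally show "gm w (J b) p = gm w (J b) v" using that F(2) by simp
    qed
    define r where "r = 1 / sqrt (gm w (v - p) (v - p))"
    define x where "x = r *\<^sub>R (v - p)"
    have r: "r > 0" "r * r * gm w (v - p) (v - p) = 1"
      using pos[OF ne] by (auto simp: r_def field_simps)
    have x1: "gm w x x = 1"
      unfolding x_def using r by (simp add: linear_scale[OF l] linear_scale[OF lr] mult.assoc)
    have x2: "gm w b x = 0" "gm w (J b) x = 0" if "b \<in> F" for b
      unfolding x_def by (simp_all add: linear_scale[OF lr] linear_diff[OF lr] gp that)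
    then have x3: "gm w x b = 0" "gm w x (J b) = 0" "gm w b (J x) = 0" if "b \<in> F" for b
      using that sym[of x b] sym[of x "J b"] gJ[of b x] by simp_all
    have "x \<notin> F" using x1 x2(1)[of x] by auto
    then have "card (insert x F) = Suc k" using F by simp
    moreover have "\<forall>a\<in>insert x F. \<forall>b\<in>insert x F. gm w a b = (if a = b then 1 else 0) \<and> gm w a (J b) = 0"
      using on x1 x2 x3 gself \<open>x \<notin> F\<close> by auto
    ultimately show ?case using F(2) by (intro exI[of _ "insert x F"]) auto
  qed
  from this[of "CARD('n)"] obtain F where F: "card F = CARD('n)" "finite F"
    "\<And>a b. a \<in> F \<Longrightarrow> b \<in> F \<Longrightarrow> gm w a b = (if a = b then 1 else 0) \<and> gm w a (J b) = 0" by auto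
  obtain f where f: "bij_betw f (UNIV :: 'n set) F"
    using finite_same_card_bij[of "UNIV :: 'n set" F] F by auto
  show thesis
  proof (rule that[of f])
    show "gm w (f i) (f j) = (if i = j then 1 else 0)" for i j
      using F(3)[of "f i" "f j"] f by (auto simp: bij_betw_def inj_eq)
    show "gm w (f i) (J (f j)) = 0" for i j
      using F(3)[of "f i" "f j"] f by (auto simp: bij_betw_def)
  qed
qed

lemma onb_unitary_basis:
  fixes w :: "'n::finite fibre"
    and f :: "'n \<Rightarrow> complex^'n"
  assumes "herm w" and f: "\<And>i j. gm w (f i) (f j) = (if i = j then 1 else 0)" "\<And>i j. gm w (f i) (J (f j)) = 0"
  shows "onb w (range f \<union> J ` range f)" "inj f" "inj_on J (range f)" "range f \<inter> J ` range f = {}"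
proof -
  have wJ: "\<And>v u. w [J v, J u] = w [v, u]" using assms by (auto simp: herm_def)
  have gJJ: "gm w (J v) (J u) = gm w v u" for v u unfolding gm_def by (simp only: wJ)
  have gJ: "gm w (J v) u = - gm w v (J u)" for v u
    using invariant_two_form_J_left[OF herm_invariant[OF assms(1)], of v "J u"] by (simp add: gm_def)
  show inj: "inj f" by (rule injI) (metis f(1) zero_neq_one)
  show injJ: "inj_on J (range f)" by (rule inj_onI) (simp add: vec_eq_iff)
  show dis: "range f \<inter> J ` range f = {}"
  proof -
    have "f i \<noteq> J (f j)" for i j
      using f(1)[of i i] f(2)[of i j] by auto
    then show ?thesis by auto
  qed
  have "card (range f \<union> J ` range f) = 2 * CARD('n)"
    by (subst card_Un_disjoint) (auto simp: dis card_image[OF injJ] card_image[OF inj])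
  moreover have "gm w (J (f i)) (f j) = 0" for i j by (simp add: gJ f)
  moreover have "f i \<noteq> J (f j)" "J (f j) \<noteq> f i" for i j using dis by auto
  moreover have "J (f i) = J (f j) \<longleftrightarrow> i = j" "f i = f j \<longleftrightarrow> i = j" for i j
    using injJ inj by (auto simp: inj_on_eq_iff inj_eq)
  ultimately show "onb w (range f \<union> J ` range f)"
    unfolding onb_def by (auto simp: f gJJ)
qed

lemma onb_exists: "herm w \<Longrightarrow> \<exists>B. onb w B"
  using unitary_basis onb_unitary_basis(1) by metis

text \<open>The sesquilinear form behind \<open>hermitian_matrix\<close>. It is defined for every
  two-form, since derivatives of the metric, which are not positive, are inserted later.\<close>

definition hform :: "'n::finite fibre \<Rightarrow> complex^'n \<Rightarrow> complex^'n \<Rightarrow> complex" where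
  "hform \<sigma> v u = (\<sigma> [v, J u] - \<i> * \<sigma> [v, u]) / 2"

definition hmat :: "'n::finite fibre \<Rightarrow> complex^'n^'n" where
  "hmat \<sigma> = (\<chi> j k. hform \<sigma> (axis j 1) (axis k 1))"

lemma hform_sesquilinear:
  assumes \<sigma>: "invariant_two_form \<sigma>"
  shows "hform \<sigma> (\<Sum>j\<in>I. c j *s v j) u = (\<Sum>j\<in>I. c j * hform \<sigma> (v j) u)"
    and "hform \<sigma> u (\<Sum>j\<in>I. c j *s v j) = (\<Sum>j\<in>I. cnj (c j) * hform \<sigma> u (v j))"
proof -
  have alt: "alternating \<sigma>" using \<sigma> by (simp add: invariant_two_form_def)
  have l1: "linear (\<lambda>v. hform \<sigma> v u)" for u
    unfolding hform_def using linear_two_left[OF alt] by (auto simp: linear_iff algebra_simps add_divide_distrib diff_divide_distrib scaleR_conv_of_real[where 'a=complex])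
  have l2: "linear (\<lambda>v. hform \<sigma> u v)" for u
    unfolding hform_def J_add J_scaleR using linear_two_right[OF alt]
    by (auto simp: linear_iff J_add J_scaleR algebra_simps add_divide_distrib diff_divide_distrib scaleR_conv_of_real[where 'a=complex])
  have J1: "hform \<sigma> (J v) u = \<i> * hform \<sigma> v u" for v u
    using \<sigma> by (simp add: hform_def invariant_two_form_J_left[OF \<sigma>] invariant_two_form_def field_simps)
  have J2: "hform \<sigma> u (J v) = - \<i> * hform \<sigma> u v" for v u
    using linear_neg[OF linear_two_right[OF alt], of u v] by (simp add: hform_def field_simps)
  have e: "c *s v = Re c *\<^sub>R v + Im c *\<^sub>R J v" for c and v :: "complex^'a"
    by (simp add: vec_eq_iff complex_eq_iff)
  have "hform \<sigma> (c *s v) u = c * hform \<sigma> v u" for c v u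
    unfolding e[of c v] linear_add[OF l1] linear_scale[OF l1] J1 by (simp add: scaleR_conv_of_real complex_eq_iff algebra_simps)
  then show "hform \<sigma> (\<Sum>j\<in>I. c j *s v j) u = (\<Sum>j\<in>I. c j * hform \<sigma> (v j) u)"
    by (simp add: linear_sum[OF l1])
  have "hform \<sigma> u (c *s v) = cnj c * hform \<sigma> u v" for c v u
    unfolding e[of c v] linear_add[OF l2] linear_scale[OF l2] J2 by (simp add: scaleR_conv_of_real complex_eq_iff algebra_simps)
  then show "hform \<sigma> u (\<Sum>j\<in>I. c j *s v j) = (\<Sum>j\<in>I. cnj (c j) * hform \<sigma> u (v j))"
    by (simp add: linear_sum[OF l2])
qed

text \<open>Changing the basis by P turns the matrix H of a sesquilinear form into the product of P
  transposed, H and P conjugated.\<close>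

lemma det_hform:
  fixes \<sigma> :: "'n::finite fibre" and f :: "'n \<Rightarrow> complex^'n"
  assumes \<sigma>: "invariant_two_form \<sigma>"
  shows "det (\<chi> a b. hform \<sigma> (f a) (f b)) = of_real ((cmod (det (\<chi> k j. f j $ k)))\<^sup>2) * det (hmat \<sigma>)"
proof -
  define P where "P = (\<chi> k j. f j $ k)"
  have ex: "v = (\<Sum>k\<in>UNIV. v $ k *s axis k 1)" for v :: "complex^'n"
    by (simp add: vec_eq_iff axis_def if_distrib cong: if_cong)
  have "hform \<sigma> (f a) (f b) = (transpose P ** hmat \<sigma> ** (\<chi> k j. cnj (P $ k $ j))) $ a $ b" for a b
  proof -
    have "hform \<sigma> (f a) (f b) = hform \<sigma> (\<Sum>k\<in>UNIV. f a $ k *s axis k 1) (\<Sum>l\<in>UNIV. f b $ l *s axis l 1)"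
      using ex by metis
    also have "\<dots> = (\<Sum>k\<in>UNIV. f a $ k * (\<Sum>l\<in>UNIV. cnj (f b $ l) * hform \<sigma> (axis k 1) (axis l 1)))"
      by (simp only: hform_sesquilinear(1)[OF \<sigma>], simp only: hform_sesquilinear(2)[OF \<sigma>])
    also have "\<dots> = (\<Sum>k\<in>UNIV. \<Sum>l\<in>UNIV. f a $ k * hform \<sigma> (axis k 1) (axis l 1) * cnj (f b $ l))"
      by (simp add: sum_distrib_left ac_simps)
    also have "\<dots> = (\<Sum>l\<in>UNIV. \<Sum>k\<in>UNIV. f a $ k * hform \<sigma> (axis k 1) (axis l 1) * cnj (f b $ l))"
      by (rule sum.swap)
    finally show ?thesis
      by (simp add: matrix_matrix_mult_def transpose_def P_def hmat_def sum_distrib_right)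
  qed
  then have "(\<chi> a b. hform \<sigma> (f a) (f b)) = transpose P ** hmat \<sigma> ** (\<chi> k j. cnj (P $ k $ j))"
    by (simp add: vec_eq_iff)
  moreover have "det (\<chi> k j. cnj (P $ k $ j)) = cnj (det P)"
    by (simp add: det_def)
  ultimately have "det (\<chi> a b. hform \<sigma> (f a) (f b)) = (det P * cnj (det P)) * det (hmat \<sigma>)"
    by (simp add: det_mul det_transpose)
  then show ?thesis by (simp only: P_def complex_norm_square)
qed

text \<open>In a unitary basis the matrix is half the identity, and a change of basis multiplies the
  determinant by a positive real number.\<close>

lemma det_hmat_pos:
  fixes w :: "'n::finite fibre"
  assumes "herm w" shows "Im (det (hmat w)) = 0" "Re (det (hmat w)) > 0"
proof -
  obtain f :: "'n \<Rightarrow> complex^'n" where f: "\<And>i j. gm w (f i) (f j) = (if i = j then 1 else 0)" "\<And>i j. gm w (f i) (J (f j)) = 0"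
    using unitary_basis[OF assms] by metis
  obtain B where "onb w B" using onb_exists[OF assms] by blast
  then interpret hermitian w B using assms by unfold_locales
  have h: "hform w (f i) (f j) = (if i = j then 1/2 else 0)" for i j
  proof -
    have 1: "gm w (J (f i)) (J (f j)) = (if i = j then 1 else 0)" by (simp add: gm_J_J f)
    have 2: "gm w (J (f i)) (f j) = 0" by (simp add: gm_J_left f)
    show ?thesis unfolding hform_def w_eq_gm 1 2 by simp
  qed
  have "det (\<chi> i j. hform w (f i) (f j)) = (\<Prod>i\<in>(UNIV :: 'n set). (1/2 :: complex))"
    by (subst det_diagonal) (auto simp: h)
  then have d: "of_real ((cmod (det (\<chi> k j. f j $ k)))\<^sup>2) * det (hmat w) = of_real ((1/2) ^ CARD('n))"
    unfolding det_hform[OF herm_invariant[OF assms]] by simp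
  define r where "r = (cmod (det (\<chi> k j. f j $ k)))\<^sup>2"
  have "r \<noteq> 0" using d by (auto simp: r_def)
  then have r: "r > 0" unfolding r_def by (metis less_eq_real_def zero_le_power2)
  have "det (hmat w) = of_real ((1/2) ^ CARD('n) / r)"
    using d r unfolding r_def[symmetric] by (simp add: field_simps)
  then show "Im (det (hmat w)) = 0" "Re (det (hmat w)) > 0" using r by simp_all
qed

section \<open>Exterior derivative and metric in coordinates\<close>

text \<open>The common shape of the coordinate formula for d and of the wedge with a one-form; f
  receives the removed vector and the remaining list.\<close>

definition alt_sum :: "('v \<Rightarrow> 'v list \<Rightarrow> complex) \<Rightarrow> 'v list \<Rightarrow> complex" where
  "alt_sum f vs = (\<Sum>i<length vs. (- 1) ^ i * f (vs ! i) (take i vs @ drop (Suc i) vs))"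

lemma alt_sum_Nil [simp]: "alt_sum f [] = 0"
  by (simp add: alt_sum_def)

lemma alt_sum_Cons: "alt_sum f (v # vs) = f v vs - alt_sum (\<lambda>x ws. f x (v # ws)) vs"
  unfolding alt_sum_def list.size add_0_right add_Suc_right sum.lessThan_Suc_shift
  by (simp add: sum_negf)

lemma alt_sum_add: "alt_sum (\<lambda>x ws. f x ws + g x ws) vs = alt_sum f vs + alt_sum g vs"
  by (simp add: alt_sum_def algebra_simps sum.distrib)

lemma alt_sum_diff: "alt_sum (\<lambda>x ws. f x ws - g x ws) vs = alt_sum f vs - alt_sum g vs"
  by (simp add: alt_sum_def algebra_simps sum_subtractf)

lemma alt_sum_minus: "alt_sum (\<lambda>x ws. - f x ws) vs = - alt_sum f vs"
  by (simp add: alt_sum_def sum_negf)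

lemma alt_sum_zero: "alt_sum (\<lambda>x ws. 0) vs = 0"
  by (simp add: alt_sum_def)

lemma alt_sum_sum: "alt_sum (\<lambda>x ws. \<Sum>i\<in>I. f i x ws) vs = (\<Sum>i\<in>I. alt_sum (f i) vs)"
  by (induction I rule: infinite_finite_induct) (simp_all add: alt_sum_zero alt_sum_add)

text \<open>Removing two positions in either order gives opposite signs, so terms symmetric in the
  removed vectors cancel in pairs. It eliminates the second derivatives of transition maps.\<close>

lemma alt_sum_symmetric: "(\<And>v x ws. h v x ws = h x v ws) \<Longrightarrow> alt_sum (\<lambda>v. alt_sum (h v)) vs = 0"
proof (induction vs arbitrary: h)
  case (Cons v vs)
  have 1: "alt_sum (\<lambda>y. alt_sum (\<lambda>x xs. h y x (v # xs))) vs = 0"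
    by (rule Cons.IH) (rule Cons.prems)
  have "alt_sum (\<lambda>y. alt_sum (h y)) (v # vs)
      = alt_sum (h v) vs - alt_sum (\<lambda>y ws. h y v ws - alt_sum (\<lambda>x xs. h y x (v # xs)) ws) vs"
    by (simp only: alt_sum_Cons)
  also have "\<dots> = alt_sum (h v) vs - alt_sum (\<lambda>y ws. h v y ws) vs"
    by (simp only: alt_sum_diff 1 Cons.prems[of _ v]) simp
  finally show ?case by simp
qed simp

lemma fwedge_one_form_alt_sum: "fwedge (one_form \<xi>) u vs = alt_sum (\<lambda>v ws. \<xi> v * u ws) vs"
  by (induction vs arbitrary: u) (simp_all add: alt_sum_Cons ins_app)

text \<open>One step of the product rule for pullbacks: the slot on which the derivative falls is
  moved to the head past \<open>L v\<close>, at the cost of a sign.\<close>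

lemma alt_sum_alternating_Cons:
  assumes "alternating \<beta>"
  shows "\<beta> (S v # map L vs) + alt_sum (\<lambda>x ws. \<beta> (L v # S x # map L ws)) vs = alt_sum (\<lambda>x ws. \<beta> (S x # map L ws)) (v # vs)"
  using alternating_swap[OF assms, of "L v"] by (simp add: alt_sum_Cons alt_sum_minus)

section \<open>Smooth form fields on open sets\<close>

definition dfield :: "(complex^'n \<Rightarrow> 'n::finite fibre) \<Rightarrow> complex^'n \<Rightarrow> complex^'n \<Rightarrow> 'n fibre" where
  "dfield a z v ws = frechet_derivative (\<lambda>z. a z ws) (at z) v"

definition sfield :: "(complex^'n) set \<Rightarrow> (complex^'n \<Rightarrow> 'n::finite fibre) \<Rightarrow> bool" where
  "sfield S a \<longleftrightarrow> (\<forall>z\<in>S. alternating (a z)) \<and> (\<forall>vs. smooth_on S (\<lambda>z. a z vs))"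

definition fd :: "(complex^'n \<Rightarrow> 'n::finite fibre) \<Rightarrow> complex^'n \<Rightarrow> 'n fibre" where
  "fd a z vs = alt_sum (dfield a z) vs"

lemma sfieldD: "sfield S a \<Longrightarrow> z \<in> S \<Longrightarrow> alternating (a z)" "sfield S a \<Longrightarrow> smooth_on S (\<lambda>z. a z vs)"
  by (simp_all add: sfield_def)

lemma sfield_has_derivative:
  "sfield S a \<Longrightarrow> z \<in> S \<Longrightarrow> ((\<lambda>z. a z vs) has_derivative (\<lambda>v. dfield a z v vs)) (at z)"
  using smooth_on_has_derivative[OF sfieldD(2)] by (simp add: dfield_def[abs_def])

lemma dfield_eqI: "((\<lambda>z. a z vs) has_derivative D) (at z) \<Longrightarrow> dfield a z v vs = D v"
  using frechet_derivative_at unfolding dfield_def by metis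

lemma sfield_cong: "open S \<Longrightarrow> (\<And>z. z \<in> S \<Longrightarrow> a z = b z) \<Longrightarrow> sfield S a \<longleftrightarrow> sfield S b"
  unfolding sfield_def using smooth_on_cong[of S "\<lambda>z. a z _" "\<lambda>z. b z _"] by simp

lemma dfield_cong:
  assumes "open S" "z \<in> S" "\<And>z. z \<in> S \<Longrightarrow> a z ws = b z ws" "sfield S a"
  shows "dfield b z v ws = dfield a z v ws"
  by (rule dfield_eqI, rule has_derivative_transform_within_open[OF sfield_has_derivative[OF assms(4,2)] assms(1,2)])
    (rule assms(3))

lemma fd_cong:
  assumes "open S" "z \<in> S" "\<And>z. z \<in> S \<Longrightarrow> a z = b z" "sfield S a"
  shows "fd b z = fd a z"
proof -
  have "dfield b z = dfield a z"
    by (intro ext dfield_cong[OF assms(1,2) _ assms(4)]) (simp add: assms(3))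
  then show ?thesis by (simp add: fd_def[abs_def])
qed

lemma smooth_on_rcoord: "open S \<Longrightarrow> smooth_on S X \<Longrightarrow> smooth_on S (\<lambda>z. rcoord i (X z))"
  by (rule smooth_on_bounded_linear[OF _ linear_conv_bounded_linear[THEN iffD1, OF linear_rcoord]])

lemma alternating_rcoord: "alternating \<alpha> \<Longrightarrow> \<alpha> (v # vs) = (\<Sum>i\<in>UNIV. of_real (rcoord i v) * \<alpha> (rbasis i # vs))"
proof -
  assume a: "alternating \<alpha>"
  have "\<alpha> (v # vs) = \<alpha> ((\<Sum>i\<in>UNIV. rcoord i v *\<^sub>R rbasis i) # vs)" using rcoord_expand[of v] by simp
  then show ?thesis by (simp add: alternating_head_sum[OF a] alternating_head_scaleR[OF a])
qed

text \<open>Smoothness of a field is only given for constant arguments, so a variable vector X is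
  expanded in the real coordinate basis before differentiating.\<close>

lemma sfield_ins:
  assumes "open S" and a: "sfield S a" and X: "smooth_on S X"
  shows "sfield S (\<lambda>z. ins (X z) (a z))"
    and "z \<in> S \<Longrightarrow> dfield (\<lambda>z. ins (X z) (a z)) z v ws = dfield a z v (X z # ws) + a z (frechet_derivative X (at z) v # ws)"
proof -
  let ?g = "\<lambda>ws z. \<Sum>i\<in>UNIV. of_real (rcoord i (X z)) * a z (rbasis i # ws)"
  have e: "ins (X z) (a z) ws = ?g ws z" if "z \<in> S" for z ws
    using alternating_rcoord[OF sfieldD(1)[OF a that], of "X z" ws] by (simp add: ins_app)
  have "smooth_on S (?g ws)" for ws
    by (intro smooth_on_sum smooth_on_mult smooth_on_of_real smooth_on_rcoord X sfieldD(2)[OF a] assms(1))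
  then have "smooth_on S (\<lambda>z. ins (X z) (a z) ws)" for ws
    using smooth_on_cong[OF assms(1), of "\<lambda>z. ins (X z) (a z) ws" "?g ws"] e by simp
  then show "sfield S (\<lambda>z. ins (X z) (a z))"
    using sfieldD(1)[OF a] by (auto simp: sfield_def)
  assume z: "z \<in> S"
  let ?X' = "frechet_derivative X (at z)"
  have rX: "((\<lambda>z. of_real (rcoord i (X z)) :: complex) has_derivative (\<lambda>v. of_real (rcoord i (?X' v)))) (at z)" for i
    by (intro bounded_linear.has_derivative[OF bounded_linear_of_real]
        bounded_linear.has_derivative[OF linear_conv_bounded_linear[THEN iffD1, OF linear_rcoord]]
        smooth_on_has_derivative[OF X z])
  have "(?g ws has_derivative (\<lambda>v. \<Sum>i\<in>UNIV. of_real (rcoord i (X z)) * dfield a z v (rbasis i # ws)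
      + of_real (rcoord i (?X' v)) * a z (rbasis i # ws))) (at z)"
    by (intro has_derivative_sum has_derivative_mult rX sfield_has_derivative[OF a z])
  then have D: "((\<lambda>z. ins (X z) (a z) ws) has_derivative (\<lambda>v. \<Sum>i\<in>UNIV. of_real (rcoord i (X z)) * dfield a z v (rbasis i # ws)
      + of_real (rcoord i (?X' v)) * a z (rbasis i # ws))) (at z)"
    by (rule has_derivative_transform_within_open[OF _ assms(1) z]) (simp add: e)
  have "dfield a z v (X z # ws) = (\<Sum>i\<in>UNIV. of_real (rcoord i (X z)) * dfield a z v (rbasis i # ws))"
  proof (rule dfield_eqI[THEN trans], rule has_derivative_transform_within_open[OF _ assms(1) z])
    show "((\<lambda>y. \<Sum>i\<in>UNIV. of_real (rcoord i (X z)) * a y (rbasis i # ws)) has_derivative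
      (\<lambda>v. \<Sum>i\<in>UNIV. of_real (rcoord i (X z)) * dfield a z v (rbasis i # ws))) (at z)"
      by (intro has_derivative_sum bounded_linear.has_derivative[OF bounded_linear_mult_right] sfield_has_derivative[OF a z])
    show "(\<Sum>i\<in>UNIV. of_real (rcoord i (X z)) * a y (rbasis i # ws)) = a y (X z # ws)" if "y \<in> S" for y
      using alternating_rcoord[OF sfieldD(1)[OF a that], of "X z" ws] by simp
  qed simp
  then show "dfield (\<lambda>z. ins (X z) (a z)) z v ws = dfield a z v (X z # ws) + a z (?X' v # ws)"
    using dfield_eqI[of "\<lambda>z. ins (X z) (a z)", OF D, of v] alternating_rcoord[OF sfieldD(1)[OF a z], of "?X' v" ws]
    by (simp add: sum.distrib)
qed

text \<open>The product rule for the arguments: every slot \<open>L z x\<close> is differentiated in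
  turn and moved to the head by alternation. The field a is already indexed by z here; the change of
  base point is left to \<open>sfield_pullback\<close>.\<close>

lemma dfield_pullback:
  fixes a :: "complex^'n::finite \<Rightarrow> 'n fibre" and \<Phi> :: "complex^'n \<Rightarrow> complex^'n"
  assumes "open S" and a: "sfield S a" and \<Phi>: "smooth_on S \<Phi>" and z: "z \<in> S"
  defines "L \<equiv> \<lambda>z. frechet_derivative \<Phi> (at z)"
  shows "smooth_on S (\<lambda>z. a z (map (L z) ws))"
    and "dfield (\<lambda>z ws. a z (map (L z) ws)) z v ws = dfield a z v (map (L z) ws)
      + alt_sum (\<lambda>x xs. a z (frechet_derivative (\<lambda>z. L z x) (at z) v # map (L z) xs)) ws"
  using a
proof (induction ws arbitrary: a)
  case Nil
  { case 1 then show ?case using sfieldD(2)[of S a "[]"] by simp }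
  { case 2 then show ?case by (simp add: dfield_def) }
next
  case (Cons w ws)
  have X: "smooth_on S (\<lambda>z. L z w)" unfolding L_def by (rule smooth_on_frechet[OF \<Phi>])
  { case 1
    show ?case using Cons.IH(1)[OF sfield_ins(1)[OF assms(1) 1 X]] by (simp add: ins_app) }
  { case 2
    note i = sfield_ins[OF assms(1) 2 X]
    have "dfield (\<lambda>z ws. a z (map (L z) ws)) z v (w # ws) = dfield (\<lambda>z ws. ins (L z w) (a z) (map (L z) ws)) z v ws"
      by (simp add: dfield_def ins_app)
    also have "\<dots> = dfield (\<lambda>z. ins (L z w) (a z)) z v (map (L z) ws)
      + alt_sum (\<lambda>x xs. ins (L z w) (a z) (frechet_derivative (\<lambda>z. L z x) (at z) v # map (L z) xs)) ws"
      by (rule Cons.IH(2)[OF i(1)])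
    also have "\<dots> = dfield a z v (map (L z) (w # ws)) + (a z (frechet_derivative (\<lambda>z. L z w) (at z) v # map (L z) ws)
      + alt_sum (\<lambda>x xs. a z (L z w # frechet_derivative (\<lambda>z. L z x) (at z) v # map (L z) xs)) ws)"
      unfolding i(2)[OF z] by (simp add: ins_app)
    also have "a z (frechet_derivative (\<lambda>z. L z w) (at z) v # map (L z) ws)
      + alt_sum (\<lambda>x xs. a z (L z w # frechet_derivative (\<lambda>z. L z x) (at z) v # map (L z) xs)) ws
      = alt_sum (\<lambda>x xs. a z (frechet_derivative (\<lambda>z. L z x) (at z) v # map (L z) xs)) (w # ws)"
      by (rule alt_sum_alternating_Cons[OF sfieldD(1)[OF 2 z]])
    finally show ?case . }
qed

text \<open>The chain rule yields the pullback of d b and a sum of terms with second derivatives of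
  \<Phi>. The latter are symmetric and are cancelled by the alternating sum.\<close>

lemma sfield_pullback:
  fixes b :: "complex^'n::finite \<Rightarrow> 'n fibre" and \<Phi> :: "complex^'n \<Rightarrow> complex^'n"
  assumes S: "open S" and T: "open T" and \<Phi>: "smooth_on S \<Phi>" "\<And>z. z \<in> S \<Longrightarrow> \<Phi> z \<in> T" and b: "sfield T b"
  shows "sfield S (\<lambda>z. pb (frechet_derivative \<Phi> (at z)) (b (\<Phi> z)))"
    and "z \<in> S \<Longrightarrow> fd (\<lambda>z. pb (frechet_derivative \<Phi> (at z)) (b (\<Phi> z))) z = pb (frechet_derivative \<Phi> (at z)) (fd b (\<Phi> z))"
proof -
  let ?L = "\<lambda>z. frechet_derivative \<Phi> (at z)"
  have b\<Phi>: "sfield S (\<lambda>z. b (\<Phi> z))"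
    unfolding sfield_def using \<Phi>(2) sfieldD[OF b] smooth_on_compose[OF S T \<Phi>(2) _ \<Phi>(1)] by auto
  have lin: "linear (?L z)" if "z \<in> S" for z
    using has_derivative_linear[OF smooth_on_has_derivative[OF \<Phi>(1) that]] .
  have "smooth_on S (\<lambda>z. pb (?L z) (b (\<Phi> z)) vs)" for vs
  proof (cases "S = {}")
    case True
    show ?thesis by (rule smooth_on_local) (simp add: True)
  next
    case False
    then obtain z where "z \<in> S" by blast
    from dfield_pullback(1)[OF S b\<Phi> \<Phi>(1) this] show ?thesis by (simp add: pb_def)
  qed
  then show "sfield S (\<lambda>z. pb (?L z) (b (\<Phi> z)))"
    using alternating_pb[OF lin sfieldD(1)[OF b\<Phi>]] by (simp add: sfield_def)
  assume z: "z \<in> S"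
  have D: "dfield (\<lambda>z. b (\<Phi> z)) z v ws = dfield b (\<Phi> z) (?L z v) ws" for v ws
    by (rule dfield_eqI[THEN trans], rule has_derivative_compose[OF smooth_on_has_derivative[OF \<Phi>(1) z] sfield_has_derivative[OF b \<Phi>(2)[OF z]]])
      simp
  show "fd (\<lambda>z. pb (?L z) (b (\<Phi> z))) z = pb (?L z) (fd b (\<Phi> z))"
  proof
    fix vs
    have "fd (\<lambda>z. pb (?L z) (b (\<Phi> z))) z vs = alt_sum (\<lambda>v ws. dfield b (\<Phi> z) (?L z v) (map (?L z) ws)) vs
       + alt_sum (\<lambda>v. alt_sum (\<lambda>x xs. b (\<Phi> z) (frechet_derivative (\<lambda>z. ?L z x) (at z) v # map (?L z) xs))) vs"
      unfolding fd_def pb_def[abs_def] dfield_pullback(2)[OF S b\<Phi> \<Phi>(1) z, abs_def] D alt_sum_add ..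
    also have "alt_sum (\<lambda>v. alt_sum (\<lambda>x xs. b (\<Phi> z) (frechet_derivative (\<lambda>z. ?L z x) (at z) v # map (?L z) xs))) vs = 0"
      by (rule alt_sum_symmetric) (simp only: symmetric_second_derivative[OF \<Phi>(1) S z])
    also have "alt_sum (\<lambda>v ws. dfield b (\<Phi> z) (?L z v) (map (?L z) ws)) vs = pb (?L z) (fd b (\<Phi> z)) vs"
      by (simp add: alt_sum_def pb_def fd_def take_map drop_map)
    finally show "fd (\<lambda>z. pb (?L z) (b (\<Phi> z))) z vs = pb (?L z) (fd b (\<Phi> z)) vs" by simp
  qed
qed

lemma sfield_fwedge: "open S \<Longrightarrow> sfield S a \<Longrightarrow> sfield S b \<Longrightarrow> sfield S (\<lambda>z. fwedge (a z) (b z))"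
  unfolding sfield_def fwedge_def[abs_def]
  by (auto intro!: alternating_fwedge[unfolded fwedge_def[abs_def]] smooth_on_sum smooth_on_mult smooth_on_const)

lemma sfield_add: "open S \<Longrightarrow> sfield S a \<Longrightarrow> sfield S b \<Longrightarrow> sfield S (\<lambda>z vs. a z vs + b z vs)"
  unfolding sfield_def by (auto intro: alternating_add smooth_on_add)

lemma sfield_mult: "open S \<Longrightarrow> smooth_on S f \<Longrightarrow> sfield S b \<Longrightarrow> sfield S (\<lambda>z vs. f z * b z vs)"
  unfolding sfield_def by (auto intro: alternating_mult smooth_on_mult)

lemma sfield_sum: "open S \<Longrightarrow> (\<And>i. i \<in> I \<Longrightarrow> sfield S (a i)) \<Longrightarrow> sfield S (\<lambda>z vs. \<Sum>i\<in>I. a i z vs)"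
  unfolding sfield_def by (auto intro: alternating_sum smooth_on_sum)

lemma sfield_cnj: "open S \<Longrightarrow> sfield S a \<Longrightarrow> sfield S (\<lambda>z vs. cnj (a z vs))"
  unfolding sfield_def by (auto intro: alternating_cnj smooth_on_cnj)

lemma sfield_ins_const: "open S \<Longrightarrow> sfield S a \<Longrightarrow> sfield S (\<lambda>z. ins v (a z))"
  by (rule sfield_ins(1)) (auto intro: smooth_on_const)

text \<open>Contraction with a constant vector commutes with differentiation of coefficients, so the
  derivatives of smooth fields form a class as required by
  \<open>alternating_coinduct\<close>.\<close>

lemma sfield_dfield:
  assumes "open S" "sfield S a" shows "sfield S (\<lambda>z. dfield a z v)"
proof -
  have "alternating (dfield a z v)" if z: "z \<in> S" for z
  proof (rule alternating_coinduct[where X = "{dfield b z v |b. sfield S b}"])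
    fix \<gamma> x xs assume "\<gamma> \<in> {dfield b z v |b. sfield S b}"
    then obtain b where b: "\<gamma> = dfield b z v" "sfield S b" by blast
    have "ins x \<gamma> = dfield (\<lambda>z. ins x (b z)) z v" by (rule ext) (simp add: b dfield_def ins_app)
    then show "ins x \<gamma> \<in> {dfield b z v |b. sfield S b}" using sfield_ins_const[OF assms(1) b(2)] by blast
    show "linear (\<lambda>y. \<gamma> (y # xs))"
    proof (rule linearI)
      fix p q
      have "((\<lambda>z. b z ((p + q) # xs)) has_derivative (\<lambda>v. dfield b z v (p # xs) + dfield b z v (q # xs))) (at z)"
        by (rule has_derivative_transform_within_open[OF has_derivative_add[OF sfield_has_derivative[OF b(2) z] sfield_has_derivative[OF b(2) z]] assms(1) z])
          (simp add: alternating_head_add[OF sfieldD(1)[OF b(2)]])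
      then show "\<gamma> ((p + q) # xs) = \<gamma> (p # xs) + \<gamma> (q # xs)" unfolding b(1) by (rule dfield_eqI)
    next
      fix r p
      have "((\<lambda>z. b z ((r *\<^sub>R p) # xs)) has_derivative (\<lambda>v. of_real r * dfield b z v (p # xs))) (at z)"
        by (rule has_derivative_transform_within_open[OF bounded_linear.has_derivative[OF bounded_linear_mult_right sfield_has_derivative[OF b(2) z]] assms(1) z])
          (simp add: alternating_head_scaleR[OF sfieldD(1)[OF b(2)]])
      then show "\<gamma> ((r *\<^sub>R p) # xs) = r *\<^sub>R \<gamma> (p # xs)" unfolding b(1) scaleR_conv_of_real[where 'a=complex] by (rule dfield_eqI)
    qed
    have "((\<lambda>z. b z (x # x # xs)) has_derivative (\<lambda>v. 0)) (at z)"
      by (rule has_derivative_transform_within_open[OF has_derivative_const[of 0] assms(1) z])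
        (simp add: alternating_same[OF sfieldD(1)[OF b(2)]])
    then show "\<gamma> (x # x # xs) = 0" unfolding b(1) by (rule dfield_eqI)
  qed (use assms in blast)
  then show ?thesis
    unfolding sfield_def using smooth_on_frechet[OF sfieldD(2)[OF assms(2)]] by (simp add: dfield_def)
qed

text \<open>The derivative is linear in its direction; expanding the direction in real coordinates
  gives d as the sum of dx_i \<and> \<partial>_i.\<close>

lemma fd_eq_sum:
  assumes "sfield S a" "z \<in> S"
  shows "fd a z vs = (\<Sum>i\<in>UNIV. fwedge (one_form (\<lambda>v. of_real (rcoord i v))) (dfield a z (rbasis i)) vs)"
proof -
  have "dfield a z v ws = (\<Sum>i\<in>UNIV. of_real (rcoord i v) * dfield a z (rbasis i) ws)" for v ws
  proof -
    have l: "linear (\<lambda>v. dfield a z v ws)" by (rule has_derivative_linear[OF sfield_has_derivative[OF assms]])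
    have "dfield a z v ws = dfield a z (\<Sum>i\<in>UNIV. rcoord i v *\<^sub>R rbasis i) ws" using rcoord_expand[of v] by simp
    then show ?thesis by (simp add: linear_sum[OF l] linear_scale[OF l] scaleR_conv_of_real[where 'a=complex])
  qed
  then have "dfield a z = (\<lambda>v ws. \<Sum>i\<in>UNIV. of_real (rcoord i v) * dfield a z (rbasis i) ws)"
    by (intro ext)
  then have "fd a z vs = alt_sum (\<lambda>v ws. \<Sum>i\<in>UNIV. of_real (rcoord i v) * dfield a z (rbasis i) ws) vs"
    unfolding fd_def by (rule arg_cong)
  then show ?thesis by (simp only: fwedge_one_form_alt_sum alt_sum_sum)
qed

lemma sfield_fd:
  fixes a :: "complex^'n::finite \<Rightarrow> 'n fibre"
  assumes "open S" "sfield S a" shows "sfield S (fd a)"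
proof -
  have o: "sfield S (\<lambda>z. one_form (\<lambda>v. of_real (rcoord i v)))" for i :: "'n ridx"
    unfolding sfield_def
    by (auto intro!: alternating_one_form smooth_on_const assms(1) linear_compose[OF linear_rcoord linear_of_real, unfolded o_def])
  have "sfield S (\<lambda>z vs. \<Sum>i\<in>UNIV. fwedge (one_form (\<lambda>v. of_real (rcoord i v))) (dfield a z (rbasis i)) vs)"
    by (intro sfield_sum sfield_fwedge sfield_dfield o assms)
  then show ?thesis
    using sfield_cong[OF assms(1), of "fd a" "\<lambda>z vs. \<Sum>i\<in>UNIV. fwedge (one_form (\<lambda>v. of_real (rcoord i v))) (dfield a z (rbasis i)) vs"]
      fd_eq_sum[OF assms(2)] by auto
qed

lemma sfield_tw:
  assumes "open S" "smooth_on S s" "smooth_on S t" "sfield S a"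
  shows "sfield S (\<lambda>z. tw (s z) (t z) (a z))"
proof -
  have "smooth_on S (\<lambda>z. tw (s z) (t z) (a z) vs)" for vs
    using assms(4)
  proof (induction vs arbitrary: a)
    case Nil then show ?case using sfieldD(2)[of S a "[]"] by simp
  next
    case (Cons v vs)
    have "sfield S (\<lambda>z ws. of_real ((s z + t z) / 2) * ins v (a z) ws + \<i> * of_real ((t z - s z) / 2) * ins (J v) (a z) ws)"
      by (intro sfield_add sfield_mult smooth_on_of_real smooth_on_mult smooth_on_const smooth_on_divide smooth_on_add smooth_on_diff
          sfield_ins_const assms Cons.prems) auto
    then have "sfield S (\<lambda>z. tw_ins (s z) (t z) v (a z))" by (simp add: tw_ins_def[abs_def] ins_app)
    then show ?case using Cons.IH by simp
  qed
  then show ?thesis using assms(4) by (auto simp: sfield_def intro: alternating_tw)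
qed

text \<open>The inverse metric with upper indices: the sum of b \<otimes> b over an orthonormal
  basis is the inverse of the metric in real coordinates.\<close>

definition metric_inv :: "(complex^'n::finite) set \<Rightarrow> 'n ridx \<Rightarrow> 'n ridx \<Rightarrow> real" where
  "metric_inv B i j = (\<Sum>b\<in>B. rcoord i b * rcoord j b)"

context hermitian
begin

lemma sum_metric_inv:
  fixes F :: "complex^'n \<Rightarrow> complex^'n \<Rightarrow> complex"
  assumes F1: "\<And>u. linear (\<lambda>v. F v u)" and F2: "\<And>v. linear (F v)"
  shows "(\<Sum>b\<in>B. F b b) = (\<Sum>i\<in>UNIV. \<Sum>j\<in>UNIV. of_real (metric_inv B i j) * F (rbasis i) (rbasis j))"
proof -
  have "F b b = (\<Sum>i\<in>UNIV. \<Sum>j\<in>UNIV. of_real (rcoord i b * rcoord j b) * F (rbasis i) (rbasis j))" for b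
  proof -
    have ex: "G b = (\<Sum>i\<in>UNIV. of_real (rcoord i b) * G (rbasis i))" if "linear G" for G :: "complex^'n \<Rightarrow> complex"
    proof -
      have "G b = G (\<Sum>i\<in>UNIV. rcoord i b *\<^sub>R rbasis i)" using rcoord_expand[of b] by simp
      then show ?thesis by (simp add: linear_sum[OF that] linear_scale[OF that] scaleR_conv_of_real[where 'a=complex])
    qed
    have "F b b = (\<Sum>i\<in>UNIV. of_real (rcoord i b) * F (rbasis i) b)" by (rule ex[OF F1])
    also have "\<dots> = (\<Sum>i\<in>UNIV. of_real (rcoord i b) * (\<Sum>j\<in>UNIV. of_real (rcoord j b) * F (rbasis i) (rbasis j)))"
      by (intro sum.cong refl arg_cong2[where f="(*)"] ex[OF F2])
    finally show ?thesis by (simp add: sum_distrib_left mult.assoc)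
  qed
  then have "(\<Sum>b\<in>B. F b b) = (\<Sum>b\<in>B. \<Sum>i\<in>UNIV. \<Sum>j\<in>UNIV. of_real (rcoord i b * rcoord j b) * F (rbasis i) (rbasis j))"
    by (intro sum.cong refl)
  also have "\<dots> = (\<Sum>i\<in>UNIV. \<Sum>b\<in>B. \<Sum>j\<in>UNIV. of_real (rcoord i b * rcoord j b) * F (rbasis i) (rbasis j))"
    by (rule sum.swap)
  also have "\<dots> = (\<Sum>i\<in>UNIV. \<Sum>j\<in>UNIV. \<Sum>b\<in>B. of_real (rcoord i b * rcoord j b) * F (rbasis i) (rbasis j))"
    by (intro sum.cong refl) (rule sum.swap)
  finally show ?thesis by (simp add: metric_inv_def sum_distrib_right)
qed

lemma metric_inv_inverse:
  "(\<Sum>j\<in>UNIV. gm w (rbasis k) (rbasis j) * metric_inv B j i) = (if k = i then 1 else 0)"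
proof -
  have "(\<Sum>j\<in>UNIV. gm w (rbasis k) (rbasis j) * metric_inv B j i)
    = (\<Sum>j\<in>UNIV. \<Sum>b\<in>B. rcoord i b * (rcoord j b * gm w (rbasis k) (rbasis j)))"
    by (simp add: metric_inv_def sum_distrib_left ac_simps)
  also have "\<dots> = (\<Sum>b\<in>B. rcoord i b * (\<Sum>j\<in>UNIV. rcoord j b * gm w (rbasis k) (rbasis j)))"
    by (subst sum.swap) (simp add: sum_distrib_left)
  also have "\<dots> = (\<Sum>b\<in>B. gm w b (rbasis k) *\<^sub>R rcoord i b)"
  proof (intro sum.cong refl)
    fix b
    have "gm w (rbasis k) b = gm w (rbasis k) (\<Sum>j\<in>UNIV. rcoord j b *\<^sub>R rbasis j)" using rcoord_expand[of b] by simp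
    then show "rcoord i b * (\<Sum>j\<in>UNIV. rcoord j b * gm w (rbasis k) (rbasis j)) = gm w b (rbasis k) *\<^sub>R rcoord i b"
      by (simp add: linear_sum[OF gm_linear] linear_scale[OF gm_linear] gm_sym[of b])
  qed
  also have "\<dots> = (if k = i then 1 else 0)"
    using expand_linear[OF linear_rcoord, of "rbasis k" i] by (simp add: rcoord_rbasis)
  finally show ?thesis .
qed

end

lemma smooth_on_det:
  fixes M :: "'b::real_normed_vector \<Rightarrow> 'c::{real_normed_field}^'m::finite^'m"
  assumes "open S" "\<And>i j. smooth_on S (\<lambda>z. M z $ i $ j)" shows "smooth_on S (\<lambda>z. det (M z))"
  unfolding det_def by (intro smooth_on_sum smooth_on_mult smooth_on_const smooth_on_prod assms)

text \<open>The bases \<open>B z\<close> at different points are unrelated choices, but the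
  coefficient is an entry of the inverse Gram matrix and thus, by Cramer's rule, a quotient of
  smooth determinants.\<close>

lemma smooth_metric_inv:
  assumes S: "open S" and W: "sfield S W" and h: "\<And>z. z \<in> S \<Longrightarrow> herm (W z)" "\<And>z. z \<in> S \<Longrightarrow> onb (W z) (B z)"
  shows "smooth_on S (\<lambda>z. metric_inv (B z) i j)"
proof -
  define G where "G z = (\<chi> i j. gm (W z) (rbasis i) (rbasis j))" for z
  have G: "smooth_on S (\<lambda>z. G z $ i $ j)" for i j
    by (simp add: G_def gm_def) (intro smooth_on_Re S sfieldD(2)[OF W])
  let ?C = "\<lambda>z. \<chi> k l. if l = i then axis j 1 $ k else G z $ k $ l"
  have C: "smooth_on S (\<lambda>z. ?C z $ k $ l)" for k l
    using G S by (cases "l = i") (auto intro: smooth_on_const)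
  have 1: "det (G z) \<noteq> 0 \<and> metric_inv (B z) i j = det (?C z) / det (G z)" if z: "z \<in> S" for z
  proof -
    interpret hermitian "W z" "B z" using h z by unfold_locales
    let ?I = "\<chi> i j. metric_inv (B z) i j"
    have I: "G z ** ?I = mat 1"
      by (simp add: vec_eq_iff matrix_matrix_mult_def G_def mat_def metric_inv_inverse)
    then have "det (G z) * det ?I = 1" by (metis det_mul det_I)
    then have nz: "det (G z) \<noteq> 0" by auto
    have "G z *v (\<chi> k. metric_inv (B z) k j) = axis j 1"
      by (simp add: vec_eq_iff matrix_vector_mult_def G_def axis_def metric_inv_inverse)
    then have "(\<chi> k. metric_inv (B z) k j) = (\<chi> k. det (\<chi> i l. if l = k then axis j 1 $ i else G z $ i $ l) / det (G z))"
      by (rule cramer[OF nz, THEN iffD1])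
    then have "(\<chi> k. metric_inv (B z) k j) $ i = (\<chi> k. det (\<chi> i l. if l = k then axis j 1 $ i else G z $ i $ l) / det (G z)) $ i"
      by (rule arg_cong)
    then show ?thesis using nz by simp
  qed
  have "smooth_on S (\<lambda>z. det (?C z) / det (G z))"
    using 1 by (intro smooth_on_divide smooth_on_det S C G) auto
  then show ?thesis using smooth_on_cong[OF S, of "\<lambda>z. metric_inv (B z) i j" "\<lambda>z. det (?C z) / det (G z)"] 1 by simp
qed

text \<open>Each trace over the chosen basis becomes a sum over fixed real indices with smooth
  weights \<open>metric_inv\<close>.\<close>

lemma sfield_adjw:
  assumes S: "open S" and W: "sfield S W" and h: "\<And>z. z \<in> S \<Longrightarrow> herm (W z)" "\<And>z. z \<in> S \<Longrightarrow> onb (W z) (B z)"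
    and "sfield S \<xi>" "sfield S v"
  shows "sfield S (\<lambda>z. adjw (B z) k (\<xi> z) (v z))"
proof -
  have "smooth_on S (\<lambda>z. adjw (B z) k (\<xi> z) (v z) vs)" for vs
    using assms(5,6)
  proof (induction k arbitrary: \<xi> v)
    case 0
    show ?case unfolding adjw.simps
      by (intro smooth_on_mult smooth_on_cnj S sfieldD(2)[OF 0(1)] sfieldD(2)[OF 0(2)])
  next
    case (Suc k)
    let ?f = "\<lambda>z. (\<Sum>i\<in>UNIV. \<Sum>j\<in>UNIV. of_real (metric_inv (B z) i j) *
        adjw (B z) k (ins (rbasis i) (\<xi> z)) (ins (rbasis j) (v z)) vs) * (1 / of_nat (Suc k))"
    have e: "adjw (B z) (Suc k) (\<xi> z) (v z) vs = ?f z" if z: "z \<in> S" for z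
    proof -
      interpret hermitian "W z" "B z" using h z by unfold_locales
      show ?thesis
        unfolding adjw.simps using sfieldD(1)[OF Suc.prems(1) z] sfieldD(1)[OF Suc.prems(2) z]
        by (subst sum_metric_inv[where F = "\<lambda>b c. adjw (B z) k (ins b (\<xi> z)) (ins c (v z)) vs"])
          (auto intro: adjw_left_ins_linear adjw_ins_linear)
    qed
    have "smooth_on S ?f"
      by (intro smooth_on_mult smooth_on_sum smooth_on_of_real smooth_on_const S smooth_metric_inv[OF S W h] Suc.IH sfield_ins_const Suc.prems)
    then show ?case using smooth_on_cong[OF S, of "\<lambda>z. adjw (B z) (Suc k) (\<xi> z) (v z) vs" ?f] e by simp
  qed
  then show ?thesis using sfieldD(1)[OF assms(6)] by (auto simp: sfield_def intro: alternating_adjw)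
qed

lemma smooth_finn:
  assumes "open S" "sfield S W" "\<And>z. z \<in> S \<Longrightarrow> herm (W z)" "\<And>z. z \<in> S \<Longrightarrow> onb (W z) (B z)" "sfield S \<alpha>" "sfield S \<beta>"
  shows "smooth_on S (\<lambda>z. finn (B z) (\<alpha> z) (\<beta> z))"
  unfolding finn_def by (intro smooth_on_sum sfieldD(2)[OF sfield_adjw[OF assms(1-4)]] assms(1,5,6))

section \<open>Charts\<close>

definition cdom :: "('a, 'n::finite) chart \<Rightarrow> (complex^'n) set" where "cdom c = snd c ` fst c"
definition civ :: "('a, 'n::finite) chart \<Rightarrow> complex^'n \<Rightarrow> 'a" where "civ c = inv_into (fst c) (snd c)"
definition tran :: "('a, 'n::finite) chart \<Rightarrow> ('a, 'n) chart \<Rightarrow> complex^'n \<Rightarrow> complex^'n" where "tran c d = snd d \<circ> civ c"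
definition covl :: "('a, 'n::finite) chart \<Rightarrow> ('a, 'n) chart \<Rightarrow> (complex^'n) set" where "covl c d = snd c ` (fst c \<inter> fst d)"
definition Tr :: "('a, 'n::finite) chart \<Rightarrow> ('a, 'n) chart \<Rightarrow> complex^'n \<Rightarrow> complex^'n \<Rightarrow> complex^'n" where
  "Tr c d z = frechet_derivative (tran c d) (at z)"

lemma in_chart_eq: "in_chart A c u z = pb (Tr c (chart_at A (civ c z)) z) (u (civ c z))"
  by (rule ext) (simp add: in_chart_def pb_def Tr_def tran_def civ_def Let_def)

locale complex_manifold =
  fixes A :: "('a::{t2_space,second_countable_topology}, 'n::finite) chart set"
  assumes atlas: "complex_atlas A"
begin

lemma chart_props:
  assumes "c \<in> A"
  shows "open (fst c)" "open (cdom c)" "homeomorphism (fst c) (cdom c) (snd c) (civ c)"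
  using assms atlas unfolding complex_atlas_def cdom_def civ_def by (simp_all add: case_prod_beta)

lemma chart_at: "chart_at A x \<in> A" "x \<in> fst (chart_at A x)"
proof -
  have "\<exists>c. c \<in> A \<and> x \<in> fst c" using atlas unfolding complex_atlas_def case_prod_beta by blast
  from someI_ex[OF this] show "chart_at A x \<in> A" "x \<in> fst (chart_at A x)" by (simp_all add: chart_at_def)
qed

lemma civ_in: "c \<in> A \<Longrightarrow> z \<in> cdom c \<Longrightarrow> civ c z \<in> fst c"
  using chart_props(3) unfolding homeomorphism_def by blast

lemma chart_civ: "c \<in> A \<Longrightarrow> z \<in> cdom c \<Longrightarrow> snd c (civ c z) = z"
  using chart_props(3) unfolding homeomorphism_def by blast

lemma civ_chart: "c \<in> A \<Longrightarrow> x \<in> fst c \<Longrightarrow> civ c (snd c x) = x"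
  using chart_props(3) unfolding homeomorphism_def by blast

lemma chart_in: "x \<in> fst c \<Longrightarrow> snd c x \<in> cdom c"
  by (simp add: cdom_def)

lemma continuous_civ: "c \<in> A \<Longrightarrow> continuous_on (cdom c) (civ c)"
  and continuous_chart: "c \<in> A \<Longrightarrow> continuous_on (fst c) (snd c)"
  using chart_props(3) unfolding homeomorphism_def by blast+

lemma covl_eq: "c \<in> A \<Longrightarrow> covl c d = {z \<in> cdom c. civ c z \<in> fst d}"
  by (auto simp: covl_def cdom_def civ_chart)

lemma covl_I: "x \<in> fst c \<Longrightarrow> x \<in> fst d \<Longrightarrow> snd c x \<in> covl c d"
  by (simp add: covl_def)

lemma open_covl: "c \<in> A \<Longrightarrow> d \<in> A \<Longrightarrow> open (covl c d)"
  using continuous_open_preimage[OF continuous_civ chart_props(2) chart_props(1)[of d]]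
  by (simp add: covl_eq vimage_def Int_def conj_commute)

lemma covl_subset: "covl c d \<subseteq> cdom c"
  by (auto simp: covl_def cdom_def)

lemma covl_self: "covl c c = cdom c"
  by (simp add: covl_def cdom_def)

lemma holo: "c \<in> A \<Longrightarrow> d \<in> A \<Longrightarrow> holomorphic_map_on (covl c d) (tran c d)"
  using atlas unfolding complex_atlas_def covl_def tran_def civ_def by (simp add: case_prod_beta)

lemma smooth_tran: "c \<in> A \<Longrightarrow> d \<in> A \<Longrightarrow> smooth_on (covl c d) (tran c d)"
  using holo by (auto simp: holomorphic_map_on_def)

lemma Tr_derivative: "c \<in> A \<Longrightarrow> d \<in> A \<Longrightarrow> z \<in> covl c d \<Longrightarrow> (tran c d has_derivative Tr c d z) (at z)"
  unfolding Tr_def by (rule smooth_on_has_derivative[OF smooth_tran])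

lemma linear_Tr: "c \<in> A \<Longrightarrow> d \<in> A \<Longrightarrow> z \<in> covl c d \<Longrightarrow> linear (Tr c d z)"
  using Tr_derivative has_derivative_linear by blast

lemma Tr_complex: "c \<in> A \<Longrightarrow> d \<in> A \<Longrightarrow> z \<in> covl c d \<Longrightarrow> Tr c d z (k *s v) = k *s Tr c d z v"
  using holo by (auto simp: holomorphic_map_on_def Tr_def)

lemma tran_in: "c \<in> A \<Longrightarrow> d \<in> A \<Longrightarrow> z \<in> covl c d \<Longrightarrow> tran c d z \<in> covl d c"
  by (auto simp: covl_def tran_def civ_chart)

lemma civ_tran: "c \<in> A \<Longrightarrow> d \<in> A \<Longrightarrow> z \<in> covl c d \<Longrightarrow> civ d (tran c d z) = civ c z"
  by (auto simp: covl_def tran_def civ_chart)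

lemma Tr_self: "c \<in> A \<Longrightarrow> z \<in> cdom c \<Longrightarrow> Tr c c z = id"
proof -
  assume c: "c \<in> A" and z: "z \<in> cdom c"
  have "(tran c c has_derivative id) (at z)"
    by (rule has_derivative_transform_within_open[OF has_derivative_id chart_props(2)[OF c] z])
      (simp add: tran_def chart_civ c)
  then show ?thesis unfolding Tr_def using frechet_derivative_at by metis
qed

lemma Tr_cocycle:
  assumes "c \<in> A" "d \<in> A" "e \<in> A" "z \<in> covl c d" "z \<in> covl c e"
  shows "Tr c e z = Tr d e (tran c d z) \<circ> Tr c d z"
proof -
  have "civ c z \<in> fst d" "civ c z \<in> fst e" using assms(4,5) by (auto simp: covl_eq[OF assms(1)])
  then have de: "tran c d z \<in> covl d e" by (simp add: tran_def covl_I)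
  have "((\<lambda>z. tran d e (tran c d z)) has_derivative (\<lambda>v. Tr d e (tran c d z) (Tr c d z v))) (at z)"
    by (rule has_derivative_compose[OF Tr_derivative[OF assms(1,2,4)] Tr_derivative[OF assms(2,3) de]])
  then have "(tran c e has_derivative (Tr d e (tran c d z) \<circ> Tr c d z)) (at z)"
    unfolding o_def
    by (rule has_derivative_transform_within_open[OF _ open_covl[OF assms(1,2)] assms(4)])
      (use assms in \<open>simp add: tran_def covl_eq civ_chart\<close>)
  then show ?thesis unfolding Tr_def[of c e] using frechet_derivative_at by metis
qed

lemma Tr_inverse:
  assumes "c \<in> A" "d \<in> A" "z \<in> covl c d"
  shows "Tr d c (tran c d z) (Tr c d z v) = v" "inj (Tr c d z)"
proof -
  have z: "z \<in> cdom c" using assms covl_subset by blast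
  have "Tr c c z = Tr d c (tran c d z) \<circ> Tr c d z"
    using z by (intro Tr_cocycle assms) (simp add: covl_self)
  then have "id = Tr d c (tran c d z) \<circ> Tr c d z" by (simp only: Tr_self[OF assms(1) z])
  then have "Tr d c (tran c d z) (Tr c d z v) = v" for v by (metis comp_apply id_apply)
  then show "Tr d c (tran c d z) (Tr c d z v) = v" "inj (Tr c d z)" by (auto intro: inj_on_inverseI)
qed

text \<open>Values of a form at a point refer to \<open>chart_at\<close>, which may jump with the
  point. The cocycle rule for three charts eliminates it and leaves an honest pullback between c and
  d.\<close>

lemma in_chart_transform:
  assumes "c \<in> A" "d \<in> A" "z \<in> covl c d"
  shows "in_chart A c u z = pb (Tr c d z) (in_chart A d u (tran c d z))"
proof -
  let ?e = "chart_at A (civ c z)"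
  have "z \<in> covl c ?e" using assms chart_at(2) by (auto simp: covl_eq)
  then have "Tr c ?e z = Tr d ?e (tran c d z) \<circ> Tr c d z"
    by (intro Tr_cocycle assms chart_at)
  then show ?thesis
    by (simp add: in_chart_eq civ_tran[OF assms] pb_def[abs_def])
qed

lemma covl_chart_at: "c \<in> A \<Longrightarrow> z \<in> cdom c \<Longrightarrow> z \<in> covl c (chart_at A (civ c z))"
  using chart_at(2) by (simp add: covl_eq)

lemma in_chart_chart_at: "in_chart A (chart_at A x) u (snd (chart_at A x) x) = u x"
proof -
  note c = chart_at[of x]
  have "Tr (chart_at A x) (chart_at A x) (snd (chart_at A x) x) = id"
    by (rule Tr_self[OF c(1) chart_in[OF c(2)]])
  then show ?thesis by (simp add: in_chart_eq civ_chart[OF c] pb_def[abs_def])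
qed

lemma form_eqI: "c \<in> A \<Longrightarrow> x \<in> fst c \<Longrightarrow> in_chart A c u (snd c x) = in_chart A c v (snd c x) \<Longrightarrow> u x = v x"
proof -
  assume c: "c \<in> A" "x \<in> fst c" "in_chart A c u (snd c x) = in_chart A c v (snd c x)"
  let ?e = "chart_at A x"
  have ov: "snd ?e x \<in> covl ?e c" by (intro covl_I chart_at c)
  have t: "tran ?e c (snd ?e x) = snd c x" by (simp add: tran_def civ_chart chart_at)
  have "u x = pb (Tr ?e c (snd ?e x)) (in_chart A c u (snd c x))" for u :: "('a, 'n) form"
    using in_chart_transform[OF chart_at(1) c(1) ov, of u] by (simp add: in_chart_chart_at t)
  then show "u x = v x" using c(3) by metis
qed

lemma forms_alternating: "u \<in> forms A \<Longrightarrow> alternating (u x)"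
  by (simp add: forms_def)

lemma forms_sfield: "u \<in> forms A \<Longrightarrow> c \<in> A \<Longrightarrow> sfield (cdom c) (in_chart A c u)"
  unfolding sfield_def
proof (intro conjI ballI allI)
  fix z assume u: "u \<in> forms A" and c: "c \<in> A" and z: "z \<in> cdom c"
  show "alternating (in_chart A c u z)"
    unfolding in_chart_eq using u c
    by (intro alternating_pb linear_Tr chart_at covl_chart_at z forms_alternating)
qed (auto simp: forms_def cdom_def)

lemma forms_I: "(\<And>c. c \<in> A \<Longrightarrow> sfield (cdom c) (in_chart A c u)) \<Longrightarrow> u \<in> forms A"
proof -
  assume s: "\<And>c. c \<in> A \<Longrightarrow> sfield (cdom c) (in_chart A c u)"
  have "alternating (u x)" for x
    using sfieldD(1)[OF s[OF chart_at(1)] chart_in[OF chart_at(2)], of x] by (simp add: in_chart_chart_at)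
  then show ?thesis using s by (auto simp: forms_def sfield_def cdom_def)
qed

text \<open>\<open>ext_d\<close> differentiates at each point in the preferred chart of that point.
  Near the point the readings in this chart and in c are pullbacks of each other, and d commutes
  with pullback.\<close>

lemma in_chart_ext_d:
  assumes u: "u \<in> forms A" and c: "c \<in> A" and z: "z \<in> cdom c"
  shows "in_chart A c (ext_d A u) z = fd (in_chart A c u) z"
proof -
  let ?x = "civ c z"
  let ?e = "chart_at A ?x"
  have ext: "ext_d A u x = fd (in_chart A (chart_at A x) u) (snd (chart_at A x) x)" for x
    by (rule ext) (simp add: ext_d_def fd_def alt_sum_def dfield_def)
  have e: "?e \<in> A" by (rule chart_at)
  have zo: "z \<in> covl c ?e" by (rule covl_chart_at[OF c z])
  have t: "tran c ?e z = snd ?e ?x" by (simp add: tran_def)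
  have se: "sfield (cdom ?e) (in_chart A ?e u)" by (rule forms_sfield[OF u e])
  have dom: "tran c ?e y \<in> cdom ?e" if "y \<in> covl c ?e" for y
    using tran_in[OF c e that] covl_subset by blast
  note p = sfield_pullback[OF open_covl[OF c e] chart_props(2)[OF e] smooth_tran[OF c e] dom se]
  have "in_chart A c (ext_d A u) z = pb (Tr c ?e z) (fd (in_chart A ?e u) (tran c ?e z))"
    by (simp add: in_chart_eq[of A c "ext_d A u"] ext t)
  also have "\<dots> = fd (\<lambda>y. pb (Tr c ?e y) (in_chart A ?e u (tran c ?e y))) z"
    using p(2)[of z] zo by (simp add: Tr_def)
  also have "\<dots> = fd (in_chart A c u) z"
  proof (rule fd_cong[OF open_covl[OF c e] zo, symmetric])
    show "sfield (covl c ?e) (\<lambda>y. pb (Tr c ?e y) (in_chart A ?e u (tran c ?e y)))"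
      using p(1) by (simp add: Tr_def)
  qed (simp add: in_chart_transform[OF c e])
  finally show ?thesis .
qed

lemma ext_d_forms: "u \<in> forms A \<Longrightarrow> ext_d A u \<in> forms A"
proof (rule forms_I)
  fix c assume u: "u \<in> forms A" and c: "c \<in> A"
  show "sfield (cdom c) (in_chart A c (ext_d A u))"
    using sfield_fd[OF chart_props(2)[OF c] forms_sfield[OF u c]]
      sfield_cong[OF chart_props(2)[OF c], of "in_chart A c (ext_d A u)" "fd (in_chart A c u)"]
      in_chart_ext_d[OF u c] by simp
qed

end

section \<open>Change of variables for Borel sets and integrals\<close>

lemma borel_image_homeomorphism:
  fixes \<Phi> :: "'a::topological_space \<Rightarrow> 'b::topological_space"
  assumes "open T" "continuous_on T \<Psi>" "\<And>w. w \<in> T \<Longrightarrow> \<Psi> w \<in> S \<and> \<Phi> (\<Psi> w) = w" "\<And>z. z \<in> S \<Longrightarrow> \<Phi> z \<in> T \<and> \<Psi> (\<Phi> z) = z"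
    and "E \<in> sets borel" "E \<subseteq> S"
  shows "\<Phi> ` E \<in> sets borel"
proof -
  have "\<Psi> \<in> borel_measurable (restrict_space borel T)"
    by (rule borel_measurable_continuous_on_restrict[OF assms(2)])
  from measurable_sets[OF this assms(5)] have "\<Psi> -` E \<inter> T \<in> sets (restrict_space borel T)"
    by (simp add: space_restrict_space)
  then have "\<Psi> -` E \<inter> T \<in> sets borel"
    using assms(1) by (subst (asm) sets_restrict_space_iff) auto
  moreover have "\<Phi> ` E = \<Psi> -` E \<inter> T" using assms(3,4,6) by force
  ultimately show ?thesis by simp
qed

text \<open>Change of variables in real coordinates, with the real Jacobian rewritten by
  \<open>det_realify\<close>. The formula used there is for real-valued measures, and boundedness
  makes the measure of the image finite.\<close>

lemma emeasure_image_bounded: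
  fixes \<Phi> :: "complex^'n::finite \<Rightarrow> complex^'n"
  assumes S: "open S" and \<Phi>: "\<And>z. z \<in> S \<Longrightarrow> (\<Phi> has_derivative (\<lambda>v. M z *v v)) (at z)" and inj: "inj_on \<Phi> S"
    and M: "\<And>z. z \<in> S \<Longrightarrow> invertible (M z)" "continuous_on S (\<lambda>z. det (M z))"
    and E: "E \<in> sets borel" "E \<subseteq> S" "\<Phi> ` E \<in> sets borel" "bounded (\<Phi> ` E)"
  shows "emeasure lborel (\<Phi> ` E) = (\<integral>\<^sup>+z. indicator E z * ennreal ((cmod (det (M z)))\<^sup>2) \<partial>lborel)"
proof -
  let ?R = "rvec ` E" and ?f = "\<lambda>x. rvec (\<Phi> (cvec x))" and ?f' = "\<lambda>x h. rvec (M (cvec x) *v cvec h)"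
  let ?h = "\<lambda>z. indicator E z * (cmod (det (M z)))\<^sup>2 :: real"
  have mr: "(rvec :: complex^'n \<Rightarrow> _) \<in> borel_measurable borel" and mc: "(cvec :: _ \<Rightarrow> complex^'n) \<in> borel_measurable borel"
    by (rule borel_measurable_continuous_onI, rule linear_continuous_on, rule bounded_linear_rvec,
        rule borel_measurable_continuous_onI, rule linear_continuous_on, rule bounded_linear_cvec)
  have im: "rvec ` X = cvec -` X" for X :: "(complex^'n) set"
    by (auto simp: image_iff) (metis rvec_cvec)
  have bR: "rvec ` X \<in> sets borel" if "X \<in> sets borel" for X :: "(complex^'n) set"
    using measurable_sets[OF mc that] by (simp add: im)
  have R: "?R \<in> sets lebesgue" using bR[OF E(1)] by (simp add: sets_completionI_sets)
  have d: "(?f has_derivative ?f' x) (at x within ?R)" if "x \<in> ?R" for x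
  proof (rule has_derivative_at_withinI)
    have "cvec x \<in> S" using that E(2) by auto
    from has_derivative_compose[OF bounded_linear_imp_has_derivative[OF bounded_linear_cvec] \<Phi>[OF this]]
    show "(?f has_derivative ?f' x) (at x)"
      by (rule bounded_linear.has_derivative[OF bounded_linear_rvec])
  qed
  have i: "inj_on ?f ?R"
    using inj E(2) by (intro inj_onI) (auto, metis cvec_rvec inj_onD subsetD)
  have fR: "?f ` ?R = rvec ` \<Phi> ` E" by (simp add: image_image)
  have bim: "rvec ` \<Phi> ` E \<in> sets borel" by (rule bR[OF E(3)])
  have bd: "bounded (rvec ` \<Phi> ` E)" by (rule bounded_linear_image[OF E(4) bounded_linear_rvec])
  have lm: "rvec ` \<Phi> ` E \<in> lmeasurable"
    by (rule bounded_set_imp_lmeasurable[OF bd]) (simp add: bim sets_completionI_sets)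
  have det: "\<bar>det (matrix (?f' x))\<bar> = (cmod (det (M (cvec x))))\<^sup>2" if "x \<in> ?R" for x
    using det_realify[OF M(1), of "cvec x"] that E(2) by (auto simp: realify_def)
  have "((\<lambda>x. \<bar>det (matrix (?f' x))\<bar>) has_integral measure lebesgue (rvec ` \<Phi> ` E)) ?R"
    using has_measure_differentiable_image[OF R d i, of "measure lebesgue (rvec ` \<Phi> ` E)"] lm unfolding fR by simp
  then have "((\<lambda>x. (cmod (det (M (cvec x))))\<^sup>2) has_integral measure lebesgue (rvec ` \<Phi> ` E)) ?R"
    by (subst has_integral_cong[symmetric]) (use det in auto)
  then have "((\<lambda>x. if x \<in> ?R then (cmod (det (M (cvec x))))\<^sup>2 else 0) has_integral measure lebesgue (rvec ` \<Phi> ` E)) UNIV"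
    by (simp add: has_integral_restrict_UNIV)
  moreover have "(\<lambda>x. if x \<in> ?R then (cmod (det (M (cvec x))))\<^sup>2 else 0) = (\<lambda>x. ?h (cvec x))"
    by (rule ext) (simp add: im indicator_def)
  ultimately have hi: "((\<lambda>x. ?h (cvec x)) has_integral measure lebesgue (rvec ` \<Phi> ` E)) UNIV" by simp
  have mh: "?h \<in> borel_measurable borel"
  proof -
    have "(\<lambda>z. indicator S z *\<^sub>R (cmod (det (M z)))\<^sup>2) \<in> borel_measurable borel"
      using M(2) S by (intro borel_measurable_continuous_on_indicator continuous_intros) auto
    then have "(\<lambda>z. indicator E z * (indicator S z *\<^sub>R (cmod (det (M z)))\<^sup>2)) \<in> borel_measurable borel"
      using E(1) by measurable
    also have "(\<lambda>z. indicator E z * (indicator S z *\<^sub>R (cmod (det (M z)))\<^sup>2)) = ?h"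
      by (rule ext) (use E(2) in \<open>auto simp: indicator_def\<close>)
    finally show ?thesis .
  qed
  have mhc: "(\<lambda>x. ?h (cvec x)) \<in> borel_measurable borel" by (rule measurable_compose[OF mc mh])
  have "emeasure lborel (\<Phi> ` E) = emeasure (distr lborel borel rvec) (rvec ` \<Phi> ` E)"
    using bim mr by (subst emeasure_distr) (auto simp: inj_vimage_image_eq inj_on_inverseI[of UNIV cvec])
  also have "\<dots> = emeasure lborel (rvec ` \<Phi> ` E)" by (simp add: distr_rvec)
  also have "\<dots> = ennreal (measure lebesgue (rvec ` \<Phi> ` E))"
    using emeasure_eq_measure2[OF lm] bim by simp
  also have "\<dots> = (\<integral>\<^sup>+x. ennreal (?h (cvec x)) \<partial>lborel)"
    by (rule nn_integral_has_integral_lborel[OF mhc _ hi, symmetric]) simp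
  also have "\<dots> = (\<integral>\<^sup>+x. ennreal (?h (cvec x)) \<partial>distr lborel borel rvec)" by (simp add: distr_rvec)
  also have "\<dots> = (\<integral>\<^sup>+z. ennreal (?h z) \<partial>lborel)"
    using mr mhc by (subst nn_integral_distr) auto
  also have "\<dots> = (\<integral>\<^sup>+z. indicator E z * ennreal ((cmod (det (M z)))\<^sup>2) \<partial>lborel)"
    by (intro nn_integral_cong) (simp add: indicator_def)
  finally show ?thesis .
qed

lemma borel_measurable_jacobian:
  fixes M :: "complex^'n::finite \<Rightarrow> complex^'n^'n"
  assumes "open S" "continuous_on S (\<lambda>z. det (M z))"
  shows "(\<lambda>z. indicator S z * ennreal ((cmod (det (M z)))\<^sup>2)) \<in> borel_measurable lborel"
proof -
  have "(\<lambda>z. indicator S z *\<^sub>R (cmod (det (M z)))\<^sup>2) \<in> borel_measurable borel"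
    using assms by (intro borel_measurable_continuous_on_indicator continuous_intros) auto
  then have "(\<lambda>z. ennreal (indicator S z *\<^sub>R (cmod (det (M z)))\<^sup>2)) \<in> borel_measurable lborel" by simp
  also have "(\<lambda>z. ennreal (indicator S z *\<^sub>R (cmod (det (M z)))\<^sup>2)) = (\<lambda>z. indicator S z * ennreal ((cmod (det (M z)))\<^sup>2))"
    by (rule ext) (simp add: indicator_def)
  finally show ?thesis .
qed

lemma emeasure_image:
  fixes \<Phi> :: "complex^'n::finite \<Rightarrow> complex^'n"
  assumes S: "open S" and \<Phi>: "\<And>z. z \<in> S \<Longrightarrow> (\<Phi> has_derivative (\<lambda>v. M z *v v)) (at z)" and T: "open T" "continuous_on T \<Psi>"
    and inv: "\<And>w. w \<in> T \<Longrightarrow> \<Psi> w \<in> S \<and> \<Phi> (\<Psi> w) = w" "\<And>z. z \<in> S \<Longrightarrow> \<Phi> z \<in> T \<and> \<Psi> (\<Phi> z) = z"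
    and M: "\<And>z. z \<in> S \<Longrightarrow> invertible (M z)" "continuous_on S (\<lambda>z. det (M z))"
    and E: "E \<in> sets borel" "E \<subseteq> S"
  shows "emeasure lborel (\<Phi> ` E) = (\<integral>\<^sup>+z. indicator E z * ennreal ((cmod (det (M z)))\<^sup>2) \<partial>lborel)"
proof -
  have inj: "inj_on \<Phi> S" using inv(2) by (metis inj_onI)
  \<comment> \<open>Exhaustion by the parts of E whose image lies in a ball of radius k; both sides
    are measures and are continuous along it.\<close>
  define F where "F k = E - {z \<in> S. norm (\<Phi> z) > real k}" for k :: nat
  have c\<Phi>: "continuous_on S \<Phi>"
    using \<Phi> has_derivative_continuous continuous_at_imp_continuous_on by blast
  have "{z \<in> S. norm (\<Phi> z) > real k} = S \<inter> \<Phi> -` (- cball 0 (real k))" for k by auto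
  then have op: "open {z \<in> S. norm (\<Phi> z) > real k}" for k
    using continuous_open_preimage[OF c\<Phi> S open_Compl[OF closed_cball[of 0 "real k"]]] by simp
  have F: "F k \<in> sets borel" "F k \<subseteq> S" "F k \<subseteq> E" for k
    using E borel_open[OF op[of k]] unfolding F_def by (blast intro: sets.Diff)+
  have im: "\<Phi> ` F k \<in> sets borel" for k by (rule borel_image_homeomorphism[OF T inv F(1,2)])
  have FE: "(\<Union>k. F k) = E"
  proof -
    have "\<exists>k. norm (\<Phi> z) \<le> real k" for z by (rule real_arch_simple)
    then show ?thesis by (auto simp: F_def not_less) (meson not_less)
  qed
  have incF: "incseq F" by (auto simp: incseq_def F_def)
  have bdd: "bounded (\<Phi> ` F k)" for k
    unfolding bounded_iff using F(2)[of k] by (intro exI[of _ "real k"]) (auto simp: F_def)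
  let ?q = "\<lambda>z. indicator S z * ennreal ((cmod (det (M z)))\<^sup>2)"
  note mq = borel_measurable_jacobian[OF S M(2)]
  let ?Q = "density lborel ?q"
  have Q: "emeasure ?Q X = (\<integral>\<^sup>+z. indicator X z * ennreal ((cmod (det (M z)))\<^sup>2) \<partial>lborel)" if "X \<in> sets borel" "X \<subseteq> S" for X
    using that mq by (subst emeasure_density) (auto intro!: nn_integral_cong simp: indicator_def)
  have eq: "emeasure lborel (\<Phi> ` F k) = emeasure ?Q (F k)" for k
    unfolding Q[OF F(1,2)] by (rule emeasure_image_bounded[OF S \<Phi> inj M F(1,2) im bdd])
  have "emeasure lborel (\<Phi> ` E) = (SUP k. emeasure lborel (\<Phi> ` F k))"
    using im incF by (subst SUP_emeasure_incseq) (auto simp: incseq_def image_mono FE image_UN[symmetric])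
  also have "\<dots> = (SUP k. emeasure ?Q (F k))" by (simp add: eq)
  also have "\<dots> = emeasure ?Q E"
    using F incF by (subst SUP_emeasure_incseq) (auto simp: FE)
  finally show ?thesis by (simp add: Q E)
qed

text \<open>The formula for sets says that the density \<open>|det M|\<^sup>2\<close> on S is pushed
  forward by \<Phi> to Lebesgue measure on T. Integrals then follow from the rules for image
  measures and densities.\<close>

lemma nn_integral_image:
  fixes \<Phi> :: "complex^'n::finite \<Rightarrow> complex^'n"
  assumes S: "open S" and \<Phi>: "\<And>z. z \<in> S \<Longrightarrow> (\<Phi> has_derivative (\<lambda>v. M z *v v)) (at z)" and T: "open T" "continuous_on T \<Psi>"
    and inv: "\<And>w. w \<in> T \<Longrightarrow> \<Psi> w \<in> S \<and> \<Phi> (\<Psi> w) = w" "\<And>z. z \<in> S \<Longrightarrow> \<Phi> z \<in> T \<and> \<Psi> (\<Phi> z) = z"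
    and M: "\<And>z. z \<in> S \<Longrightarrow> invertible (M z)" "continuous_on S (\<lambda>z. det (M z))"
    and E: "E \<in> sets borel" "E \<subseteq> S"
    and r: "continuous_on T r" "\<And>w. w \<in> T \<Longrightarrow> 0 \<le> r w"
  shows "(\<integral>\<^sup>+w. indicator (\<Phi> ` E) w * ennreal (r w) \<partial>lborel)
    = (\<integral>\<^sup>+z. indicator E z * ennreal (r (\<Phi> z) * (cmod (det (M z)))\<^sup>2) \<partial>lborel)"
proof -
  have c\<Phi>: "continuous_on S \<Phi>"
    using \<Phi> has_derivative_continuous continuous_at_imp_continuous_on by blast
  let ?q = "\<lambda>z. indicator S z * ennreal ((cmod (det (M z)))\<^sup>2)"
  note mq = borel_measurable_jacobian[OF S M(2)]
  \<comment> \<open>Extended by 0 outside S to obtain a Borel function on the whole space; the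
    density carries the indicator of S.\<close>
  define \<Phi>' where "\<Phi>' = (\<lambda>z. indicator S z *\<^sub>R \<Phi> z)"
  have m\<Phi>: "\<Phi>' \<in> borel_measurable borel"
    unfolding \<Phi>'_def using S by (intro borel_measurable_continuous_on_indicator c\<Phi>) auto
  have "distr (density lborel ?q) borel \<Phi>' = density lborel (indicator T)"
  proof (rule measure_eqI)
    fix X assume "X \<in> sets (distr (density lborel ?q) borel \<Phi>')"
    then have X: "X \<in> sets borel" by simp
    have P: "S \<inter> \<Phi>' -` X \<in> sets borel" using measurable_sets[OF m\<Phi> X] S by auto
    have im: "\<Phi> ` (S \<inter> \<Phi>' -` X) = T \<inter> X"
    proof (intro equalityI subsetI)
      fix w assume "w \<in> T \<inter> X"
      then show "w \<in> \<Phi> ` (S \<inter> \<Phi>' -` X)"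
        using inv(1)[of w] by (intro image_eqI[of _ _ "\<Psi> w"]) (auto simp: \<Phi>'_def)
    next
      fix w assume "w \<in> \<Phi> ` (S \<inter> \<Phi>' -` X)"
      then obtain z where "z \<in> S" "\<Phi>' z \<in> X" "w = \<Phi> z" by auto
      then show "w \<in> T \<inter> X" using inv(2)[of z] by (simp add: \<Phi>'_def)
    qed
    have "emeasure (distr (density lborel ?q) borel \<Phi>') X = (\<integral>\<^sup>+z. ?q z * indicator (\<Phi>' -` X) z \<partial>lborel)"
      using m\<Phi> X mq measurable_sets[OF m\<Phi> X] by (simp add: emeasure_distr emeasure_density)
    also have "\<dots> = (\<integral>\<^sup>+z. indicator (S \<inter> \<Phi>' -` X) z * ennreal ((cmod (det (M z)))\<^sup>2) \<partial>lborel)"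
      by (intro nn_integral_cong) (auto simp: indicator_def)
    also have "\<dots> = emeasure lborel (T \<inter> X)"
      using emeasure_image[OF S \<Phi> T inv M P] by (simp add: im)
    also have "\<dots> = emeasure (density lborel (indicator T)) X"
      using T(1) X by (simp add: emeasure_density nn_integral_indicator' indicator_inter_arith[symmetric] nn_integral_indicator)
    finally show "emeasure (distr (density lborel ?q) borel \<Phi>') X = emeasure (density lborel (indicator T)) X" .
  qed simp
  note meq = this
  let ?g = "\<lambda>w. indicator (\<Phi> ` E) w * ennreal (indicator T w *\<^sub>R r w)"
  have im: "\<Phi> ` E \<in> sets borel" by (rule borel_image_homeomorphism[OF T inv E])
  have "(\<lambda>w. indicator T w *\<^sub>R r w) \<in> borel_measurable borel"
    using T by (intro borel_measurable_continuous_on_indicator r) auto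
  then have mg: "?g \<in> borel_measurable borel" using im by measurable
  have imT: "\<Phi> ` E \<subseteq> T" using inv(2) E(2) by auto
  have "(\<integral>\<^sup>+w. indicator (\<Phi> ` E) w * ennreal (r w) \<partial>lborel) = (\<integral>\<^sup>+w. indicator T w * ?g w \<partial>lborel)"
    using imT by (intro nn_integral_cong) (auto simp: indicator_def)
  also have "\<dots> = (\<integral>\<^sup>+w. ?g w \<partial>density lborel (indicator T))"
    using T(1) mg by (subst nn_integral_density) auto
  also have "\<dots> = (\<integral>\<^sup>+z. ?g (\<Phi>' z) \<partial>density lborel ?q)"
    unfolding meq[symmetric] using m\<Phi> mg by (subst nn_integral_distr) auto
  also have "\<dots> = (\<integral>\<^sup>+z. ?q z * ?g (\<Phi>' z) \<partial>lborel)"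
    using mq measurable_compose[OF m\<Phi> mg] by (subst nn_integral_density) auto
  also have "\<dots> = (\<integral>\<^sup>+z. indicator E z * ennreal (r (\<Phi> z) * (cmod (det (M z)))\<^sup>2) \<partial>lborel)"
  proof (intro nn_integral_cong)
    fix z
    have "z \<in> S \<Longrightarrow> \<Phi> z \<in> \<Phi> ` E \<longleftrightarrow> z \<in> E" using inv(2) E(2) by (metis image_iff subsetD)
    then show "?q z * ?g (\<Phi>' z) = indicator E z * ennreal (r (\<Phi> z) * (cmod (det (M z)))\<^sup>2)"
      using E(2) inv(2)[of z] r(2)[of "\<Phi> z"]
      by (cases "z \<in> S"; cases "z \<in> E") (auto simp: \<Phi>'_def indicator_def ennreal_mult mult.commute)
  qed
  finally show ?thesis .
qed

lemma det_hmat_pb: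
  fixes L :: "complex^'n::finite \<Rightarrow> complex^'n"
  assumes "invariant_two_form \<sigma>" "\<And>v. L (J v) = J (L v)"
  shows "det (hmat (pb L \<sigma>)) = of_real ((cmod (det (\<chi> k j. L (axis j 1) $ k)))\<^sup>2) * det (hmat \<sigma>)"
proof -
  have "hmat (pb L \<sigma>) = (\<chi> a b. hform \<sigma> (L (axis a 1)) (L (axis b 1)))"
    by (simp add: hmat_def hform_def pb_def assms(2))
  then show ?thesis by (simp add: det_hform[OF assms(1)])
qed

lemma complex_linear_matrix:
  fixes L :: "complex^'n::finite \<Rightarrow> complex^'m::finite"
  assumes "linear L" "\<And>k v. L (k *s v) = k *s L v"
  shows "(\<chi> k j. L (axis j 1) $ k) *v v = L v"
proof -
  have "v = (\<Sum>j\<in>UNIV. v $ j *s axis j 1)"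
    by (simp add: vec_eq_iff axis_def if_distrib cong: if_cong)
  then have "L v = (\<Sum>j\<in>UNIV. v $ j *s L (axis j 1))"
    using linear_sum[OF assms(1), of "\<lambda>j. v $ j *s axis j 1" UNIV] by (simp add: assms(2))
  then show ?thesis by (simp add: vec_eq_iff matrix_vector_mult_def mult.commute)
qed

section \<open>Volume measure\<close>

definition dens :: "('a, 'n::finite) chart set \<Rightarrow> ('a, 'n) form \<Rightarrow> ('a, 'n) chart \<Rightarrow> complex^'n \<Rightarrow> real" where
  "dens A \<omega> c z = 2 ^ CARD('n) * Re (det (hermitian_matrix A c \<omega> z))"

lemma hermitian_matrix_eq: "hermitian_matrix A c \<omega> z = hmat (in_chart A c \<omega> z)"
  by (simp add: hermitian_matrix_def hmat_def hform_def)

locale hermitian_manifold = complex_manifold A for A :: "('a::{t2_space,second_countable_topology}, 'n::finite) chart set" +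
  fixes \<omega> :: "('a, 'n) form"
  assumes metric: "hermitian_metric A \<omega>"
begin

lemma \<omega>_forms: "\<omega> \<in> forms A" using metric by (simp add: hermitian_metric_def)

lemma herm_\<omega>: "herm (\<omega> x)"
proof -
  have c: "bidegree 1 1 (\<omega> x) = \<omega> x" "cnj (\<omega> x vs) = \<omega> x vs" for vs
    using metric unfolding hermitian_metric_def component_def conj_form_def by metis+
  have a: "alternating (\<omega> x)" by (rule forms_alternating[OF \<omega>_forms])
  have "homog 2 (\<omega> x)" using homog_bidegree[of 1 1 "\<omega> x"] by (simp only: c(1) one_add_one)
  moreover have "\<omega> x [J v, J u] = \<omega> x [v, u]" for v u
    using bidegree_1_1[OF a, of v u] unfolding c(1) by simp
  ultimately show ?thesis using metric a c(2) by (simp add: herm_def hermitian_metric_def)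
qed

lemma herm_in_chart: "c \<in> A \<Longrightarrow> z \<in> cdom c \<Longrightarrow> herm (in_chart A c \<omega> z)"
  unfolding in_chart_eq
  by (intro herm_pb linear_Tr Tr_complex Tr_inverse(2) chart_at covl_chart_at herm_\<omega>)

lemma dens_pos: "c \<in> A \<Longrightarrow> z \<in> cdom c \<Longrightarrow> dens A \<omega> c z > 0"
  using det_hmat_pos(2)[OF herm_in_chart] by (simp add: dens_def hermitian_matrix_eq)

lemma smooth_dens: assumes "c \<in> A" shows "smooth_on (cdom c) (dens A \<omega> c)"
proof -
  note o = chart_props(2)[OF assms] and s = sfieldD(2)[OF forms_sfield[OF \<omega>_forms assms]]
  have "smooth_on (cdom c) (\<lambda>z. det (hmat (in_chart A c \<omega> z)))"
    unfolding hmat_def hform_def divide_inverse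
    by (intro smooth_on_det o, simp only: vec_lambda_beta) (intro smooth_on_diff smooth_on_mult smooth_on_const o s)
  then show ?thesis
    unfolding dens_def[abs_def] hermitian_matrix_eq
    by (intro smooth_on_mult smooth_on_const o smooth_on_Re)
qed

definition TrM :: "('a, 'n) chart \<Rightarrow> ('a, 'n) chart \<Rightarrow> complex^'n \<Rightarrow> complex^'n^'n" where
  "TrM c d z = (\<chi> k j. Tr c d z (axis j 1) $ k)"

context
  fixes c d :: "('a, 'n) chart" assumes cd: "c \<in> A" "d \<in> A"
begin

lemma TrM: "z \<in> covl c d \<Longrightarrow> TrM c d z *v v = Tr c d z v"
  unfolding TrM_def by (rule complex_linear_matrix[OF linear_Tr[OF cd] Tr_complex[OF cd]])

lemma invertible_TrM:
  assumes z: "z \<in> covl c d" shows "invertible (TrM c d z)"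
proof -
  have "inj ((*v) (TrM c d z))" using Tr_inverse(2)[OF cd z] by (simp add: TrM[OF z] inj_def)
  then have "\<exists>B. B ** TrM c d z = mat 1" by (simp add: matrix_left_invertible_injective)
  then show ?thesis by (simp add: invertible_left_inverse)
qed

lemma continuous_det_TrM: "continuous_on (covl c d) (\<lambda>z. det (TrM c d z))"
proof -
  note o = open_covl[OF cd]
  have "smooth_on (covl c d) (\<lambda>z. Tr c d z (axis j 1) $ k)" for j k
    unfolding Tr_def by (intro smooth_on_bounded_linear[OF o bounded_linear_vec_nth] smooth_on_frechet[OF smooth_tran[OF cd]])
  then have "smooth_on (covl c d) (\<lambda>z. det (TrM c d z))"
    unfolding TrM_def by (intro smooth_on_det o) simp
  then show ?thesis by (rule smooth_on_continuous)
qed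

text \<open>The Hermitian determinant scales by the squared modulus of the complex Jacobian
  determinant, which is exactly the real Jacobian; so the chart densities describe one
  measure.\<close>

lemma dens_transform:
  assumes z: "z \<in> covl c d"
  shows "dens A \<omega> c z = dens A \<omega> d (tran c d z) * (cmod (det (TrM c d z)))\<^sup>2"
proof -
  have t: "tran c d z \<in> cdom d" using tran_in[OF cd z] covl_subset by blast
  show ?thesis
    unfolding dens_def hermitian_matrix_eq in_chart_transform[OF cd z]
    by (subst det_hmat_pb) (simp_all add: herm_invariant herm_in_chart cd t Tr_complex[OF cd z] TrM_def)
qed

end

abbreviation gvol :: "('a, 'n) chart \<Rightarrow> 'a set \<Rightarrow> ennreal" where
  "gvol c X \<equiv> \<integral>\<^sup>+z. indicator (snd c ` X) z * ennreal (dens A \<omega> c z) \<partial>lborel"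

lemma gvol_change:
  assumes cd: "c \<in> A" "d \<in> A" and X: "X \<in> sets borel" "X \<subseteq> fst c" "X \<subseteq> fst d"
  shows "gvol d X = gvol c X"
proof -
  have E: "snd c ` X \<in> sets borel"
    by (rule borel_image_homeomorphism[OF chart_props(2)[OF cd(1)] continuous_civ[OF cd(1)], of "fst c"])
      (use X cd in \<open>auto simp: civ_in chart_civ civ_chart chart_in\<close>)
  have Es: "snd c ` X \<subseteq> covl c d" using X by (auto simp: covl_def)
  have im: "tran c d ` snd c ` X = snd d ` X"
    using X(2) by (force simp: image_image tran_def civ_chart[OF cd(1)])
  have der: "(tran c d has_derivative (\<lambda>v. TrM c d z *v v)) (at z)" if "z \<in> covl c d" for z
    unfolding TrM[OF cd that] by (rule Tr_derivative[OF cd that])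
  have sub: "covl d c \<subseteq> cdom d" by (rule covl_subset)
  have inv: "tran d c w \<in> covl c d \<and> tran c d (tran d c w) = w" if "w \<in> covl d c" for w
    using that by (intro conjI tran_in[OF cd(2,1)]) (simp_all add: covl_eq[OF cd(2)] tran_def civ_chart chart_civ cd)
  have inv2: "tran c d z \<in> covl d c \<and> tran d c (tran c d z) = z" if "z \<in> covl c d" for z
    using that by (intro conjI tran_in[OF cd]) (simp_all add: covl_eq[OF cd(1)] tran_def civ_chart chart_civ cd)
  have "gvol d X = (\<integral>\<^sup>+z. indicator (snd c ` X) z * ennreal (dens A \<omega> d (tran c d z) * (cmod (det (TrM c d z)))\<^sup>2) \<partial>lborel)"
    unfolding im[symmetric]
  proof (rule nn_integral_image[OF open_covl[OF cd] der open_covl[OF cd(2,1)] _ inv inv2 invertible_TrM[OF cd] continuous_det_TrM[OF cd] E Es])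
    show "continuous_on (covl d c) (tran d c)" by (rule smooth_on_continuous[OF smooth_tran[OF cd(2,1)]])
    show "continuous_on (covl d c) (dens A \<omega> d)"
      by (rule continuous_on_subset[OF smooth_on_continuous[OF smooth_dens[OF cd(2)]] sub])
    show "0 \<le> dens A \<omega> d w" if "w \<in> covl d c" for w
      using dens_pos[OF cd(2)] that sub by (meson less_imp_le subsetD)
  qed
  also have "\<dots> = gvol c X"
    by (intro nn_integral_cong) (use Es in \<open>auto simp: indicator_def dens_transform[OF cd]\<close>)
  finally show ?thesis .
qed

text \<open>The image of the chart density under the inverse chart, as a measure on the whole
  manifold. The density is zero outside \<open>cdom c\<close>, where the map takes the value
  \<open>undefined\<close>.\<close>

definition nvol :: "('a, 'n) chart \<Rightarrow> 'a measure" where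
  "nvol c = distr (density lborel (\<lambda>z. ennreal (indicator (cdom c) z * dens A \<omega> c z))) borel
     (\<lambda>z. if z \<in> cdom c then civ c z else undefined)"

lemma measurable_civ: "c \<in> A \<Longrightarrow> (\<lambda>z. if z \<in> cdom c then civ c z else undefined) \<in> borel_measurable borel"
  by (subst measurable_If_restrict_space_iff)
    (simp_all add: chart_props(2) borel_measurable_continuous_on_restrict continuous_civ)

lemma measurable_dens: "c \<in> A \<Longrightarrow> (\<lambda>z. indicator (cdom c) z * dens A \<omega> c z) \<in> borel_measurable borel"
  using borel_measurable_continuous_on_indicator[OF _ smooth_on_continuous[OF smooth_dens]] chart_props(2)
  by simp

lemma sets_nvol [simp]: "sets (nvol c) = sets borel" by (simp add: nvol_def)

lemma emeasure_nvol:
  assumes c: "c \<in> A" and X: "X \<in> sets borel"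
  shows "emeasure (nvol c) X = gvol c (X \<inter> fst c)"
proof -
  let ?f = "\<lambda>z. if z \<in> cdom c then civ c z else undefined"
  have m: "?f -` X \<in> sets borel" using measurable_sets[OF measurable_civ[OF c] X] by simp
  have "emeasure (nvol c) X = (\<integral>\<^sup>+z. ennreal (indicator (cdom c) z * dens A \<omega> c z) * indicator (?f -` X) z \<partial>lborel)"
    unfolding nvol_def using measurable_civ[OF c] measurable_dens[OF c] X m
    by (simp add: emeasure_distr emeasure_density)
  also have "\<dots> = gvol c (X \<inter> fst c)"
  proof (intro nn_integral_cong)
    fix z
    have "z \<in> snd c ` (X \<inter> fst c) \<longleftrightarrow> z \<in> cdom c \<and> civ c z \<in> X"
    proof
      assume "z \<in> cdom c \<and> civ c z \<in> X"
      then show "z \<in> snd c ` (X \<inter> fst c)"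
        by (intro image_eqI[of _ _ "civ c z"]) (simp_all add: chart_civ[OF c] civ_in[OF c])
    qed (auto simp: chart_in civ_chart[OF c])
    then show "ennreal (indicator (cdom c) z * dens A \<omega> c z) * indicator (?f -` X) z
      = indicator (snd c ` (X \<inter> fst c)) z * ennreal (dens A \<omega> c z)"
      by (auto simp: indicator_def)
  qed
  finally show ?thesis .
qed

section \<open>Existence and uniqueness of the volume measure\<close>

lemma countable_charts: obtains C :: "nat \<Rightarrow> ('a, 'n) chart" where "\<And>i. C i \<in> A" "(\<Union>i. fst (C i)) = UNIV"
proof -
  obtain F where F: "F \<subseteq> fst ` A" "countable F" "\<Union>F = \<Union>(fst ` A)"
    using Lindelof[of "fst ` A"] chart_props(1) by (metis imageE)
  have "\<Union>F = UNIV" using F(3) chart_at by (metis UNIV_eq_I UnionI image_eqI)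
  then have "F \<noteq> {}" by auto
  have "\<exists>c. c \<in> A \<and> fst c = from_nat_into F i" for i
    using from_nat_into[OF \<open>F \<noteq> {}\<close>, of i] F(1) by (metis imageE subsetD)
  then obtain C where C: "\<And>i. C i \<in> A \<and> fst (C i) = from_nat_into F i" by metis
  have "(\<Union>i. fst (C i)) = \<Union>F"
    using range_from_nat_into[OF \<open>F \<noteq> {}\<close> F(2)] C by simp
  then have "(\<Union>i. fst (C i)) = UNIV" using \<open>\<Union>F = UNIV\<close> by (rule trans)
  moreover have "C i \<in> A" for i using C[of i] by (rule conjunct1)
  ultimately show ?thesis by (intro that)
qed

text \<open>\<open>vol\<close> is a definite description. Existence: countably many charts yield a
  disjoint Borel partition P, each piece is measured in its own chart, and
  \<open>gvol_change\<close> gives the right value in every other chart. Uniqueness: the values on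
  Borel subsets of the pieces are prescribed.\<close>

lemma vol_props: "sets (vol A \<omega>) = sets borel"
  "\<And>c X. c \<in> A \<Longrightarrow> X \<in> sets borel \<Longrightarrow> X \<subseteq> fst c \<Longrightarrow> emeasure (vol A \<omega>) X = gvol c X"
proof -
  obtain C :: "nat \<Rightarrow> ('a, 'n) chart" where C: "\<And>i. C i \<in> A" "(\<Union>i. fst (C i)) = UNIV"
    by (rule countable_charts) (rule that)
  define P where "P = disjointed (\<lambda>i. fst (C i))"
  have Pb: "P i \<in> sets borel" for i
    unfolding P_def disjointed_def by (intro sets.Diff sets.finite_UN borel_open chart_props(1) C(1)) simp
  have Ps: "P i \<subseteq> fst (C i)" for i using disjointed_subset by (simp add: P_def)
  have Pu: "(\<Union>i. P i) = UNIV" using UN_disjointed_eq[of "\<lambda>i. fst (C i)"] C(2) by (simp add: P_def)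
  have Pd: "disjoint_family P" unfolding P_def by (rule disjoint_family_disjointed)
  let ?\<mu>0 = "\<lambda>X. \<Sum>i. emeasure (nvol (C i)) (X \<inter> P i)"
  define \<mu> where "\<mu> = measure_of UNIV (sets (borel :: 'a measure)) ?\<mu>0"
  have sets\<mu>: "sets \<mu> = sets borel" unfolding \<mu>_def using sets.sigma_sets_eq[of "borel :: 'a measure"] by simp
  have \<mu>: "emeasure \<mu> X = ?\<mu>0 X" if "X \<in> sets borel" for X
    unfolding \<mu>_def
  proof (rule emeasure_measure_of_sigma)
    show "sigma_algebra UNIV (sets (borel :: 'a measure))" using sets.sigma_algebra_axioms[of "borel :: 'a measure"] by simp
    show "positive (sets borel) ?\<mu>0" by (simp add: positive_def)
    show "countably_additive (sets borel) ?\<mu>0"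
    proof (rule countably_additiveI)
      fix X :: "nat \<Rightarrow> 'a set" assume X: "range X \<subseteq> sets borel" "disjoint_family X" "(\<Union>i. X i) \<in> sets borel"
      have "(\<Sum>j. ?\<mu>0 (X j)) = (\<Sum>j. \<integral>\<^sup>+i. emeasure (nvol (C i)) (X j \<inter> P i) \<partial>count_space UNIV)"
        by (simp add: nn_integral_count_space_nat)
      also have "\<dots> = (\<integral>\<^sup>+i. (\<Sum>j. emeasure (nvol (C i)) (X j \<inter> P i)) \<partial>count_space UNIV)"
        by (subst nn_integral_suminf) auto
      also have "\<dots> = (\<integral>\<^sup>+i. emeasure (nvol (C i)) (\<Union>j. X j \<inter> P i) \<partial>count_space UNIV)"
        using X Pb by (intro nn_integral_cong suminf_emeasure) (auto simp: disjoint_family_on_def)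
      also have "\<dots> = ?\<mu>0 (\<Union>j. X j)" by (simp add: nn_integral_count_space_nat)
      finally show "(\<Sum>j. ?\<mu>0 (X j)) = ?\<mu>0 (\<Union>j. X j)" .
    qed
  qed (rule that)
  have split: "emeasure \<nu> X = (\<Sum>i. emeasure \<nu> (X \<inter> P i))" if "sets \<nu> = sets borel" "X \<in> sets borel" for \<nu> :: "'a measure" and X
  proof -
    have "disjoint_family (\<lambda>i. X \<inter> P i)" using Pd unfolding disjoint_family_on_def by blast
    then have "(\<Sum>i. emeasure \<nu> (X \<inter> P i)) = emeasure \<nu> (\<Union>i. X \<inter> P i)"
      using that Pb by (intro suminf_emeasure) auto
    also have "(\<Union>i. X \<inter> P i) = X" using Pu by auto
    finally show ?thesis by simp
  qed
  let ?Q = "\<lambda>\<mu>. sets \<mu> = sets borel \<and> (\<forall>c\<in>A. \<forall>S\<in>sets borel. S \<subseteq> fst c \<longrightarrow> emeasure \<mu> S = gvol c S)"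
  have Q\<mu>: "?Q \<mu>"
  proof (intro conjI ballI impI sets\<mu>)
    fix c X assume c: "c \<in> A" and X: "X \<in> sets borel" "X \<subseteq> fst c"
    have "emeasure (nvol (C i)) (X \<inter> P i) = emeasure (nvol c) (X \<inter> P i)" for i
    proof -
      have s: "X \<inter> P i \<in> sets borel" "X \<inter> P i \<subseteq> fst (C i)" "X \<inter> P i \<subseteq> fst c" using X Pb Ps by auto
      then show ?thesis
        using gvol_change[OF c C(1) s(1,3,2)] by (simp add: emeasure_nvol[OF C(1)] emeasure_nvol[OF c] Int_absorb2)
    qed
    then have "emeasure \<mu> X = (\<Sum>i. emeasure (nvol c) (X \<inter> P i))" by (simp add: \<mu>[OF X(1)])
    also have "\<dots> = emeasure (nvol c) X" by (rule split[symmetric]) (simp_all add: X)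
    finally show "emeasure \<mu> X = gvol c X" using X by (simp add: emeasure_nvol[OF c] Int_absorb2)
  qed
  have uniq: "\<nu> = \<mu>" if Q: "?Q \<nu>" for \<nu>
  proof (rule measure_eqI)
    show "sets \<nu> = sets \<mu>" using Q by (simp add: sets\<mu>)
    fix X assume "X \<in> sets \<nu>"
    then have X: "X \<in> sets borel" using Q by simp
    have "emeasure \<nu> (X \<inter> P i) = emeasure \<mu> (X \<inter> P i)" for i
    proof -
      have s: "X \<inter> P i \<in> sets borel" "X \<inter> P i \<subseteq> fst (C i)" using X Pb Ps[of i] by auto
      have "emeasure \<nu> (X \<inter> P i) = gvol (C i) (X \<inter> P i)" using conjunct2[OF Q] C(1)[of i] s by blast
      also have "\<dots> = emeasure \<mu> (X \<inter> P i)" using conjunct2[OF Q\<mu>] C(1)[of i] s by simp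
      finally show ?thesis .
    qed
    then show "emeasure \<nu> X = emeasure \<mu> X" using split[of \<nu> X] split[of \<mu> X] Q sets\<mu> X by simp
  qed
  have "vol A \<omega> = \<mu>"
    unfolding vol_def dens_def[symmetric] by (rule the_equality, rule Q\<mu>, rule uniq)
  with Q\<mu> show "sets (vol A \<omega>) = sets borel"
    "\<And>c X. c \<in> A \<Longrightarrow> X \<in> sets borel \<Longrightarrow> X \<subseteq> fst c \<Longrightarrow> emeasure (vol A \<omega>) X = gvol c X" by auto
qed

text \<open>Restricting \<open>vol\<close> to the domain of c gives \<open>nvol c\<close>, and f
  sees only this restriction; the integral is then transported along the chart.\<close>

lemma vol_integral:
  fixes f :: "'a \<Rightarrow> complex"
  assumes c: "c \<in> A" and f: "f \<in> borel_measurable borel" "\<And>x. x \<notin> fst c \<Longrightarrow> f x = 0"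
  defines "h \<equiv> \<lambda>z. if z \<in> cdom c then dens A \<omega> c z *\<^sub>R f (civ c z) else 0"
  shows "integral\<^sup>L (vol A \<omega>) f = integral\<^sup>L lborel h" "integrable (vol A \<omega>) f \<longleftrightarrow> integrable lborel h"
proof -
  let ?f = "\<lambda>z. if z \<in> cdom c then civ c z else undefined"
  have oc: "fst c \<in> sets borel" using chart_props(1)[OF c] by simp
  have fv: "f \<in> borel_measurable (vol A \<omega>)" using f(1) measurable_cong_sets[OF vol_props(1) refl] by blast
  have ov: "fst c \<in> sets (vol A \<omega>)" using oc by (simp only: vol_props(1))
  have ic: "(indicator (fst c) :: 'a \<Rightarrow> ennreal) \<in> borel_measurable (vol A \<omega>)" by (rule borel_measurable_indicator[OF ov])
  have d: "density (vol A \<omega>) (indicator (fst c)) = nvol c"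
  proof (rule measure_eqI)
    fix X assume "X \<in> sets (density (vol A \<omega>) (indicator (fst c)))"
    then have X: "X \<in> sets borel" by (simp add: vol_props(1))
    have "emeasure (density (vol A \<omega>) (indicator (fst c))) X = (\<integral>\<^sup>+x. indicator (X \<inter> fst c) x \<partial>vol A \<omega>)"
      using X ic by (simp add: emeasure_density vol_props(1) indicator_inter_arith mult.commute)
    also have "\<dots> = emeasure (vol A \<omega>) (X \<inter> fst c)" using X oc by (simp add: vol_props(1))
    also have "\<dots> = gvol c (X \<inter> fst c)" using X oc by (intro vol_props(2) c) auto
    finally show "emeasure (density (vol A \<omega>) (indicator (fst c))) X = emeasure (nvol c) X"
      by (simp add: emeasure_nvol[OF c X])
  qed (simp add: vol_props(1))
  have ind: "(\<lambda>x. indicator (fst c) x *\<^sub>R f x) = f" using f(2) by (auto simp: indicator_def fun_eq_iff)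
  have h: "(\<lambda>z. (indicator (cdom c) z * dens A \<omega> c z) *\<^sub>R f (?f z)) = h"
    by (auto simp: h_def indicator_def fun_eq_iff)
  have fm: "(\<lambda>z. f (?f z)) \<in> borel_measurable borel" by (rule measurable_compose[OF measurable_civ[OF c] f(1)])
  have pos: "AE z in lborel. 0 \<le> indicator (cdom c) z * dens A \<omega> c z"
    using dens_pos[OF c] by (auto simp: indicator_def less_imp_le)
  have pos': "AE x in vol A \<omega>. 0 \<le> (indicator (fst c) x :: real)" by simp
  have d': "density (vol A \<omega>) (\<lambda>x. ennreal (indicator (fst c) x)) = nvol c"
    using d by (simp add: ennreal_indicator[abs_def] del: ennreal_indicator)
  have ic': "(indicator (fst c) :: 'a \<Rightarrow> real) \<in> borel_measurable (vol A \<omega>)" by (rule borel_measurable_indicator[OF ov])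
  have "integral\<^sup>L (vol A \<omega>) f = integral\<^sup>L (nvol c) f"
    using integral_density[OF fv ic' pos'] by (simp add: d' ind)
  also have "\<dots> = integral\<^sup>L (density lborel (\<lambda>z. ennreal (indicator (cdom c) z * dens A \<omega> c z))) (\<lambda>z. f (?f z))"
    unfolding nvol_def using measurable_civ[OF c] f(1) by (subst integral_distr) auto
  also have "\<dots> = integral\<^sup>L lborel h"
    using fm measurable_dens[OF c] pos by (subst integral_density) (auto simp: h)
  finally show "integral\<^sup>L (vol A \<omega>) f = integral\<^sup>L lborel h" .
  have "integrable (vol A \<omega>) f \<longleftrightarrow> integrable (nvol c) f"
    using integrable_density[OF fv ic' pos'] by (simp add: d' ind)
  also have "\<dots> \<longleftrightarrow> integrable (density lborel (\<lambda>z. ennreal (indicator (cdom c) z * dens A \<omega> c z))) (\<lambda>z. f (?f z))"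
    unfolding nvol_def using measurable_civ[OF c] f(1) by (subst integrable_distr_eq) auto
  also have "\<dots> \<longleftrightarrow> integrable lborel h"
    using fm measurable_dens[OF c] pos by (subst integrable_density) (auto simp: h)
  finally show "integrable (vol A \<omega>) f \<longleftrightarrow> integrable lborel h" .
qed

end

section \<open>The codifferential in a chart\<close>

lemma dfield_ins_const:
  assumes "open S" "sfield S a" "z \<in> S"
  shows "dfield (\<lambda>z. ins x (a z)) z v = ins x (dfield a z v)"
proof
  fix ws
  have "((\<lambda>z. a z (x # ws)) has_derivative (\<lambda>v. dfield a z v (x # ws))) (at z)"
    by (rule sfield_has_derivative[OF assms(2,3)])
  then show "dfield (\<lambda>z. ins x (a z)) z v ws = ins x (dfield a z v) ws"
    by (intro dfield_eqI[THEN trans]) (simp_all add: ins_app[of x])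
qed

lemma linear_rbasis:
  fixes G :: "complex^'n::finite \<Rightarrow> complex"
  assumes "linear G" shows "(\<Sum>i\<in>UNIV. of_real (rcoord i b) * G (rbasis i)) = G b"
proof -
  have "G b = G (\<Sum>i\<in>UNIV. rcoord i b *\<^sub>R rbasis i)" using rcoord_expand[of b] by simp
  then show ?thesis by (simp add: linear_sum[OF assms] linear_scale[OF assms] scaleR_conv_of_real[where 'a=complex])
qed

text \<open>A metric on an open set with an orthonormal basis chosen separately at each point. At
  z0, where derivatives are taken, the pointwise theory is inherited.\<close>

locale metric_field =
  fixes S :: "(complex^'n::finite) set" and W :: "complex^'n \<Rightarrow> 'n fibre" and Bf z0
  assumes openS: "open S" and W: "sfield S W" and hW: "\<And>z. z \<in> S \<Longrightarrow> herm (W z)"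
    and oW: "\<And>z. z \<in> S \<Longrightarrow> onb (W z) (Bf z)" and z0: "z0 \<in> S"
begin

sublocale hermitian "W z0" "Bf z0"
  by unfold_locales (rule hW[OF z0], rule oW[OF z0])

abbreviation B where "B \<equiv> Bf z0"
abbreviation \<sigma> where "\<sigma> \<equiv> dfield W z0"

text \<open>J is constant in a holomorphic chart, so the linear conditions on the metric form pass
  to its directional derivatives. Positivity does not.\<close>

lemma invariant_\<sigma>: "invariant_two_form (\<sigma> v)"
proof -
  have d: "dfield W z0 v vs = D v" if "((\<lambda>z. W z vs) has_derivative D) (at z0)" for vs D
    using dfield_eqI[where a=W and vs=vs and D=D, OF that] .
  have "alternating (\<sigma> v)" by (rule sfieldD(1)[OF sfield_dfield[OF openS W] z0])
  moreover have "\<sigma> v vs = 0" if "length vs \<noteq> 2" for vs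
    by (rule d[of vs "\<lambda>_. 0"], rule has_derivative_transform_within_open[OF has_derivative_const openS z0])
      (use hW that in \<open>auto simp: herm_def homog_def\<close>)
  moreover have "cnj (\<sigma> v vs) = \<sigma> v vs" for vs
  proof (rule d[symmetric])
    have "((\<lambda>z. cnj (W z vs)) has_derivative (\<lambda>v. cnj (\<sigma> v vs))) (at z0)"
      by (rule bounded_linear.has_derivative[OF bounded_linear_cnj sfield_has_derivative[OF W z0]])
    then show "((\<lambda>z. W z vs) has_derivative (\<lambda>v. cnj (\<sigma> v vs))) (at z0)"
      by (rule has_derivative_transform_within_open[OF _ openS z0]) (use hW in \<open>simp add: herm_def\<close>)
  qed
  moreover have "\<sigma> v [J a, J b] = \<sigma> v [a, b]" for a b
    by (rule d, rule has_derivative_transform_within_open[OF sfield_has_derivative[OF W z0] openS z0])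
      (use hW in \<open>simp add: herm_def\<close>)
  ultimately show ?thesis by (simp add: invariant_two_form_def homog_def)
qed

lemma alt_\<sigma>: "alternating (\<sigma> v)" using invariant_\<sigma> by (simp add: invariant_two_form_def)

lemma metric_inv_sym: "metric_inv C i j = metric_inv C j i"
  by (simp add: metric_inv_def mult.commute)

text \<open>The derivative of an inverse matrix, minus inverse times derivative times inverse, with
  both inverses written as sums over the basis at z0.\<close>

lemma metric_inv_has_derivative:
  "((\<lambda>z. metric_inv (Bf z) i j) has_derivative
     (\<lambda>v. - (\<Sum>b\<in>B. \<Sum>c\<in>B. rcoord i b * rcoord j c * Re (\<sigma> v [b, J c])))) (at z0)"
proof -
  let ?\<gamma> = "\<lambda>i j z. metric_inv (Bf z) i j" and ?g = "\<lambda>i j z. gm (W z) (rbasis i) (rbasis j)"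
  define \<gamma>' where "\<gamma>' i j = frechet_derivative (?\<gamma> i j) (at z0)" for i j
  have d\<gamma>: "(?\<gamma> i j has_derivative \<gamma>' i j) (at z0)" for i j
    unfolding \<gamma>'_def by (rule smooth_on_has_derivative[OF smooth_metric_inv[OF openS W hW oW] z0])
  let ?g' = "\<lambda>i j v. Re (\<sigma> v [rbasis i, J (rbasis j)])"
  have dg: "(?g i j has_derivative ?g' i j) (at z0)" for i j
    unfolding gm_def by (rule bounded_linear.has_derivative[OF bounded_linear_Re sfield_has_derivative[OF W z0]])
  have inv: "(\<Sum>j\<in>UNIV. ?g k j z * ?\<gamma> j i z) = (if k = i then 1 else 0)" if "z \<in> S" for k i z
    by (rule hermitian.metric_inv_inverse) (simp add: hermitian_def hW oW that)
  have inv0: "(\<Sum>k\<in>UNIV. ?\<gamma> l k z0 * ?g k j z0) = (if l = j then 1 else 0)" for l j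
    using inv[OF z0, of j l] by (simp add: gm_sym[of "rbasis j"] metric_inv_sym[of _ _ l] mult.commute)
  \<comment> \<open>The relation between the metric and its inverse, differentiated at z0.\<close>
  have 0: "(\<Sum>j\<in>UNIV. ?g k j z0 * \<gamma>' j i v) = - (\<Sum>j\<in>UNIV. ?g' k j v * ?\<gamma> j i z0)" for k i v
  proof -
    have "((\<lambda>z. \<Sum>j\<in>UNIV. ?g k j z * ?\<gamma> j i z) has_derivative (\<lambda>v. \<Sum>j\<in>UNIV. ?g k j z0 * \<gamma>' j i v + ?g' k j v * ?\<gamma> j i z0)) (at z0)"
      by (intro has_derivative_sum has_derivative_mult dg d\<gamma>)
    moreover have "((\<lambda>z. \<Sum>j\<in>UNIV. ?g k j z * ?\<gamma> j i z) has_derivative (\<lambda>v. 0)) (at z0)"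
      by (rule has_derivative_transform_within_open[OF has_derivative_const openS z0]) (simp add: inv)
    ultimately have "(\<lambda>v. \<Sum>j\<in>UNIV. ?g k j z0 * \<gamma>' j i v + ?g' k j v * ?\<gamma> j i z0) = (\<lambda>v. 0)"
      by (rule has_derivative_unique)
    from fun_cong[OF this, of v] show ?thesis by (simp add: sum.distrib add_eq_0_iff2)
  qed
  have g\<sigma>: "linear (\<lambda>a. Re (\<sigma> v [a, J c]))" "linear (\<lambda>c. Re (\<sigma> v [a, J c]))" for v a c
    using linear_compose[OF linear_two_left[OF alt_\<sigma>] bounded_linear.linear[OF bounded_linear_Re]]
      linear_compose[OF linear_comp_J[OF linear_two_right[OF alt_\<sigma>]] bounded_linear.linear[OF bounded_linear_Re]]
    by (simp_all add: o_def)
  have ex: "(\<Sum>i\<in>UNIV. rcoord i b * G (rbasis i)) = G b" if "linear G" for G :: "complex^'n \<Rightarrow> real" and b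
  proof -
    have "G b = G (\<Sum>i\<in>UNIV. rcoord i b *\<^sub>R rbasis i)" using rcoord_expand[of b] by simp
    then show ?thesis by (simp add: linear_sum[OF that] linear_scale[OF that])
  qed
  have "\<gamma>' i j v = - (\<Sum>b\<in>B. \<Sum>c\<in>B. rcoord i b * rcoord j c * Re (\<sigma> v [b, J c]))" for v
  proof -
    have "\<gamma>' i j v = (\<Sum>m\<in>UNIV. (if i = m then 1 else 0) * \<gamma>' m j v)"
      by (simp add: if_distrib[of "\<lambda>x. x * _"] cong: if_cong)
    also have "\<dots> = (\<Sum>m\<in>UNIV. \<Sum>k\<in>UNIV. ?\<gamma> i k z0 * (?g k m z0 * \<gamma>' m j v))"
      by (simp add: inv0[symmetric] sum_distrib_right mult.assoc)
    also have "\<dots> = (\<Sum>k\<in>UNIV. ?\<gamma> i k z0 * (\<Sum>m\<in>UNIV. ?g k m z0 * \<gamma>' m j v))"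
      by (subst sum.swap) (simp add: sum_distrib_left)
    also have "\<dots> = - (\<Sum>k\<in>UNIV. \<Sum>m\<in>UNIV. \<Sum>b\<in>B. \<Sum>c\<in>B. rcoord i b * rcoord k b * (?g' k m v * (rcoord m c * rcoord j c)))"
    proof -
      have "?\<gamma> i k z0 * (?g' k m v * ?\<gamma> m j z0) = (\<Sum>b\<in>B. \<Sum>c\<in>B. rcoord i b * rcoord k b * (?g' k m v * (rcoord m c * rcoord j c)))" for k m
        unfolding metric_inv_def by (simp only: sum_distrib_right, simp only: sum_distrib_left)
      then show ?thesis unfolding 0 by (simp add: sum_distrib_left sum_negf)
    qed
    also have "(\<Sum>k\<in>UNIV. \<Sum>m\<in>UNIV. \<Sum>b\<in>B. \<Sum>c\<in>B. rcoord i b * rcoord k b * (?g' k m v * (rcoord m c * rcoord j c)))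
      = (\<Sum>b\<in>B. \<Sum>c\<in>B. \<Sum>k\<in>UNIV. \<Sum>m\<in>UNIV. rcoord i b * rcoord k b * (?g' k m v * (rcoord m c * rcoord j c)))"
      by (simp only: sum.swap[of _ B "UNIV :: 'n ridx set"])
    also have "\<dots> = (\<Sum>b\<in>B. \<Sum>c\<in>B. rcoord i b * rcoord j c * (\<Sum>k\<in>UNIV. rcoord k b * (\<Sum>m\<in>UNIV. rcoord m c * ?g' k m v)))"
      by (simp add: sum_distrib_left ac_simps)
    also have "\<dots> = (\<Sum>b\<in>B. \<Sum>c\<in>B. rcoord i b * rcoord j c * Re (\<sigma> v [b, J c]))"
      by (simp only: ex[OF g\<sigma>(2)] ex[OF g\<sigma>(1)])
    finally show ?thesis .
  qed
  then show ?thesis by (intro has_derivative_eq_rhs[OF d\<gamma>] ext)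
qed

lemma \<sigma>_Re: "of_real (Re (\<sigma> v vs)) = \<sigma> v vs"
  using invariant_\<sigma>[of v] by (simp add: invariant_two_form_def complex_eq_iff)

text \<open>In coordinates the trace over the moving basis has fixed indices and weights
  \<open>metric_inv\<close>. The product rule differentiates G and the weights; the weights give the
  correction with \<sigma>.\<close>

lemma trace_has_derivative:
  fixes G :: "complex^'n \<Rightarrow> complex^'n \<Rightarrow> complex^'n \<Rightarrow> complex"
  assumes lin: "\<And>z u. z \<in> S \<Longrightarrow> linear (\<lambda>v. G z v u)" "\<And>z v. z \<in> S \<Longrightarrow> linear (G z v)"
    and D: "\<And>a b. ((\<lambda>z. G z a b) has_derivative (\<lambda>v. G' v a b)) (at z0)"
    and lin': "\<And>h u. linear (\<lambda>v. G' h v u)" "\<And>h v. linear (G' h v)"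
  shows "((\<lambda>z. \<Sum>b\<in>Bf z. G z b b) has_derivative
    (\<lambda>v. (\<Sum>b\<in>B. G' v b b) - (\<Sum>b\<in>B. \<Sum>c\<in>B. \<sigma> v [b, J c] * G z0 b c))) (at z0)"
proof -
  let ?s = "\<lambda>z. \<Sum>i\<in>UNIV. \<Sum>j\<in>UNIV. of_real (metric_inv (Bf z) i j) * G z (rbasis i) (rbasis j)"
  let ?\<gamma>' = "\<lambda>i j v. - (\<Sum>b\<in>B. \<Sum>c\<in>B. rcoord i b * rcoord j c * Re (\<sigma> v [b, J c]))"
  have d: "(?s has_derivative (\<lambda>v. \<Sum>i\<in>UNIV. \<Sum>j\<in>UNIV. of_real (metric_inv B i j) * G' v (rbasis i) (rbasis j)
      + of_real (?\<gamma>' i j v) * G z0 (rbasis i) (rbasis j))) (at z0)"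
    by (intro has_derivative_sum has_derivative_mult D
      bounded_linear.has_derivative[OF bounded_linear_of_real metric_inv_has_derivative])
  have 1: "(\<Sum>i\<in>UNIV. \<Sum>j\<in>UNIV. of_real (metric_inv B i j) * G' v (rbasis i) (rbasis j)) = (\<Sum>b\<in>B. G' v b b)" for v
    by (rule sum_metric_inv[symmetric]) (rule lin')+
  have 2: "(\<Sum>i\<in>UNIV. \<Sum>j\<in>UNIV. of_real (?\<gamma>' i j v) * G z0 (rbasis i) (rbasis j))
    = - (\<Sum>b\<in>B. \<Sum>c\<in>B. \<sigma> v [b, J c] * G z0 b c)" for v
  proof -
    have "(\<Sum>i\<in>UNIV. \<Sum>j\<in>UNIV. of_real (?\<gamma>' i j v) * G z0 (rbasis i) (rbasis j))
      = - (\<Sum>i\<in>UNIV. \<Sum>j\<in>UNIV. \<Sum>b\<in>B. \<Sum>c\<in>B. of_real (rcoord i b) * of_real (rcoord j c) * \<sigma> v [b, J c] * G z0 (rbasis i) (rbasis j))"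
      by (simp add: sum_distrib_right sum_negf \<sigma>_Re)
    also have "(\<Sum>i\<in>UNIV. \<Sum>j\<in>UNIV. \<Sum>b\<in>B. \<Sum>c\<in>B. of_real (rcoord i b) * of_real (rcoord j c) * \<sigma> v [b, J c] * G z0 (rbasis i) (rbasis j))
      = (\<Sum>b\<in>B. \<Sum>c\<in>B. \<Sum>i\<in>UNIV. \<Sum>j\<in>UNIV. of_real (rcoord i b) * of_real (rcoord j c) * \<sigma> v [b, J c] * G z0 (rbasis i) (rbasis j))"
      by (simp only: sum.swap[of _ B "UNIV :: 'n ridx set"])
    also have "\<dots> = (\<Sum>b\<in>B. \<Sum>c\<in>B. \<sigma> v [b, J c] * (\<Sum>i\<in>UNIV. of_real (rcoord i b) * (\<Sum>j\<in>UNIV. of_real (rcoord j c) * G z0 (rbasis i) (rbasis j))))"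
      by (simp add: sum_distrib_left ac_simps)
    finally show ?thesis by (simp only: linear_rbasis[OF lin(2)[OF z0]] linear_rbasis[OF lin(1)[OF z0]])
  qed
  have "(?s has_derivative (\<lambda>v. (\<Sum>b\<in>B. G' v b b) - (\<Sum>b\<in>B. \<Sum>c\<in>B. \<sigma> v [b, J c] * G z0 b c))) (at z0)"
    by (rule has_derivative_eq_rhs[OF d], rule ext) (simp only: sum.distrib 1 2 diff_conv_add_uminus)
  then show ?thesis
  proof (rule has_derivative_transform_within_open[OF _ openS z0])
    fix z assume z: "z \<in> S"
    show "?s z = (\<Sum>b\<in>Bf z. G z b b)"
      by (rule hermitian.sum_metric_inv[symmetric, of "W z"]) (simp_all add: hermitian_def hW oW z lin)
  qed
qed

text \<open>The derivation of the exterior algebra induced by the metric derivative with one index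
  raised, that is, the second summand of \<open>two_form_op (\<sigma> v)\<close>.\<close>

definition Nop :: "complex^'n \<Rightarrow> 'n fibre \<Rightarrow> 'n fibre" where
  "Nop v x vs = (\<Sum>b\<in>B. \<Sum>c\<in>B. \<sigma> v [b, J c] * fwedge (flat b) (ins c x) vs)"

lemma two_form_op_Nop: "two_form_op (\<sigma> v) x vs = (\<Sum>b\<in>B. \<sigma> v [b, J b]) / 2 * x vs - Nop v x vs"
  by (simp add: two_form_op_def Nop_def)

lemma ins_Nop:
  assumes "alternating x"
  shows "ins a (Nop v x) = (\<lambda>vs. Nop v (ins a x) vs + (\<Sum>c\<in>B. \<sigma> v [a, J c] * ins c x vs))"
proof
  fix vs
  have "two_form_op (\<sigma> v) x (a # vs) = two_form_op (\<sigma> v) (ins a x) vs - (\<Sum>c\<in>B. \<sigma> v [a, J c] * x (c # vs))"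
    by (rule two_form_op_ins[OF invariant_\<sigma> assms])
  then show "ins a (Nop v x) vs = Nop v (ins a x) vs + (\<Sum>c\<in>B. \<sigma> v [a, J c] * ins c x vs)"
    unfolding two_form_op_Nop ins_app by algebra
qed

lemma Nop_add: "Nop v (\<lambda>vs. x vs + y vs) vs = Nop v x vs + Nop v y vs"
  and Nop_mult: "Nop v (\<lambda>vs. k * x vs) vs = k * Nop v x vs"
proof -
  have "ins c (\<lambda>vs. x vs + y vs) = (\<lambda>vs. ins c x vs + ins c y vs)"
    "ins c (\<lambda>vs. k * x vs) = (\<lambda>vs. k * ins c x vs)" for c by (simp_all add: ins_app fun_eq_iff)
  then show "Nop v (\<lambda>vs. x vs + y vs) vs = Nop v x vs + Nop v y vs" "Nop v (\<lambda>vs. k * x vs) vs = k * Nop v x vs"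
    by (simp_all add: Nop_def fwedge_add_right fwedge_mult_right distrib_left sum.distrib sum_distrib_left mult.left_commute)
qed

lemma real_\<sigma>: "cnj (\<sigma> v vs) = \<sigma> v vs" using invariant_\<sigma>[of v] by (simp add: invariant_two_form_def)

lemma \<sigma>_swap: "\<sigma> v [p, q] = - \<sigma> v [q, p]"
  using alternating_swap[OF alt_\<sigma>, of v p q "[]"] by simp

text \<open>The product rule with the metric included: differentiating the inverse metric in all k
  traces amounts to the single derivation \<open>Nop\<close> on \<xi>.\<close>

lemma adjw_has_derivative:
  assumes "sfield S \<xi>" "sfield S x"
  shows "((\<lambda>z. adjw (Bf z) k (\<xi> z) (x z) vs) has_derivative
    (\<lambda>v. adjw B k (dfield \<xi> z0 v) (x z0) vs + adjw B k (\<xi> z0) (dfield x z0 v) vs - adjw B k (Nop v (\<xi> z0)) (x z0) vs)) (at z0)"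
  using assms
proof (induction k arbitrary: \<xi> x)
  case 0
  have n: "Nop v (\<xi> z0) [] = 0" for v by (simp add: Nop_def)
  have "((\<lambda>z. cnj (\<xi> z []) * x z vs) has_derivative (\<lambda>v. cnj (\<xi> z0 []) * dfield x z0 v vs + cnj (dfield \<xi> z0 v []) * x z0 vs)) (at z0)"
    by (intro has_derivative_mult bounded_linear.has_derivative[OF bounded_linear_cnj] sfield_has_derivative[OF 0(1) z0] sfield_has_derivative[OF 0(2) z0])
  then show ?case by (simp add: adjw.simps n add.commute)
next
  case (Suc k)
  note a = Suc.prems(1) and b = Suc.prems(2)
  have az: "z \<in> S \<Longrightarrow> alternating (\<xi> z)" and bz: "z \<in> S \<Longrightarrow> alternating (x z)" for z
    using a b by (auto simp: sfield_def)
  have da: "alternating (dfield \<xi> z0 v)" "alternating (dfield x z0 v)" for v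
    using sfieldD(1)[OF sfield_dfield[OF openS a] z0] sfieldD(1)[OF sfield_dfield[OF openS b] z0] by auto
  let ?G = "\<lambda>z p q. adjw (Bf z) k (ins p (\<xi> z)) (ins q (x z)) vs"
  let ?G' = "\<lambda>v p q. adjw B k (ins p (dfield \<xi> z0 v)) (ins q (x z0)) vs + adjw B k (ins p (\<xi> z0)) (ins q (dfield x z0 v)) vs
      - adjw B k (Nop v (ins p (\<xi> z0))) (ins q (x z0)) vs"
  have G: "((\<lambda>z. ?G z p q) has_derivative (\<lambda>v. ?G' v p q)) (at z0)" for p q
    using Suc.IH[OF sfield_ins_const[OF openS a, of p] sfield_ins_const[OF openS b, of q]]
    by (simp only: dfield_ins_const[OF openS a z0] dfield_ins_const[OF openS b z0])
  have "linear (\<lambda>p. adjw B k (Nop v (ins p (\<xi> z0))) y vs)" for v y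
    using az[OF z0] by (auto intro!: linearI simp: ins_add ins_scaleR Nop_add[abs_def] Nop_mult[abs_def] adjw_left_add adjw_left_mult scaleR_conv_of_real[where 'a=complex])
  then have lin: "linear (\<lambda>p. ?G' h p q)" "linear (\<lambda>q. ?G' h p q)" for h p q
    by (intro linear_compose_add linear_compose_sub adjw_ins_linear adjw_left_ins_linear az bz z0 da; assumption)+
  have T: "((\<lambda>z. \<Sum>b\<in>Bf z. ?G z b b) has_derivative
    (\<lambda>v. (\<Sum>b\<in>B. ?G' v b b) - (\<Sum>b\<in>B. \<Sum>c\<in>B. \<sigma> v [b, J c] * ?G z0 b c))) (at z0)"
    by (rule trace_has_derivative) (intro adjw_ins_linear adjw_left_ins_linear az bz G lin; assumption)+
  \<comment> \<open>The metric derivative is symmetric, so the correction from the outermost trace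
    can be read as acting on \<xi>. There it is the extra term of \<open>ins_Nop\<close> that
    completes the derivation.\<close>
  have "\<sigma> v [b, J c] = \<sigma> v [c, J b]" for v b c
    using \<sigma>_swap[of v b "J c"] invariant_two_form_J_left[OF invariant_\<sigma>, of v c b] by simp
  then have "(\<Sum>b\<in>B. \<Sum>c\<in>B. \<sigma> v [b, J c] * ?G z0 b c) = (\<Sum>b\<in>B. \<Sum>c\<in>B. \<sigma> v [b, J c] * ?G z0 c b)" for v
    by (subst sum.swap) (intro sum.cong refl arg_cong2[where f="(*)"])
  then have N: "(\<Sum>b\<in>B. adjw B k (ins b (Nop v (\<xi> z0))) (ins b (x z0)) vs)
    = (\<Sum>b\<in>B. adjw B k (Nop v (ins b (\<xi> z0))) (ins b (x z0)) vs) + (\<Sum>b\<in>B. \<Sum>c\<in>B. \<sigma> v [b, J c] * ?G z0 b c)" for v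
    by (simp add: ins_Nop[OF az[OF z0]] adjw_left_add adjw_left_sum adjw_left_mult sum.distrib real_\<sigma>)
  show ?case
    unfolding adjw.simps(2)
    by (rule has_derivative_eq_rhs[OF bounded_linear.has_derivative[OF bounded_linear_divide T]], rule ext)
      (simp only: N, simp add: sum.distrib sum_subtractf add_divide_distrib diff_divide_distrib)
qed

end

section \<open>The operator d^c and the local codifferential\<close>

lemma dfield_linear: "sfield S x \<Longrightarrow> z \<in> S \<Longrightarrow> linear (\<lambda>v. dfield x z v ws)"
  using has_derivative_linear[OF sfield_has_derivative] by blast

lemma dfield_tw:
  assumes S: "open S" and x: "sfield S x" and z: "z \<in> S"
  shows "dfield (\<lambda>z. tw s t (x z)) z v = tw s t (dfield x z v)"
proof
  fix vs
  have "((\<lambda>z. tw s t (x z) vs) has_derivative (\<lambda>v. tw s t (dfield x z v) vs)) (at z)"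
    using x
  proof (induction vs arbitrary: x)
    case Nil then show ?case using sfield_has_derivative[OF Nil z] by simp
  next
    case (Cons a vs)
    let ?y = "\<lambda>z vs. of_real ((s + t) / 2) * ins a (x z) vs + \<i> * of_real ((t - s) / 2) * ins (J a) (x z) vs"
    have y: "tw_ins s t a (x z) = ?y z" for z by (rule ext) (simp add: tw_ins_def ins_app)
    have sy: "sfield S ?y"
      by (intro sfield_add sfield_mult sfield_ins_const S Cons.prems smooth_on_const)
    have "dfield ?y z v = tw_ins s t a (dfield x z v)" for v
    proof (rule ext, rule dfield_eqI[THEN trans])
      fix ws
      show "((\<lambda>z. ?y z ws) has_derivative (\<lambda>v. of_real ((s + t) / 2) * dfield x z v (a # ws)
          + \<i> * of_real ((t - s) / 2) * dfield x z v (J a # ws))) (at z)"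
        unfolding ins_app
        by (intro has_derivative_add has_derivative_mult_right sfield_has_derivative[OF Cons.prems z])
    qed (simp add: tw_ins_def ins_app)
    with Cons.IH[OF sy] show ?case by (simp add: y)
  qed
  then show "dfield (\<lambda>z. tw s t (x z)) z v vs = tw s t (dfield x z v) vs" by (rule dfield_eqI)
qed

lemma fwedge_diff_right: "fwedge \<alpha> (\<lambda>vs. \<beta> vs - \<beta>' vs) vs = fwedge \<alpha> \<beta> vs - fwedge \<alpha> \<beta>' vs"
  by (simp add: fwedge_def algebra_simps sum_subtractf)

lemma alternating_diff: "alternating \<alpha> \<Longrightarrow> alternating \<beta> \<Longrightarrow> alternating (\<lambda>vs. \<alpha> vs - \<beta> vs)"
  using alternating_add[OF _ alternating_mult[of \<beta> "-1"]] by simp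

lemma alternating_coord_form: "alternating (one_form (\<lambda>v. complex_of_real (rcoord i v)))"
  using linear_rcoord[of i] by (intro alternating_one_form) (simp add: linear_iff scaleR_conv_of_real)

text \<open>With T acting as (-1)^q, conjugation of d by T is \<partial> minus its conjugate; times
  - \<i> this is d^c.\<close>

definition dc :: "(complex^'n \<Rightarrow> 'n::finite fibre) \<Rightarrow> complex^'n \<Rightarrow> 'n fibre" where
  "dc x z vs = - \<i> * tw 1 (- 1) (fd (\<lambda>z. tw 1 (- 1) (x z)) z) vs"

text \<open>The operator [\<Lambda>, d^c] - \<tau>^*, the candidate for the adjoint of d given by
  relation (a) at \<eta> = 1. The last line is the adjoint of [\<Lambda>, d\<omega> \<and>], with
  the order of the factors reversed.\<close>

definition codiff :: "(complex^'n \<Rightarrow> 'n::finite fibre) \<Rightarrow> (complex^'n \<Rightarrow> (complex^'n) set) \<Rightarrow> (complex^'n \<Rightarrow> 'n fibre)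
    \<Rightarrow> complex^'n \<Rightarrow> 'n fibre" where
  "codiff W Bf x z vs = adjw (Bf z) 2 (W z) (dc x z) vs - dc (\<lambda>z. adjw (Bf z) 2 (W z) (x z)) z vs
     - (adjw (Bf z) 3 (fd W z) (fwedge (W z) (x z)) vs - fwedge (W z) (adjw (Bf z) 3 (fd W z) (x z)) vs)"

lemma finn_add_left: "finn B (\<lambda>vs. \<alpha> vs + \<beta> vs) \<gamma> = finn B \<alpha> \<gamma> + finn B \<beta> \<gamma>"
  and finn_add_right: "finn B \<gamma> (\<lambda>vs. \<alpha> vs + \<beta> vs) = finn B \<gamma> \<alpha> + finn B \<gamma> \<beta>"
  and finn_mult_left: "finn B (\<lambda>vs. c * \<alpha> vs) \<gamma> = c * finn B \<alpha> \<gamma>"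
  and finn_mult_right: "finn B \<gamma> (\<lambda>vs. c * \<alpha> vs) = cnj c * finn B \<gamma> \<alpha>"
  by (simp_all add: finn_def adjw_add adjw_left_add adjw_mult adjw_left_mult sum.distrib sum_distrib_left)

lemma finn_zero [simp]: "finn B (\<lambda>vs. 0) \<gamma> = 0" "finn B \<gamma> (\<lambda>vs. 0) = 0"
  using finn_mult_left[of B 0 "\<lambda>vs. 0"] finn_mult_right[of B \<gamma> 0 "\<lambda>vs. 0"] by simp_all

lemma finn_sum_left: "finn B (\<lambda>vs. \<Sum>i\<in>I. \<alpha> i vs) \<gamma> = (\<Sum>i\<in>I. finn B (\<alpha> i) \<gamma>)"
  and finn_sum_right: "finn B \<gamma> (\<lambda>vs. \<Sum>i\<in>I. \<alpha> i vs) = (\<Sum>i\<in>I. finn B \<gamma> (\<alpha> i))"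
  by (simp_all add: finn_def adjw_sum adjw_left_sum) (subst sum.swap, simp)+

context metric_field
begin

lemma finn_has_derivative:
  assumes "sfield S \<alpha>" "sfield S \<beta>"
  shows "((\<lambda>z. finn (Bf z) (\<alpha> z) (\<beta> z)) has_derivative
    (\<lambda>v. finn B (dfield \<alpha> z0 v) (\<beta> z0) + finn B (\<alpha> z0) (dfield \<beta> z0 v) - finn B (\<alpha> z0) (Nop v (\<beta> z0)))) (at z0)"
  unfolding finn_def
  by (rule has_derivative_eq_rhs, rule has_derivative_sum, rule adjw_has_derivative[OF assms(2,1)])
    (simp add: sum.distrib sum_subtractf add.commute)

lemma contract_W:
  assumes "linear F"
  shows "(\<Sum>c\<in>B. W z0 [p, c] * F c) = F (J p)" "(\<Sum>c\<in>B. W z0 [c, p] * F c) = - F (J p)"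
proof -
  show 1: "(\<Sum>c\<in>B. W z0 [p, c] * F c) = F (J p)"
    unfolding w_eq_gm by (rule expand_complex(2)[OF assms])
  have "W z0 [c, p] = - W z0 [p, c]" for c
    using alternating_swap[OF alt_w, of c p "[]"] by simp
  then show "(\<Sum>c\<in>B. W z0 [c, p] * F c) = - F (J p)" using 1 by (simp add: sum_negf)
qed

lemma linear_alternating: "alternating \<alpha> \<Longrightarrow> linear (\<lambda>v. \<alpha> (v # vs))" "alternating \<alpha> \<Longrightarrow> linear (\<lambda>v. \<alpha> (u # v # vs))"
proof -
  assume a: "alternating \<alpha>"
  show "linear (\<lambda>v. \<alpha> (v # vs))" by (rule alternating_linear[OF a])
  show "linear (\<lambda>v. \<alpha> (u # v # vs))" using alternating_linear[of "ins u \<alpha>" vs] a by (simp add: ins_app)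
qed

text \<open>Differentiating the form W gives \<sigma>, and differentiating the inverse metric in two
  slots gives - \<open>Nop\<close> of W, which is -2 \<sigma>; the total is - \<sigma>.\<close>

lemma Lam_has_derivative:
  assumes x: "sfield S x"
  shows "((\<lambda>z. adjw (Bf z) 2 (W z) (x z) vs) has_derivative
    (\<lambda>v. adjw B 2 (W z0) (dfield x z0 v) vs - adjw B 2 (\<sigma> v) (x z0) vs)) (at z0)"
proof -
  have "Nop v (W z0) [p, q] = 2 * \<sigma> v [p, q]" for v p q
  proof -
    note l = linear_comp_J[OF linear_two_right[OF alt_\<sigma>]]
    have "Nop v (W z0) [p, q] = (\<Sum>c\<in>B. \<sigma> v [q, J c] * W z0 [p, c]) + (\<Sum>c\<in>B. \<sigma> v [p, J c] * W z0 [c, q])"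
      using fun_cong[OF ins_Nop[OF alt_w], of p v "[q]"] fun_cong[OF ins_Nop[OF alternating_ins[OF alt_w]], of q v p "[]"]
      by (simp add: ins_app Nop_def)
    also have "\<dots> = \<sigma> v [q, J (J p)] - \<sigma> v [p, J (J q)]"
      by (simp only: mult.commute[of "\<sigma> v _"] contract_W[OF l] diff_conv_add_uminus)
    also have "\<dots> = 2 * \<sigma> v [p, q]"
      using \<sigma>_swap[of v q p] by (simp add: linear_neg[OF linear_two_right[OF alt_\<sigma>]])
    finally show ?thesis .
  qed
  then have "adjw B 2 (Nop v (W z0)) (x z0) vs = adjw B 2 (\<lambda>us. 2 * \<sigma> v us) (x z0) vs" for v
    by (intro adjw_cong) (auto simp: length_Suc_conv numeral_2_eq_2)
  then show ?thesis
    using adjw_has_derivative[OF W x, of 2 vs] by (simp add: adjw_left_mult)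
qed

lemma rcoord_gm: "rcoord i v = (\<Sum>b\<in>B. gm (W z0) b v * rcoord i b)"
  using expand_linear[OF linear_rcoord, of v i] by simp

text \<open>A contraction of covectors with dual vectors is the same in the coordinate basis and in
  an orthonormal one. L allows the covectors to be composed with J.\<close>

lemma frame_change:
  assumes "\<And>ws. linear (\<lambda>v. F v ws)"
  shows "(\<Sum>i\<in>UNIV. fwedge (one_form (\<lambda>v. of_real (rcoord i (L v)))) (F (rbasis i)) vs)
    = (\<Sum>b\<in>B. fwedge (one_form (\<lambda>v. of_real (gm (W z0) b (L v)))) (F b) vs)"
proof -
  have 1: "one_form (\<lambda>v. of_real (rcoord i (L v))) = (\<lambda>vs. \<Sum>b\<in>B. of_real (rcoord i b) * one_form (\<lambda>v. of_real (gm (W z0) b (L v))) vs)" for i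
    by (rule ext) (simp add: one_form_def rcoord_gm[of i "L v" for v] mult.commute split: list.split)
  have lin: "linear (\<lambda>v. fwedge \<xi> (F v) vs)" for \<xi>
    using assms unfolding linear_iff fwedge_def by (simp add: algebra_simps sum.distrib scaleR_sum_right)
  have "(\<Sum>i\<in>UNIV. fwedge (one_form (\<lambda>v. of_real (rcoord i (L v)))) (F (rbasis i)) vs)
    = (\<Sum>b\<in>B. \<Sum>i\<in>UNIV. of_real (rcoord i b) * fwedge (one_form (\<lambda>v. of_real (gm (W z0) b (L v)))) (F (rbasis i)) vs)"
    unfolding 1 by (subst sum.swap) (simp add: fwedge_sum_left fwedge_mult_left)
  then show ?thesis by (simp only: linear_rbasis[OF lin])
qed

lemma fd_frame: assumes "sfield S x" shows "fd x z0 vs = (\<Sum>b\<in>B. fwedge (flat b) (dfield x z0 b) vs)"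
  using frame_change[of "dfield x z0" "\<lambda>v. v"] dfield_linear[OF assms z0] by (simp add: fd_eq_sum[OF assms z0])

lemma dc_frame:
  assumes x: "sfield S x"
  shows "dc x z0 vs = (\<Sum>b\<in>B. fwedge (flat (J b)) (dfield x z0 b) vs)"
proof -
  have sx: "sfield S (\<lambda>z. tw 1 (- 1) (x z))" by (intro sfield_tw smooth_on_const openS x)
  have alt: "alternating (dfield x z0 v)" for v by (rule sfieldD(1)[OF sfield_dfield[OF openS x] z0])
  have "fd (\<lambda>z. tw 1 (- 1) (x z)) z0 = (\<lambda>vs. \<Sum>i\<in>UNIV. fwedge (one_form (\<lambda>v. of_real (rcoord i v))) (tw 1 (- 1) (dfield x z0 (rbasis i))) vs)"
    by (rule ext) (simp add: fd_eq_sum[OF sx z0] dfield_tw[OF openS x z0])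
  then have "dc x z0 vs = (\<Sum>i\<in>UNIV. - \<i> * fwedge (one_form (\<lambda>v. - \<i> * of_real (rcoord i (J v)))) (dfield x z0 (rbasis i)) vs)"
    by (simp add: dc_def tw_sum tw_fwedge tw_tw[OF alt] tw_one[OF alt] tw_one_form sum_distrib_left sum_negf)
  also have "\<dots> = (\<Sum>i\<in>UNIV. fwedge (one_form (\<lambda>v. of_real (rcoord i (- J v)))) (dfield x z0 (rbasis i)) vs)"
  proof (intro sum.cong refl)
    fix i :: "'n ridx"
    have "one_form (\<lambda>v. of_real (rcoord i (- J v))) = (\<lambda>vs. - \<i> * one_form (\<lambda>v. - \<i> * of_real (rcoord i (J v))) vs)"
      unfolding one_form_mult[symmetric] by (simp add: linear_neg[OF linear_rcoord])
    then show "- \<i> * fwedge (one_form (\<lambda>v. - \<i> * of_real (rcoord i (J v)))) (dfield x z0 (rbasis i)) vs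
      = fwedge (one_form (\<lambda>v. of_real (rcoord i (- J v)))) (dfield x z0 (rbasis i)) vs"
      by (simp only: fwedge_mult_left)
  qed
  also have "\<dots> = (\<Sum>b\<in>B. fwedge (one_form (\<lambda>v. of_real (gm (W z0) b (- J v)))) (dfield x z0 b) vs)"
    by (rule frame_change) (rule dfield_linear[OF x z0])
  finally show ?thesis by (simp add: linear_neg[OF gm_linear] gm_J_left)
qed

text \<open>Both d and d^c are sums over the frame of wedges with \<open>flat b\<close> or
  \<open>flat (J b)\<close> after coordinate derivatives. The derivative of \<Lambda> and the
  torsion combine by \<open>kaehler_pointwise\<close>, and what remains has the shape of minus a
  divergence.\<close>

lemma codiff_frame:
  assumes x: "sfield S x"
  shows "codiff W Bf x z0 vs = - (\<Sum>b\<in>B. dfield x z0 b (b # vs) + two_form_op (\<sigma> b) (x z0) (b # vs))"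
proof -
  have sL: "sfield S (\<lambda>z. adjw (Bf z) 2 (W z) (x z))" by (rule sfield_adjw[OF openS W hW oW W x])
  have dL: "dfield (\<lambda>z. adjw (Bf z) 2 (W z) (x z)) z0 v = (\<lambda>vs. adjw B 2 (W z0) (dfield x z0 v) vs + (- 1) * adjw B 2 (\<sigma> v) (x z0) vs)" for v
    by (rule ext, rule dfield_eqI[THEN trans, OF Lam_has_derivative[OF x]]) simp
  have ax: "alternating (x z0)" and adx: "alternating (dfield x z0 v)" for v
    using sfieldD(1)[OF x z0] sfieldD(1)[OF sfield_dfield[OF openS x] z0] by auto
  have dcx: "dc x z0 = (\<lambda>vs. \<Sum>b\<in>B. fwedge (flat (J b)) (dfield x z0 b) vs)" by (rule ext) (rule dc_frame[OF x])
  have fdW: "fd W z0 = (\<lambda>vs. \<Sum>b\<in>B. fwedge (flat b) (\<sigma> b) vs)" by (rule ext) (rule fd_frame[OF W])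
  \<comment> \<open>The adjoint of the sum of \<open>flat b\<close> \<and> \<open>\<sigma> b\<close>
    is the sum of the adjoints of \<open>\<sigma> b\<close> after contraction with b.\<close>
  have A3: "adjw B 3 (fd W z0) y us = (\<Sum>b\<in>B. adjw B 2 (\<sigma> b) (ins b y) us)" if "alternating y" for y us
  proof -
    have "adjw B 3 (fd W z0) y us = (\<Sum>b\<in>B. adjw B (Suc 2) (fwedge (flat b) (\<sigma> b)) y us)"
      unfolding fdW by (subst adjw_left_sum) (simp add: numeral_3_eq_3)
    also have "\<dots> = (\<Sum>b\<in>B. \<Sum>c\<in>B. of_real (gm (W z0) b c) * adjw B 2 (\<sigma> b) (ins c y) us)"
      by (simp only: adjw_fwedge_one_form[OF that] complex_cnj_complex_of_real)
    finally show ?thesis by (simp add: expand_complex(2)[OF adjw_ins_linear[OF that]])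
  qed
  \<comment> \<open>The commutator of \<Lambda> with the wedge by \<open>flat (J b)\<close> is
    contraction with \<open>J (J b)\<close>, hence minus contraction with b.\<close>
  have lam: "adjw B 2 (W z0) (fwedge (flat (J b)) y) vs - fwedge (flat (J b)) (adjw B 2 (W z0) y) vs = - y (b # vs)"
    if y: "alternating y" for y b
  proof -
    have l: "linear (\<lambda>c. y (J c # vs))" by (rule linear_comp_J[OF linear_alternating(1)[OF y]])
    have "adjw B 2 (W z0) (fwedge (flat (J b)) y) vs - fwedge (flat (J b)) (adjw B 2 (W z0) y) vs
      = (\<Sum>c\<in>B. of_real (gm (W z0) (J b) c) * y (J c # vs))"
      by (subst Lam_fwedge_one_form[OF y]) (simp_all add: linear_gm_right)
    also have "\<dots> = y (J (J b) # vs)" by (rule expand_complex(2)[OF l])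
    also have "J (J b) = - b" by (rule J_J)
    finally show ?thesis by (simp add: alternating_head_minus[OF y])
  qed
  have "codiff W Bf x z0 vs = (\<Sum>b\<in>B. - dfield x z0 b (b # vs) + fwedge (flat (J b)) (adjw B 2 (\<sigma> b) (x z0)) vs
      - (adjw B 2 (\<sigma> b) (ins b (fwedge (W z0) (x z0))) vs - fwedge (W z0) (adjw B 2 (\<sigma> b) (ins b (x z0))) vs))"
  proof -
    have A3x: "adjw B 3 (fd W z0) (x z0) = (\<lambda>us. \<Sum>b\<in>B. adjw B 2 (\<sigma> b) (ins b (x z0)) us)" by (rule ext) (rule A3[OF ax])
    have "codiff W Bf x z0 vs = (\<Sum>b\<in>B. adjw B 2 (W z0) (fwedge (flat (J b)) (dfield x z0 b)) vs)
      - (\<Sum>b\<in>B. fwedge (flat (J b)) (adjw B 2 (W z0) (dfield x z0 b)) vs - fwedge (flat (J b)) (adjw B 2 (\<sigma> b) (x z0)) vs)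
      - ((\<Sum>b\<in>B. adjw B 2 (\<sigma> b) (ins b (fwedge (W z0) (x z0))) vs) - (\<Sum>b\<in>B. fwedge (W z0) (adjw B 2 (\<sigma> b) (ins b (x z0))) vs))"
      unfolding codiff_def dcx dc_frame[OF sL] dL A3[OF alternating_fwedge[OF alt_w ax]] A3x
      by (simp add: adjw_sum fwedge_sum_right fwedge_diff_right sum_subtractf)
    also have "\<dots> = (\<Sum>b\<in>B. (adjw B 2 (W z0) (fwedge (flat (J b)) (dfield x z0 b)) vs - fwedge (flat (J b)) (adjw B 2 (W z0) (dfield x z0 b)) vs)
        + fwedge (flat (J b)) (adjw B 2 (\<sigma> b) (x z0)) vs
      - (adjw B 2 (\<sigma> b) (ins b (fwedge (W z0) (x z0))) vs - fwedge (W z0) (adjw B 2 (\<sigma> b) (ins b (x z0))) vs))"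
      by (simp add: sum.distrib sum_subtractf)
    finally show ?thesis by (simp only: lam[OF adx])
  qed
  also have "\<dots> = (\<Sum>b\<in>B. - (dfield x z0 b (b # vs) + two_form_op (\<sigma> b) (x z0) (b # vs)))"
    by (intro sum.cong refl) (simp add: kaehler_pointwise[OF invariant_\<sigma> ax, symmetric])
  finally show ?thesis by (simp only: sum_negf)
qed

text \<open>Jacobi's formula in a basis f that is unitary at z0 and kept constant in z: at z0 the
  matrix is half the identity, and the change of basis only contributes the constant factor
  r.\<close>

lemma det_hmat_has_derivative:
  "((\<lambda>z. det (hmat (W z))) has_derivative (\<lambda>v. det (hmat (W z0)) * (\<Sum>b\<in>B. \<sigma> v [b, J b]) / 2)) (at z0)"
proof -
  have sm: "smooth_on S (\<lambda>z. det (hmat (W z)))"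
    unfolding hmat_def hform_def divide_inverse
    by (intro smooth_on_det openS, simp only: vec_lambda_beta)
      (intro smooth_on_diff smooth_on_mult smooth_on_const openS sfieldD(2)[OF W])
  note d = smooth_on_has_derivative[OF sm z0]
  let ?D = "frechet_derivative (\<lambda>z. det (hmat (W z))) (at z0)"
  obtain f :: "'n \<Rightarrow> complex^'n" where f: "\<And>i j. gm (W z0) (f i) (f j) = (if i = j then 1 else 0)" "\<And>i j. gm (W z0) (f i) (J (f j)) = 0"
    using unitary_basis[OF herm] by metis
  note uf = onb_unitary_basis[OF herm f]
  define r where "r = complex_of_real ((cmod (det (\<chi> k j. f j $ k)))\<^sup>2)"
  have detf: "det (\<chi> i j. hform (W z) (f i) (f j)) = r * det (hmat (W z))" if "z \<in> S" for z
    unfolding r_def by (rule det_hform[OF herm_invariant[OF hW[OF that]]])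
  have h0: "hform (W z0) (f i) (f j) = (if i = j then 1/2 else 0)" for i j
  proof -
    have 1: "gm (W z0) (J (f i)) (J (f j)) = (if i = j then 1 else 0)" by (simp add: gm_J_J f)
    have 2: "gm (W z0) (J (f i)) (f j) = 0" by (simp add: gm_J_left f)
    show ?thesis unfolding hform_def w_eq_gm 1 2 by simp
  qed
  have det0: "r * det (hmat (W z0)) = (1/2) ^ CARD('n)"
    unfolding detf[OF z0, symmetric] by (subst det_diagonal) (auto simp: h0)
  have r0: "r \<noteq> 0" using det0 by auto
  have "?D v = det (hmat (W z0)) * (\<Sum>b\<in>B. \<sigma> v [b, J b]) / 2" for v
  proof -
    let ?p = "\<lambda>t::real. z0 + t *\<^sub>R v"
    have p: "(?p has_vector_derivative v) (at 0)"
      by (auto intro!: derivative_eq_intros simp: has_vector_derivative_def)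
    have Wp: "((\<lambda>t. W (?p t) us) has_vector_derivative \<sigma> v us) (at 0)" for us
      using vector_derivative_diff_chain_within[OF p, of "\<lambda>z. W z us" "\<lambda>v. \<sigma> v us"]
        sfield_has_derivative[OF W z0] by (simp add: o_def has_derivative_at_withinI)
    have m: "((\<lambda>t. hform (W (?p t)) (f i) (f j)) has_vector_derivative hform (\<sigma> v) (f i) (f j)) (at 0)" for i j
      unfolding hform_def
      by (intro has_vector_derivative_divide has_vector_derivative_diff has_vector_derivative_mult_right Wp)
    have 1: "((\<lambda>t. det (\<chi> i j. hform (W (?p t)) (f i) (f j))) has_vector_derivative
        (1/2) ^ (CARD('n) - 1) * (\<Sum>i\<in>UNIV. hform (\<sigma> v) (f i) (f i))) (at 0)"
      by (rule det_has_vector_derivative[OF m]) (simp add: h0)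
    have "((\<lambda>t. det (hmat (W (?p t)))) has_vector_derivative ?D v) (at 0)"
      using vector_derivative_diff_chain_within[OF p, of "\<lambda>z. det (hmat (W z))" ?D] d
      by (simp add: o_def has_derivative_at_withinI)
    then have 2: "((\<lambda>t. r * det (hmat (W (?p t)))) has_vector_derivative r * ?D v) (at 0)"
      by (rule has_vector_derivative_mult_right)
    have "open ((\<lambda>t. ?p t) -` S)"
      by (rule open_vimage[OF openS]) (intro continuous_intros)
    then have "((\<lambda>t. det (\<chi> i j. hform (W (?p t)) (f i) (f j))) has_vector_derivative r * ?D v) (at 0)"
      using has_vector_derivative_transform_within_open[OF 2, of "(\<lambda>t. ?p t) -` S"] z0 by (simp add: detf)
    from vector_derivative_unique_at[OF this 1]
    have e: "r * ?D v = (1/2) ^ (CARD('n) - 1) * (\<Sum>i\<in>UNIV. hform (\<sigma> v) (f i) (f i))" .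
    have hs: "hform (\<sigma> v) a a = \<sigma> v [a, J a] / 2" for a
      using alternating_same[OF alt_\<sigma>, of v a "[]"] by (simp add: hform_def)
    have "(\<Sum>b\<in>B. \<sigma> v [b, J b]) = (\<Sum>b\<in>range f \<union> J ` range f. \<sigma> v [b, J b])"
      by (rule trace_indep[where F = "\<lambda>a b. \<sigma> v [a, J b]", symmetric, OF linear_two_left[OF alt_\<sigma>]
          linear_comp_J[OF linear_two_right[OF alt_\<sigma>]] uf(1)])
    also have "\<dots> = (\<Sum>b\<in>range f. \<sigma> v [b, J b]) + (\<Sum>b\<in>range f. \<sigma> v [J b, J (J b)])"
      using uf by (subst sum.union_disjoint) (simp_all add: sum.reindex[OF uf(3)] o_def)
    also have "\<dots> = 2 * (\<Sum>b\<in>range f. \<sigma> v [b, J b])"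
    proof -
      have "\<sigma> v [J b, J (J b)] = \<sigma> v [b, J b]" for b
        using invariant_\<sigma>[of v] unfolding invariant_two_form_def by blast
      then show ?thesis by (simp only: mult_2)
    qed
    also have "(\<Sum>b\<in>range f. \<sigma> v [b, J b]) = (\<Sum>i\<in>UNIV. \<sigma> v [f i, J (f i)])"
      by (simp add: sum.reindex[OF uf(2)] o_def)
    finally have t: "(\<Sum>i\<in>UNIV. \<sigma> v [f i, J (f i)]) = (\<Sum>b\<in>B. \<sigma> v [b, J b]) / 2" by simp
    \<comment> \<open>The power from Jacobi's formula and the one half from \<open>hform\<close>
      make up (1/2)^n, which is r times the determinant at z0.\<close>
    have "(1/2 :: complex) ^ CARD('n) = (1/2) ^ (CARD('n) - 1) * (1/2)"
      using power_Suc2[of "1/2 :: complex" "CARD('n) - 1"] by (simp del: power_Suc power_Suc2)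
    then have "r * ?D v = r * (det (hmat (W z0)) * (\<Sum>b\<in>B. \<sigma> v [b, J b]) / 2)"
      unfolding e hs sum_divide_distrib[symmetric] t using det0 by (simp add: field_simps)
    then show ?thesis using r0 by simp
  qed
  then show ?thesis by (intro has_derivative_eq_rhs[OF d] ext)
qed

text \<open>The volume density without its constant factor 2^n, complex-valued so that it multiplies
  the inner product directly.\<close>

definition rho :: "complex^'n \<Rightarrow> complex" where "rho z = det (hmat (W z))"

text \<open>The divergence of the vector field dual to \<open>\<xi> \<mapsto> \<langle>\<xi> \<and> u, v\<rangle>\<close>.\<close>

lemma divergence_formula:
  assumes u: "sfield S u" and v: "sfield S v"
  shows "(\<Sum>i\<in>UNIV. frechet_derivative (\<lambda>z. rho z * finn (Bf z) (fwedge (one_form (\<lambda>v. of_real (rcoord i v))) (u z)) (v z)) (at z0) (rbasis i))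
    = rho z0 * (finn B (fd u z0) (v z0) - finn B (u z0) (codiff W Bf v z0))"
proof -
  let ?e = "\<lambda>i. one_form (\<lambda>v. complex_of_real (rcoord i v)) :: 'n fibre"
  have se: "sfield S (\<lambda>z. ?e i)" for i
    unfolding sfield_def by (auto intro: alternating_coord_form smooth_on_const openS)
  have su: "sfield S (\<lambda>z. fwedge (?e i) (u z))" for i by (rule sfield_fwedge[OF openS se u])
  have du: "dfield (\<lambda>z. fwedge (?e i) (u z)) z0 a = fwedge (?e i) (dfield u z0 a)" for i a
  proof (rule ext, rule dfield_eqI)
    fix vs
    show "((\<lambda>z. fwedge (?e i) (u z) vs) has_derivative (\<lambda>a. fwedge (?e i) (dfield u z0 a) vs)) (at z0)"
      unfolding fwedge_def by (intro has_derivative_sum has_derivative_mult_right sfield_has_derivative[OF u z0])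
  qed
  have av: "alternating (v z0)" and adv: "alternating (dfield v z0 a)" for a
    using sfieldD(1)[OF v z0] sfieldD(1)[OF sfield_dfield[OF openS v] z0] by auto
  \<comment> \<open>Here \<open>two_form_op\<close> collects the derivative of the volume density
    (half the trace) and that of the metric on forms (minus \<open>Nop\<close>), as in
    \<open>codiff_frame\<close>.\<close>
  define y where "y a = (\<lambda>vs. dfield v z0 a vs + two_form_op (\<sigma> a) (v z0) vs)" for a
  have aN: "alternating (two_form_op (\<sigma> a) (v z0))" for a
    unfolding two_form_op_def[abs_def]
    by (intro alternating_diff alternating_mult alternating_sum alternating_fwedge alternating_one_form alternating_ins av linear_gm_right)
  have ay: "alternating (y a)" for a unfolding y_def by (intro alternating_add adv aN)
  have two: "two_form_op (\<sigma> a) (v z0) = (\<lambda>vs. (\<Sum>b\<in>B. \<sigma> a [b, J b]) / 2 * v z0 vs + (- 1) * Nop a (v z0) vs)" for a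
    by (rule ext) (simp add: two_form_op_Nop)
  have "((\<lambda>z. rho z * finn (Bf z) (fwedge (?e i) (u z)) (v z)) has_derivative
      (\<lambda>a. rho z0 * (finn B (fwedge (?e i) (dfield u z0 a)) (v z0) + finn B (fwedge (?e i) (u z0)) (y a)))) (at z0)" for i
    by (rule has_derivative_eq_rhs[OF has_derivative_mult[OF det_hmat_has_derivative[folded rho_def] finn_has_derivative[OF su v]]], rule ext)
      (simp only: du y_def two finn_add_right finn_mult_right, simp add: real_\<sigma> algebra_simps)
  note D = this
  have fr: "frechet_derivative (\<lambda>z. rho z * finn (Bf z) (fwedge (?e i) (u z)) (v z)) (at z0) a
    = rho z0 * (finn B (fwedge (?e i) (dfield u z0 a)) (v z0) + finn B (fwedge (?e i) (u z0)) (y a))" for i a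
    by (rule fun_cong[OF frechet_derivative_at[OF D, symmetric]])
  have 1: "(\<Sum>i\<in>UNIV. finn B (fwedge (?e i) (dfield u z0 (rbasis i))) (v z0)) = finn B (fd u z0) (v z0)"
  proof -
    have "fd u z0 = (\<lambda>vs. \<Sum>i\<in>UNIV. fwedge (?e i) (dfield u z0 (rbasis i)) vs)" by (rule ext) (rule fd_eq_sum[OF u z0])
    then show ?thesis by (simp add: finn_sum_left)
  qed
  have 2: "finn B (fwedge (?e i) (u z0)) (y a) = (\<Sum>b\<in>B. of_real (rcoord i b) * finn B (u z0) (ins b (y a)))" for i a
  proof -
    have "finn B (fwedge (?e i) (u z0)) (y a) = finn B (u z0) (adjw B 1 (?e i) (y a))"
      by (rule finn_fwedge[OF ay alternating_coord_form homog_one_form, folded One_nat_def])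
    also have "adjw B 1 (?e i) (y a) = (\<lambda>vs. \<Sum>b\<in>B. of_real (rcoord i b) * ins b (y a) vs)"
      by (rule ext) (simp add: adjw_1 one_form_def ins_app del: One_nat_def)
    finally show ?thesis by (simp add: finn_sum_right finn_mult_right)
  qed
  have lin\<sigma>: "linear (\<lambda>a. \<sigma> a us)" for us by (rule dfield_linear[OF W z0])
  have ylin: "linear (\<lambda>a. y a us)" for us
    unfolding y_def two_form_op_def divide_inverse
    by (intro linear_compose_add linear_compose_sub linear_compose_sum ballI linear_mult_left_real lin\<sigma> dfield_linear[OF v z0])
  have flin: "linear (\<lambda>a. finn B (u z0) (ins b (y a)))" for b
  proof (rule linearI)
    fix p q and c :: real
    have "ins b (y (p + q)) = (\<lambda>vs. ins b (y p) vs + ins b (y q) vs)" "ins b (y (c *\<^sub>R p)) = (\<lambda>vs. of_real c * ins b (y p) vs)"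
      using linear_add[OF ylin] linear_scale[OF ylin] by (simp_all add: fun_eq_iff ins_app scaleR_conv_of_real[where 'a=complex])
    then show "finn B (u z0) (ins b (y (p + q))) = finn B (u z0) (ins b (y p)) + finn B (u z0) (ins b (y q))"
      "finn B (u z0) (ins b (y (c *\<^sub>R p))) = c *\<^sub>R finn B (u z0) (ins b (y p))"
      by (simp_all add: finn_add_right finn_mult_right scaleR_conv_of_real[where 'a=complex])
  qed
  have "(\<Sum>i\<in>UNIV. finn B (fwedge (?e i) (u z0)) (y (rbasis i)))
    = (\<Sum>b\<in>B. \<Sum>i\<in>UNIV. of_real (rcoord i b) * finn B (u z0) (ins b (y (rbasis i))))"
    unfolding 2 by (rule sum.swap)
  also have "\<dots> = (\<Sum>b\<in>B. finn B (u z0) (ins b (y b)))" by (simp only: linear_rbasis[OF flin])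
  also have "\<dots> = finn B (u z0) (\<lambda>vs. \<Sum>b\<in>B. ins b (y b) vs)" by (rule finn_sum_right[symmetric])
  also have "\<dots> = - finn B (u z0) (codiff W Bf v z0)"
  proof -
    have "codiff W Bf v z0 = (\<lambda>vs. (- 1) * (\<Sum>b\<in>B. ins b (y b) vs))"
      by (rule ext) (simp add: codiff_frame[OF v] y_def ins_app)
    then show ?thesis by (simp only: finn_mult_right) simp
  qed
  finally have 3: "(\<Sum>i\<in>UNIV. finn B (fwedge (?e i) (u z0)) (y (rbasis i))) = - finn B (u z0) (codiff W Bf v z0)" .
  show ?thesis
    unfolding fr sum_distrib_left[symmetric] sum.distrib 1 3 by simp
qed

end

section \<open>Global forms\<close>

definition tws :: "('a \<Rightarrow> real) \<Rightarrow> ('a \<Rightarrow> real) \<Rightarrow> ('a, 'n::finite) form \<Rightarrow> ('a, 'n) form" where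
  "tws s t u x = tw (s x) (t x) (u x)"

lemma compactly_supportedI:
  fixes u :: "('a::t2_space, 'n) form"
  assumes "compact K" "\<And>x. x \<notin> K \<Longrightarrow> u x = 0" shows "compactly_supported u"
proof -
  have "closure {x. u x \<noteq> 0} \<subseteq> K" using assms by (intro closure_minimal compact_imp_closed) auto
  then show ?thesis
    unfolding compactly_supported_def using closed_Int_compact[OF closed_closure assms(1), of "{x. u x \<noteq> 0}"]
    by (simp add: Int_absorb2)
qed

lemma compactly_supported_zero: "x \<notin> closure {x. u x \<noteq> 0} \<Longrightarrow> u x = 0"
  using closure_subset[of "{x. u x \<noteq> 0}"] by auto

lemma compactly_supported_add:
  fixes u v :: "('a::t2_space, 'n) form"
  assumes "compactly_supported u" "compactly_supported v" shows "compactly_supported (u + v)"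
proof (rule compactly_supportedI[OF compact_Un[OF assms[unfolded compactly_supported_def]]])
  fix x assume "x \<notin> closure {x. u x \<noteq> 0} \<union> closure {x. v x \<noteq> 0}"
  then have "u x = 0" "v x = 0" using compactly_supported_zero[of x u] compactly_supported_zero[of x v] by blast+
  then show "(u + v) x = 0" by simp
qed

context complex_manifold
begin

definition smoothf :: "('a \<Rightarrow> 'c::real_normed_vector) \<Rightarrow> bool" where
  "smoothf f \<longleftrightarrow> (\<forall>c\<in>A. smooth_on (cdom c) (\<lambda>z. f (civ c z)))"

lemma smoothfD: "smoothf f \<Longrightarrow> c \<in> A \<Longrightarrow> smooth_on (cdom c) (\<lambda>z. f (civ c z))"
  by (simp add: smoothf_def)

lemma in_chart_wedge: "in_chart A c (wedge u v) z = fwedge (in_chart A c u z) (in_chart A c v z)"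
  by (simp add: in_chart_eq wedge_def pb_fwedge)

lemma in_chart_fmult: "in_chart A c (f \<odot> u) z = (\<lambda>vs. f (civ c z) * in_chart A c u z vs)"
  by (rule ext) (simp add: in_chart_eq fmult_def pb_def)

lemma in_chart_add: "in_chart A c (u + v) z = (\<lambda>vs. in_chart A c u z vs + in_chart A c v z vs)"
  and in_chart_diff: "in_chart A c (u - v) z = (\<lambda>vs. in_chart A c u z vs - in_chart A c v z vs)"
  by (rule ext, simp add: in_chart_eq pb_def)+

lemma in_chart_conj: "in_chart A c (conj_form u) z = (\<lambda>vs. cnj (in_chart A c u z vs))"
  by (rule ext) (simp add: in_chart_eq conj_form_def pb_def)

lemma Tr_chart_at:
  assumes "c \<in> A" "z \<in> cdom c"
  shows "linear (Tr c (chart_at A (civ c z)) z)" "inj (Tr c (chart_at A (civ c z)) z)"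
    "Tr c (chart_at A (civ c z)) z (J v) = J (Tr c (chart_at A (civ c z)) z v)"
  by (intro linear_Tr Tr_inverse(2) Tr_complex assms chart_at covl_chart_at)+

lemma in_chart_tws:
  "c \<in> A \<Longrightarrow> z \<in> cdom c \<Longrightarrow> in_chart A c (tws s t u) z = tw (s (civ c z)) (t (civ c z)) (in_chart A c u z)"
  unfolding in_chart_eq tws_def by (rule pb_tw) (rule Tr_chart_at(3))

lemma forms_cong_chart:
  assumes "\<And>c. c \<in> A \<Longrightarrow> sfield (cdom c) (a c)" "\<And>c z. c \<in> A \<Longrightarrow> z \<in> cdom c \<Longrightarrow> in_chart A c u z = a c z"
  shows "u \<in> forms A"
  by (rule forms_I) (use assms sfield_cong[OF chart_props(2)] in \<open>metis (no_types, lifting)\<close>)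

lemma forms_wedge: "u \<in> forms A \<Longrightarrow> v \<in> forms A \<Longrightarrow> wedge u v \<in> forms A"
  by (rule forms_cong_chart[OF _ in_chart_wedge]) (intro sfield_fwedge chart_props forms_sfield)

lemma forms_add: "u \<in> forms A \<Longrightarrow> v \<in> forms A \<Longrightarrow> u + v \<in> forms A"
  by (rule forms_cong_chart[OF _ in_chart_add]) (intro sfield_add chart_props forms_sfield)

lemma forms_fmult: "smoothf f \<Longrightarrow> u \<in> forms A \<Longrightarrow> f \<odot> u \<in> forms A"
  by (rule forms_cong_chart[OF _ in_chart_fmult]) (intro sfield_mult chart_props forms_sfield smoothfD)

lemma forms_conj: "u \<in> forms A \<Longrightarrow> conj_form u \<in> forms A"
  by (rule forms_cong_chart[OF _ in_chart_conj]) (intro sfield_cnj chart_props forms_sfield)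

lemma forms_tws: "smoothf s \<Longrightarrow> smoothf t \<Longrightarrow> u \<in> forms A \<Longrightarrow> tws s t u \<in> forms A"
  by (rule forms_cong_chart[OF _ in_chart_tws]) (intro sfield_tw chart_props forms_sfield smoothfD)

lemma smoothf_const: "smoothf (\<lambda>x. k)"
  by (simp add: smoothf_def smooth_on_const chart_props)

lemma forms_diff: "u \<in> forms A \<Longrightarrow> v \<in> forms A \<Longrightarrow> u - v \<in> forms A"
proof -
  assume "u \<in> forms A" "v \<in> forms A"
  then have "u + (\<lambda>_. - 1) \<odot> v \<in> forms A" by (intro forms_add forms_fmult smoothf_const)
  also have "u + (\<lambda>_. - 1) \<odot> v = u - v" by (intro ext) (simp add: fmult_def)
  finally show ?thesis .
qed

lemma forms_zero: "0 \<in> forms A"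
  by (rule forms_cong_chart[where a = "\<lambda>c z vs. 0"])
    (simp_all add: sfield_def alternating_zero smooth_on_const chart_props in_chart_eq pb_def fun_eq_iff)

lemma smoothf_mult: "smoothf f \<Longrightarrow> smoothf g \<Longrightarrow> smoothf (\<lambda>x. f x * g x :: 'c::real_normed_algebra)"
  by (auto simp: smoothf_def intro: smooth_on_mult chart_props)

lemma smoothf_of_real: "smoothf f \<Longrightarrow> smoothf (\<lambda>x. of_real (f x) :: complex)"
  by (auto simp: smoothf_def intro: smooth_on_of_real chart_props)

lemma smoothf_divide:
  "smoothf f \<Longrightarrow> smoothf g \<Longrightarrow> (\<And>x. g x \<noteq> 0) \<Longrightarrow> smoothf (\<lambda>x. f x / g x :: real)"
  by (auto simp: smoothf_def intro!: smooth_on_divide chart_props)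

lemma smoothf_minus: "smoothf f \<Longrightarrow> smoothf (\<lambda>x. - f x)"
  by (auto simp: smoothf_def intro: smooth_on_minus chart_props)

lemma open_chart_preimage:
  assumes "c \<in> A" "open U" shows "open {z \<in> cdom c. civ c z \<in> U}"
proof -
  have "{z \<in> cdom c. civ c z \<in> U} = cdom c \<inter> civ c -` U" by auto
  then show ?thesis
    using continuous_open_preimage[OF continuous_civ[OF assms(1)] chart_props(2)[OF assms(1)] assms(2)] by simp
qed

text \<open>Smoothness is checked on the two open sets \<open>U\<close> and \<open>- K\<close>.\<close>

lemma smoothf_extend:
  fixes f :: "'a \<Rightarrow> 'c::real_normed_vector"
  assumes U: "open U" and K: "closed K" "K \<subseteq> U" "\<And>x. x \<notin> K \<Longrightarrow> f x = 0"
    and sm: "\<And>c. c \<in> A \<Longrightarrow> smooth_on {z \<in> cdom c. civ c z \<in> U} (\<lambda>z. f (civ c z))"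
  shows "smoothf f"
  unfolding smoothf_def
proof (intro ballI smooth_on_local)
  fix c z assume c: "c \<in> A" and z: "z \<in> cdom c"
  show "\<exists>T. open T \<and> z \<in> T \<and> smooth_on T (\<lambda>z. f (civ c z))"
  proof (cases "civ c z \<in> U")
    case True
    then show ?thesis using open_chart_preimage[OF c U] sm[OF c] z by blast
  next
    case False
    let ?T = "{z \<in> cdom c. civ c z \<in> - K}"
    have o: "open ?T" using K(1) by (intro open_chart_preimage c) auto
    have "smooth_on ?T (\<lambda>z. f (civ c z))"
      using smooth_on_const[OF o, of 0] smooth_on_cong[OF o, of "\<lambda>z. f (civ c z)" "\<lambda>z. 0"] K(3) by auto
    then show ?thesis using o z False K(2) by blast
  qed
qed

section \<open>Bump functions and partitions of unity\<close>

definition cbump :: "'a \<Rightarrow> real \<Rightarrow> 'a \<Rightarrow> real" where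
  "cbump x r y = (let c = chart_at A x in if y \<in> fst c then bump (snd c x) r (snd c y) else 0)"

definition cball_at :: "'a \<Rightarrow> real \<Rightarrow> 'a set" where
  "cball_at x r = civ (chart_at A x) ` cball (snd (chart_at A x) x) r"

lemma cbump:
  assumes r: "r > 0" "cball (snd (chart_at A x) x) r \<subseteq> cdom (chart_at A x)"
  shows "compact (cball_at x r)" "cball_at x r \<subseteq> fst (chart_at A x)"
    and "\<And>y. y \<notin> cball_at x r \<Longrightarrow> cbump x r y = 0" "\<And>y. cbump x r y \<ge> 0" "cbump x r x > 0"
    and "smoothf (cbump x r)" "open {y. cbump x r y > 0}"
proof -
  let ?c = "chart_at A x" and ?z = "snd (chart_at A x) x"
  note c = chart_at(1)[of x]
  show K: "compact (cball_at x r)"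
    unfolding cball_at_def
    by (rule compact_continuous_image[OF continuous_on_subset[OF continuous_civ[OF c] r(2)]]) simp
  show sub: "cball_at x r \<subseteq> fst ?c" unfolding cball_at_def using r(2) civ_in[OF c] by auto
  show zero: "cbump x r y = 0" if "y \<notin> cball_at x r" for y
  proof (cases "y \<in> fst ?c")
    case True
    have "snd ?c y \<notin> ball ?z r"
    proof
      assume "snd ?c y \<in> ball ?z r"
      then have "y \<in> cball_at x r"
        unfolding cball_at_def by (intro image_eqI[of _ _ "snd ?c y"]) (simp_all add: civ_chart[OF c True])
      with that show False by contradiction
    qed
    then have "bump ?z r (snd ?c y) = 0"
      using bump_pos_iff[OF r(1), of ?z "snd ?c y"] bump_nonneg[of ?z r "snd ?c y"] by linarith
    then show ?thesis by (simp add: cbump_def Let_def)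
  qed (simp add: cbump_def Let_def)
  show "cbump x r y \<ge> 0" for y by (simp add: cbump_def Let_def bump_nonneg)
  show "cbump x r x > 0" using bump_pos_iff[OF r(1), of ?z ?z] r(1) chart_at(2)[of x] by (simp add: cbump_def Let_def)
  show "smoothf (cbump x r)"
  proof (rule smoothf_extend[OF chart_props(1)[OF c] compact_imp_closed[OF K] sub zero])
    fix d assume d: "d \<in> A"
    have e: "{z \<in> cdom d. civ d z \<in> fst ?c} = covl d ?c" by (simp add: covl_eq d)
    have "smooth_on (covl d ?c) (\<lambda>z. bump ?z r (tran d ?c z))"
      by (rule smooth_on_compose[OF open_covl[OF d c] open_UNIV _ smooth_bump smooth_tran[OF d c]]) simp
    then show "smooth_on {z \<in> cdom d. civ d z \<in> fst ?c} (\<lambda>z. cbump x r (civ d z))"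
      unfolding e using smooth_on_cong[OF open_covl[OF d c], of "\<lambda>z. cbump x r (civ d z)" "\<lambda>z. bump ?z r (tran d ?c z)"]
      by (simp add: cbump_def Let_def covl_eq[OF d] tran_def)
  qed
  have "{y. cbump x r y > 0} = fst ?c \<inter> snd ?c -` ball ?z r"
    by (rule set_eqI) (simp add: cbump_def Let_def bump_pos_iff[OF r(1)])
  then show "open {y. cbump x r y > 0}"
    using continuous_open_preimage[OF continuous_chart[OF c] chart_props(1)[OF c] open_ball] by simp
qed

lemma cbump_radius: "\<exists>r. r > 0 \<and> cball (snd (chart_at A x) x) r \<subseteq> cdom (chart_at A x)"
  using open_contains_cball chart_props(2)[OF chart_at(1)] chart_in[OF chart_at(2)] by blast

text \<open>Finitely many chart bumps have a positive sum s on the support of u. Multiplying u by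
  the quotients b / s splits it into pieces with compact support inside one chart each; this is how
  a partition of unity is used from here on.\<close>

lemma compactly_supported_induct [consumes 2, case_names local zero add]:
  assumes u: "u \<in> forms A" "compactly_supported u"
    and loc: "\<And>u c K. u \<in> forms A \<Longrightarrow> c \<in> A \<Longrightarrow> compact K \<Longrightarrow> K \<subseteq> fst c \<Longrightarrow> (\<And>x. x \<notin> K \<Longrightarrow> u x = 0) \<Longrightarrow> P u"
    and zero: "P 0" and add: "\<And>u v. u \<in> forms A \<Longrightarrow> v \<in> forms A \<Longrightarrow> compactly_supported u \<Longrightarrow> compactly_supported v \<Longrightarrow> P u \<Longrightarrow> P v \<Longrightarrow> P (u + v)"
  shows "P u"
proof -
  let ?K = "closure {x. u x \<noteq> 0}"
  have K: "compact ?K" using u(2) by (simp add: compactly_supported_def)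
  obtain r where r: "\<And>x. r x > 0" "\<And>x. cball (snd (chart_at A x) x) (r x) \<subseteq> cdom (chart_at A x)"
    using cbump_radius by metis
  note cb = cbump[OF r]
  define b where "b x = cbump x (r x)" for x
  have "?K \<subseteq> (\<Union>x\<in>?K. {y. b x y > 0})" using cb(5) by (auto simp: b_def)
  with compactE_image[OF K, of ?K "\<lambda>x. {y. b x y > 0}"] cb(7)
  obtain X where X: "X \<subseteq> ?K" "finite X" "?K \<subseteq> (\<Union>x\<in>X. {y. b x y > 0})" by (metis b_def)
  define s where "s y = (\<Sum>x\<in>X. b x y)" for y
  have s0: "s y > 0" if y: "y \<in> ?K" for y
  proof -
    obtain x where x: "x \<in> X" "b x y > 0" using X(3) y by auto
    then have "0 < b x y" by simp
    also have "b x y \<le> s y" unfolding s_def using cb(4) by (intro member_le_sum x X(2)) (simp_all add: b_def)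
    finally show ?thesis .
  qed
  have cs: "continuous_on UNIV s"
  proof -
    have "continuous_on (fst c) s" if c: "c \<in> A" for c
    proof -
      have "smooth_on (cdom c) (\<lambda>z. s (civ c z))"
        unfolding s_def using cb(6) c by (intro smooth_on_sum chart_props c) (simp add: smoothf_def b_def)
      from continuous_on_compose[OF continuous_chart[OF c] smooth_on_continuous[OF this, unfolded cdom_def]]
      show ?thesis by (rule continuous_on_eq) (simp add: civ_chart[OF c])
    qed
    then have "continuous_on (\<Union>c\<in>A. fst c) s"
      using chart_props(1) by (intro continuous_on_open_UN) auto
    also have "(\<Union>c\<in>A. fst c) = UNIV" using chart_at by auto
    finally show ?thesis .
  qed
  let ?U = "{y. s y > 0}"
  have U: "open ?U" using open_vimage[OF open_greaterThan cs, of 0] by (simp add: vimage_def)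
  \<comment> \<open>The quotient b / s is singular where s vanishes. Smoothness of the product is
    checked where s > 0 and off the support of u; these open sets cover everything because s > 0 on
    the support.\<close>
  define v where "v x = (\<lambda>y. of_real (b x y / s y) :: complex) \<odot> u" for x
  have vz: "v x y = 0" if "y \<notin> ?K" for x y
    using that closure_subset[of "{x. u x \<noteq> 0}"] by (auto simp: v_def fmult_def fun_eq_iff)
  have vf: "v x \<in> forms A" if "x \<in> X" for x
  proof (rule forms_I)
    fix c assume c: "c \<in> A"
    have alt: "alternating (in_chart A c (v x) z)" if "z \<in> cdom c" for z
      unfolding v_def in_chart_fmult by (rule alternating_mult[OF sfieldD(1)[OF forms_sfield[OF u(1) c] that]])
    have "smooth_on (cdom c) (\<lambda>z. in_chart A c (v x) z vs)" for vs
    proof (rule smooth_on_local)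
      fix z assume z: "z \<in> cdom c"
      show "\<exists>T. open T \<and> z \<in> T \<and> smooth_on T (\<lambda>z. in_chart A c (v x) z vs)"
      proof (cases "civ c z \<in> ?U")
        case True
        let ?T = "{z \<in> cdom c. civ c z \<in> ?U}"
        have o: "open ?T" by (rule open_chart_preimage[OF c U])
        have sb: "smooth_on ?T (\<lambda>z. b x (civ c z))" for x
          unfolding b_def by (rule smooth_on_subset[OF smoothfD[OF cb(6) c]]) blast
        have ss: "smooth_on ?T (\<lambda>z. s (civ c z))"
          using smooth_on_sum[OF o sb] by (simp only: s_def)
        have "smooth_on ?T (\<lambda>z. of_real (b x (civ c z) / s (civ c z)) * in_chart A c u z vs)"
          by (intro smooth_on_mult smooth_on_of_real smooth_on_divide o sb ss smooth_on_subset[OF sfieldD(2)[OF forms_sfield[OF u(1) c]]]) auto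
        then show ?thesis using o z True by (intro exI[of _ ?T]) (simp add: v_def in_chart_fmult)
      next
        case False
        let ?T = "{z \<in> cdom c. civ c z \<in> - ?K}"
        have o: "open ?T" by (intro open_chart_preimage c open_Compl closed_closure)
        have "in_chart A c (v x) z vs = 0" if "z \<in> ?T" for z
          using vz[of "civ c z" x] that by (simp add: in_chart_eq pb_def)
        then have "smooth_on ?T (\<lambda>z. in_chart A c (v x) z vs)"
          using smooth_on_const[OF o, of 0] smooth_on_cong[OF o, of "\<lambda>z. in_chart A c (v x) z vs" "\<lambda>z. 0"] by auto
        then show ?thesis using o z False s0 by (intro exI[of _ ?T]) auto
      qed
    qed
    then show "sfield (cdom c) (in_chart A c (v x))" using alt by (simp add: sfield_def)
  qed
  have vloc: "v x y = 0" if "y \<notin> cball_at x (r x)" for x y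
    using cb(3)[OF that] by (auto simp: v_def b_def fmult_def fun_eq_iff)
  have vcs: "compactly_supported (v x)" for x
    by (rule compactly_supportedI[OF cb(1)[of x]]) (rule vloc)
  have Pv: "P (v x)" if "x \<in> X" for x
    by (rule loc[OF vf[OF that] chart_at(1) cb(1,2)]) (rule vloc)
  have sumv: "(\<Sum>x\<in>Y. v x) \<in> forms A \<and> compactly_supported (\<Sum>x\<in>Y. v x) \<and> P (\<Sum>x\<in>Y. v x)" if "Y \<subseteq> X" for Y
    using finite_subset[OF that X(2)] that
  proof (induction Y rule: finite_induct)
    case empty
    show ?case unfolding sum.empty by (intro conjI zero forms_zero compactly_supportedI[of "{}"] compact_empty zero_fun_apply)
  next
    case (insert x Y)
    show ?case unfolding sum.insert[OF insert(1,2)]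
      using insert by (intro conjI forms_add vf compactly_supported_add vcs add Pv) blast+
  qed
  have "(\<Sum>x\<in>X. v x) = u"
  proof
    fix y
    show "(\<Sum>x\<in>X. v x) y = u y"
    proof (cases "y \<in> ?K")
      case True
      have ap: "(\<Sum>x\<in>Y. v x) y = (\<lambda>vs. \<Sum>x\<in>Y. v x y vs)" if "finite Y" for Y
        using that by (induction Y rule: finite_induct) (simp_all add: fun_eq_iff)
      have "(\<Sum>x\<in>X. v x y vs) = u y vs" for vs
        using s0[OF True] X(2) unfolding v_def fmult_def
        by (simp add: sum_distrib_right[symmetric] of_real_sum[symmetric] sum_divide_distrib[symmetric] s_def[symmetric] del: of_real_divide of_real_sum)
      then show ?thesis by (simp add: ap[OF X(2)])
    next
      case False
      have ap: "(\<Sum>x\<in>Y. v x) y = 0" if "finite Y" for Y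
        using that by (induction Y rule: finite_induct) (simp_all add: vz[OF False])
      have "u y = 0" using False closure_subset[of "{x. u x \<noteq> 0}"] by auto
      then show ?thesis by (simp add: ap[OF X(2)])
    qed
  qed
  then show ?thesis using sumv[OF subset_refl] by simp
qed

end

section \<open>Positivity of the inner product and integration of forms\<close>

lemma adjw_nonneg: "Im (adjw B k y y []) = 0" "Re (adjw B k y y []) \<ge> 0"
proof -
  have "Im (adjw B k y y []) = 0 \<and> Re (adjw B k y y []) \<ge> 0"
    by (induction k arbitrary: y) (auto simp: adjw.simps sum_nonneg simp del: of_nat_Suc)
  then show "Im (adjw B k y y []) = 0" "Re (adjw B k y y []) \<ge> 0" by auto
qed

lemma finn_nonneg: "Im (finn B y y) = 0" "Re (finn B y y) \<ge> 0"
  by (simp_all add: finn_def sum_nonneg adjw_nonneg)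

text \<open>The inner product is a sum of squared moduli of values on basis tuples. If all these
  vanish, multilinearity kills the remaining values in degrees up to 2n, and alternation those
  above.\<close>

lemma (in hermitian) finn_zero_iff:
  assumes y: "alternating y" "finn B y y = 0" shows "y = (\<lambda>vs. 0)"
proof -
  have adjw_zero: "y vs = 0" if "alternating y" "adjw B (length vs) y y [] = 0" for y :: "'n fibre" and vs
    using that
  proof (induction vs arbitrary: y)
    case Nil then show ?case by (simp add: adjw.simps)
  next
    case (Cons v us)
    have "(\<Sum>b\<in>B. Re (adjw B (length us) (ins b y) (ins b y) [])) = 0"
      using Cons.prems(2) by (simp add: adjw.simps Re_sum[symmetric] del: Re_sum of_nat_Suc)
    then have "adjw B (length us) (ins b y) (ins b y) [] = 0" if "b \<in> B" for b
      using that by (simp add: sum_nonneg_eq_0_iff adjw_nonneg complex_eq_iff)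
    then have "y (b # us) = 0" if "b \<in> B" for b
      using Cons.IH[of "ins b y"] alternating_ins[OF Cons.prems(1)] that by (simp add: ins_app[of b y us])
    then show ?case
      using expand_linear[OF alternating_linear[OF Cons.prems(1)], of v us] by simp
  qed
  have "(\<Sum>k\<le>2 * CARD('n). Re (adjw B k y y [])) = 0"
    using y(2) by (simp add: finn_def complex_eq_iff)
  then have "adjw B k y y [] = 0" if "k \<le> 2 * CARD('n)" for k
    using that by (simp add: sum_nonneg_eq_0_iff adjw_nonneg complex_eq_iff)
  moreover have "adjw B k y y [] = 0" if "\<not> k \<le> 2 * CARD('n)" for k
    using that by (intro adjw_top_degree[OF y(1)]) auto
  ultimately show ?thesis using adjw_zero[OF y(1)] by blast
qed

text \<open>The set where f is nonzero has measure zero and is open, hence empty.\<close>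

lemma integral_zero_continuous:
  fixes f :: "'a::euclidean_space \<Rightarrow> real"
  assumes f: "continuous_on UNIV f" "integrable lborel f" "\<And>x. f x \<ge> 0" "integral\<^sup>L lborel f = 0"
  shows "f x = 0"
proof (rule ccontr)
  assume "f x \<noteq> 0"
  have "AE x in lborel. f x = 0" using f by (subst (asm) integral_nonneg_eq_0_iff_AE) auto
  moreover have U: "open {x. f x \<noteq> 0}" using open_vimage[OF _ f(1), of "- {0}"] by (auto simp: vimage_def)
  ultimately have "{x. f x \<noteq> 0} \<in> null_sets lborel" by (subst (asm) AE_iff_null) auto
  then have "negligible {x. f x \<noteq> 0}" by (simp add: negligible_iff_null_sets null_sets_completionI)
  then show False using open_not_negligible[OF U] \<open>f x \<noteq> 0\<close> by auto
qed

text \<open>The very basis selected inside \<open>form_inner\<close>, so that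
  \<open>form_inner\<close> becomes \<open>finn\<close> for it.\<close>

definition Bx :: "('a, 'n::finite) form \<Rightarrow> 'a \<Rightarrow> (complex^'n) set" where
  "Bx \<omega> x = (SOME B. orthonormal_basis \<omega> x B)"

definition Aw :: "('a, 'n::finite) form \<Rightarrow> nat \<Rightarrow> ('a, 'n) form \<Rightarrow> ('a, 'n) form \<Rightarrow> ('a, 'n) form" where
  "Aw \<omega> k \<xi> v x = adjw (Bx \<omega> x) k (\<xi> x) (v x)"

context hermitian_manifold
begin

lemma onb_Bx: "onb (\<omega> x) (Bx \<omega> x)"
  unfolding Bx_def orthonormal_basis_iff_onb by (rule someI_ex[OF onb_exists[OF herm_\<omega>]])

lemma hermitian_\<omega>: "hermitian (\<omega> x) (Bx \<omega> x)"
  by (simp add: hermitian_def herm_\<omega> onb_Bx)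

lemma form_inner_finn: "form_inner \<omega> x \<alpha> \<beta> = finn (Bx \<omega> x) \<alpha> \<beta>"
  unfolding Bx_def by (rule form_inner_eq_finn[OF onb_Bx[unfolded Bx_def]])

text \<open>A separate choice at each point of a chart. The tangent map of the transition carries it
  to an orthonormal basis at the point of the manifold, in general not \<open>Bx\<close>;
  \<open>adjw_indep\<close> and \<open>finn_indep\<close> bridge the gap.\<close>

definition Bc :: "('a, 'n) chart \<Rightarrow> complex^'n \<Rightarrow> (complex^'n) set" where
  "Bc c z = (SOME B. onb (in_chart A c \<omega> z) B)"

context
  fixes c assumes c: "c \<in> A"
begin

lemma onb_Bc: "z \<in> cdom c \<Longrightarrow> onb (in_chart A c \<omega> z) (Bc c z)"
  unfolding Bc_def by (rule someI_ex[OF onb_exists[OF herm_in_chart[OF c]]])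

lemma onb_image: "z \<in> cdom c \<Longrightarrow> onb (\<omega> (civ c z)) (Tr c (chart_at A (civ c z)) z ` Bc c z)"
  using onb_Bc unfolding in_chart_eq by (intro onb_pb Tr_chart_at c)

lemma in_chart_Aw:
  assumes z: "z \<in> cdom c" and "\<xi> \<in> forms A" "v \<in> forms A"
  shows "in_chart A c (Aw \<omega> k \<xi> v) z = adjw (Bc c z) k (in_chart A c \<xi> z) (in_chart A c v z)"
proof -
  let ?x = "civ c z" and ?L = "Tr c (chart_at A (civ c z)) z"
  have "Aw \<omega> k \<xi> v ?x = adjw (?L ` Bc c z) k (\<xi> ?x) (v ?x)"
    unfolding Aw_def
    by (rule ext, rule hermitian.adjw_indep[OF hermitian_\<omega> onb_image[OF z], symmetric]) (intro forms_alternating assms)+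
  then show ?thesis
    unfolding in_chart_eq using Tr_chart_at(2)[OF c z] by (simp add: pb_adjw inj_on_subset)
qed

lemma inner_chart:
  assumes z: "z \<in> cdom c" and "u \<in> forms A" "v \<in> forms A"
  shows "form_inner \<omega> (civ c z) (u (civ c z)) (v (civ c z)) = finn (Bc c z) (in_chart A c u z) (in_chart A c v z)"
proof -
  let ?x = "civ c z" and ?L = "Tr c (chart_at A (civ c z)) z"
  have "form_inner \<omega> ?x (u ?x) (v ?x) = finn (?L ` Bc c z) (u ?x) (v ?x)"
    unfolding form_inner_finn
    by (rule hermitian.finn_indep[OF hermitian_\<omega> onb_image[OF z], symmetric]) (intro forms_alternating assms)+
  then show ?thesis
    unfolding in_chart_eq using Tr_chart_at(2)[OF c z] by (simp add: finn_pb inj_on_subset)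
qed

lemma metric_field_chart: "z \<in> cdom c \<Longrightarrow> metric_field (cdom c) (in_chart A c \<omega>) (Bc c) z"
  unfolding metric_field_def by (intro conjI allI impI chart_props c forms_sfield \<omega>_forms herm_in_chart onb_Bc)

lemma smooth_inner:
  assumes "u \<in> forms A" "v \<in> forms A"
  shows "smooth_on (cdom c) (\<lambda>z. form_inner \<omega> (civ c z) (u (civ c z)) (v (civ c z)))"
proof -
  have "smooth_on (cdom c) (\<lambda>z. finn (Bc c z) (in_chart A c u z) (in_chart A c v z))"
    by (rule smooth_finn[where W = "in_chart A c \<omega>"]) (intro chart_props c forms_sfield \<omega>_forms herm_in_chart onb_Bc assms; assumption)+
  then show ?thesis
    using smooth_on_cong[OF chart_props(2)[OF c], of "\<lambda>z. form_inner \<omega> (civ c z) (u (civ c z)) (v (civ c z))"]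
    by (simp add: inner_chart assms)
qed

lemma dens_rho:
  assumes z: "z \<in> cdom c"
  shows "complex_of_real (dens A \<omega> c z) = 2 ^ CARD('n) * det (hmat (in_chart A c \<omega> z))"
  using det_hmat_pos(1)[OF herm_in_chart[OF c z]]
  by (simp add: dens_def hermitian_matrix_eq complex_eq_iff Im_power_real)

end

lemma forms_Aw:
  assumes "\<xi> \<in> forms A" "v \<in> forms A" shows "Aw \<omega> k \<xi> v \<in> forms A"
proof (rule forms_cong_chart)
  fix c assume c: "c \<in> A"
  show "sfield (cdom c) (\<lambda>z. adjw (Bc c z) k (in_chart A c \<xi> z) (in_chart A c v z))"
    by (rule sfield_adjw[where W = "in_chart A c \<omega>"])
      (intro chart_props c forms_sfield \<omega>_forms herm_in_chart onb_Bc assms; assumption)+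
qed (rule in_chart_Aw[OF _ _ assms])

definition fin :: "('a, 'n) form \<Rightarrow> ('a, 'n) form \<Rightarrow> 'a \<Rightarrow> complex" where
  "fin u v x = form_inner \<omega> x (u x) (v x)"

lemma fin_finn: "fin u v x = finn (Bx \<omega> x) (u x) (v x)" by (simp add: fin_def form_inner_finn)

lemma fin_linear:
  "fin (u + u') v x = fin u v x + fin u' v x" "fin u (v + v') x = fin u v x + fin u v' x"
  "fin (f \<odot> u) v x = f x * fin u v x" "fin u (f \<odot> v) x = cnj (f x) * fin u v x"
  "cnj (fin u v x) = fin v u x"
  unfolding fin_finn fmult_def plus_fun_def
  by (simp_all add: finn_add_left finn_add_right finn_mult_left finn_mult_right finn_cnj)

lemma fin_zero: "u x = 0 \<or> v x = 0 \<Longrightarrow> fin u v x = 0"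
  by (auto simp: fin_finn zero_fun_def)

lemma smoothf_continuous: assumes "smoothf f" shows "continuous_on UNIV f"
proof -
  have "continuous_on (fst c) f" if c: "c \<in> A" for c
    using continuous_on_compose[OF continuous_chart[OF c] smooth_on_continuous[OF smoothfD[OF assms c], unfolded cdom_def]]
    by (rule continuous_on_eq) (simp add: civ_chart[OF c])
  then have "continuous_on (\<Union>c\<in>A. fst c) f" using chart_props(1) by (intro continuous_on_open_UN) auto
  also have "(\<Union>c\<in>A. fst c) = UNIV" using chart_at by auto
  finally show ?thesis .
qed

lemma smoothf_fin: "u \<in> forms A \<Longrightarrow> v \<in> forms A \<Longrightarrow> smoothf (fin u v)"
  unfolding smoothf_def fin_def by (intro ballI smooth_inner)

text \<open>The support lies in a compact subset of the chart domain, so the weighted function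
  extends by zero to a continuous, compactly supported function on the whole coordinate
  space.\<close>

lemma chart_integral:
  fixes f :: "'a \<Rightarrow> complex"
  assumes c: "c \<in> A" and K: "compact K" "K \<subseteq> fst c" and f: "smoothf f" "\<And>x. x \<notin> K \<Longrightarrow> f x = 0"
  defines "h \<equiv> \<lambda>z. if z \<in> cdom c then of_real (dens A \<omega> c z) * f (civ c z) else 0"
  shows "integral\<^sup>L (vol A \<omega>) f = integral\<^sup>L lborel h" "integrable (vol A \<omega>) f" "integrable lborel h"
    "continuous_on UNIV h"
proof -
  have K': "compact (snd c ` K)" by (rule compact_continuous_image[OF continuous_on_subset[OF continuous_chart[OF c] K(2)] K(1)])
  have h0: "h z = 0" if "z \<notin> snd c ` K" for z
  proof -
    have "civ c z \<notin> K" if "z \<in> cdom c"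
      using \<open>z \<notin> snd c ` K\<close> chart_civ[OF c that] by (metis imageI)
    then show ?thesis by (simp add: h_def f(2))
  qed
  have "smooth_on (cdom c) (\<lambda>z. of_real (dens A \<omega> c z) * f (civ c z))"
    by (intro smooth_on_mult smooth_on_of_real smooth_dens smoothfD f c chart_props)
  then have 1: "continuous_on (cdom c) h"
    using smooth_on_continuous by (subst continuous_on_cong[OF refl]) (auto simp: h_def)
  have 2: "continuous_on (- (snd c ` K)) h"
    by (subst continuous_on_cong[OF refl h0]) simp_all
  have "continuous_on (cdom c \<union> - (snd c ` K)) h"
    by (intro continuous_on_open_Un 1 2 chart_props c open_Compl compact_imp_closed K')
  also have "cdom c \<union> - (snd c ` K) = UNIV" using K(2) by (auto simp: cdom_def)
  finally show hc: "continuous_on UNIV h" .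
  show hi: "integrable lborel h" by (rule integrable_continuous_compact[OF hc K' h0])
  have fm: "f \<in> borel_measurable borel" by (intro borel_measurable_continuous_onI smoothf_continuous f)
  have f0: "f x = 0" if "x \<notin> fst c" for x using that f(2) K(2) by blast
  have e: "(\<lambda>z. if z \<in> cdom c then dens A \<omega> c z *\<^sub>R f (civ c z) else 0) = h"
    by (simp add: h_def fun_eq_iff scaleR_conv_of_real)
  show "integral\<^sup>L (vol A \<omega>) f = integral\<^sup>L lborel h" "integrable (vol A \<omega>) f"
    using vol_integral[OF c fm f0] hi by (simp_all add: e)
qed

lemma L2_eq: "L2_inner A \<omega> u v = integral\<^sup>L (vol A \<omega>) (fin u v)"
  by (simp add: L2_inner_def fin_def[abs_def])

lemma integrable_fin:
  assumes uv: "u \<in> forms A" "v \<in> forms A" and cs: "compactly_supported u \<or> compactly_supported v"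
  shows "integrable (vol A \<omega>) (fin u v)"
proof -
  have 1: "integrable (vol A \<omega>) (fin u v)" if "u \<in> forms A" "v \<in> forms A" "compactly_supported u" for u v
    using that(1,3)
  proof (induction u rule: compactly_supported_induct)
    case (local u c K)
    show ?case
      by (rule chart_integral(2)[OF local(2-4) smoothf_fin[OF local(1) that(2)]]) (simp add: fin_zero local(5))
  next
    case zero
    have "fin 0 v = (\<lambda>x. 0)" by (rule ext) (rule fin_zero[OF disjI1[OF zero_fun_apply]])
    then show ?case by (simp only: integrable_zero)
  next
    case (add u u')
    have "fin (u + u') v = (\<lambda>x. fin u v x + fin u' v x)" by (rule ext) (rule fin_linear)
    then show ?case using add by (simp only:) (rule Bochner_Integration.integrable_add)
  qed
  show ?thesis
  proof (cases "compactly_supported u")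
    case False
    then have "integrable (vol A \<omega>) (\<lambda>x. cnj (fin v u x))" using 1[OF uv(2,1)] cs by simp
    then show ?thesis by (simp add: fin_linear)
  qed (rule 1[OF uv])
qed

lemma L2_add:
  assumes "u \<in> forms A" "u' \<in> forms A" "v \<in> forms A" "compactly_supported u \<and> compactly_supported u' \<or> compactly_supported v"
  shows "L2_inner A \<omega> (u + u') v = L2_inner A \<omega> u v + L2_inner A \<omega> u' v"
  unfolding L2_eq fin_linear(1)[abs_def] using assms by (intro Bochner_Integration.integral_add integrable_fin) auto

lemma L2_cnj: "cnj (L2_inner A \<omega> u v) = L2_inner A \<omega> v u"
  unfolding L2_eq Bochner_Integration.integral_cnj[symmetric] fin_linear ..

lemma L2_add_right:
  assumes "u \<in> forms A" "v \<in> forms A" "v' \<in> forms A" "compactly_supported v \<and> compactly_supported v' \<or> compactly_supported u"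
  shows "L2_inner A \<omega> u (v + v') = L2_inner A \<omega> u v + L2_inner A \<omega> u v'"
  using L2_add[OF assms(2,3,1,4)] L2_cnj by (metis complex_cnj_add)

text \<open>Tested against a bump function times \<open>w - w'\<close>.\<close>

lemma L2_unique:
  assumes w: "w \<in> forms A" "w' \<in> forms A"
    and eq: "\<And>u. u \<in> forms A \<Longrightarrow> compactly_supported u \<Longrightarrow> L2_inner A \<omega> u w = L2_inner A \<omega> u w'"
  shows "w = w'"
proof
  fix x
  define y where "y = w - w'"
  have y: "y \<in> forms A" unfolding y_def by (rule forms_diff[OF w])
  obtain r where r: "r > 0" "cball (snd (chart_at A x) x) r \<subseteq> cdom (chart_at A x)" using cbump_radius by blast
  note b = cbump[OF r]
  let ?b = "\<lambda>x. complex_of_real (cbump x r x)"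
  define u where "u = (\<lambda>z. complex_of_real (cbump x r z)) \<odot> y"
  have u: "u \<in> forms A" unfolding u_def by (intro forms_fmult smoothf_of_real b y)
  have u0: "u z = 0" if "z \<notin> cball_at x r" for z using b(3)[OF that] by (auto simp: u_def fmult_def fun_eq_iff)
  have cu: "compactly_supported u" by (rule compactly_supportedI[OF b(1) u0])
  have "L2_inner A \<omega> u w = L2_inner A \<omega> u y + L2_inner A \<omega> u w'"
    using L2_add_right[OF u y w(2)] cu by (simp add: y_def)
  then have 0: "L2_inner A \<omega> u y = 0" using eq[OF u cu] by simp
  let ?c = "chart_at A x"
  let ?f = "fin u y"
  let ?h = "\<lambda>z. if z \<in> cdom ?c then of_real (dens A \<omega> ?c z) * ?f (civ ?c z) else 0"
  note C = chart_integral[OF chart_at(1) b(1,2) smoothf_fin[OF u y] fin_zero[OF disjI1[OF u0]]]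
  have f: "?f z = of_real (cbump x r z * Re (fin y y z))" for z
  proof -
    have "fin y y z = of_real (Re (fin y y z))"
      using finn_nonneg(1)[of "Bx \<omega> z" "y z"] by (simp add: fin_finn complex_eq_iff)
    then show ?thesis unfolding u_def fin_linear(3) of_real_mult by simp
  qed
  have hr: "?h z = of_real (Re (?h z))" "Re (?h z) \<ge> 0" for z
    unfolding f of_real_mult[symmetric]
    using dens_pos[OF chart_at(1), of z x] finn_nonneg(2)[of "Bx \<omega> (civ ?c z)" "y (civ ?c z)"] b(4)[of "civ ?c z"]
    by (simp_all add: fin_finn less_imp_le del: of_real_mult)
  have "integral\<^sup>L lborel ?h = 0" using C(1) 0 by (simp add: L2_eq)
  then have i0: "integral\<^sup>L lborel (\<lambda>z. Re (?h z)) = 0" using integral_Re[OF C(3)] by simp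
  have "Re (?h (snd ?c x)) = 0"
    by (rule integral_zero_continuous[where f = "\<lambda>z. Re (?h z)", OF _ integrable_Re[OF C(3)] hr(2) i0])
      (intro continuous_on_Re C(4))
  then have "?h (snd ?c x) = 0" using hr(1) by (metis of_real_0)
  then have "dens A \<omega> ?c (snd ?c x) * (cbump x r x * Re (fin y y x)) = 0"
    using chart_in[OF chart_at(2)[of x]] by (simp add: civ_chart[OF chart_at] f)
  then have "Re (fin y y x) = 0" using dens_pos[OF chart_at(1) chart_in[OF chart_at(2)[of x]]] b(5) by simp
  then have "finn (Bx \<omega> x) (y x) (y x) = 0" using finn_nonneg(1) by (simp add: fin_finn complex_eq_iff)
  then have "y x = (\<lambda>vs. 0)" by (rule hermitian.finn_zero_iff[OF hermitian_\<omega> forms_alternating[OF y]])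
  then show "w x = w' x" by (simp add: y_def fun_eq_iff)
qed

end

section \<open>Local operators and formal adjoints\<close>

definition dcF :: "('a, 'n::finite) chart set \<Rightarrow> ('a, 'n) form \<Rightarrow> ('a, 'n) form" where
  "dcF A v = (\<lambda>_. - \<i>) \<odot> tws (\<lambda>_. 1) (\<lambda>_. - 1) (ext_d A (tws (\<lambda>_. 1) (\<lambda>_. - 1) v))"

definition codiff_form :: "('a, 'n::finite) chart set \<Rightarrow> ('a, 'n) form \<Rightarrow> ('a, 'n) form \<Rightarrow> ('a, 'n) form" where
  "codiff_form A \<omega> v = Aw \<omega> 2 \<omega> (dcF A v) - dcF A (Aw \<omega> 2 \<omega> v)
     - (Aw \<omega> 3 (ext_d A \<omega>) (wedge \<omega> v) - wedge \<omega> (Aw \<omega> 3 (ext_d A \<omega>) v))"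

context complex_manifold
begin

lemma forms_dcF: "v \<in> forms A \<Longrightarrow> dcF A v \<in> forms A"
  unfolding dcF_def by (intro forms_fmult forms_tws ext_d_forms smoothf_const)

lemma in_chart_dcF:
  assumes v: "v \<in> forms A" and c: "c \<in> A" and z: "z \<in> cdom c"
    and a: "\<And>z. z \<in> cdom c \<Longrightarrow> in_chart A c v z = a z"
  shows "in_chart A c (dcF A v) z = dc a z"
proof -
  let ?t = "tws (\<lambda>_. 1) (\<lambda>_. - 1) v"
  have t: "?t \<in> forms A" by (intro forms_tws smoothf_const v)
  have "fd (\<lambda>z. tw 1 (- 1) (a z)) z = fd (in_chart A c ?t) z"
    by (rule fd_cong[OF chart_props(2)[OF c] z _ forms_sfield[OF t c]]) (simp add: in_chart_tws[OF c] a)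
  then show ?thesis
    unfolding dcF_def in_chart_fmult in_chart_tws[OF c z] in_chart_ext_d[OF t c z] by (intro ext) (simp add: dc_def)
qed

text \<open>Supports do not grow. Composing formal adjoints depends on it, because the image of a
  compactly supported form is tested again.\<close>

definition localop :: "(('a, 'n) form \<Rightarrow> ('a, 'n) form) \<Rightarrow> bool" where
  "localop P \<longleftrightarrow> (\<forall>u\<in>forms A. \<forall>U. open U \<longrightarrow> (\<forall>x\<in>U. u x = 0) \<longrightarrow> (\<forall>x\<in>U. P u x = 0))"

lemma localopD: "localop P \<Longrightarrow> u \<in> forms A \<Longrightarrow> open U \<Longrightarrow> (\<And>x. x \<in> U \<Longrightarrow> u x = 0) \<Longrightarrow> x \<in> U \<Longrightarrow> P u x = 0"
  unfolding localop_def by blast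

lemma localop_ext_d: "localop (ext_d A)"
  unfolding localop_def
proof (intro ballI allI impI)
  fix u U x assume u: "u \<in> forms A" and U: "open U" "\<forall>x\<in>U. u x = 0" and x: "x \<in> U"
  let ?c = "chart_at A x"
  let ?S = "{z \<in> cdom ?c. civ ?c z \<in> U}"
  have z: "snd ?c x \<in> ?S" using x chart_in[OF chart_at(2)] by (simp add: civ_chart chart_at)
  have o: "open ?S" by (rule open_chart_preimage[OF chart_at(1) U(1)])
  have 0: "(\<lambda>vs. 0) = in_chart A ?c u z" if "z \<in> ?S" for z
    using that U(2) by (simp add: in_chart_eq pb_def fun_eq_iff)
  have sz: "sfield ?S (\<lambda>z vs. 0)"
    by (simp add: sfield_def alternating_zero smooth_on_const[OF o])
  have "in_chart A ?c (ext_d A u) (snd ?c x) = fd (in_chart A ?c u) (snd ?c x)"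
    by (rule in_chart_ext_d[OF u chart_at(1) chart_in[OF chart_at(2)]])
  also have "\<dots> = fd (\<lambda>z vs. 0) (snd ?c x)" by (rule fd_cong[OF o z 0 sz])
  also have "\<dots> = 0" by (rule ext) (simp add: fd_def alt_sum_def dfield_def)
  finally show "ext_d A u x = 0" by (simp add: in_chart_chart_at)
qed

lemma localop_pointwise: "(\<And>u x. u \<in> forms A \<Longrightarrow> u x = 0 \<Longrightarrow> P u x = 0) \<Longrightarrow> localop P"
  unfolding localop_def by blast

lemma localop_compose: "localop P \<Longrightarrow> localop Q \<Longrightarrow> (\<And>u. u \<in> forms A \<Longrightarrow> Q u \<in> forms A) \<Longrightarrow> localop (\<lambda>u. P (Q u))"
  unfolding localop_def by blast

lemma localop_add: "localop P \<Longrightarrow> localop Q \<Longrightarrow> localop (\<lambda>u. P u + Q u)"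
  and localop_diff: "localop P \<Longrightarrow> localop Q \<Longrightarrow> localop (\<lambda>u. P u - Q u)"
  unfolding localop_def by simp_all

lemma localop_compactly_supported:
  "localop P \<Longrightarrow> u \<in> forms A \<Longrightarrow> compactly_supported u \<Longrightarrow> compactly_supported (P u)"
proof -
  assume P: "localop P" and u: "u \<in> forms A" "compactly_supported u"
  let ?K = "closure {x. u x \<noteq> 0}"
  show "compactly_supported (P u)"
  proof (rule compactly_supportedI[of ?K])
    show "compact ?K" using u(2) by (simp only: compactly_supported_def)
    fix x assume "x \<notin> ?K"
    then have x: "x \<in> - ?K" by (simp only: Compl_iff not_False_eq_True)
    show "P u x = 0"
      by (rule localopD[OF P u(1) _ _ x]) (rule open_Compl[OF closed_closure], rule compactly_supported_zero, erule ComplD)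
  qed
qed

lemma localop_tws: "localop (tws s t)"
  by (rule localop_pointwise) (simp add: tws_def zero_fun_def tw_zero[abs_def])

lemma localop_fmult: "localop ((\<odot>) f)"
  by (rule localop_pointwise) (simp add: fmult_def fun_eq_iff)

lemma localop_wedge: "localop (wedge \<xi>)"
  by (rule localop_pointwise) (simp add: wedge_def zero_fun_def fwedge_zero_right[abs_def])

lemma localop_Aw: "localop (Aw \<omega> k \<xi>)"
proof (rule localop_pointwise)
  fix u :: "('a, 'n) form" and x assume "u x = 0"
  have "adjw B k \<xi> (\<lambda>vs. 0) vs = 0" for B k \<xi> and vs :: "(complex^'n) list"
    using adjw_mult[of B k \<xi> 0 "\<lambda>_. 0" vs] by simp
  then show "Aw \<omega> k \<xi> u x = 0" unfolding Aw_def \<open>u x = 0\<close> by (intro ext) (simp add: zero_fun_def)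
qed

lemma localop_dcF: "localop (dcF A)"
  unfolding dcF_def
  by (intro localop_compose[OF localop_fmult] localop_compose[OF localop_tws] localop_compose[OF localop_ext_d] localop_tws
      forms_tws ext_d_forms smoothf_const)

end

context hermitian_manifold
begin

lemma forms_codiff: "v \<in> forms A \<Longrightarrow> codiff_form A \<omega> v \<in> forms A"
  unfolding codiff_form_def by (intro forms_diff forms_Aw forms_dcF forms_wedge ext_d_forms \<omega>_forms)

lemma localop_codiff: "localop (codiff_form A \<omega>)"
  unfolding codiff_form_def
  by (intro localop_diff localop_compose[OF localop_Aw] localop_compose[OF localop_dcF] localop_compose[OF localop_wedge]
      localop_dcF localop_Aw localop_wedge forms_Aw forms_dcF forms_wedge ext_d_forms \<omega>_forms)

lemma in_chart_codiff:
  assumes v: "v \<in> forms A" and c: "c \<in> A" and z: "z \<in> cdom c"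
  shows "in_chart A c (codiff_form A \<omega> v) z = codiff (in_chart A c \<omega>) (Bc c) (in_chart A c v) z"
proof -
  have 1: "in_chart A c (dcF A v) z = dc (in_chart A c v) z" by (rule in_chart_dcF[OF v c z refl])
  have 2: "in_chart A c (dcF A (Aw \<omega> 2 \<omega> v)) z = dc (\<lambda>z. adjw (Bc c z) 2 (in_chart A c \<omega> z) (in_chart A c v z)) z"
    by (rule in_chart_dcF[OF forms_Aw[OF \<omega>_forms v] c z]) (rule in_chart_Aw[OF c _ \<omega>_forms v])
  note d = ext_d_forms[OF \<omega>_forms]
  show ?thesis
    unfolding codiff_form_def in_chart_diff 2 in_chart_wedge in_chart_Aw[OF c z \<omega>_forms forms_dcF[OF v]]
      in_chart_Aw[OF c z d forms_wedge[OF \<omega>_forms v]] in_chart_Aw[OF c z d v] 1 in_chart_ext_d[OF \<omega>_forms c z]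
    by (rule ext) (simp add: codiff_def)
qed

text \<open>By \<open>divergence_formula\<close> the weighted difference of the integrands is the
  divergence of the field F. One of u and v vanishes outside K, so F extends by zero to a smooth,
  compactly supported field, and its divergence integrates to zero.\<close>

lemma stokes_chart:
  assumes u: "u \<in> forms A" and v: "v \<in> forms A" and c: "c \<in> A" and K: "compact K" "K \<subseteq> fst c"
    and supp: "(\<forall>x. x \<notin> K \<longrightarrow> u x = 0) \<or> (\<forall>x. x \<notin> K \<longrightarrow> v x = 0)"
  shows "L2_inner A \<omega> (ext_d A u) v = L2_inner A \<omega> u (codiff_form A \<omega> v)"
proof -
  let ?S = "cdom c" and ?U = "in_chart A c u" and ?V = "in_chart A c v"
  let ?e = "\<lambda>i. one_form (\<lambda>v. complex_of_real (rcoord i v)) :: 'n fibre"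
  let ?d = "\<lambda>z. complex_of_real (dens A \<omega> c z)"
  note oS = chart_props(2)[OF c]
  define F where "F i z = (if z \<in> ?S then ?d z * finn (Bc c z) (fwedge (?e i) (?U z)) (?V z) else 0)" for i z
  have K': "compact (snd c ` K)" by (rule compact_continuous_image[OF continuous_on_subset[OF continuous_chart[OF c] K(2)] K(1)])
  have oK: "open (- (snd c ` K))" by (rule open_Compl[OF compact_imp_closed[OF K']])
  have F0: "F i z = 0" if "z \<notin> snd c ` K" for i z
  proof (cases "z \<in> ?S")
    case True
    have "civ c z \<notin> K" using that chart_civ[OF c True] by (metis imageI)
    then have "?U z = (\<lambda>vs. 0) \<or> ?V z = (\<lambda>vs. 0)" using supp by (auto simp: in_chart_eq pb_def fun_eq_iff)
    then show ?thesis by (auto simp: F_def fwedge_zero_right[abs_def])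
  qed (simp add: F_def)
  have se: "sfield ?S (\<lambda>z. ?e i)" for i
    unfolding sfield_def by (auto intro: alternating_coord_form smooth_on_const oS)
  have sfn: "smooth_on ?S (\<lambda>z. finn (Bc c z) (fwedge (?e i) (?U z)) (?V z))" for i
    by (rule smooth_finn[where W = "in_chart A c \<omega>"])
      (intro oS forms_sfield[OF \<omega>_forms c] herm_in_chart[OF c] onb_Bc[OF c] sfield_fwedge se forms_sfield u v c; assumption)+
  have sF: "smooth_on UNIV (F i)" for i
  proof (rule smooth_on_local)
    fix z
    show "\<exists>T. open T \<and> z \<in> T \<and> smooth_on T (F i)"
    proof (cases "z \<in> ?S")
      case True
      have "smooth_on ?S (F i)"
        using smooth_on_cong[OF oS, of "F i" "\<lambda>z. ?d z * finn (Bc c z) (fwedge (?e i) (?U z)) (?V z)"]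
          smooth_on_mult[OF oS smooth_on_of_real[OF oS smooth_dens[OF c]] sfn[of i]] by (simp add: F_def)
      then show ?thesis using oS True by blast
    next
      case False
      have "smooth_on (- (snd c ` K)) (F i)"
        using smooth_on_cong[OF oK, of "F i" "\<lambda>_. 0"] smooth_on_const[OF oK, of 0] F0 by simp
      moreover have "z \<in> - (snd c ` K)" using False K(2) by (auto simp: cdom_def)
      ultimately show ?thesis using oK by blast
    qed
  qed
  let ?DF = "\<lambda>i z. frechet_derivative (F i) (at z) (rbasis i)"
  have DF0: "?DF i z = 0" if "z \<notin> snd c ` K" for i z
  proof -
    have "(F i has_derivative (\<lambda>_. 0)) (at z)"
      by (rule has_derivative_transform_within_open[OF has_derivative_const oK]) (use that F0 in auto)
    from fun_cong[OF frechet_derivative_at[OF this], of "rbasis i"] show ?thesis by simp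
  qed
  have DFi: "integrable lborel (?DF i)" for i
    by (rule integrable_continuous_compact[OF smooth_on_continuous[OF smooth_on_frechet[OF sF]] K' DF0])
  have int0: "(\<integral>z. (\<Sum>i\<in>UNIV. ?DF i z) \<partial>lborel) = 0"
  proof -
    have "(\<integral>z. (\<Sum>i\<in>UNIV. ?DF i z) \<partial>lborel) = (\<Sum>i\<in>UNIV. \<integral>z. ?DF i z \<partial>lborel)"
      by (rule Bochner_Integration.integral_sum) (rule DFi)
    then show ?thesis by (simp add: integral_derivative_compact_support[OF sF K' F0])
  qed
  note dU = ext_d_forms[OF u] and dV = forms_codiff[OF v]
  have van: "fin (ext_d A u) v x = 0 \<and> fin u (codiff_form A \<omega> v) x = 0" if "x \<notin> K" for x
  proof -
    have oc: "open (- K)" by (rule open_Compl[OF compact_imp_closed[OF K(1)]])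
    show ?thesis
    proof (cases "\<forall>x. x \<notin> K \<longrightarrow> u x = 0")
      case True
      then have "ext_d A u x = 0" using that by (intro localopD[OF localop_ext_d u oc]) auto
      then show ?thesis using True that by (simp add: fin_zero)
    next
      case False
      then have v0: "\<forall>x. x \<notin> K \<longrightarrow> v x = 0" using supp by blast
      then have "codiff_form A \<omega> v x = 0" using that by (intro localopD[OF localop_codiff v oc]) auto
      then show ?thesis using v0 that by (simp add: fin_zero)
    qed
  qed
  let ?h1 = "\<lambda>z. if z \<in> ?S then ?d z * fin (ext_d A u) v (civ c z) else 0"
  let ?h2 = "\<lambda>z. if z \<in> ?S then ?d z * fin u (codiff_form A \<omega> v) (civ c z) else 0"
  note C1 = chart_integral[OF c K smoothf_fin[OF dU v] conjunct1[OF van]]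
  note C2 = chart_integral[OF c K smoothf_fin[OF u dV] conjunct2[OF van]]
  have pt: "?h1 z - ?h2 z = (\<Sum>i\<in>UNIV. ?DF i z)" for z
  proof (cases "z \<in> ?S")
    case True
    interpret metric_field ?S "in_chart A c \<omega>" "Bc c" z by (rule metric_field_chart[OF c True])
    \<comment> \<open>F carries the full density \<open>dens\<close>, while
      \<open>divergence_formula\<close> uses \<open>rho\<close>; they differ by the factor
      2^n.\<close>
    have D: "?DF i z = 2 ^ CARD('n) * frechet_derivative (\<lambda>z. rho z * finn (Bc c z) (fwedge (?e i) (?U z)) (?V z)) (at z) (rbasis i)" for i
    proof -
      let ?g = "\<lambda>z. rho z * finn (Bc c z) (fwedge (?e i) (?U z)) (?V z)"
      have "smooth_on ?S (\<lambda>z. inverse (2 ^ CARD('n)) * F i z)"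
        by (intro smooth_on_mult smooth_on_const oS smooth_on_subset[OF sF]) auto
      moreover have g: "inverse (2 ^ CARD('n)) * F i z = ?g z" if "z \<in> ?S" for z
        using that by (simp add: F_def dens_rho[OF c that] rho_def)
      ultimately have "smooth_on ?S ?g" using smooth_on_cong[OF oS, of "\<lambda>z. inverse (2 ^ CARD('n)) * F i z" ?g] by simp
      from has_derivative_mult_right[OF smooth_on_has_derivative[OF this True], of "2 ^ CARD('n)"]
      have "(F i has_derivative (\<lambda>v. 2 ^ CARD('n) * frechet_derivative ?g (at z) v)) (at z)"
        by (rule has_derivative_transform_within_open[OF _ oS True]) (simp add: g[symmetric])
      from fun_cong[OF frechet_derivative_at[OF this], of "rbasis i"] show ?thesis by simp
    qed
    have "(\<Sum>i\<in>UNIV. ?DF i z) = 2 ^ CARD('n) * (rho z * (finn B (fd ?U z) (?V z) - finn B (?U z) (codiff (in_chart A c \<omega>) (Bc c) ?V z)))"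
      unfolding D sum_distrib_left[symmetric]
      by (subst divergence_formula[OF forms_sfield[OF u c] forms_sfield[OF v c]]) (rule refl)
    also have "\<dots> = ?d z * (fin (ext_d A u) v (civ c z) - fin u (codiff_form A \<omega> v) (civ c z))"
      unfolding fin_def inner_chart[OF c True dU v] inner_chart[OF c True u dV] in_chart_ext_d[OF u c True] in_chart_codiff[OF v c True]
      by (simp add: dens_rho[OF c True] rho_def)
    finally show ?thesis using True by (simp add: right_diff_distrib)
  next
    case False
    then have "z \<notin> snd c ` K" using K(2) by (auto simp: cdom_def)
    then show ?thesis using False by (simp add: DF0)
  qed
  have "integral\<^sup>L lborel ?h1 - integral\<^sup>L lborel ?h2 = integral\<^sup>L lborel (\<lambda>z. ?h1 z - ?h2 z)"
    by (rule Bochner_Integration.integral_diff[symmetric, OF C1(3) C2(3)])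
  also have "\<dots> = 0" unfolding pt by (rule int0)
  finally show ?thesis using C1(1) C2(1) by (simp add: L2_eq)
qed

text \<open>More than the condition inside \<open>adj\<close>: compact support may be on either
  side, and both operators are local. The relation is thereby symmetric and stable under sums and
  compositions, and by \<open>L2_unique\<close> it determines \<open>adj\<close> on smooth
  forms.\<close>

definition adjp :: "(('a, 'n) form \<Rightarrow> ('a, 'n) form) \<Rightarrow> (('a, 'n) form \<Rightarrow> ('a, 'n) form) \<Rightarrow> bool" where
  "adjp P Q \<longleftrightarrow> (\<forall>u\<in>forms A. P u \<in> forms A \<and> Q u \<in> forms A) \<and> localop P \<and> localop Q \<and>
     (\<forall>u\<in>forms A. \<forall>v\<in>forms A. compactly_supported u \<or> compactly_supported v \<longrightarrow> L2_inner A \<omega> (P u) v = L2_inner A \<omega> u (Q v))"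

lemma adjpD: assumes "adjp P Q"
  shows "u \<in> forms A \<Longrightarrow> P u \<in> forms A" "u \<in> forms A \<Longrightarrow> Q u \<in> forms A" "localop P" "localop Q"
    "u \<in> forms A \<Longrightarrow> v \<in> forms A \<Longrightarrow> compactly_supported u \<or> compactly_supported v \<Longrightarrow> L2_inner A \<omega> (P u) v = L2_inner A \<omega> u (Q v)"
  using assms unfolding adjp_def by blast+

lemma adjp_adj: assumes PQ: "adjp P Q" and v: "v \<in> forms A" shows "adj A \<omega> P v = Q v"
  unfolding adj_def
proof (rule the_equality)
  show "Q v \<in> forms A \<and> (\<forall>u\<in>forms A. compactly_supported u \<longrightarrow> L2_inner A \<omega> (P u) v = L2_inner A \<omega> u (Q v))"
    using adjpD(2,5)[OF PQ] v by blast
  fix w assume w: "w \<in> forms A \<and> (\<forall>u\<in>forms A. compactly_supported u \<longrightarrow> L2_inner A \<omega> (P u) v = L2_inner A \<omega> u w)"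
  show "w = Q v"
    using w adjpD(5)[OF PQ _ v] by (intro L2_unique) (simp_all add: adjpD(2)[OF PQ v])
qed

lemma adjp_sym: "adjp P Q \<Longrightarrow> adjp Q P"
  unfolding adjp_def using L2_cnj by metis

lemma adjp_unique: assumes "adjp P Q" "adjp P Q'" "v \<in> forms A" shows "Q v = Q' v"
  using adjp_adj[OF assms(1,3)] adjp_adj[OF assms(2,3)] by simp

lemma adjp_compose: assumes "adjp P Q" "adjp P' Q'" shows "adjp (\<lambda>u. P (P' u)) (\<lambda>u. Q' (Q u))"
  unfolding adjp_def
proof (intro conjI ballI impI)
  show "localop (\<lambda>u. P (P' u))"
    by (rule localop_compose[OF adjpD(3)[OF assms(1)] adjpD(3)[OF assms(2)] adjpD(1)[OF assms(2)]])
  show "localop (\<lambda>u. Q' (Q u))"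
    by (rule localop_compose[OF adjpD(4)[OF assms(2)] adjpD(4)[OF assms(1)] adjpD(2)[OF assms(1)]])
  fix u v assume uv: "u \<in> forms A" "v \<in> forms A" "compactly_supported u \<or> compactly_supported v"
  have "L2_inner A \<omega> (P (P' u)) v = L2_inner A \<omega> (P' u) (Q v)"
    using uv localop_compactly_supported[OF adjpD(3)[OF assms(2)] uv(1)]
    by (intro adjpD(5)[OF assms(1)] adjpD(1)[OF assms(2)]) auto
  also have "\<dots> = L2_inner A \<omega> u (Q' (Q v))"
    using uv localop_compactly_supported[OF adjpD(4)[OF assms(1)] uv(2)]
    by (intro adjpD(5)[OF assms(2)] adjpD(2)[OF assms(1)]) auto
  finally show "L2_inner A \<omega> (P (P' u)) v = L2_inner A \<omega> u (Q' (Q v))" .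
qed (intro forms_add adjpD(1,2)[OF assms(1)] adjpD(1,2)[OF assms(2)]; assumption)+

lemma adjp_pointwise:
  assumes "\<And>u. u \<in> forms A \<Longrightarrow> P u \<in> forms A" "\<And>u. u \<in> forms A \<Longrightarrow> Q u \<in> forms A" "localop P" "localop Q"
    "\<And>u v x. u \<in> forms A \<Longrightarrow> v \<in> forms A \<Longrightarrow> fin (P u) v x = fin u (Q v) x"
  shows "adjp P Q"
proof -
  have "fin (P u) v = fin u (Q v)" if "u \<in> forms A" "v \<in> forms A" for u v
    by (rule ext) (rule assms(5)[OF that])
  then show ?thesis unfolding adjp_def L2_eq using assms(1-4) by simp
qed

lemma adjp_fmult: "smoothf f \<Longrightarrow> smoothf (\<lambda>x. cnj (f x)) \<Longrightarrow> adjp ((\<odot>) f) ((\<odot>) (\<lambda>x. cnj (f x)))"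
  by (intro adjp_pointwise forms_fmult localop_fmult) (simp_all add: fin_linear)

lemma adjp_tws: "smoothf s \<Longrightarrow> smoothf t \<Longrightarrow> adjp (tws s t) (tws s t)"
  by (intro adjp_pointwise forms_tws localop_tws)
    (simp_all add: fin_finn tws_def hermitian.finn_tw[OF hermitian_\<omega>] forms_alternating)

lemma adjp_wedge:
  assumes "\<xi> \<in> forms A" "\<And>x. homog k (\<xi> x)" shows "adjp (wedge \<xi>) (Aw \<omega> k \<xi>)"
  by (intro adjp_pointwise forms_wedge forms_Aw localop_wedge localop_Aw assms)
    (simp_all add: fin_finn wedge_def Aw_def hermitian.finn_fwedge[OF hermitian_\<omega>] forms_alternating assms)

lemma adjp_add: assumes "adjp P Q" "adjp P' Q'" shows "adjp (\<lambda>u. P u + P' u) (\<lambda>u. Q u + Q' u)"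
  unfolding adjp_def
proof (intro conjI ballI impI)
  show "localop (\<lambda>u. P u + P' u)" "localop (\<lambda>u. Q u + Q' u)"
    by (intro localop_add adjpD(3,4)[OF assms(1)] adjpD(3,4)[OF assms(2)])+
  fix u v assume uv: "u \<in> forms A" "v \<in> forms A" "compactly_supported u \<or> compactly_supported v"
  note c1 = localop_compactly_supported[OF adjpD(3)[OF assms(1)] uv(1)] localop_compactly_supported[OF adjpD(3)[OF assms(2)] uv(1)]
  note c2 = localop_compactly_supported[OF adjpD(4)[OF assms(1)] uv(2)] localop_compactly_supported[OF adjpD(4)[OF assms(2)] uv(2)]
  have "L2_inner A \<omega> (P u + P' u) v = L2_inner A \<omega> (P u) v + L2_inner A \<omega> (P' u) v"
    using c1 uv(3) by (intro L2_add adjpD(1)[OF assms(1)] adjpD(1)[OF assms(2)] uv) auto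
  also have "\<dots> = L2_inner A \<omega> u (Q v) + L2_inner A \<omega> u (Q' v)"
    by (simp only: adjpD(5)[OF assms(1) uv] adjpD(5)[OF assms(2) uv])
  also have "\<dots> = L2_inner A \<omega> u (Q v + Q' v)"
    using c2 uv(3) by (intro L2_add_right[symmetric] adjpD(2)[OF assms(1)] adjpD(2)[OF assms(2)] uv) auto
  finally show "L2_inner A \<omega> (P u + P' u) v = L2_inner A \<omega> u (Q v + Q' v)" .
qed (intro forms_add adjpD(1,2)[OF assms(1)] adjpD(1,2)[OF assms(2)]; assumption)+

lemma adjp_scale: assumes "adjp P Q" "smoothf f" "smoothf (\<lambda>x. cnj (f x))"
  shows "adjp (\<lambda>u. f \<odot> P u) (\<lambda>u. Q ((\<lambda>x. cnj (f x)) \<odot> u))"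
  by (rule adjp_compose[OF adjp_fmult[OF assms(2,3)] assms(1)])

lemma adjp_cong:
  assumes "adjp P Q" "\<And>u. u \<in> forms A \<Longrightarrow> P' u = P u" "\<And>u. u \<in> forms A \<Longrightarrow> Q' u = Q u"
  shows "adjp P' Q'"
  using assms(1) by (simp add: adjp_def localop_def assms(2,3))

lemma ext_d_add:
  assumes "u \<in> forms A" "v \<in> forms A" shows "ext_d A (u + v) = ext_d A u + ext_d A v"
proof
  fix x
  let ?c = "chart_at A x"
  let ?z = "snd ?c x"
  note c = chart_at[of x]
  note uv = forms_add[OF assms]
  have z: "?z \<in> cdom ?c" by (rule chart_in[OF c(2)])
  have "in_chart A ?c (ext_d A (u + v)) ?z = (\<lambda>vs. fd (in_chart A ?c u) ?z vs + fd (in_chart A ?c v) ?z vs)"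
  proof (rule ext)
    fix vs
    have "((\<lambda>z. in_chart A ?c (u + v) z ws) has_derivative
        (\<lambda>h. dfield (in_chart A ?c u) ?z h ws + dfield (in_chart A ?c v) ?z h ws)) (at ?z)" for ws
      unfolding in_chart_add
      by (intro has_derivative_add sfield_has_derivative[OF forms_sfield[OF assms(1) c(1)] z] sfield_has_derivative[OF forms_sfield[OF assms(2) c(1)] z])
    then have "dfield (in_chart A ?c (u + v)) ?z = (\<lambda>h ws. dfield (in_chart A ?c u) ?z h ws + dfield (in_chart A ?c v) ?z h ws)"
      by (intro ext) (rule dfield_eqI)
    then show "in_chart A ?c (ext_d A (u + v)) ?z vs = fd (in_chart A ?c u) ?z vs + fd (in_chart A ?c v) ?z vs"
      by (simp add: in_chart_ext_d[OF uv c(1) z] fd_def alt_sum_def sum.distrib distrib_left)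
  qed
  then have "in_chart A ?c (ext_d A (u + v)) ?z = in_chart A ?c (ext_d A u + ext_d A v) ?z"
    by (simp only: in_chart_add in_chart_ext_d[OF assms(1) c(1) z] in_chart_ext_d[OF assms(2) c(1) z])
  then show "ext_d A (u + v) x = (ext_d A u + ext_d A v) x" by (rule form_eqI[OF c])
qed

lemma fwedge_Aw_add:
  "wedge \<xi> (u + v) = wedge \<xi> u + wedge \<xi> v" "Aw \<omega> k \<xi> (u + v) = Aw \<omega> k \<xi> u + Aw \<omega> k \<xi> v"
  "tws s t (u + v) = tws s t u + tws s t v" "f \<odot> (u + v) = f \<odot> u + f \<odot> v"
  by (intro ext; simp add: wedge_def plus_fun_def fwedge_add_right Aw_def adjw_add tws_def tw_add fmult_def distrib_left)+

lemma dcF_add: "u \<in> forms A \<Longrightarrow> v \<in> forms A \<Longrightarrow> dcF A (u + v) = dcF A u + dcF A v"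
  unfolding dcF_def by (simp only: fwedge_Aw_add ext_d_add forms_tws smoothf_const)

lemma codiff_add: "u \<in> forms A \<Longrightarrow> v \<in> forms A \<Longrightarrow> codiff_form A \<omega> (u + v) = codiff_form A \<omega> u + codiff_form A \<omega> v"
  unfolding codiff_form_def by (simp only: fwedge_Aw_add dcF_add forms_Aw \<omega>_forms) (intro ext, simp)

lemma L2_zero: "L2_inner A \<omega> 0 v = 0" "L2_inner A \<omega> u 0 = 0"
proof -
  have "fin 0 v = (\<lambda>x. 0)" "fin u 0 = (\<lambda>x. 0)" by (intro ext fin_zero disjI1 disjI2 zero_fun_apply)+
  then show "L2_inner A \<omega> 0 v = 0" "L2_inner A \<omega> u 0 = 0" by (simp_all only: L2_eq integral_zero)
qed

lemma localop_0: assumes "localop P" shows "P 0 = 0"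
proof
  fix x show "P 0 x = 0 x"
    by (rule trans[OF localopD[OF assms forms_zero open_UNIV] zero_fun_apply[symmetric]]) (rule zero_fun_apply, rule UNIV_I)
qed

text \<open>Whichever of u and v has compact support is cut into pieces inside single charts, where
  \<open>stokes_chart\<close> applies.\<close>

lemma adjp_ext_d: "adjp (ext_d A) (codiff_form A \<omega>)"
  unfolding adjp_def
proof (intro conjI ballI impI localop_ext_d localop_codiff ext_d_forms forms_codiff; assumption?)
  fix u v assume uv: "u \<in> forms A" "v \<in> forms A" and cs: "compactly_supported u \<or> compactly_supported v"
  let ?P = "\<lambda>u v. L2_inner A \<omega> (ext_d A u) v = L2_inner A \<omega> u (codiff_form A \<omega> v)"
  note csd = localop_compactly_supported[OF localop_ext_d] localop_compactly_supported[OF localop_codiff]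
  from cs show "?P u v"
  proof
    assume "compactly_supported u"
    with uv(1) show ?thesis
    proof (induction u rule: compactly_supported_induct)
      case (local u c K)
      then show ?case by (intro stokes_chart[OF local(1) uv(2) local(2-4)]) blast
    next
      case zero
      show ?case by (simp only: localop_0[OF localop_ext_d] L2_zero)
    next
      case (add u u')
      have "L2_inner A \<omega> (ext_d A (u + u')) v = L2_inner A \<omega> (ext_d A u) v + L2_inner A \<omega> (ext_d A u') v"
        unfolding ext_d_add[OF add(1,2)] using add by (intro L2_add ext_d_forms uv) (simp_all add: csd)
      also have "\<dots> = L2_inner A \<omega> (u + u') (codiff_form A \<omega> v)"
        unfolding add(5,6) using add by (intro L2_add[symmetric] forms_codiff uv) simp_all
      finally show ?case .
    qed
  next
    assume "compactly_supported v"
    with uv(2) show ?thesis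
    proof (induction v rule: compactly_supported_induct)
      case (local v c K)
      then show ?case by (intro stokes_chart[OF uv(1) local(1-4)]) blast
    next
      case zero
      show ?case by (simp only: localop_0[OF localop_codiff] L2_zero)
    next
      case (add v v')
      have "L2_inner A \<omega> (ext_d A u) (v + v') = L2_inner A \<omega> (ext_d A u) v + L2_inner A \<omega> (ext_d A u) v'"
        using add by (intro L2_add_right ext_d_forms uv) simp_all
      also have "\<dots> = L2_inner A \<omega> u (codiff_form A \<omega> (v + v'))"
        unfolding add(5,6) codiff_add[OF add(1,2)] using add by (intro L2_add_right[symmetric] forms_codiff uv) (simp_all add: csd)
      finally show ?case .
    qed
  qed
qed

end

section \<open>Twisting by a function\<close>

definition degmult :: "'n::finite fibre \<Rightarrow> 'n fibre" where
  "degmult y vs = of_nat (length vs) * y vs"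

text \<open>The shift c is there for the induction: a contraction lowers the length by one, so c
  grows by one.\<close>

lemma fwedge_degmult_shift:
  "fwedge (one_form \<xi>) (\<lambda>ws. (of_nat (length ws) + c) * y ws) vs = (of_nat (length vs) - 1 + c) * fwedge (one_form \<xi>) y vs"
proof (induction vs arbitrary: y c)
  case Nil
  then show ?case by (simp add: fwedge_def one_form_def)
next
  case (Cons v vs)
  have "ins v (\<lambda>ws. (of_nat (length ws) + c) * y ws) = (\<lambda>ws. (of_nat (length ws) + (1 + c)) * ins v y ws)"
    by (rule ext) (simp add: ins_app algebra_simps)
  then have "fwedge (one_form \<xi>) (ins v (\<lambda>ws. (of_nat (length ws) + c) * y ws)) vs
    = (of_nat (length vs) - 1 + (1 + c)) * fwedge (one_form \<xi>) (ins v y) vs"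
    by (simp only: Cons.IH)
  then show ?case unfolding fwedge_one_form_Cons by (simp only:) (simp add: algebra_simps)
qed

lemma fwedge_degmult: "fwedge (one_form \<xi>) (degmult y) vs = (of_nat (length vs) - 1) * fwedge (one_form \<xi>) y vs"
  using fwedge_degmult_shift[of \<xi> 0 y vs] by (simp add: degmult_def[abs_def])

lemma adjw_shift:
  "adjw B k \<xi> (\<lambda>ws. (of_nat (length ws) - 1) * y ws) vs = (of_nat (length vs) + of_nat k - 1) * adjw B k \<xi> y vs"
proof -
  have "adjw B k \<xi> (\<lambda>ws. (of_nat (length ws) - 1) * y ws) vs = adjw B k \<xi> (\<lambda>ws. (of_nat (length vs) + of_nat k - 1) * y ws) vs"
    by (rule adjw_cong) simp_all
  then show ?thesis by (simp add: adjw_mult)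
qed

lemma alternating_degmult: "alternating y \<Longrightarrow> alternating (degmult y)"
proof -
  assume y: "alternating y"
  have "degmult y = (\<lambda>vs. of_nat (length vs) * y vs)" by (rule ext) (simp add: degmult_def)
  then show ?thesis using y unfolding alternating_def by (auto simp: linear_iff algebra_simps)
qed

lemma tw_degmult: "tw s t (degmult y) = degmult (tw s t y)"
proof
  fix vs
  have "tw s t (degmult y) vs = tw s t (\<lambda>ws. of_nat (length vs) * y ws) vs" by (rule tw_cong) (simp add: degmult_def)
  then show "tw s t (degmult y) vs = degmult (tw s t y) vs" by (simp add: tw_mult degmult_def)
qed

context hermitian
begin

text \<open>The adjoint of \<xi> \<and> w is \<Lambda> after contraction with \<xi>. This is the
  part of the twisted torsion that comes from differentiating \<eta>.\<close>

lemma adjw_3_fwedge_w: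
  assumes "alternating y"
  shows "adjw B 3 (fwedge (one_form \<xi>) w) y vs = adjw B 2 w (adjw B 1 (one_form \<xi>) y) vs"
proof -
  have "adjw B 1 (one_form \<xi>) y = (\<lambda>vs. \<Sum>b\<in>B. cnj (\<xi> b) * ins b y vs)"
    by (rule ext) (simp add: adjw_1 one_form_def ins_app del: One_nat_def)
  then show ?thesis
    using adjw_fwedge_one_form[OF assms, of 2 \<xi> w vs] by (simp add: adjw_sum adjw_mult numeral_3_eq_3)
qed

text \<open>The zero-order bookkeeping of \<open>twisted_identity\<close> at one point. There U is
  u, V is T u, P1 and P2 are d^c applied to T u and to T \<Lambda> u, DO is d\<omega>, D' is the
  derivative of T^{-1} \<omega>, and QU, QL are the values of Q on u and on \<Lambda> u. Derivatives
  of forms enter only through P1, P2 and DO, which are arbitrary alternating forms here; the rest is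
  algebra with Z = d\<eta>.\<close>

lemma twisted_pointwise:
  fixes \<xi> :: "complex^'n \<Rightarrow> real" and s t s' t' \<eta> \<epsilon> :: real
  assumes \<xi>: "linear \<xi>" and P: "alternating P1" "alternating P2" and U: "alternating U" and DO: "alternating DO"
    and nz: "s \<noteq> 0" "t \<noteq> 0" "\<eta> \<noteq> 0" and ss: "s * s' = \<eta>" "t * t' = - \<eta>" "s * t = \<epsilon> * \<eta>" and \<epsilon>: "\<epsilon> * \<epsilon> = 1"
  defines "Z \<equiv> one_form (\<lambda>v. complex_of_real (\<xi> v))" and "Z' \<equiv> one_form (\<lambda>v. - complex_of_real (\<xi> (J v)))"
    and "V \<equiv> tw s t U" and "V2 \<equiv> tw s t (adjw B 2 w U)"
  defines "D' \<equiv> \<lambda>vs. of_real (1 / (s * t)) * DO vs - of_real (\<epsilon> / (s * t)^2) * fwedge Z w vs"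
    and "QU \<equiv> \<lambda>vs. \<i> * tw (1 / s) (1 / t) (\<lambda>vs. of_real \<eta> * P1 vs - fwedge Z' (degmult V) vs) vs"
    and "QL \<equiv> \<lambda>vs. \<i> * tw (1 / s) (1 / t) (\<lambda>vs. of_real \<eta> * P2 vs - fwedge Z' (degmult V2) vs) vs"
  shows "tw (1 / s) (1 / t) (\<lambda>vs. adjw B 2 w P1 vs - (of_real (s * t) * P2 vs + of_real \<epsilon> * fwedge Z' V2 vs)
        - (adjw B 3 DO (fwedge w V) vs - fwedge w (adjw B 3 DO V) vs)) vs
      + (adjw B 3 (tw s t D') (fwedge w U) vs - fwedge w (adjw B 3 (tw s t D') U) vs)
    = - \<i> * of_real \<epsilon> * (adjw B 2 w QU vs - QL vs)
      + of_real (\<epsilon> * CARD('n) / \<eta>) * (fwedge (\<lambda>vs. \<i> * tw s' t' Z vs) (adjw B 2 w U) vs - adjw B 2 w (fwedge (\<lambda>vs. \<i> * tw s' t' Z vs) U) vs)"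
proof -
  let ?T = "tw s t" and ?I = "tw (1 / s) (1 / t)" and ?L = "adjw B 2 w" and ?\<kappa> = "s * t"
  have \<epsilon>0: "\<epsilon> \<noteq> 0" using \<epsilon> by auto
  have \<kappa>0: "?\<kappa> \<noteq> 0" using nz by simp
  have e\<kappa>: "\<epsilon> / ?\<kappa> = 1 / \<eta>" "\<epsilon> * \<eta> / ?\<kappa> = 1" using \<epsilon>0 nz(3) unfolding ss(3) by simp_all
  have l\<xi>: "linear (\<lambda>v. complex_of_real (\<xi> v))" "linear (\<lambda>v. - complex_of_real (\<xi> (J v)))"
    using \<xi> by (auto simp: linear_iff J_add J_scaleR scaleR_conv_of_real[where 'a=complex])
  have aZ: "alternating Z" "alternating Z'" unfolding Z_def Z'_def by (intro alternating_one_form l\<xi>)+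
  have aV: "alternating V" "alternating V2" unfolding V_def V2_def by (intro alternating_tw alternating_adjw U)+
  have aD: "alternating D'" unfolding D'_def by (intro alternating_diff alternating_mult DO alternating_fwedge aZ alt_w)
  have TI: "?T (?I y) = y" "?I (?T y) = y" if "alternating y" for y
    using nz by (simp_all add: tw_tw[OF that] tw_one[OF that])
  have wI: "fwedge w (?I y) vs = of_real ?\<kappa> * ?I (fwedge w y) vs" for y vs
    unfolding tw_fwedge tw_w fwedge_mult_left using nz by (simp add: field_simps)
  have LI: "?L (?I y) vs = of_real (1 / ?\<kappa>) * ?I (?L y) vs" if "alternating y" for y vs
    using Lam_tw[OF that, of "1 / s" "1 / t" vs] by simp
  have TwU: "?T (fwedge w U) = (\<lambda>vs. of_real ?\<kappa> * fwedge w V vs)"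
    by (rule ext) (simp add: tw_fwedge tw_w fwedge_mult_left V_def)
  have A3: "adjw B 3 (?T D') y vs = ?I (adjw B 3 D' (?T y)) vs" if y: "alternating y" for y vs
  proof -
    have "adjw B 3 D' (?T y) = ?T (adjw B 3 (?T D') y)" by (rule ext) (rule adjw_tw[OF y aD])
    then show ?thesis by (simp add: TI(2)[OF alternating_adjw[OF y]])
  qed
  have V2: "V2 = (\<lambda>vs. of_real (1 / ?\<kappa>) * ?L V vs)"
    using Lam_tw[OF U, of s t] \<kappa>0 by (intro ext) (simp add: V2_def V_def)
  let ?A = "adjw B 1 Z"
  \<comment> \<open>The part d\<eta> \<and> \<omega> of D' contributes \<Lambda> after contraction
    with d\<eta>; its coefficient is \<epsilon> / (s t) = 1 / \<eta>.\<close>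
  have D'A: "of_real ?\<kappa> * adjw B 3 D' y vs = adjw B 3 DO y vs - of_real (1 / \<eta>) * ?L (?A y) vs" if y: "alternating y" for y vs
  proof -
    have "D' = (\<lambda>vs. of_real (1 / ?\<kappa>) * DO vs + of_real (- (\<epsilon> / ?\<kappa>^2)) * fwedge Z w vs)" unfolding D'_def by (rule ext) simp
    then have "adjw B 3 D' y vs = of_real (1 / ?\<kappa>) * adjw B 3 DO y vs + of_real (- (\<epsilon> / ?\<kappa>^2)) * ?L (?A y) vs"
      unfolding Z_def by (simp only: adjw_left_add adjw_left_mult adjw_3_fwedge_w[OF y] complex_cnj_complex_of_real)
    then have "of_real ?\<kappa> * adjw B 3 D' y vs = of_real (?\<kappa> * (1 / ?\<kappa>)) * adjw B 3 DO y vs - of_real (?\<kappa> * (\<epsilon> / ?\<kappa>^2)) * ?L (?A y) vs"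
    proof -
      have "k * x = (k * a) * p - (k * b) * q" if "x = a * p + (- b) * q" for k x a b p q :: complex
        unfolding that by (simp add: algebra_simps)
      then show ?thesis using \<open>adjw B 3 D' y vs = _\<close> unfolding of_real_mult[of ?\<kappa>] of_real_minus by blast
    qed
    also have "?\<kappa> * (1 / ?\<kappa>) = 1" using \<kappa>0 by simp
    also have "?\<kappa> * (\<epsilon> / ?\<kappa>^2) = 1 / \<eta>" using e\<kappa>(1) \<kappa>0 by (simp add: power2_eq_square)
    finally show ?thesis by simp
  qed
  \<comment> \<open>X and Y are the two sides once T^{-1} has been taken out; both are expressed
    through V instead of U.\<close>
  define X where "X = (\<lambda>vs. ?L P1 vs - of_real ?\<kappa> * P2 vs - of_real (1 / \<eta>) * fwedge Z' (?L V) vs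
    - of_real (1 / \<eta>) * (?L (?A (fwedge w V)) vs - fwedge w (?L (?A V)) vs))"
  define Y where "Y = (\<lambda>vs. ?L P1 vs - of_real ?\<kappa> * P2 vs - of_real (1 / \<eta>) * ?L (fwedge Z' (degmult V)) vs
    + of_real (1 / \<eta>) * fwedge Z' (degmult (?L V)) vs + of_real (CARD('n) / \<eta>) * (?L (fwedge Z' V) vs - fwedge Z' (?L V) vs))"
  have XY: "X = Y"
  proof
    fix vs
    note z = zero_order[OF aV(1) \<xi>, folded Z_def Z'_def]
    have 1: "?L (fwedge Z' (degmult V)) vs = (of_nat (length vs) + 1) * (fwedge Z' (?L V) vs - ?A V vs)"
    proof -
      have "fwedge Z' (degmult V) = (\<lambda>ws. (of_nat (length ws) - 1) * fwedge Z' V ws)"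
        unfolding Z'_def by (rule ext) (rule fwedge_degmult)
      then show ?thesis by (simp add: adjw_shift z(2))
    qed
    have 2: "fwedge Z' (degmult (?L V)) vs = (of_nat (length vs) - 1) * fwedge Z' (?L V) vs"
      unfolding Z'_def by (rule fwedge_degmult)
    \<comment> \<open>With l = \<open>length vs\<close>, both zero-order parts are - (2 Z' \<and>
      \<Lambda> V + (n - l - 1) \<open>?A V\<close>) / \<eta>. In Y the multiples of l come from the
      degree operator before and after \<Lambda>, and n comes from the last commutator.\<close>
    show "X vs = Y vs"
      unfolding X_def Y_def z 1 2 by (simp add: algebra_simps add_divide_distrib diff_divide_distrib)
  qed
  have lhs: "?I (\<lambda>vs. ?L P1 vs - (of_real ?\<kappa> * P2 vs + of_real \<epsilon> * fwedge Z' V2 vs)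
        - (adjw B 3 DO (fwedge w V) vs - fwedge w (adjw B 3 DO V) vs)) vs
      + (adjw B 3 (?T D') (fwedge w U) vs - fwedge w (adjw B 3 (?T D') U) vs) = ?I X vs"
  proof -
    have k1: "adjw B 3 (?T D') (fwedge w U) vs = ?I (\<lambda>vs. of_real ?\<kappa> * adjw B 3 D' (fwedge w V) vs) vs"
      unfolding A3[OF alternating_fwedge[OF alt_w U]] TwU by (simp add: adjw_mult[abs_def])
    have k2: "fwedge w (adjw B 3 (?T D') U) vs = ?I (\<lambda>vs. of_real ?\<kappa> * fwedge w (adjw B 3 D' V) vs) vs"
    proof -
      have "adjw B 3 (?T D') U = ?I (adjw B 3 D' V)" unfolding V_def by (rule ext) (rule A3[OF U])
      then show ?thesis by (simp add: wI tw_mult)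
    qed
    have k3: "of_real ?\<kappa> * fwedge w (adjw B 3 D' V) vs = fwedge w (adjw B 3 DO V) vs - of_real (1 / \<eta>) * fwedge w (?L (?A V)) vs" for vs
      unfolding fwedge_mult_right[symmetric] D'A[OF aV(1)] by (simp add: fwedge_diff_right)
    have k4: "of_real \<epsilon> * fwedge Z' V2 vs = of_real (1 / \<eta>) * fwedge Z' (?L V) vs" for vs
      unfolding V2 fwedge_mult_right e\<kappa>(1)[symmetric] by simp
    show ?thesis
      unfolding k1 k2 D'A[OF alternating_fwedge[OF alt_w aV(1)]] k3 k4 tw_diff[symmetric] tw_add[symmetric] X_def
      by (rule arg_cong[of _ _ "\<lambda>f. ?I f vs"], rule ext) (simp add: algebra_simps)
  qed
  \<comment> \<open>Multiplying by T_{s,t} leaves T_{\<eta>,-\<eta>}, which on a one-form is \<i>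
    \<eta> times minus composition with J.\<close>
  have T'Z: "tw s' t' Z = ?I (\<lambda>vs. \<i> * of_real \<eta> * Z' vs)"
  proof -
    have "?T (tw s' t' Z) = tw \<eta> (- \<eta>) Z" by (simp add: tw_tw[OF aZ(1)] ss)
    also have "\<dots> = (\<lambda>vs. \<i> * of_real \<eta> * Z' vs)"
      unfolding Z_def Z'_def tw_one_form one_form_mult[symmetric] by (simp add: field_simps)
    finally show ?thesis using TI(2)[OF alternating_tw[OF aZ(1)]] by metis
  qed
  have rhs: "- \<i> * of_real \<epsilon> * (?L QU vs - QL vs)
      + of_real (\<epsilon> * CARD('n) / \<eta>) * (fwedge (\<lambda>vs. \<i> * tw s' t' Z vs) (?L U) vs - ?L (fwedge (\<lambda>vs. \<i> * tw s' t' Z vs) U) vs) = ?I Y vs"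
  proof -
    have aq: "alternating (\<lambda>vs. of_real \<eta> * P1 vs - fwedge Z' (degmult V) vs)"
      by (intro alternating_diff alternating_mult P alternating_fwedge aZ alternating_degmult aV)
    have LU: "?L U = ?I (\<lambda>vs. of_real (1 / ?\<kappa>) * ?L V vs)"
      using TI(2)[OF alternating_adjw[OF U]] V2 V2_def by metis
    have q1: "?L QU vs = \<i> * ?I (\<lambda>vs. of_real (\<eta> / ?\<kappa>) * ?L P1 vs - of_real (1 / ?\<kappa>) * ?L (fwedge Z' (degmult V)) vs) vs"
    proof -
      have "?L (\<lambda>vs. of_real \<eta> * P1 vs - fwedge Z' (degmult V) vs) = (\<lambda>vs. of_real \<eta> * ?L P1 vs - ?L (fwedge Z' (degmult V)) vs)"
        using adjw_add[of B 2 w "\<lambda>vs. of_real \<eta> * P1 vs" "\<lambda>vs. (- 1) * fwedge Z' (degmult V) vs"]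
        by (intro ext) (simp only: adjw_mult, simp)
      then show ?thesis
        unfolding QU_def adjw_mult LI[OF aq] by (simp add: tw_mult[symmetric] right_diff_distrib del: of_real_divide) (simp add: tw_mult tw_diff field_simps)
    qed
    have q2: "QL vs = \<i> * ?I (\<lambda>vs. of_real \<eta> * P2 vs - of_real (1 / ?\<kappa>) * fwedge Z' (degmult (?L V)) vs) vs"
    proof -
      have "degmult V2 = (\<lambda>vs. of_real (1 / ?\<kappa>) * degmult (?L V) vs)" unfolding V2 by (rule ext) (simp add: degmult_def)
      then show ?thesis unfolding QL_def by (simp only: fwedge_mult_right)
    qed
    have iT: "(\<lambda>vs. \<i> * tw s' t' Z vs) = ?I (\<lambda>vs. - of_real \<eta> * Z' vs)"
      unfolding T'Z tw_mult[symmetric] by (rule arg_cong[of _ _ ?I], rule ext) (simp add: mult.assoc[symmetric])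
    have r1: "fwedge (\<lambda>vs. \<i> * tw s' t' Z vs) (?L U) vs = ?I (\<lambda>vs. - of_real (\<eta> / ?\<kappa>) * fwedge Z' (?L V) vs) vs"
      unfolding iT LU tw_fwedge[symmetric] fwedge_mult_left fwedge_mult_right by (simp add: field_simps)
    have r2: "?L (fwedge (\<lambda>vs. \<i> * tw s' t' Z vs) U) vs = ?I (\<lambda>vs. - of_real (\<eta> / ?\<kappa>) * ?L (fwedge Z' V) vs) vs"
    proof -
      have UV: "U = ?I V" unfolding V_def by (rule TI(2)[OF U, symmetric])
      have "fwedge (\<lambda>vs. \<i> * tw s' t' Z vs) U = ?I (fwedge (\<lambda>vs. - of_real \<eta> * Z' vs) V)"
        unfolding iT tw_fwedge UV[symmetric] ..
      also have "fwedge (\<lambda>vs. - of_real \<eta> * Z' vs) V = (\<lambda>vs. - of_real \<eta> * fwedge Z' V vs)" by (rule ext) (rule fwedge_mult_left)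
      finally have e: "fwedge (\<lambda>vs. \<i> * tw s' t' Z vs) U = ?I (\<lambda>vs. - of_real \<eta> * fwedge Z' V vs)" .
      have "?L (\<lambda>vs. - of_real \<eta> * fwedge Z' V vs) = (\<lambda>vs. - of_real \<eta> * ?L (fwedge Z' V) vs)" by (rule ext) (rule adjw_mult)
      then show ?thesis
        unfolding e LI[OF alternating_mult[OF alternating_fwedge[OF aZ(2) aV(1)]]] by (simp only: tw_mult) simp
    qed
    have c: "of_real \<epsilon> * of_real (\<eta> / ?\<kappa>) = (1 :: complex)" "of_real \<epsilon> * of_real (1 / ?\<kappa>) = complex_of_real (1 / \<eta>)" "of_real \<epsilon> * of_real \<eta> = complex_of_real ?\<kappa>"
      unfolding of_real_mult[symmetric] using \<epsilon>0 nz(3) unfolding ss(3) by simp_all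
    have "?I Y vs = (of_real \<epsilon> * of_real (\<eta> / ?\<kappa>)) * ?I (?L P1) vs - (of_real \<epsilon> * of_real \<eta>) * ?I P2 vs - (of_real \<epsilon> * of_real (1 / ?\<kappa>)) * ?I (?L (fwedge Z' (degmult V))) vs
      + (of_real \<epsilon> * of_real (1 / ?\<kappa>)) * ?I (fwedge Z' (degmult (?L V))) vs
      + of_real (CARD('n) / \<eta>) * (of_real \<epsilon> * of_real (\<eta> / ?\<kappa>)) * (?I (?L (fwedge Z' V)) vs - ?I (fwedge Z' (?L V)) vs)"
      unfolding c Y_def by (simp only: tw_add tw_diff tw_mult) simp
    also have "\<dots> = - \<i> * of_real \<epsilon> * (?L QU vs - QL vs)
      + of_real (\<epsilon> * CARD('n) / \<eta>) * (fwedge (\<lambda>vs. \<i> * tw s' t' Z vs) (?L U) vs - ?L (fwedge (\<lambda>vs. \<i> * tw s' t' Z vs) U) vs)"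
      unfolding q1 q2 r1 r2 tw_add tw_diff tw_mult
      by (simp add: algebra_simps)
    finally show ?thesis ..
  qed
  show ?thesis unfolding lhs rhs XY ..
qed

end

section \<open>Derivatives of weighted forms\<close>

context complex_manifold
begin

definition Dv :: "('a \<Rightarrow> real) \<Rightarrow> 'a \<Rightarrow> complex^'n \<Rightarrow> real" where
  "Dv f x = frechet_derivative (\<lambda>z. f (civ (chart_at A x) z)) (at (snd (chart_at A x) x))"

lemma Dv_has_derivative:
  "smoothf f \<Longrightarrow> ((\<lambda>z. f (civ (chart_at A x) z)) has_derivative Dv f x) (at (snd (chart_at A x) x))"
  unfolding Dv_def by (rule smooth_on_has_derivative[OF smoothfD[OF _ chart_at(1)] chart_in[OF chart_at(2)]])

lemma linear_Dv: "smoothf f \<Longrightarrow> linear (Dv f x)"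
  using has_derivative_linear[OF Dv_has_derivative] .

lemma DvI: "((\<lambda>z. f (civ (chart_at A x) z)) has_derivative D) (at (snd (chart_at A x) x)) \<Longrightarrow> Dv f x = D"
  unfolding Dv_def by (rule frechet_derivative_at[symmetric])

lemma civ_chart_at: "civ (chart_at A x) (snd (chart_at A x) x) = x"
  by (rule civ_chart[OF chart_at])

lemma ext_d_eq: "ext_d A u x = fd (in_chart A (chart_at A x) u) (snd (chart_at A x) x)"
  by (rule ext) (simp add: ext_d_def fd_def alt_sum_def dfield_def)

text \<open>The Leibniz rule with a weight depending on the degree, as needed for powers of \<eta>.
  For an output with \<open>length vs\<close> arguments the differentiated form has degree
  \<open>length vs - 1\<close>.\<close>

lemma ext_d_weighted:
  assumes y: "y \<in> forms A" and \<phi>: "\<And>k. smoothf (\<phi> k)"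
  shows "ext_d A (\<lambda>x vs. of_real (\<phi> (length vs) x) * y x vs) x vs
    = of_real (\<phi> (length vs - 1) x) * ext_d A y x vs + fwedge (one_form (\<lambda>v. of_real (Dv (\<phi> (length vs - 1)) x v))) (y x) vs"
proof -
  let ?c = "chart_at A x" and ?w = "\<lambda>x vs. of_real (\<phi> (length vs) x) * y x vs"
  let ?z = "snd ?c x"
  have c: "in_chart A ?c ?w = (\<lambda>z ws. of_real (\<phi> (length ws) (civ ?c z)) * in_chart A ?c y z ws)"
    by (intro ext) (simp add: in_chart_eq pb_def)
  have d: "dfield (in_chart A ?c ?w) ?z v ws = of_real (\<phi> (length ws) x) * dfield (in_chart A ?c y) ?z v ws + of_real (Dv (\<phi> (length ws)) x v) * y x ws" for v ws
  proof (rule trans[OF dfield_eqI])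
    show "((\<lambda>z. in_chart A ?c ?w z ws) has_derivative
        (\<lambda>v. of_real (\<phi> (length ws) (civ ?c ?z)) * dfield (in_chart A ?c y) ?z v ws + of_real (Dv (\<phi> (length ws)) x v) * in_chart A ?c y ?z ws)) (at ?z)"
      unfolding c by (intro has_derivative_mult bounded_linear.has_derivative[OF bounded_linear_of_real Dv_has_derivative[OF \<phi>]]
          sfield_has_derivative[OF forms_sfield[OF y chart_at(1)] chart_in[OF chart_at(2)]])
  qed (simp add: civ_chart_at in_chart_chart_at)
  show ?thesis
    unfolding ext_d_eq fd_def alt_sum_def d fwedge_one_form_alt_sum sum_distrib_left sum.distrib[symmetric]
    by (intro sum.cong refl) (simp add: algebra_simps)
qed

lemma ext_d_fmult:
  assumes "y \<in> forms A" "smoothf f"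
  shows "ext_d A ((\<lambda>x. of_real (f x)) \<odot> y) x = (\<lambda>vs. of_real (f x) * ext_d A y x vs + fwedge (one_form (\<lambda>v. of_real (Dv f x v))) (y x) vs)"
proof
  fix vs
  have "(\<lambda>x. of_real (f x)) \<odot> y = (\<lambda>x vs. of_real (f x) * y x vs)" by (intro ext) (simp add: fmult_def)
  then show "ext_d A ((\<lambda>x. of_real (f x)) \<odot> y) x vs = of_real (f x) * ext_d A y x vs + fwedge (one_form (\<lambda>v. of_real (Dv f x v))) (y x) vs"
    using ext_d_weighted[OF assms(1), of "\<lambda>_. f" x vs] assms(2) by simp
qed

lemma smoothf_power: "smoothf f \<Longrightarrow> smoothf (\<lambda>x. f x ^ k :: real)"
  by (induction k) (auto intro: smoothf_const smoothf_mult)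

lemma Dv_power_inverse:
  assumes "smoothf \<eta>" "\<And>x. \<eta> x \<noteq> 0"
  shows "Dv (\<lambda>x. (1 / \<eta> x) ^ k) x v = - (real k / \<eta> x ^ Suc k) * Dv \<eta> x v"
proof -
  have "((\<lambda>z. (1 / \<eta> (civ (chart_at A x) z)) ^ k) has_derivative (\<lambda>v. - (real k / \<eta> x ^ Suc k) * Dv \<eta> x v)) (at (snd (chart_at A x) x))"
    by (rule has_derivative_eq_rhs[OF has_derivative_power[OF has_derivative_divide[OF has_derivative_const Dv_has_derivative[OF assms(1)]]]], fact assms(2), rule ext)
      (cases k; simp add: civ_chart_at assms(2) field_simps power_divide)
  from DvI[OF this] show ?thesis by simp
qed

text \<open>Multiply the Leibniz rule for \<eta>^{-k} y by \<eta>^{k+1}: the derivative of the power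
  leaves - k d\<eta> \<and> y, so the degree operator stands inside the wedge.\<close>

lemma ext_d_power:
  assumes y: "y \<in> forms A" and \<eta>: "smoothf \<eta>" "\<And>x. \<eta> x \<noteq> 0"
  shows "tw (\<eta> x) (\<eta> x) (ext_d A (tws (\<lambda>x. 1 / \<eta> x) (\<lambda>x. 1 / \<eta> x) y) x)
    = (\<lambda>vs. of_real (\<eta> x) * ext_d A y x vs - fwedge (one_form (\<lambda>v. of_real (Dv \<eta> x v))) (degmult (y x)) vs)"
proof
  fix vs
  let ?f = "\<lambda>x. 1 / \<eta> x" and ?Z = "one_form (\<lambda>v. complex_of_real (Dv \<eta> x v))"
  have sf: "smoothf ?f" by (intro smoothf_divide smoothf_const \<eta>)
  have t: "tws ?f ?f y \<in> forms A" by (intro forms_tws sf y)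
  have e: "tws ?f ?f y = (\<lambda>x vs. of_real (?f x ^ length vs) * y x vs)"
    by (intro ext) (simp add: tws_def tw_scalar forms_alternating[OF y])
  show "tw (\<eta> x) (\<eta> x) (ext_d A (tws ?f ?f y) x) vs = of_real (\<eta> x) * ext_d A y x vs - fwedge ?Z (degmult (y x)) vs"
  proof (cases "length vs")
    case 0
    then show ?thesis by (simp add: ext_d_def fwedge_def one_form_def)
  next
    case (Suc k)
    have "one_form (\<lambda>v. complex_of_real (Dv (\<lambda>x. ?f x ^ k) x v)) = (\<lambda>vs. of_real (- (real k / \<eta> x ^ Suc k)) * ?Z vs)"
      unfolding one_form_mult[symmetric] Dv_power_inverse[OF \<eta>] by simp
    then have "ext_d A (tws ?f ?f y) x vs = of_real (?f x ^ k) * ext_d A y x vs + of_real (- (real k / \<eta> x ^ Suc k)) * fwedge ?Z (y x) vs"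
      unfolding e ext_d_weighted[where \<phi> = "\<lambda>k x. ?f x ^ k", OF y smoothf_power[OF sf]] Suc diff_Suc_1 by (simp only: fwedge_mult_left)
    then have "tw (\<eta> x) (\<eta> x) (ext_d A (tws ?f ?f y) x) vs
      = of_real (\<eta> x ^ Suc k * ?f x ^ k) * ext_d A y x vs + of_real (\<eta> x ^ Suc k * - (real k / \<eta> x ^ Suc k)) * fwedge ?Z (y x) vs"
      unfolding tw_scalar[OF forms_alternating[OF ext_d_forms[OF t]]] Suc by (simp only: of_real_mult of_real_power distrib_left mult.assoc)
    also have "\<eta> x ^ Suc k * ?f x ^ k = \<eta> x" using \<eta>(2) by (simp add: power_divide)
    also have "\<eta> x ^ Suc k * - (real k / \<eta> x ^ Suc k) = - real k" using \<eta>(2) by (simp del: power_Suc)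
    finally show ?thesis by (simp add: fwedge_degmult Suc)
  qed
qed

lemma fmult_apply: "(f \<odot> u) x = (\<lambda>vs. f x * u x vs)"
  by (rule ext) (simp add: fmult_def)

lemma tws_apply: "tws s t u x = tw (s x) (t x) (u x)" by (simp add: tws_def)

lemma T1_one_form: "tw 1 (- 1) (one_form \<xi>) = (\<lambda>vs. \<i> * one_form (\<lambda>v. - \<xi> (J v)) vs)"
  unfolding tw_one_form one_form_mult[symmetric] by simp

lemma dcF_apply: "dcF A y x = (\<lambda>vs. - \<i> * tw 1 (- 1) (ext_d A (tws (\<lambda>_. 1) (\<lambda>_. - 1) y) x) vs)"
  by (rule ext) (simp add: dcF_def fmult_def tws_def)

lemma T1_T1: "y \<in> forms A \<Longrightarrow> tw 1 (- 1) (tw 1 (- 1) (y x)) = y x"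
  by (simp add: tw_tw[OF forms_alternating] tw_one[OF forms_alternating])

lemma dcF_fmult:
  assumes y: "y \<in> forms A" and f: "smoothf f"
  shows "dcF A ((\<lambda>x. of_real (f x)) \<odot> y) x = (\<lambda>vs. of_real (f x) * dcF A y x vs + fwedge (one_form (\<lambda>v. - of_real (Dv f x (J v)))) (y x) vs)"
proof -
  let ?T = "tws (\<lambda>_. 1) (\<lambda>_. - 1)"
  have Ty: "?T y \<in> forms A" by (intro forms_tws smoothf_const y)
  have "?T ((\<lambda>x. of_real (f x)) \<odot> y) = (\<lambda>x. of_real (f x)) \<odot> ?T y"
    by (intro ext) (simp add: tws_def fmult_apply tw_mult)
  then have "ext_d A (?T ((\<lambda>x. of_real (f x)) \<odot> y)) x = (\<lambda>vs. of_real (f x) * ext_d A (?T y) x vs + fwedge (one_form (\<lambda>v. of_real (Dv f x v))) (?T y x) vs)"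
    by (simp only: ext_d_fmult[OF Ty f])
  then show ?thesis
    unfolding dcF_apply by (intro ext) (simp add: tw_add tw_mult tw_fwedge tws_apply T1_T1[OF y] T1_one_form fwedge_mult_left algebra_simps)
qed

lemma ext_d_fun_form:
  assumes f: "smoothf f" shows "ext_d A (fun_form f) x = one_form (\<lambda>v. of_real (Dv f x v))"
proof
  fix vs :: "(complex^'n) list"
  let ?c = "chart_at A x"
  let ?z = "snd ?c x"
  have c: "in_chart A ?c (fun_form f) = (\<lambda>z ws. if ws = [] then of_real (f (civ ?c z)) else 0)"
    by (intro ext) (simp add: in_chart_eq pb_def fun_form_def)
  have d: "dfield (in_chart A ?c (fun_form f)) ?z v ws = (if ws = [] then of_real (Dv f x v) else 0)" for v ws
  proof (cases "ws = []")
    case True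
    then show ?thesis unfolding c
      by (simp add: dfield_eqI[OF bounded_linear.has_derivative[OF bounded_linear_of_real Dv_has_derivative[OF f]]])
        (rule dfield_eqI, simp, rule bounded_linear.has_derivative[OF bounded_linear_of_real Dv_has_derivative[OF f]])
  qed (simp add: c dfield_def)
  show "ext_d A (fun_form f) x vs = one_form (\<lambda>v. of_real (Dv f x v)) vs"
    unfolding ext_d_eq fd_def alt_sum_def d one_form_def by (cases vs; cases "tl vs") (auto intro!: sum.neutral)
qed

lemma forms_fun_form: "smoothf f \<Longrightarrow> fun_form f \<in> forms A"
proof (rule forms_cong_chart)
  assume f: "smoothf f"
  fix c assume c: "c \<in> A"
  show "sfield (cdom c) (\<lambda>z ws. if ws = [] then complex_of_real (f (civ c z)) else 0)"
  proof -
    have "smooth_on (cdom c) (\<lambda>z. if ws = [] then complex_of_real (f (civ c z)) else 0)" for ws :: "(complex^'n) list"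
      by (cases "ws = []") (simp_all add: smooth_on_of_real chart_props(2)[OF c] smoothfD[OF f c] smooth_on_const)
    then show ?thesis by (simp add: sfield_def alternating_def linear_iff)
  qed
qed (intro ext, simp add: in_chart_eq pb_def fun_form_def)

end

text \<open>T_{s,t} defines D, and T_{s',t'} its partner Q. Relations (a) and (c) have s = \<eta>, t
  = 1, s' = 1, t' = - \<eta> and \<epsilon> = 1; in (b) and (d) the two pairs are exchanged and
  \<epsilon> = -1, which accounts for their opposite signs.\<close>

locale twisted = hermitian_manifold A \<omega> for A :: "('a::{t2_space,second_countable_topology}, 'n::finite) chart set" and \<omega> +
  fixes s t s' t' \<eta> :: "'a \<Rightarrow> real" and \<epsilon> :: real
  assumes sm: "smoothf s" "smoothf t" "smoothf s'" "smoothf t'" "smoothf \<eta>"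
    and nz: "\<And>x. \<eta> x \<noteq> 0"
    and ss: "\<And>x. s x * s' x = \<eta> x" "\<And>x. t x * t' x = - \<eta> x" "\<And>x. s x * t x = \<epsilon> * \<eta> x" and \<epsilon>: "\<epsilon> * \<epsilon> = 1"
begin

lemma nz': "s x \<noteq> 0" "t x \<noteq> 0" "s' x \<noteq> 0" "t' x \<noteq> 0"
  using ss(1,2)[of x] nz[of x] by auto

abbreviation T where "T \<equiv> tws s t"
abbreviation I where "I \<equiv> tws (\<lambda>x. 1 / s x) (\<lambda>x. 1 / t x)"
abbreviation D where "D u \<equiv> T (ext_d A (I u))"
abbreviation Q where "Q u \<equiv> tws s' t' (ext_d A (tws (\<lambda>x. 1 / s' x) (\<lambda>x. 1 / t' x) u))"
abbreviation Lm where "Lm \<equiv> Aw \<omega> 2 \<omega>"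
abbreviation \<xi> where "\<xi> \<equiv> tws s' t' (ext_d A (fun_form \<eta>))"

lemma smI: "smoothf (\<lambda>x. 1 / s x)" "smoothf (\<lambda>x. 1 / t x)" "smoothf (\<lambda>x. 1 / s' x)" "smoothf (\<lambda>x. 1 / t' x)"
  by (intro smoothf_divide smoothf_const sm nz')+

lemma forms_ops:
  "u \<in> forms A \<Longrightarrow> T u \<in> forms A" "u \<in> forms A \<Longrightarrow> I u \<in> forms A" "u \<in> forms A \<Longrightarrow> D u \<in> forms A"
  "u \<in> forms A \<Longrightarrow> Q u \<in> forms A" "u \<in> forms A \<Longrightarrow> Lm u \<in> forms A" "\<xi> \<in> forms A"
  by (intro forms_tws ext_d_forms forms_Aw forms_fun_form \<omega>_forms sm smI; assumption)+

text \<open>T_{s',t'} is the product of T_{\<eta>,\<eta>}, T_{1,-1} and the inverse of T_{s,t}.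
  Conjugation by the first is \<open>ext_d_power\<close>; conjugation by the second turns d into
  \<i> d^c and d\<eta> into - \<i> d\<eta> composed with J.\<close>

lemma Q_apply:
  assumes y: "y \<in> forms A"
  shows "Q y x = (\<lambda>vs. \<i> * tw (1 / s x) (1 / t x) (\<lambda>vs. of_real (\<eta> x) * dcF A (T y) x vs
    - fwedge (one_form (\<lambda>v. - of_real (Dv \<eta> x (J v)))) (degmult (tw (s x) (t x) (y x))) vs) vs)"
proof -
  define y1 where "y1 = tws (\<lambda>_. 1) (\<lambda>_. - 1) (T y)"
  have y1: "y1 \<in> forms A" unfolding y1_def by (intro forms_tws smoothf_const forms_ops y)
  let ?f = "\<lambda>x. 1 / \<eta> x"
  have e1: "1 / \<eta> x * (1 * s x) = 1 / s' x" "1 / \<eta> x * (- 1 * t x) = 1 / t' x" for x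
    using ss(1,2)[of x] nz[of x] nz'[of x] by (simp_all add: field_simps)
  have 1: "tws (\<lambda>x. 1 / s' x) (\<lambda>x. 1 / t' x) y = tws ?f ?f y1"
    unfolding y1_def
    by (rule ext) (simp only: tws_apply tw_tw[OF forms_alternating[OF y]] tw_tw[OF alternating_tw[OF forms_alternating[OF y]]] e1)
  let ?W = "ext_d A (tws ?f ?f y1) x"
  have aW: "alternating ?W" by (intro forms_alternating ext_d_forms forms_tws smoothf_divide smoothf_const sm nz y1)
  have e2: "1 / s x * (1 * \<eta> x) = s' x" "1 / t x * (- 1 * \<eta> x) = t' x"
    using ss(1,2)[of x] nz'[of x] by (simp_all add: field_simps)
  have 2: "Q y x = tw (1 / s x) (1 / t x) (tw 1 (- 1) (tw (\<eta> x) (\<eta> x) ?W))"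
    unfolding 1 tws_apply[of s'] by (simp only: tw_tw[OF aW] tw_tw[OF alternating_tw[OF aW]] e2)
  have y1x: "tw 1 (- 1) (y1 x) = tw (s x) (t x) (y x)"
    unfolding y1_def using T1_T1[OF forms_ops(1)[OF y], of x] by (simp add: tws_apply)
  have dc: "tw 1 (- 1) (ext_d A y1 x) vs = \<i> * dcF A (T y) x vs" for vs
    unfolding dcF_apply y1_def by simp
  have "tw 1 (- 1) (tw (\<eta> x) (\<eta> x) ?W) = (\<lambda>vs. \<i> * (of_real (\<eta> x) * dcF A (T y) x vs
    - fwedge (one_form (\<lambda>v. - of_real (Dv \<eta> x (J v)))) (degmult (tw (s x) (t x) (y x))) vs))"
    unfolding ext_d_power[OF y1 sm(5) nz]
    by (rule ext) (simp add: tw_diff tw_mult tw_fwedge T1_one_form tw_degmult y1x dc fwedge_mult_left right_diff_distrib)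
  then show ?thesis unfolding 2 by (intro ext) (simp only: tw_mult)
qed

text \<open>Since \<Lambda> T = s t T \<Lambda> and T^{-1} \<omega> = \<omega> / (s t),
  differentiating s t = \<epsilon> \<eta> produces all terms with d\<eta> on the left, both in d^c
  \<Lambda> T u and in the torsion. The rest is \<open>twisted_pointwise\<close>.\<close>

lemma twisted_identity:
  assumes u: "u \<in> forms A"
  shows "I (codiff_form A \<omega> (T u)) + (Aw \<omega> 3 (D \<omega>) (wedge \<omega> u) - wedge \<omega> (Aw \<omega> 3 (D \<omega>) u))
    = (\<lambda>_. - \<i> * of_real \<epsilon>) \<odot> (Lm (Q u) - Q (Lm u))
      + (\<lambda>x. of_real (\<epsilon> * CARD('n) / \<eta> x)) \<odot> (wedge ((\<lambda>_. \<i>) \<odot> \<xi>) (Lm u) - Lm (wedge ((\<lambda>_. \<i>) \<odot> \<xi>) u))"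
proof (intro ext, goal_cases)
  case (1 x vs)
  interpret h: hermitian "\<omega> x" "Bx \<omega> x" by (rule hermitian_\<omega>)
  let ?\<kappa> = "\<lambda>x. s x * t x"
  note Lu = forms_ops(5)[OF u]
  have s\<kappa>: "smoothf ?\<kappa>" by (intro smoothf_mult sm)
  have D\<kappa>: "Dv ?\<kappa> x v = \<epsilon> * Dv \<eta> x v" for v
  proof -
    have "((\<lambda>z. s (civ (chart_at A x) z) * t (civ (chart_at A x) z)) has_derivative (\<lambda>v. \<epsilon> * Dv \<eta> x v)) (at (snd (chart_at A x) x))"
      unfolding ss by (rule has_derivative_mult_right[OF Dv_has_derivative[OF sm(5)]])
    from DvI[OF this] show ?thesis by simp
  qed
  have Di: "Dv (\<lambda>x. 1 / ?\<kappa> x) x v = - (\<epsilon> / (?\<kappa> x)^2) * Dv \<eta> x v" for v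
    using Dv_power_inverse[OF s\<kappa>, of 1 x v] nz' D\<kappa> by (simp add: power2_eq_square)
  have a: "Lm (T u) = (\<lambda>x. of_real (?\<kappa> x)) \<odot> T (Lm u)"
    by (intro ext) (simp add: Aw_def tws_def fmult_def hermitian.Lam_tw[OF hermitian_\<omega>] forms_alternating[OF u])
  have b: "I \<omega> = (\<lambda>x. of_real (1 / ?\<kappa> x)) \<odot> \<omega>"
    by (intro ext) (simp add: tws_def fmult_def hermitian.tw_w[OF hermitian_\<omega>])
  let ?Z = "one_form (\<lambda>v. complex_of_real (Dv \<eta> x v))"
  let ?Z' = "one_form (\<lambda>v. - complex_of_real (Dv \<eta> x (J v)))"
  have c: "ext_d A (I \<omega>) x = (\<lambda>vs. of_real (1 / ?\<kappa> x) * ext_d A \<omega> x vs - of_real (\<epsilon> / (?\<kappa> x)^2) * fwedge ?Z (\<omega> x) vs)"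
  proof -
    have "one_form (\<lambda>v. complex_of_real (Dv (\<lambda>x. 1 / ?\<kappa> x) x v)) = (\<lambda>vs. of_real (- (\<epsilon> / (?\<kappa> x)^2)) * ?Z vs)"
      unfolding one_form_mult[symmetric] Di by simp
    note e = this
    have "smoothf (\<lambda>x. 1 / ?\<kappa> x)" by (intro smoothf_divide smoothf_const s\<kappa>) (simp add: nz')
    then show ?thesis
      unfolding b ext_d_fmult[OF \<omega>_forms \<open>smoothf (\<lambda>x. 1 / ?\<kappa> x)\<close>] e by (intro ext) (simp only: fwedge_mult_left of_real_minus, simp)
  qed
  have d: "dcF A (Lm (T u)) x = (\<lambda>vs. of_real (?\<kappa> x) * dcF A (T (Lm u)) x vs + of_real \<epsilon> * fwedge ?Z' (tw (s x) (t x) (Lm u x)) vs)"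
  proof -
    have "one_form (\<lambda>v. - complex_of_real (Dv ?\<kappa> x (J v))) = (\<lambda>vs. of_real \<epsilon> * ?Z' vs)"
      unfolding one_form_mult[symmetric] D\<kappa> by simp
    note e = this
    show ?thesis unfolding a dcF_fmult[OF forms_ops(1)[OF Lu] s\<kappa>] e by (intro ext) (simp only: fwedge_mult_left tws_apply)
  qed
  have \<xi>x: "\<xi> x = tw (s' x) (t' x) ?Z" by (simp add: tws_apply ext_d_fun_form[OF sm(5)])
  have i\<xi>: "((\<lambda>_. \<i>) \<odot> \<xi>) x = (\<lambda>vs. \<i> * tw (s' x) (t' x) ?Z vs)" by (rule ext) (simp add: fmult_def \<xi>x)
  have Lx: "Lm v x = adjw (Bx \<omega> x) 2 (\<omega> x) (v x)" for v by (simp add: Aw_def)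
  have codx: "codiff_form A \<omega> (T u) x = (\<lambda>vs. adjw (Bx \<omega> x) 2 (\<omega> x) (dcF A (T u) x) vs
      - (of_real (?\<kappa> x) * dcF A (T (Lm u)) x vs + of_real \<epsilon> * fwedge ?Z' (tw (s x) (t x) (Lm u x)) vs)
      - (adjw (Bx \<omega> x) 3 (ext_d A \<omega> x) (fwedge (\<omega> x) (tw (s x) (t x) (u x))) vs - fwedge (\<omega> x) (adjw (Bx \<omega> x) 3 (ext_d A \<omega> x) (tw (s x) (t x) (u x))) vs))"
    unfolding codiff_form_def minus_apply d by (rule ext) (simp add: Aw_def wedge_def tws_apply)
  have Dx: "D \<omega> x = tw (s x) (t x) (ext_d A (I \<omega>) x)" by (simp add: tws_apply)
  have alt: "alternating (dcF A (T u) x)" "alternating (dcF A (T (Lm u)) x)" "alternating (u x)" "alternating (ext_d A \<omega> x)"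
    by (intro forms_alternating forms_dcF forms_ops ext_d_forms \<omega>_forms Lu u)+
  note P = h.twisted_pointwise[OF linear_Dv[OF sm(5), of x] alt nz'(1,2)[of x] nz[of x] ss[of x] \<epsilon>, of vs]
  have lhs: "(I (codiff_form A \<omega> (T u)) + (Aw \<omega> 3 (D \<omega>) (wedge \<omega> u) - wedge \<omega> (Aw \<omega> 3 (D \<omega>) u))) x vs
    = tw (1 / s x) (1 / t x) (codiff_form A \<omega> (T u) x) vs
      + (adjw (Bx \<omega> x) 3 (D \<omega> x) (fwedge (\<omega> x) (u x)) vs - fwedge (\<omega> x) (adjw (Bx \<omega> x) 3 (D \<omega> x) (u x)) vs)"
    by (simp add: tws_apply[of "\<lambda>x. 1 / s x"] wedge_def Aw_def)
  have rhs: "((\<lambda>_. - \<i> * of_real \<epsilon>) \<odot> (Lm (Q u) - Q (Lm u))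
      + (\<lambda>x. of_real (\<epsilon> * CARD('n) / \<eta> x)) \<odot> (wedge ((\<lambda>_. \<i>) \<odot> \<xi>) (Lm u) - Lm (wedge ((\<lambda>_. \<i>) \<odot> \<xi>) u))) x vs
    = - \<i> * of_real \<epsilon> * (adjw (Bx \<omega> x) 2 (\<omega> x) (Q u x) vs - Q (Lm u) x vs)
      + of_real (\<epsilon> * CARD('n) / \<eta> x) * (fwedge (((\<lambda>_. \<i>) \<odot> \<xi>) x) (Lm u x) vs - adjw (Bx \<omega> x) 2 (\<omega> x) (fwedge (((\<lambda>_. \<i>) \<odot> \<xi>) x) (u x)) vs)"
    unfolding plus_fun_apply fmult_def[of _ "_ - _"] minus_apply wedge_def Lx ..
  show ?case
    unfolding lhs rhs codx Dx c Q_apply[OF u] Q_apply[OF Lu] i\<xi> Lx by (rule P)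
qed

end

context hermitian_manifold
begin

lemma L2_const:
  "L2_inner A \<omega> ((\<lambda>_. k) \<odot> u) v = k * L2_inner A \<omega> u v" "L2_inner A \<omega> u ((\<lambda>_. k) \<odot> v) = cnj k * L2_inner A \<omega> u v"
proof -
  have "fin ((\<lambda>_. k) \<odot> u) v = (\<lambda>x. k * fin u v x)" "fin u ((\<lambda>_. k) \<odot> v) = (\<lambda>x. cnj k * fin u v x)"
    by (rule ext, rule fin_linear)+
  then show "L2_inner A \<omega> ((\<lambda>_. k) \<odot> u) v = k * L2_inner A \<omega> u v" "L2_inner A \<omega> u ((\<lambda>_. k) \<odot> v) = cnj k * L2_inner A \<omega> u v"
    by (simp_all add: L2_eq)
qed

lemma adjp_const: assumes "adjp P Q" shows "adjp (\<lambda>u. (\<lambda>_. k) \<odot> P u) (\<lambda>u. (\<lambda>_. cnj k) \<odot> Q u)"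
  unfolding adjp_def
proof (intro conjI ballI impI)
  show "localop (\<lambda>u. (\<lambda>_. k) \<odot> P u)"
    by (rule localop_compose[OF localop_fmult adjpD(3,1)[OF assms]])
  show "localop (\<lambda>u. (\<lambda>_. cnj k) \<odot> Q u)"
    by (rule localop_compose[OF localop_fmult adjpD(4,2)[OF assms]])
  fix u v assume uv: "u \<in> forms A" "v \<in> forms A" "compactly_supported u \<or> compactly_supported v"
  show "L2_inner A \<omega> ((\<lambda>_. k) \<odot> P u) v = L2_inner A \<omega> u ((\<lambda>_. cnj k) \<odot> Q v)"
    by (simp add: L2_const adjpD(5)[OF assms uv])
qed (intro forms_fmult smoothf_const adjpD(1,2)[OF assms]; assumption)+

lemma adjp_diff: assumes "adjp P Q" "adjp P' Q'" shows "adjp (\<lambda>u. P u - P' u) (\<lambda>u. Q u - Q' u)"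
proof -
  have e: "u - v = u + (\<lambda>_. - 1) \<odot> v" for u v :: "('a, 'n) form" by (intro ext) (simp add: fmult_def)
  show ?thesis using adjp_add[OF assms(1) adjp_const[OF assms(2), of "- 1"]] by (simp add: e)
qed

lemma Lam_eq_Aw: "u \<in> forms A \<Longrightarrow> Lam A \<omega> u = Aw \<omega> 2 \<omega> u"
  using herm_\<omega> unfolding Lam_def by (intro adjp_adj adjp_wedge \<omega>_forms) (auto simp: herm_def)

lemma adjp_L: "adjp (wedge \<omega>) (Aw \<omega> 2 \<omega>)"
  using herm_\<omega> by (intro adjp_wedge \<omega>_forms) (auto simp: herm_def)

end

lemma homog_ext_d:
  assumes "\<And>x. homog k (u x)" shows "homog (Suc k) (ext_d A u x)"
  unfolding homog_def
proof (intro allI impI)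
  fix vs :: "(complex^'b) list" assume l: "length vs \<noteq> Suc k"
  have "in_chart A c u z (take i vs @ drop (Suc i) vs) = 0" if "i < length vs" for c i z
    using assms l that by (auto simp: in_chart_def Let_def homog_def)
  then show "ext_d A u x vs = 0" by (simp add: ext_d_def)
qed

context twisted
begin

abbreviation Ds where "Ds u \<equiv> I (codiff_form A \<omega> (T u))"
abbreviation Qs where "Qs u \<equiv> tws (\<lambda>x. 1 / s' x) (\<lambda>x. 1 / t' x) (codiff_form A \<omega> (tws s' t' u))"
abbreviation \<Xi> where "\<Xi> \<equiv> D \<omega>"
abbreviation A3 where "A3 \<equiv> Aw \<omega> 3 \<Xi>"
abbreviation \<zeta> where "\<zeta> \<equiv> (\<lambda>_. \<i>) \<odot> \<xi>"

lemma adjp_D: "adjp (\<lambda>u. D u) (\<lambda>u. Ds u)"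
  by (intro adjp_compose[OF adjp_tws, where P' = "\<lambda>u. ext_d A (I u)" and Q' = "\<lambda>u. I (codiff_form A \<omega> u)"]
      adjp_compose[OF adjp_ext_d] adjp_tws sm smI)

lemma adjp_Q: "adjp (\<lambda>u. Q u) (\<lambda>u. Qs u)"
  by (intro adjp_compose[OF adjp_tws, where P' = "\<lambda>u. ext_d A (tws (\<lambda>x. 1 / s' x) (\<lambda>x. 1 / t' x) u)"
      and Q' = "\<lambda>u. tws (\<lambda>x. 1 / s' x) (\<lambda>x. 1 / t' x) (codiff_form A \<omega> u)"]
      adjp_compose[OF adjp_ext_d] adjp_tws sm smI)

lemma homog_\<Xi>: "homog 3 (\<Xi> x)"
proof -
  have "homog (Suc 2) (ext_d A (I \<omega>) x)"
    using herm_\<omega> by (intro homog_ext_d) (auto simp: tws_def herm_def intro: tw_homog)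
  then show ?thesis by (simp add: tws_def tw_homog numeral_3_eq_3)
qed

lemma adjp_\<Xi>: "adjp (wedge \<Xi>) A3"
  by (intro adjp_wedge forms_ops \<omega>_forms homog_\<Xi>)

lemma homog_\<xi>: "homog 1 (\<xi> x)"
  by (simp add: tws_def ext_d_fun_form[OF sm(5)] tw_homog homog_one_form)

lemma forms_\<zeta>: "\<zeta> \<in> forms A" by (intro forms_fmult smoothf_const forms_ops)

text \<open>The constant \<i> is conjugated on passing to the adjoint; relations (c) and (d) carry
  \<i> outside the adjoint, which is the source of their sign in the last term.\<close>

lemma adjp_\<zeta>: "adjp (wedge \<zeta>) (\<lambda>u. (\<lambda>_. - \<i>) \<odot> Aw \<omega> 1 \<xi> u)"
proof -
  have "wedge \<zeta> = (\<lambda>u. (\<lambda>_. \<i>) \<odot> wedge \<xi> u)"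
    by (intro ext) (simp add: wedge_def fmult_apply fwedge_mult_left)
  then show ?thesis using adjp_const[OF adjp_wedge[OF forms_ops(6) homog_\<xi>], of \<i>] by (simp only: complex_cnj_i)
qed

lemma smoothf_coeff: "smoothf (\<lambda>x. complex_of_real (r / \<eta> x))"
  by (intro smoothf_of_real smoothf_divide smoothf_const sm nz)

lemma adjp_torsion: "adjp (\<lambda>u. Lm (wedge \<Xi> u) - wedge \<Xi> (Lm u)) (\<lambda>u. A3 (wedge \<omega> u) - wedge \<omega> (A3 u))"
  by (intro adjp_diff adjp_compose[OF adjp_sym[OF adjp_L] adjp_\<Xi>] adjp_compose[OF adjp_\<Xi> adjp_sym[OF adjp_L]])

text \<open>The identity for \<open>D\<close> plus torsion is the formal adjoint of \<open>twisted_identity\<close>.\<close>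

lemma twisted_identity_adjoint:
  assumes v: "v \<in> forms A"
  shows "D v + (Lm (wedge \<Xi> v) - wedge \<Xi> (Lm v))
    = (\<lambda>_. \<i> * of_real \<epsilon>) \<odot> (Qs (wedge \<omega> v) - wedge \<omega> (Qs v))
      - (\<lambda>x. of_real (\<epsilon> * real CARD('n) / \<eta> x)) \<odot> (wedge \<omega> ((\<lambda>_. \<i>) \<odot> Aw \<omega> 1 \<xi> v) - (\<lambda>_. \<i>) \<odot> Aw \<omega> 1 \<xi> (wedge \<omega> v))"
proof -
  let ?L = "\<lambda>u. Ds u + (A3 (wedge \<omega> u) - wedge \<omega> (A3 u))"
  let ?R = "\<lambda>u. (\<lambda>_. - \<i> * of_real \<epsilon>) \<odot> (Lm (Q u) - Q (Lm u)) + (\<lambda>x. of_real (\<epsilon> * real CARD('n) / \<eta> x)) \<odot> (wedge \<zeta> (Lm u) - Lm (wedge \<zeta> u))"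
  let ?Z = "\<lambda>u. (\<lambda>_. - \<i>) \<odot> Aw \<omega> 1 \<xi> u"
  let ?S = "\<lambda>v. (\<lambda>_. cnj (- \<i> * of_real \<epsilon>)) \<odot> (Qs (wedge \<omega> v) - wedge \<omega> (Qs v))
      + (wedge \<omega> (?Z ((\<lambda>x. cnj (complex_of_real (\<epsilon> * real CARD('n) / \<eta> x))) \<odot> v)) - ?Z (wedge \<omega> ((\<lambda>x. cnj (complex_of_real (\<epsilon> * real CARD('n) / \<eta> x))) \<odot> v)))"
  note AL = adjp_sym[OF adjp_L]
  have 1: "adjp ?L (\<lambda>u. D u + (Lm (wedge \<Xi> u) - wedge \<Xi> (Lm u)))"
    by (intro adjp_add adjp_sym[OF adjp_D] adjp_sym[OF adjp_torsion])
  have s\<nu>: "smoothf (\<lambda>x. complex_of_real (\<epsilon> * real CARD('n) / \<eta> x))" "smoothf (\<lambda>x. cnj (complex_of_real (\<epsilon> * real CARD('n) / \<eta> x)))" using smoothf_coeff[of "\<epsilon> * real CARD('n)"] by simp_all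
  have "adjp ?R ?S"
    by (intro adjp_add adjp_const adjp_diff adjp_compose[OF AL adjp_Q] adjp_compose[OF adjp_Q AL]
      adjp_scale[where P = "\<lambda>u. wedge \<zeta> (Lm u) - Lm (wedge \<zeta> u)" and Q = "\<lambda>u. wedge \<omega> (?Z u) - ?Z (wedge \<omega> u)"]
      adjp_compose[OF adjp_\<zeta> AL] adjp_compose[OF AL adjp_\<zeta>] s\<nu>)
  then have 2: "adjp ?L ?S"
    by (rule adjp_cong) (rule twisted_identity, assumption, rule refl)
  have "D v + (Lm (wedge \<Xi> v) - wedge \<Xi> (Lm v)) = ?S v" by (rule adjp_unique[OF 1 2 v])
  also have "\<dots> = (\<lambda>_. \<i> * of_real \<epsilon>) \<odot> (Qs (wedge \<omega> v) - wedge \<omega> (Qs v))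
      - (\<lambda>x. of_real (\<epsilon> * real CARD('n) / \<eta> x)) \<odot> (wedge \<omega> ((\<lambda>_. \<i>) \<odot> Aw \<omega> 1 \<xi> v) - (\<lambda>_. \<i>) \<odot> Aw \<omega> 1 \<xi> (wedge \<omega> v))"
  proof -
    have "wedge \<omega> (f \<odot> w) = f \<odot> wedge \<omega> w" "Aw \<omega> 1 \<xi> (f \<odot> w) = f \<odot> Aw \<omega> 1 \<xi> w" for f and w :: "('a, 'n) form"
      by (intro ext, simp only: wedge_def fmult_apply fwedge_mult_right Aw_def adjw_mult)+
    then show ?thesis by (intro ext) (simp add: fmult_apply algebra_simps)
  qed
  finally show ?thesis .
qed

text \<open>Replaces \<open>adj\<close> by the explicit formal adjoints. P and \<tau> are compared
  with D and its torsion on smooth forms, where \<open>adj\<close> and \<open>Lam\<close> are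
  determined.\<close>

lemma adj_sum:
  assumes u: "u \<in> forms A"
    and P: "\<And>u. u \<in> forms A \<Longrightarrow> P u = D u" and \<tau>: "\<And>u. u \<in> forms A \<Longrightarrow> \<tau> u = Lm (wedge \<Xi> u) - wedge \<Xi> (Lm u)"
  shows "adj A \<omega> P u + adj A \<omega> \<tau> u = (\<lambda>_. - \<i> * of_real \<epsilon>) \<odot> (Lm (Q u) - Q (Lm u))
      + (\<lambda>x. of_real (\<epsilon> * real CARD('n) / \<eta> x)) \<odot> (wedge \<zeta> (Lm u) - Lm (wedge \<zeta> u))"
  using adjp_adj[OF adjp_cong[OF adjp_D P refl] u] adjp_adj[OF adjp_cong[OF adjp_torsion \<tau> refl] u] twisted_identity[OF u]
  by simp

end

section \<open>Identification with the operators of the theorem\<close>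

context hermitian_manifold
begin

lemma theta_eq: "u \<in> forms A \<Longrightarrow> theta \<eta> u = tws \<eta> (\<lambda>_. 1) u"
  by (intro ext) (simp only: theta_def component_def tws_def bidegree_expand forms_alternating)

text \<open>\<open>theta\<close> is \<open>tws\<close> with second weight 1. The quotient
  \<open>1 / 1\<close> gives the right side the shape of D in \<open>twisted\<close> for s = \<eta>
  and t = 1.\<close>

lemma tw_D_eq:
  assumes "smoothf \<eta>" "\<And>x. \<eta> x \<noteq> 0" "u \<in> forms A"
  shows "tw_D A \<eta> u = tws \<eta> (\<lambda>_. 1) (ext_d A (tws (\<lambda>x. 1 / \<eta> x) (\<lambda>x. 1 / 1) u))"
proof -
  have t: "tws (\<lambda>x. 1 / \<eta> x) (\<lambda>x. 1) u \<in> forms A" by (intro forms_tws smoothf_divide smoothf_const assms)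
  show ?thesis unfolding tw_D_def theta_eq[OF assms(3)] theta_eq[OF ext_d_forms[OF t]] by simp
qed

lemma conj_form_tws: "conj_form (tws s t u) = tws t s (conj_form u)"
  by (intro ext) (simp add: conj_form_def[abs_def] tws_def tw_cnj)

lemma conj_form_conj_form [simp]: "conj_form (conj_form u) = u"
  by (intro ext) (simp add: conj_form_def)

lemma ext_d_conj:
  assumes "u \<in> forms A" shows "ext_d A (conj_form u) = conj_form (ext_d A u)"
proof (intro ext)
  fix x vs
  let ?c = "chart_at A x"
  let ?z = "snd ?c x"
  have "dfield (in_chart A ?c (conj_form u)) ?z v ws = cnj (dfield (in_chart A ?c u) ?z v ws)" for v ws
    unfolding in_chart_conj
    by (rule dfield_eqI, rule bounded_linear.has_derivative[OF bounded_linear_cnj],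
        rule sfield_has_derivative[OF forms_sfield[OF assms chart_at(1)] chart_in[OF chart_at(2)]])
  then show "ext_d A (conj_form u) x vs = conj_form (ext_d A u) x vs"
    unfolding ext_d_eq conj_form_def fd_def alt_sum_def by simp
qed

text \<open>Conjugation exchanges the types (p, q) and (q, p), hence the two weights, and d is
  real.\<close>

lemma tw_Dbar_eq:
  assumes "smoothf \<eta>" "\<And>x. \<eta> x \<noteq> 0" "u \<in> forms A"
  shows "tw_Dbar_minus A \<eta> u = tws (\<lambda>_. 1) (\<lambda>x. - \<eta> x) (ext_d A (tws (\<lambda>x. 1 / 1) (\<lambda>x. 1 / - \<eta> x) u))"
proof -
  have sm: "smoothf (\<lambda>x. - \<eta> x)" by (rule smoothf_minus[OF assms(1)])
  let ?y = "tws (\<lambda>x. 1 / 1) (\<lambda>x. 1 / - \<eta> x) u"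
  have y: "?y \<in> forms A"
    by (intro forms_tws smoothf_divide smoothf_const sm assms(3)) (simp_all add: assms(2))
  have "tw_D A (\<lambda>x. - \<eta> x) (conj_form u) = tws (\<lambda>x. - \<eta> x) (\<lambda>_. 1) (ext_d A (tws (\<lambda>x. 1 / - \<eta> x) (\<lambda>x. 1 / 1) (conj_form u)))"
    by (rule tw_D_eq[OF sm _ forms_conj[OF assms(3)]]) (simp add: assms(2))
  also have "tws (\<lambda>x. 1 / - \<eta> x) (\<lambda>x. 1 / 1) (conj_form u) = conj_form ?y" by (rule conj_form_tws[symmetric])
  finally have e: "tw_D A (\<lambda>x. - \<eta> x) (conj_form u) = tws (\<lambda>x. - \<eta> x) (\<lambda>_. 1) (ext_d A (conj_form ?y))" .
  show ?thesis
    unfolding tw_Dbar_minus_def conj_op_def e ext_d_conj[OF y] by (simp only: conj_form_tws[of "\<lambda>x. - \<eta> x"] conj_form_conj_form)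
qed

lemma component_fun_form: "component p q (fun_form f :: ('a, 'n) form) = (if p = 0 \<and> q = 0 then fun_form f else 0)"
proof (intro ext)
  fix x and vs :: "(complex^'n) list"
  have "homog 0 (fun_form f x :: 'n fibre)" by (simp add: homog_def fun_form_def)
  show "component p q (fun_form f :: ('a, 'n) form) x vs = (if p = 0 \<and> q = 0 then fun_form f else 0) x vs"
  proof (cases "p = 0 \<and> q = 0")
    case True
    then show ?thesis
      using bidegree_0_0[of "fun_form f x :: 'n fibre"] by (cases "vs = []") (simp_all add: component_def fun_form_def, simp_all add: bidegree_def)
  next
    case False
    have z: "complexified (fun_form f x) ws = 0" if "length ws = p + q" for ws :: "((complex^'n) \<times> (complex^'n)) list"
      using that False by (auto simp: complexified_def fun_form_def intro!: sum.neutral)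
    show ?thesis using False by (auto simp: component_def bidegree_def z intro!: sum.neutral)
  qed
qed

lemma component_0: "component p q (0 :: ('a, 'n) form) = 0"
proof (intro ext)
  fix x and vs :: "(complex^'n) list"
  show "component p q (0 :: ('a, 'n) form) x vs = (0 :: ('a, 'n) form) x vs"
    by (simp add: component_def bidegree_def complexified_def zero_fun_def)
qed

lemma del_fun_form:
  fixes vs :: "(complex^'n) list"
  shows "del A (fun_form f) x vs = (if length vs = 1 then component 1 0 (ext_d A (fun_form f)) x vs else 0)"
    and "delbar A (fun_form f) x vs = (if length vs = 1 then component 0 1 (ext_d A (fun_form f)) x vs else 0)"
proof -
  have z: "component p q (ext_d A (component p' q' (fun_form f))) x vs = 0" if "\<not> (p' = 0 \<and> q' = 0)" for p q p' q'
    unfolding component_fun_form using that by (simp only: if_False localop_0[OF localop_ext_d] component_0 zero_fun_apply)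
  have "component (Suc p) q (ext_d A (component p q (fun_form f))) x vs = 0" if "p < length vs" "q = length vs - Suc p" "length vs \<noteq> 1" for p q
    using that by (intro z) (cases vs; auto)
  then show "del A (fun_form f) x vs = (if length vs = 1 then component 1 0 (ext_d A (fun_form f)) x vs else 0)"
    by (auto simp: del_def Let_def component_fun_form lessThan_Suc intro!: sum.neutral)
  have "component p (Suc q) (ext_d A (component p q (fun_form f))) x vs = 0" if "p < length vs" "q = length vs - Suc p" "length vs \<noteq> 1" for p q
    using that by (intro z) (cases vs; auto)
  then show "delbar A (fun_form f) x vs = (if length vs = 1 then component 0 1 (ext_d A (fun_form f)) x vs else 0)"
    by (auto simp: delbar_def Let_def component_fun_form lessThan_Suc intro!: sum.neutral)
qed

text \<open>On a function, \<open>del\<close> and \<open>delbar\<close> are the (1,0) and (0,1)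
  parts of its differential. Weighting them by \<eta> and 1 is the twist of a one-form.\<close>

lemma tw_d_fun_form:
  assumes f: "smoothf f" shows "tw_d A \<eta> (fun_form f) = tws \<eta> (\<lambda>_. 1) (ext_d A (fun_form f))"
proof (intro ext)
  fix x and vs :: "(complex^'n) list"
  let ?d = "ext_d A (fun_form f)"
  have a: "alternating (?d x)" by (intro forms_alternating ext_d_forms forms_fun_form f)
  have h: "homog 1 (?d x)" by (simp add: ext_d_fun_form[OF f] homog_one_form)
  show "tw_d A \<eta> (fun_form f) x vs = tws \<eta> (\<lambda>_. 1) ?d x vs"
  proof (cases "length vs = 1")
    case True
    then obtain v where v: "vs = [v]" by (auto simp: length_Suc_conv)
    have "tw_d A \<eta> (fun_form f) x vs = of_real (\<eta> x) * bidegree 1 0 (?d x) [v] + bidegree 0 1 (?d x) [v]"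
      by (simp add: tw_d_def fmult_def del_fun_form v component_def)
    also have "\<dots> = tw (\<eta> x) 1 (?d x) vs"
      unfolding bidegree_1_0[OF a] bidegree_0_1[OF a] v by (simp add: tw_ins_def field_simps)
    finally show ?thesis by (simp add: tws_def)
  next
    case False
    then show ?thesis
      using tw_homog[OF h] by (simp add: tw_d_def fmult_def del_fun_form tws_def homog_def)
  qed
qed

lemma tw_dbar_fun_form:
  assumes f: "smoothf f" shows "tw_dbar_minus A \<eta> (fun_form f) = tws (\<lambda>_. 1) (\<lambda>x. - \<eta> x) (ext_d A (fun_form f))"
proof -
  have c: "conj_form (fun_form f) = fun_form f" by (intro ext) (simp add: conj_form_def fun_form_def)
  have "conj_form (ext_d A (fun_form f)) = ext_d A (fun_form f)"
    using ext_d_conj[OF forms_fun_form[OF f]] by (simp only: c)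
  then show ?thesis
    unfolding tw_dbar_minus_def conj_op_def c tw_d_fun_form[OF f] by (simp only: conj_form_tws)
qed

text \<open>Every commutator in the theorem has an operator of even degree, \<Lambda> or \<omega>
  \<and>, so the graded sign is +1 throughout.\<close>

lemma gcomm_even: "even (a * b) \<Longrightarrow> gcomm a b P Q u = P (Q u) - Q (P u)"
  by (intro ext) (simp add: gcomm_def fmult_def)

end

theorem proposition3p5:
  fixes A :: "('a::{t2_space,second_countable_topology}, 'n::finite) chart set"
    and \<omega> u :: "('a, 'n) form"
    and \<eta> :: "'a \<Rightarrow> real"
  assumes "complex_atlas A"
    and "hermitian_metric A \<omega>"
    and "CARD('n) \<ge> 2"
    and "smooth_function A \<eta>"
    and "(\<forall>x. \<eta> x > 0) \<or> (\<forall>x. \<eta> x < 0)"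
    and "u \<in> forms A"
  shows
    "(adj A \<omega> (tw_D A \<eta>) u + adj A \<omega> (torsion A \<omega> \<eta>) u =
        (\<lambda>_. - \<i>) \<odot> gcomm (- 2) 1 (Lam A \<omega>) (tw_Dbar_minus A \<eta>) u +
        (\<lambda>x. of_real (real CARD('n) / \<eta> x)) \<odot>
          gcomm 1 (- 2) (wedge ((\<lambda>_. \<i>) \<odot> tw_dbar_minus A \<eta> (fun_form \<eta>))) (Lam A \<omega>) u) \<and>
     (adj A \<omega> (tw_Dbar_minus A \<eta>) u + adj A \<omega> (torsion_bar_minus A \<omega> \<eta>) u =
        (\<lambda>_. \<i>) \<odot> gcomm (- 2) 1 (Lam A \<omega>) (tw_D A \<eta>) u -
        (\<lambda>x. of_real (real CARD('n) / \<eta> x)) \<odot>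
          gcomm 1 (- 2) (wedge ((\<lambda>_. \<i>) \<odot> tw_d A \<eta> (fun_form \<eta>))) (Lam A \<omega>) u) \<and>
     (tw_D A \<eta> u + torsion A \<omega> \<eta> u =
        (\<lambda>_. \<i>) \<odot> gcomm (- 1) 2 (adj A \<omega> (tw_Dbar_minus A \<eta>)) (wedge \<omega>) u -
        (\<lambda>x. of_real (real CARD('n) / \<eta> x)) \<odot>
          gcomm 2 (- 1) (wedge \<omega>)
            (\<lambda>v. (\<lambda>_. \<i>) \<odot> adj A \<omega> (wedge (tw_dbar_minus A \<eta> (fun_form \<eta>))) v) u) \<and>
     (tw_Dbar_minus A \<eta> u + torsion_bar_minus A \<omega> \<eta> u =
        (\<lambda>_. - \<i>) \<odot> gcomm (- 1) 2 (adj A \<omega> (tw_D A \<eta>)) (wedge \<omega>) u +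
        (\<lambda>x. of_real (real CARD('n) / \<eta> x)) \<odot>
          gcomm 2 (- 1) (wedge \<omega>)
            (\<lambda>v. (\<lambda>_. \<i>) \<odot> adj A \<omega> (wedge (tw_d A \<eta> (fun_form \<eta>))) v) u)"
proof -
  interpret hermitian_manifold A \<omega> using assms(1,2) by unfold_locales
  have \<eta>: "smoothf \<eta>"
    using assms(4) by (auto simp: smooth_function_def smoothf_def cdom_def civ_def o_def)
  have nz: "\<eta> x \<noteq> 0" for x using assms(5) by (metis less_irrefl)
  \<comment> \<open>Main operator D_\<eta>, partner the conjugate of D_{-\<eta>}: relations (a) and
    (c).\<close>
  interpret a: twisted A \<omega> \<eta> "\<lambda>_. 1" "\<lambda>_. 1" "\<lambda>x. - \<eta> x" \<eta> 1
    by unfold_locales (simp_all add: \<eta> smoothf_const smoothf_minus nz)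
  \<comment> \<open>The roles are exchanged and \<epsilon> = -1: relations (b) and (d).\<close>
  interpret b: twisted A \<omega> "\<lambda>_. 1" "\<lambda>x. - \<eta> x" \<eta> "\<lambda>_. 1" \<eta> "- 1"
    by unfold_locales (simp_all add: \<eta> smoothf_const smoothf_minus nz)
  \<comment> \<open>Each of the two twisted derivatives is the operator D of one interpretation and
    the partner Q of the other.\<close>
  have D: "tw_D A \<eta> v = a.D v" "tw_D A \<eta> v = b.Q v" if "v \<in> forms A" for v
    using tw_D_eq[OF \<eta> nz that] by simp_all
  have Db: "tw_Dbar_minus A \<eta> v = b.D v" "tw_Dbar_minus A \<eta> v = a.Q v" if "v \<in> forms A" for v
    using tw_Dbar_eq[OF \<eta> nz that] by simp_all
  note L = Lam_eq_Aw
  have f: "Aw \<omega> 2 \<omega> v \<in> forms A" "wedge \<omega> v \<in> forms A" if "v \<in> forms A" for v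
    by (intro forms_Aw forms_wedge \<omega>_forms that)+
  have \<tau>: "torsion A \<omega> \<eta> v = Aw \<omega> 2 \<omega> (wedge a.\<Xi> v) - wedge a.\<Xi> (Aw \<omega> 2 \<omega> v)" if "v \<in> forms A" for v
    unfolding torsion_def D(1)[OF \<omega>_forms] gcomm_even[of "- 2" 3, simplified]
      L[OF that] L[OF forms_wedge[OF a.forms_ops(3)[OF \<omega>_forms] that]] ..
  have \<tau>b: "torsion_bar_minus A \<omega> \<eta> v = Aw \<omega> 2 \<omega> (wedge b.\<Xi> v) - wedge b.\<Xi> (Aw \<omega> 2 \<omega> v)" if "v \<in> forms A" for v
    unfolding torsion_bar_minus_def Db(1)[OF \<omega>_forms] gcomm_even[of "- 2" 3, simplified]
      L[OF that] L[OF forms_wedge[OF b.forms_ops(3)[OF \<omega>_forms] that]] ..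
  note \<xi> = tw_d_fun_form[OF \<eta>] tw_dbar_fun_form[OF \<eta>]
  note u = assms(6)
  have "adj A \<omega> (tw_D A \<eta>) v = a.Ds v" "adj A \<omega> (tw_Dbar_minus A \<eta>) v = b.Ds v" if "v \<in> forms A" for v
    using adjp_adj[OF adjp_cong[OF a.adjp_D D(1) refl] that] adjp_adj[OF adjp_cong[OF b.adjp_D Db(1) refl] that] by simp_all
  note Ds = this
  have A1: "adj A \<omega> (wedge a.\<xi>) v = Aw \<omega> 1 a.\<xi> v" "adj A \<omega> (wedge b.\<xi>) v = Aw \<omega> 1 b.\<xi> v" if "v \<in> forms A" for v
    using adjp_adj[OF adjp_wedge[OF a.forms_ops(6) a.homog_\<xi>] that] adjp_adj[OF adjp_wedge[OF b.forms_ops(6) b.homog_\<xi>] that] by simp_all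
  have w\<zeta>: "wedge ((\<lambda>_. \<i>) \<odot> a.\<xi>) v \<in> forms A" "wedge ((\<lambda>_. \<i>) \<odot> b.\<xi>) v \<in> forms A" if "v \<in> forms A" for v
    by (intro forms_wedge a.forms_\<zeta> b.forms_\<zeta> that)+
  note gc = gcomm_even[of "- 2" 1, simplified] gcomm_even[of 1 "- 2", simplified] gcomm_even[of "- 1" 2, simplified] gcomm_even[of 2 "- 1", simplified]
  show ?thesis
  proof (intro conjI, goal_cases)
    case 1 show ?case
      unfolding gc \<xi> L[OF u] Db(2)[OF u] Db(2)[OF f(1)[OF u]] L[OF a.forms_ops(4)[OF u]] L[OF w\<zeta>(1)[OF u]]
      by (rule trans, rule a.adj_sum[OF u], erule D(1), erule \<tau>) simp
  next
    case 2 show ?case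
      unfolding gc \<xi> L[OF u] D(2)[OF u] D(2)[OF f(1)[OF u]] L[OF b.forms_ops(4)[OF u]] L[OF w\<zeta>(2)[OF u]]
      by (rule trans, rule b.adj_sum[OF u], erule Db(1), erule \<tau>b, intro ext) (simp add: fmult_def)
  next
    case 3 show ?case
      unfolding \<tau>[OF u] D(1)[OF u] a.twisted_identity_adjoint[OF u] gc \<xi> Ds(2)[OF u] Ds(2)[OF f(2)[OF u]] A1(1)[OF u] A1(1)[OF f(2)[OF u]] by simp
  next
    case 4 show ?case
      unfolding \<tau>b[OF u] Db(1)[OF u] b.twisted_identity_adjoint[OF u] gc \<xi> Ds(1)[OF u] Ds(1)[OF f(2)[OF u]] A1(2)[OF u] A1(2)[OF f(2)[OF u]] by (intro ext) (simp add: fmult_def)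
  qed
qed

end
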